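(* Let $G$ be a finitely generated group. Then, for all $k\ge1$: (1) $\theta_k(\mathrm{gr}(G))\le\theta_k(\mathfrak{h}(G))$, with equality if $k\le2$, or if $G$ is graded-formal. (2) $\theta_k(G)\le\theta_k(\mathrm{gr}(G))$, with equality if $k\le3$, or if $G$ is filtered-formal.
   Context: For a finitely generated group $G$, $\mathrm{gr}(G)=\bigoplus_{k\ge1}(\Gamma_kG/\Gamma_{k+1}G)\otimes\mathbb{C}$ is the associated graded Lie algebra of the lower central series. The Chen ranks of $G$ are $\theta_k(G)=\dim_{\mathbb{C}}\mathrm{gr}_k(G/G'')$. For a finitely generated graded complex Lie algebra $\mathfrak{g}$, with second derived algebra $\mathfrak{g}''$, the Chen ranks are $\theta_k(\mathfrak{g})=\dim(\mathfrak{g}/\mathfrak{g}'')_k$. The holonomy Lie algebra $\mathfrak{h}(G)$ is the quotient of the free complex Lie algebra on $H_1(G;\mathbb{C})$ by the ideal generated by the image of the dual of the cup product, $H^2(G;\mathbb{C})^*\to H_1(G;\mathbb{C})\wedge H_1(G;\mathbb{C})$ (the target being the degree $2$ part of the free Lie algebra). The identification $H_1(G;\mathbb{C})=\mathrm{gr}_1(G)$ induces an epimorphism of graded Lie algebras $\Psi\colon\mathfrak{h}(G)\to\mathrm{gr}(G)$; $G$ is graded-formal if $\Psi$ is an isomorphism. The Malcev Lie algebra $\mathfrak{m}(G)$ is the filtered Lie algebra of primitive elements in the completion $\varprojlim_r\mathbb{C}[G]/I^r$ of the Hopf algebra $\mathbb{C}[G]$ ($\Delta(g)=g\otimes g$)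 with respect to powers of the augmentation ideal $I$; $G$ is filtered-formal if $\mathfrak{m}(G)$ is isomorphic, as a filtered Lie algebra, to the degree completion of $\mathrm{gr}(G)$. *)

theory Defs
  imports
    "HOL-Library.Poly_Mapping"
    "Jordan_Normal_Form.VS_Connect"
    "HOL-Algebra.Generated_Groups"
    "HOL-Algebra.Ideal_Product"
    "HOL-Algebra.QuotRing"
begin

hide_const (open) Multiset.mult Polynomial.smult Modules.module

abbreviation (input) single where "single \<equiv> Poly_Mapping.single"
abbreviation (input) keys where "keys \<equiv> Poly_Mapping.keys"
abbreviation (input) lookup where "lookup \<equiv> Poly_Mapping.lookup"

section \<open>Complex vector spaces and algebras\<close>

text \<open>
  A (not necessarily associative) complex algebra is a record of type \<open>(complex, 'l) module\<close> over
  the field \<open>class_ring\<close>; its field \<open>mult\<close> is the product, which for a Lie algebra is the bracket.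
  The field \<open>one\<close> has a meaning only for the group algebra and its completion.
\<close>

text \<open>The free vector space on a set \<open>S\<close>, with zero product.\<close>

definition free_module :: "'s set \<Rightarrow> (complex, 's \<Rightarrow>\<^sub>0 complex) module" where
  "free_module S = \<lparr>
     carrier = {u. keys u \<subseteq> S},
     mult = (\<lambda>u v. 0),
     one = 0,
     zero = 0,
     add = (+),
     smult = (\<lambda>c u. Poly_Mapping.map ((*) c) u)\<rparr>"

text \<open>The linear, respectively bilinear, extension of a map between basis elements.\<close>

definition pushforward :: "('s \<Rightarrow> 't) \<Rightarrow> ('s \<Rightarrow>\<^sub>0 complex) \<Rightarrow> ('t \<Rightarrow>\<^sub>0 complex)" where
  "pushforward h u = (\<Sum>x\<in>keys u. single (h x) (lookup u x))"

definition bilinear :: "('s \<Rightarrow> 't \<Rightarrow> 'r) \<Rightarrow> ('s \<Rightarrow>\<^sub>0 complex) \<Rightarrow> ('t \<Rightarrow>\<^sub>0 complex) \<Rightarrow> ('r \<Rightarrow>\<^sub>0 complex)"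
  where
  "bilinear m u v =
     (\<Sum>x\<in>keys u. \<Sum>y\<in>keys v. single (m x y) (lookup u x * lookup v y))"

text \<open>The linear extension to a free vector space of a map \<open>h\<close> from the basis into \<open>L\<close>.\<close>

definition linear_extension ::
  "(complex, 'l, 'm) module_scheme \<Rightarrow> ('s \<Rightarrow> 'l) \<Rightarrow> ('s \<Rightarrow>\<^sub>0 complex) \<Rightarrow> 'l" where
  "linear_extension L h u = (\<Oplus>\<^bsub>L\<^esub>x\<in>keys u. lookup u x \<odot>\<^bsub>L\<^esub> h x)"

text \<open>The value on a class \<open>X\<close> of the map induced by \<open>h\<close>, when \<open>h\<close> is constant on \<open>X\<close>.\<close>

definition induced :: "('a \<Rightarrow> 'b) \<Rightarrow> 'a set \<Rightarrow> 'b" where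
  "induced h X = the_elem (h ` X)"

definition induced2 :: "('a \<Rightarrow> 'b \<Rightarrow> 'c) \<Rightarrow> 'a set \<Rightarrow> 'b set \<Rightarrow> 'c" where
  "induced2 h X Y = the_elem ((\<lambda>(x, y). h x y) ` (X \<times> Y))"

text \<open>Quotient of an algebra by an ideal, or of a vector space by a subspace (the product is then
  irrelevant). It extends the library's quotient ring by the scalar multiplication.\<close>

definition quot :: "(complex, 'l, 'm) module_scheme \<Rightarrow> 'l set \<Rightarrow> (complex, 'l set) module" where
  "quot L I = \<lparr>
     carrier = a_rcosets\<^bsub>L\<^esub> I,
     mult = rcoset_mult L I,
     one = I +>\<^bsub>L\<^esub> \<one>\<^bsub>L\<^esub>,
     zero = I,
     add = set_add L,
     smult = (\<lambda>c. induced (\<lambda>x. I +>\<^bsub>L\<^esub> (c \<odot>\<^bsub>L\<^esub> x)))\<rparr>"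

abbreviation span_of :: "(complex, 'l, 'm) module_scheme \<Rightarrow> 'l set \<Rightarrow> 'l set" where
  "span_of L \<equiv> LinearCombinations.module.span class_ring L"

text \<open>The library's dimension is \<open>nat\<close>-valued, and is meaningful for finite-dimensional spaces only.
  The homogeneous components considered here are finite-dimensional when \<open>G\<close> is finitely generated.\<close>

abbreviation dim_of :: "(complex, 'l, 'm) module_scheme \<Rightarrow> nat" where
  "dim_of L \<equiv> vectorspace.dim class_ring L"

definition algebra_ideal :: "(complex, 'l, 'm) module_scheme \<Rightarrow> 'l set \<Rightarrow> bool" where
  "algebra_ideal L I \<longleftrightarrow>
     VectorSpace.subspace class_ring I L \<and>
     (\<forall>x\<in>carrier L. \<forall>y\<in>I. x \<otimes>\<^bsub>L\<^esub> y \<in> I \<and> y \<otimes>\<^bsub>L\<^esub> x \<in> I)"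

definition ideal_generated :: "(complex, 'l, 'm) module_scheme \<Rightarrow> 'l set \<Rightarrow> 'l set" where
  "ideal_generated L S = \<Inter>{I. algebra_ideal L I \<and> S \<subseteq> I}"

definition lie_iso ::
  "(complex, 'l, 'm) module_scheme \<Rightarrow> (complex, 'k, 'n) module_scheme \<Rightarrow> ('l \<Rightarrow> 'k) set" where
  "lie_iso L M = {f \<in> LinearCombinations.module_hom class_ring L M.
     (\<forall>x\<in>carrier L. \<forall>y\<in>carrier L. f (x \<otimes>\<^bsub>L\<^esub> y) = f x \<otimes>\<^bsub>M\<^esub> f y) \<and>
     bij_betw f (carrier L) (carrier M)}"


section \<open>Graded Lie algebras and their Chen ranks\<close>

text \<open>\<open>homog L k\<close> is the homogeneous component of degree \<open>k\<close>, zero for \<open>k = 0\<close>.\<close>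

record 'l graded_lie = "(complex, 'l) module" +
  homog :: "nat \<Rightarrow> 'l set"

definition graded_quot :: "'l graded_lie \<Rightarrow> 'l set \<Rightarrow> 'l set graded_lie" where
  "graded_quot L I =
     module.extend (quot L I) (graded_lie.fields (\<lambda>k. (\<lambda>x. I +>\<^bsub>L\<^esub> x) ` homog L k))"

definition derived_lie :: "(complex, 'l, 'm) module_scheme \<Rightarrow> 'l set \<Rightarrow> 'l set" where
  "derived_lie L A = span_of L {x \<otimes>\<^bsub>L\<^esub> y | x y. x \<in> A \<and> y \<in> A}"

definition second_derived_lie :: "(complex, 'l, 'm) module_scheme \<Rightarrow> 'l set" where
  "second_derived_lie L = derived_lie L (derived_lie L (carrier L))"

definition chen_rank_lie :: "'l graded_lie \<Rightarrow> nat \<Rightarrow> nat" where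
  "chen_rank_lie L k =
     (let Q = graded_quot L (second_derived_lie L) in dim_of (Q\<lparr>carrier := homog Q k\<rparr>))"


section \<open>The associated graded Lie algebra of a group\<close>

definition commutator :: "('a, 'b) monoid_scheme \<Rightarrow> 'a \<Rightarrow> 'a \<Rightarrow> 'a" where
  "commutator G x y = x \<otimes>\<^bsub>G\<^esub> y \<otimes>\<^bsub>G\<^esub> inv\<^bsub>G\<^esub> x \<otimes>\<^bsub>G\<^esub> inv\<^bsub>G\<^esub> y"

text \<open>\<open>lcs G 1 = G\<close> and \<open>lcs G (k + 1) = [lcs G k, G]\<close>. Setting also \<open>lcs G 0 = G\<close> makes the quotient in
  degree \<open>0\<close> trivial, so that direct sums and products below can be taken over all of \<open>nat\<close>.\<close>

primrec lcs :: "('a, 'b) monoid_scheme \<Rightarrow> nat \<Rightarrow> 'a set" where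
  "lcs G 0 = carrier G"
| "lcs G (Suc k) = (if k = 0 then carrier G else
     generate G {commutator G x y | x y. x \<in> lcs G k \<and> y \<in> carrier G})"

text \<open>The group \<open>\<Gamma>\<^sub>k G / \<Gamma>\<^sub>k\<^sub>+\<^sub>1 G\<close>.\<close>

definition lcs_quot :: "('a, 'b) monoid_scheme \<Rightarrow> nat \<Rightarrow> 'a set monoid" where
  "lcs_quot G k = (G\<lparr>carrier := lcs G k\<rparr>) Mod lcs G (k + 1)"

text \<open>For an abelian group \<open>A\<close>, the vector space \<open>A \<otimes> \<complex>\<close> is the free vector space on \<open>A\<close> modulo the
  additivity relations; the class of \<open>single x c\<close> is \<open>x \<otimes> c\<close>.\<close>

definition additivity_relations :: "('a, 'b) monoid_scheme \<Rightarrow> ('a \<Rightarrow>\<^sub>0 complex) set" where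
  "additivity_relations A = span_of (free_module (carrier A))
     {single (x \<otimes>\<^bsub>A\<^esub> y) 1 - single x 1 - single y 1 | x y.
        x \<in> carrier A \<and> y \<in> carrier A}"

definition tensor_complex ::
  "('a, 'b) monoid_scheme \<Rightarrow> (complex, ('a \<Rightarrow>\<^sub>0 complex) set) module" where
  "tensor_complex A = quot (free_module (carrier A)) (additivity_relations A)"

definition tensor_class ::
  "('a, 'b) monoid_scheme \<Rightarrow> ('a \<Rightarrow>\<^sub>0 complex) \<Rightarrow> ('a \<Rightarrow>\<^sub>0 complex) set" where
  "tensor_class A u = additivity_relations A +>\<^bsub>free_module (carrier A)\<^esub> u"

definition gr_comp ::
  "('a, 'b) monoid_scheme \<Rightarrow> nat \<Rightarrow> (complex, ('a set \<Rightarrow>\<^sub>0 complex) set) module" where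
  "gr_comp G k = tensor_complex (lcs_quot G k)"

text \<open>The bracket \<open>gr\<^sub>i \<times> gr\<^sub>j \<rightarrow> gr\<^sub>i\<^sub>+\<^sub>j\<close> induced by the group commutator.\<close>

definition lcs_commutator ::
  "('a, 'b) monoid_scheme \<Rightarrow> nat \<Rightarrow> nat \<Rightarrow> 'a set \<Rightarrow> 'a set \<Rightarrow> 'a set" where
  "lcs_commutator G i j = induced2 (\<lambda>x y. lcs G (i + j + 1) #>\<^bsub>G\<^esub> commutator G x y)"

definition gr_bracket :: "('a, 'b) monoid_scheme \<Rightarrow> nat \<Rightarrow> nat \<Rightarrow>
    ('a set \<Rightarrow>\<^sub>0 complex) set \<Rightarrow> ('a set \<Rightarrow>\<^sub>0 complex) set \<Rightarrow> ('a set \<Rightarrow>\<^sub>0 complex) set" where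
  "gr_bracket G i j =
     induced2 (\<lambda>u v. tensor_class (lcs_quot G (i + j)) (bilinear (lcs_commutator G i j) u v))"

definition gr :: "('a, 'b) monoid_scheme \<Rightarrow> (nat \<Rightarrow> ('a set \<Rightarrow>\<^sub>0 complex) set) graded_lie" where
  "gr G = (let S = {f. (\<forall>k. f k \<in> carrier (gr_comp G k)) \<and> finite {k. f k \<noteq> \<zero>\<^bsub>gr_comp G k\<^esub>}} in \<lparr>
     carrier = S,
     mult = (\<lambda>f g k. \<Oplus>\<^bsub>gr_comp G k\<^esub>i\<in>{..k}. gr_bracket G i (k - i) (f i) (g (k - i))),
     one = (\<lambda>k. \<zero>\<^bsub>gr_comp G k\<^esub>),
     zero = (\<lambda>k. \<zero>\<^bsub>gr_comp G k\<^esub>),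
     add = (\<lambda>f g k. f k \<oplus>\<^bsub>gr_comp G k\<^esub> g k),
     smult = (\<lambda>c f k. c \<odot>\<^bsub>gr_comp G k\<^esub> f k),
     homog = (\<lambda>k. {f \<in> S. \<forall>i. i \<noteq> k \<longrightarrow> f i = \<zero>\<^bsub>gr_comp G i\<^esub>})\<rparr>)"

definition second_derived :: "('a, 'b) monoid_scheme \<Rightarrow> 'a set" where
  "second_derived G = derived G (derived G (carrier G))"

definition chen_rank :: "('a, 'b) monoid_scheme \<Rightarrow> nat \<Rightarrow> nat" where
  "chen_rank G k = dim_of (gr_comp (G Mod second_derived G) k)"


section \<open>Free Lie algebras\<close>

text \<open>Nonassociative monomials.\<close>

datatype 'v monomial = Gen 'v | Br "'v monomial" "'v monomial"

primrec monomial_degree :: "'v monomial \<Rightarrow> nat" where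
  "monomial_degree (Gen v) = 1"
| "monomial_degree (Br s t) = monomial_degree s + monomial_degree t"

definition free_nonassoc_algebra :: "'v set \<Rightarrow> ('v monomial \<Rightarrow>\<^sub>0 complex) graded_lie" where
  "free_nonassoc_algebra S =
     module.extend ((free_module {t. set_monomial t \<subseteq> S})\<lparr>mult := bilinear Br\<rparr>)
       (graded_lie.fields
         (\<lambda>k. {u. keys u \<subseteq> {t. set_monomial t \<subseteq> S \<and> monomial_degree t = k}}))"

text \<open>The relations defining the free Lie algebra on a vector space \<open>V\<close>: linearity of the
  generators in \<open>V\<close>, the alternating law and the Jacobi identity.\<close>

definition free_lie_relations :: "(complex, 'v, 'm) module_scheme \<Rightarrow> ('v monomial \<Rightarrow>\<^sub>0 complex) set"
  where
  "free_lie_relations V = (let F = free_nonassoc_algebra (carrier V) in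
     {single (Gen (x \<oplus>\<^bsub>V\<^esub> y)) 1 - single (Gen x) 1
        - single (Gen y) 1 | x y. x \<in> carrier V \<and> y \<in> carrier V} \<union>
     {single (Gen (c \<odot>\<^bsub>V\<^esub> x)) 1 - single (Gen x) c | c x. x \<in> carrier V} \<union>
     {u \<otimes>\<^bsub>F\<^esub> u | u. u \<in> carrier F} \<union>
     {u \<otimes>\<^bsub>F\<^esub> (v \<otimes>\<^bsub>F\<^esub> w) \<oplus>\<^bsub>F\<^esub> v \<otimes>\<^bsub>F\<^esub> (w \<otimes>\<^bsub>F\<^esub> u) \<oplus>\<^bsub>F\<^esub> w \<otimes>\<^bsub>F\<^esub> (u \<otimes>\<^bsub>F\<^esub> v) | u v w.
        u \<in> carrier F \<and> v \<in> carrier F \<and> w \<in> carrier F})"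

definition free_lie_ideal :: "(complex, 'v, 'm) module_scheme \<Rightarrow> ('v monomial \<Rightarrow>\<^sub>0 complex) set" where
  "free_lie_ideal V =
     ideal_generated (free_nonassoc_algebra (carrier V)) (free_lie_relations V)"

definition free_lie ::
  "(complex, 'v, 'm) module_scheme \<Rightarrow> ('v monomial \<Rightarrow>\<^sub>0 complex) set graded_lie" where
  "free_lie V = graded_quot (free_nonassoc_algebra (carrier V)) (free_lie_ideal V)"

definition free_lie_gen ::
  "(complex, 'v, 'm) module_scheme \<Rightarrow> 'v \<Rightarrow> ('v monomial \<Rightarrow>\<^sub>0 complex) set" where
  "free_lie_gen V x =
     free_lie_ideal V +>\<^bsub>free_nonassoc_algebra (carrier V)\<^esub> single (Gen x) 1"

text \<open>The Lie algebra morphism from a free Lie algebra to \<open>L\<close> extending a linear map \<open>h\<close>.\<close>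

primrec eval_monomial :: "(complex, 'l, 'm) module_scheme \<Rightarrow> ('v \<Rightarrow> 'l) \<Rightarrow> 'v monomial \<Rightarrow> 'l" where
  "eval_monomial L h (Gen v) = h v"
| "eval_monomial L h (Br s t) = eval_monomial L h s \<otimes>\<^bsub>L\<^esub> eval_monomial L h t"

definition free_lie_lift ::
  "(complex, 'l, 'm) module_scheme \<Rightarrow> ('v \<Rightarrow> 'l) \<Rightarrow> ('v monomial \<Rightarrow>\<^sub>0 complex) set \<Rightarrow> 'l" where
  "free_lie_lift L h = induced (linear_extension L (eval_monomial L h))"


section \<open>Group (co)homology in low degrees and the cup product\<close>

text \<open>Homology and cohomology are computed from the inhomogeneous bar complex with trivial coefficients
  \<open>\<complex>\<close>. In particular the differentials \<open>C\<^sub>1 \<rightarrow> C\<^sub>0\<close> and \<open>C\<^sup>0 \<rightarrow> C\<^sup>1\<close> vanish.\<close>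

definition boundaries1 :: "('a, 'b) monoid_scheme \<Rightarrow> ('a \<Rightarrow>\<^sub>0 complex) set" where
  "boundaries1 G = span_of (free_module (carrier G))
     {single y 1 - single (x \<otimes>\<^bsub>G\<^esub> y) 1 + single x 1 | x y.
        x \<in> carrier G \<and> y \<in> carrier G}"

definition H1 :: "('a, 'b) monoid_scheme \<Rightarrow> (complex, ('a \<Rightarrow>\<^sub>0 complex) set) module" where
  "H1 G = quot (free_module (carrier G)) (boundaries1 G)"

definition cochains1 :: "('a, 'b) monoid_scheme \<Rightarrow> (complex, 'a \<Rightarrow> complex) module" where
  "cochains1 G = ring.func_space class_ring (carrier G)"

definition cochains2 :: "('a, 'b) monoid_scheme \<Rightarrow> (complex, 'a \<times> 'a \<Rightarrow> complex) module" where
  "cochains2 G = ring.func_space class_ring (carrier G \<times> carrier G)"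

definition coboundary1 :: "('a, 'b) monoid_scheme \<Rightarrow> ('a \<Rightarrow> complex) \<Rightarrow> ('a \<times> 'a \<Rightarrow> complex)" where
  "coboundary1 G a = restrict (\<lambda>(x, y). a y - a (x \<otimes>\<^bsub>G\<^esub> y) + a x) (carrier G \<times> carrier G)"

definition cocycles1 :: "('a, 'b) monoid_scheme \<Rightarrow> ('a \<Rightarrow> complex) set" where
  "cocycles1 G = {a \<in> carrier (cochains1 G).
     \<forall>x\<in>carrier G. \<forall>y\<in>carrier G. coboundary1 G a (x, y) = 0}"

definition cocycles2 :: "('a, 'b) monoid_scheme \<Rightarrow> ('a \<times> 'a \<Rightarrow> complex) set" where
  "cocycles2 G = {c \<in> carrier (cochains2 G).
     \<forall>x\<in>carrier G. \<forall>y\<in>carrier G. \<forall>z\<in>carrier G.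
       c (y, z) - c (x \<otimes>\<^bsub>G\<^esub> y, z) + c (x, y \<otimes>\<^bsub>G\<^esub> z) - c (x, y) = 0}"

definition coboundaries2 :: "('a, 'b) monoid_scheme \<Rightarrow> ('a \<times> 'a \<Rightarrow> complex) set" where
  "coboundaries2 G = coboundary1 G ` carrier (cochains1 G)"

definition H2 :: "('a, 'b) monoid_scheme \<Rightarrow> (complex, ('a \<times> 'a \<Rightarrow> complex) set) module" where
  "H2 G = quot ((cochains2 G)\<lparr>carrier := cocycles2 G\<rparr>) (coboundaries2 G)"

text \<open>The cup product of classes of degree \<open>1\<close>, which are identified with their unique cocycle.\<close>

definition cup ::
  "('a, 'b) monoid_scheme \<Rightarrow> ('a \<Rightarrow> complex) \<Rightarrow> ('a \<Rightarrow> complex) \<Rightarrow> ('a \<times> 'a \<Rightarrow> complex) set" where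
  "cup G a b =
     coboundaries2 G +>\<^bsub>cochains2 G\<^esub> restrict (\<lambda>(x, y). a x * b y) (carrier G \<times> carrier G)"

definition dual :: "(complex, 'v, 'm) module_scheme \<Rightarrow> ('v \<Rightarrow> complex) set" where
  "dual V = {\<phi>. (\<forall>x\<in>carrier V. \<forall>y\<in>carrier V. \<phi> (x \<oplus>\<^bsub>V\<^esub> y) = \<phi> x + \<phi> y) \<and>
                (\<forall>c. \<forall>x\<in>carrier V. \<phi> (c \<odot>\<^bsub>V\<^esub> x) = c * \<phi> x)}"

text \<open>The evaluation pairing of cohomology and homology classes of degree \<open>1\<close>.\<close>

definition kronecker :: "('a \<Rightarrow> complex) \<Rightarrow> ('a \<Rightarrow>\<^sub>0 complex) set \<Rightarrow> complex" where
  "kronecker a = induced (\<lambda>u. \<Sum>x\<in>keys u. lookup u x * a x)"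


section \<open>The holonomy Lie algebra and graded formality\<close>

text \<open>An element of \<open>H\<^sub>1 \<and> H\<^sub>1\<close> is presented as a finite sum \<open>\<Sum> p (X, Y) \<cdot> X \<and> Y\<close>. It is the image of
  \<open>\<phi> \<in> (H\<^sup>2)\<^sup>*\<close> under the dual of the cup product \<open>H\<^sup>1 \<and> H\<^sup>1 \<rightarrow> H\<^sup>2\<close> iff it pairs with each \<open>a \<and> b\<close> to
  \<open>\<phi> (a \<union> b)\<close>, where \<open>\<langle>a \<and> b, X \<and> Y\<rangle> = a(X) b(Y) - a(Y) b(X)\<close> is the pairing that identifies
  \<open>H\<^sub>1 \<and> H\<^sub>1\<close> with \<open>(H\<^sup>1 \<and> H\<^sup>1)\<^sup>*\<close>. In the free Lie algebra, \<open>X \<and> Y\<close> is the bracket \<open>[X, Y]\<close>.\<close>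

definition wedge_pairing :: "('a \<Rightarrow> complex) \<Rightarrow> ('a \<Rightarrow> complex) \<Rightarrow>
    (('a \<Rightarrow>\<^sub>0 complex) set \<times> ('a \<Rightarrow>\<^sub>0 complex) set \<Rightarrow>\<^sub>0 complex) \<Rightarrow> complex" where
  "wedge_pairing a b p = (\<Sum>(X, Y)\<in>keys p. lookup p (X, Y) *
     (kronecker a X * kronecker b Y - kronecker a Y * kronecker b X))"

definition wedge_to_free_lie :: "('a, 'b) monoid_scheme \<Rightarrow>
    (('a \<Rightarrow>\<^sub>0 complex) set \<times> ('a \<Rightarrow>\<^sub>0 complex) set \<Rightarrow>\<^sub>0 complex) \<Rightarrow>
    (('a \<Rightarrow>\<^sub>0 complex) set monomial \<Rightarrow>\<^sub>0 complex) set" where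
  "wedge_to_free_lie G = linear_extension (free_lie (H1 G))
     (\<lambda>(X, Y). free_lie_gen (H1 G) X \<otimes>\<^bsub>free_lie (H1 G)\<^esub> free_lie_gen (H1 G) Y)"

definition dual_cup_image ::
  "('a, 'b) monoid_scheme \<Rightarrow> (('a \<Rightarrow>\<^sub>0 complex) set monomial \<Rightarrow>\<^sub>0 complex) set set" where
  "dual_cup_image G = {wedge_to_free_lie G p | p.
     keys p \<subseteq> carrier (H1 G) \<times> carrier (H1 G) \<and>
     (\<exists>\<phi>\<in>dual (H2 G). \<forall>a\<in>cocycles1 G. \<forall>b\<in>cocycles1 G. wedge_pairing a b p = \<phi> (cup G a b))}"

definition holonomy ::
  "('a, 'b) monoid_scheme \<Rightarrow> (('a \<Rightarrow>\<^sub>0 complex) set monomial \<Rightarrow>\<^sub>0 complex) set set graded_lie" where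
  "holonomy G =
     graded_quot (free_lie (H1 G)) (ideal_generated (free_lie (H1 G)) (dual_cup_image G))"

text \<open>The identification of \<open>H\<^sub>1\<close> with \<open>gr\<^sub>1\<close> sends the class of \<open>x\<close> to \<open>x \<Gamma>\<^sub>2 \<otimes> 1\<close>.\<close>

definition H1_to_gr ::
  "('a, 'b) monoid_scheme \<Rightarrow> ('a \<Rightarrow>\<^sub>0 complex) set \<Rightarrow> nat \<Rightarrow> ('a set \<Rightarrow>\<^sub>0 complex) set" where
  "H1_to_gr G X = (\<lambda>k. if k = 1
     then induced (\<lambda>u. tensor_class (lcs_quot G 1) (pushforward (\<lambda>x. lcs G 2 #>\<^bsub>G\<^esub> x) u)) X
     else \<zero>\<^bsub>gr_comp G k\<^esub>)"

definition holonomy_to_gr :: "('a, 'b) monoid_scheme \<Rightarrow>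
    (('a \<Rightarrow>\<^sub>0 complex) set monomial \<Rightarrow>\<^sub>0 complex) set set \<Rightarrow> nat \<Rightarrow> ('a set \<Rightarrow>\<^sub>0 complex) set" where
  "holonomy_to_gr G = induced (free_lie_lift (gr G) (H1_to_gr G))"

definition graded_formal :: "('a, 'b) monoid_scheme \<Rightarrow> bool" where
  "graded_formal G \<longleftrightarrow> holonomy_to_gr G \<in> lie_iso (holonomy G) (gr G)"


section \<open>Filtered Lie algebras, the Malcev Lie algebra and filtered formality\<close>

record 'l filtered_lie = "(complex, 'l) module" +
  filt :: "nat \<Rightarrow> 'l set"

definition filtered_isomorphic :: "'l filtered_lie \<Rightarrow> 'k filtered_lie \<Rightarrow> bool" where
  "filtered_isomorphic L M \<longleftrightarrow> (\<exists>f\<in>lie_iso L M. \<forall>r. f ` filt L r = filt M r)"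

text \<open>The degree completion, i.e. the product of the homogeneous components.\<close>

definition degree_completion :: "'l graded_lie \<Rightarrow> (nat \<Rightarrow> 'l) filtered_lie" where
  "degree_completion L = (let S = {f. \<forall>k. f k \<in> homog L k} in \<lparr>
     carrier = S,
     mult = (\<lambda>f g k. \<Oplus>\<^bsub>L\<^esub>i\<in>{..k}. f i \<otimes>\<^bsub>L\<^esub> g (k - i)),
     one = (\<lambda>k. \<zero>\<^bsub>L\<^esub>),
     zero = (\<lambda>k. \<zero>\<^bsub>L\<^esub>),
     add = (\<lambda>f g k. f k \<oplus>\<^bsub>L\<^esub> g k),
     smult = (\<lambda>c f k. c \<odot>\<^bsub>L\<^esub> f k),
     filt = (\<lambda>r. {f \<in> S. \<forall>i<r. f i = \<zero>\<^bsub>L\<^esub>})\<rparr>)"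

definition group_algebra :: "('a, 'b) monoid_scheme \<Rightarrow> (complex, 'a \<Rightarrow>\<^sub>0 complex) module" where
  "group_algebra G = (free_module (carrier G))\<lparr>
     mult := bilinear (mult G), one := single \<one>\<^bsub>G\<^esub> 1\<rparr>"

definition augmentation_ideal :: "('a, 'b) monoid_scheme \<Rightarrow> ('a \<Rightarrow>\<^sub>0 complex) set" where
  "augmentation_ideal G = {u \<in> carrier (group_algebra G). (\<Sum>x\<in>keys u. lookup u x) = 0}"

primrec augmentation_power :: "('a, 'b) monoid_scheme \<Rightarrow> nat \<Rightarrow> ('a \<Rightarrow>\<^sub>0 complex) set" where
  "augmentation_power G 0 = carrier (group_algebra G)"
| "augmentation_power G (Suc r) =
     ideal_prod (group_algebra G) (augmentation_ideal G) (augmentation_power G r)"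

text \<open>The inverse limit of the quotients \<open>A / J r\<close> for a descending filtration \<open>J\<close>. For \<open>r \<le> s\<close>,
  the projection \<open>A / J s \<rightarrow> A / J r\<close> sends a coset to the unique coset containing it.\<close>

definition completion ::
  "(complex, 'l, 'm) module_scheme \<Rightarrow> (nat \<Rightarrow> 'l set) \<Rightarrow> (complex, nat \<Rightarrow> 'l set) module" where
  "completion A J = \<lparr>
     carrier = {x. (\<forall>r. x r \<in> carrier (quot A (J r))) \<and> (\<forall>r s. r \<le> s \<longrightarrow> x s \<subseteq> x r)},
     mult = (\<lambda>x y r. x r \<otimes>\<^bsub>quot A (J r)\<^esub> y r),
     one = (\<lambda>r. \<one>\<^bsub>quot A (J r)\<^esub>),
     zero = (\<lambda>r. \<zero>\<^bsub>quot A (J r)\<^esub>),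
     add = (\<lambda>x y r. x r \<oplus>\<^bsub>quot A (J r)\<^esub> y r),
     smult = (\<lambda>c x r. c \<odot>\<^bsub>quot A (J r)\<^esub> x r)\<rparr>"

definition completed_group_algebra ::
  "('a, 'b) monoid_scheme \<Rightarrow> (complex, nat \<Rightarrow> ('a \<Rightarrow>\<^sub>0 complex) set) module" where
  "completed_group_algebra G = completion (group_algebra G) (augmentation_power G)"

text \<open>\<open>\<complex>[G] \<otimes> \<complex>[G]\<close> is the free vector space on \<open>G \<times> G\<close>, with \<open>u \<otimes> v = bilinear Pair u v\<close>, and carries
  the tensor product filtration \<open>\<Sum>\<^bsub>i + j = r\<^esub> I\<^sup>i \<otimes> I\<^sup>j\<close>.\<close>

definition tensor_filtration ::
  "('a, 'b) monoid_scheme \<Rightarrow> nat \<Rightarrow> ('a \<times> 'a \<Rightarrow>\<^sub>0 complex) set" where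
  "tensor_filtration G r = span_of (free_module (carrier G \<times> carrier G))
     {bilinear Pair u v | u v i j.
        i + j = r \<and> u \<in> augmentation_power G i \<and> v \<in> augmentation_power G j}"

definition tensor_square_class ::
  "('a, 'b) monoid_scheme \<Rightarrow> nat \<Rightarrow> ('a \<times> 'a \<Rightarrow>\<^sub>0 complex) \<Rightarrow> ('a \<times> 'a \<Rightarrow>\<^sub>0 complex) set" where
  "tensor_square_class G r w =
     tensor_filtration G r +>\<^bsub>free_module (carrier G \<times> carrier G)\<^esub> w"

definition completed_tensor_square ::
  "('a, 'b) monoid_scheme \<Rightarrow> (complex, nat \<Rightarrow> ('a \<times> 'a \<Rightarrow>\<^sub>0 complex) set) module" where
  "completed_tensor_square G =
     completion (free_module (carrier G \<times> carrier G)) (tensor_filtration G)"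

definition completed_tensor :: "('a, 'b) monoid_scheme \<Rightarrow>
    (nat \<Rightarrow> ('a \<Rightarrow>\<^sub>0 complex) set) \<Rightarrow> (nat \<Rightarrow> ('a \<Rightarrow>\<^sub>0 complex) set) \<Rightarrow>
    nat \<Rightarrow> ('a \<times> 'a \<Rightarrow>\<^sub>0 complex) set" where
  "completed_tensor G x y =
     (\<lambda>r. induced2 (\<lambda>u v. tensor_square_class G r (bilinear Pair u v)) (x r) (y r))"

text \<open>The comultiplication, \<open>g \<mapsto> g \<otimes> g\<close> on group elements.\<close>

definition completed_comult :: "('a, 'b) monoid_scheme \<Rightarrow>
    (nat \<Rightarrow> ('a \<Rightarrow>\<^sub>0 complex) set) \<Rightarrow> nat \<Rightarrow> ('a \<times> 'a \<Rightarrow>\<^sub>0 complex) set" where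
  "completed_comult G x =
     (\<lambda>r. induced (\<lambda>u. tensor_square_class G r (pushforward (\<lambda>g. (g, g)) u)) (x r))"

definition primitive_elements :: "('a, 'b) monoid_scheme \<Rightarrow> (nat \<Rightarrow> ('a \<Rightarrow>\<^sub>0 complex) set) set" where
  "primitive_elements G = (let A = completed_group_algebra G in {x \<in> carrier A.
     completed_comult G x =
       completed_tensor G x \<one>\<^bsub>A\<^esub> \<oplus>\<^bsub>completed_tensor_square G\<^esub> completed_tensor G \<one>\<^bsub>A\<^esub> x})"

text \<open>The filtration is induced by that of the completion, whose \<open>r\<close>-th term is the kernel of the
  projection to \<open>\<complex>[G] / I\<^sup>r\<close>.\<close>

definition malcev_lie ::
  "('a, 'b) monoid_scheme \<Rightarrow> (nat \<Rightarrow> ('a \<Rightarrow>\<^sub>0 complex) set) filtered_lie" where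
  "malcev_lie G = (let A = completed_group_algebra G in \<lparr>
     carrier = primitive_elements G,
     mult = (\<lambda>x y. x \<otimes>\<^bsub>A\<^esub> y \<ominus>\<^bsub>A\<^esub> y \<otimes>\<^bsub>A\<^esub> x),
     one = \<zero>\<^bsub>A\<^esub>,
     zero = \<zero>\<^bsub>A\<^esub>,
     add = add A,
     smult = smult A,
     filt = (\<lambda>r. {x \<in> primitive_elements G. x r = \<zero>\<^bsub>quot (group_algebra G) (augmentation_power G r)\<^esub>})\<rparr>)"

definition filtered_formal :: "('a, 'b) monoid_scheme \<Rightarrow> bool" where
  "filtered_formal G \<longleftrightarrow> filtered_isomorphic (malcev_lie G) (degree_completion (gr G))"

definition finitely_generated_group :: "('a, 'b) monoid_scheme \<Rightarrow> bool" where
  "finitely_generated_group G \<longleftrightarrow>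
     group G \<and> (\<exists>S. finite S \<and> S \<subseteq> carrier G \<and> generate G S = carrier G)"

end

(*
  Every comparison is made on an explicit vector space U that surjects linearly onto both
  finite-dimensional spaces: dimensions are compared by comparing the kernels in U.

  (1) U is spanned by the nonassociative monomials of degree k in H_1. Since gr(G) is generated in
  degree 1, both h/h'' and gr/gr'' are quotients of U. That Psi exists amounts to: a functional f on
  Gamma_2/Gamma_3 extends to a function F on G with F(xy) = F(x) + F(y) + f[x,y]/2. Conversely,
  every relation in gr_2 comes from the cup product, by an explicit 2-cycle in the bar complex.

  (2) U = C[Gamma_k]. An element of gr'' is represented by elements of G'', and
  equality holds once the class in gr_k of every c in Gamma_k and G'' lies in gr''; this is clear for
  k <= 3 because G'' is contained in Gamma_4. If m(G) is isomorphic to the completion of gr(G) by phi, then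
  x |-> phi(log x)_k induces a Lie endomorphism alpha of gr(G). It is onto because a primitive
  element of I^k is modulo I^(k+1) a combination of x - 1 with x in Gamma_k. As log xy - log x - log y is a
  combination of brackets, phi(log c) lies in gr'' for c in G'', so alpha [c] lies in gr''; and alpha is
  injective on the finite-dimensional space (gr/gr'')_k, being onto. Both facts on logarithms are
  obtained by applying the first Eulerian idempotent to products of primitive elements.
*)
theory Submission
  imports Defs
begin

section \<open>Linear algebra\<close>

text \<open>Behind part (2) stand the Baker-Campbell-Hausdorff formula, the Poincare-Birkhoff-Witt
  theorem and Quillen's description of gr C[G]; only fragments of them enter. The linear extension
  of x -> x^2 to C[G] acts on a product of n elements that are primitive modulo I^r as 2^n, up to
  shorter products and I^r. A polynomial in this operator therefore projects onto length 1; that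
  gives the bracket form of log xy and the surjectivity of alpha. Injectivity is obtained by
  counting dimensions, since an isomorphism of filtered Lie algebras need not induce the identity on
  gr(G) and alpha is at first only an endomorphism. Counting needs finite dimension: it is proved
  for h/h'' by monomials in a finite spanning set of H_1 and passes to gr/gr'' along a surjection.
  In part (1) the factor 1/2 makes F(xy) - F(yx) equal to f[x,y], and complex values can be divided
  by integers, which is what lets F be extended over a new generator some power of which is already
  covered.\<close>

abbreviation cvs :: "(complex, 'l, 'm) module_scheme => bool" where
 "cvs L \<equiv> vectorspace class_ring L"

abbreviation subsp :: "'l set => (complex, 'l, 'm) module_scheme => bool" where
 "subsp N L \<equiv> VectorSpace.subspace class_ring N L"

abbreviation lin_hom ::
 "(complex, 'l, 'm) module_scheme => (complex, 'k, 'n) module_scheme => ('l => 'k) set" where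
 "lin_hom L M \<equiv> LinearCombinations.module_hom class_ring L M"

lemma cvsI:
 fixes L :: "(complex, 'l, 'm) module_scheme" (structure)
 assumes "\<And>x y. x \<in> carrier L ==> y \<in> carrier L ==> x \<oplus> y \<in> carrier L"
  "\<zero> \<in> carrier L"
  "\<And>x y z. x \<in> carrier L ==> y \<in> carrier L ==> z \<in> carrier L ==> (x \<oplus> y) \<oplus> z = x \<oplus> (y \<oplus> z)"
  "\<And>x y. x \<in> carrier L ==> y \<in> carrier L ==> x \<oplus> y = y \<oplus> x"
  "\<And>x. x \<in> carrier L ==> \<zero> \<oplus> x = x"
  "\<And>x. x \<in> carrier L ==> \<exists>y\<in>carrier L. y \<oplus> x = \<zero>"
  "\<And>c x. x \<in> carrier L ==> c \<odot> x \<in> carrier L"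
  "\<And>c d x. x \<in> carrier L ==> (c + d) \<odot> x = c \<odot> x \<oplus> d \<odot> x"
  "\<And>c x y. x \<in> carrier L ==> y \<in> carrier L ==> c \<odot> (x \<oplus> y) = c \<odot> x \<oplus> c \<odot> y"
  "\<And>c d x. x \<in> carrier L ==> (c * d) \<odot> x = c \<odot> (d \<odot> x)"
  "\<And>x. x \<in> carrier L ==> 1 \<odot> x = x"
 shows "cvs L"
proof -
 have "abelian_group L" by (rule abelian_groupI) (use assms in auto)
 moreover have "cring (class_ring :: complex ring)" using class_cring.cring_axioms .
 ultimately have "Module.module class_ring L" by (intro moduleI) (use assms in auto)
 thus ?thesis unfolding vectorspace_def using class_field by blast
qed

context
 fixes L :: "(complex, 'l, 'm) module_scheme" (structure)
 assumes L: "cvs L"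
begin

interpretation V: vectorspace class_ring L by (rule L)

lemma cvs_abelian_group: "abelian_group L" by (rule V.abelian_group_axioms)

lemma cvs_module: "Module.module class_ring L" by (rule V.module_axioms)

lemma cvs_smult [simp]: "x \<in> carrier L ==> c \<odot> x \<in> carrier L" by simp

lemma cvs_add [simp]: "x \<in> carrier L ==> y \<in> carrier L ==> x \<oplus> y \<in> carrier L" by simp

lemma cvs_zero [simp]: "\<zero> \<in> carrier L" by simp

lemma cvs_assoc: "x \<in> carrier L ==> y \<in> carrier L ==> z \<in> carrier L ==>
  (x \<oplus> y) \<oplus> z = x \<oplus> (y \<oplus> z)"
 by (simp add: V.a_assoc)

lemma cvs_comm: "x \<in> carrier L ==> y \<in> carrier L ==> x \<oplus> y = y \<oplus> x" by (simp add: V.M.a_comm)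

lemma cvs_zero_left [simp]: "x \<in> carrier L ==> \<zero> \<oplus> x = x" by simp

lemma cvs_zero_right [simp]: "x \<in> carrier L ==> x \<oplus> \<zero> = x" by simp

lemma cvs_smult_add: "x \<in> carrier L ==> y \<in> carrier L ==> c \<odot> (x \<oplus> y) = c \<odot> x \<oplus> c \<odot> y" by (simp add: V.smult_r_distr)

lemma cvs_add_smult: "x \<in> carrier L ==> (c + d) \<odot> x = c \<odot> x \<oplus> d \<odot> x" using V.smult_l_distr[of c d x] by simp

lemma cvs_smult_smult: "x \<in> carrier L ==> c \<odot> (d \<odot> x) = (c * d) \<odot> x" using V.smult_assoc1[of c d x] by simp

lemma cvs_one [simp]: "x \<in> carrier L ==> 1 \<odot> x = x" using V.smult_one[of x] by simp

lemma cvs_smult_zero_left [simp]: "x \<in> carrier L ==> 0 \<odot> x = \<zero>" using V.smult_l_null[of x] by simp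

lemma cvs_smult_zero [simp]: "c \<odot> \<zero> = \<zero>" using V.smult_r_null[of c] by simp

lemma cvs_minus: "x \<in> carrier L ==> \<ominus> x = (-1) \<odot> x" using V.smult_minus_1[of x] by (simp add: class_ring_simps)

lemma cvs_minus_closed [simp]: "x \<in> carrier L ==> \<ominus> x \<in> carrier L" by simp

lemma cvs_diff_closed [simp]: "x \<in> carrier L ==> y \<in> carrier L ==> x \<ominus> y \<in> carrier L" by simp

lemma cvs_diff: "x \<in> carrier L ==> y \<in> carrier L ==> x \<ominus> y = x \<oplus> (-1) \<odot> y" by (simp add: a_minus_def cvs_minus)

lemma cvs_diff_eq_zero: "x \<in> carrier L ==> y \<in> carrier L ==> x \<ominus> y = \<zero> \<longleftrightarrow> x = y"
 by (metis V.M.add.inv_closed V.M.minus_eq V.M.minus_equality V.M.minus_minus V.M.r_neg)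

lemma cvs_add_diff: "x \<in> carrier L ==> y \<in> carrier L ==> (x \<oplus> y) \<ominus> y = x" by (simp add: V.M.minus_eq V.M.a_assoc V.M.r_neg)

lemma cvs_add_eq_zero: "x \<in> carrier L ==> y \<in> carrier L ==> x \<oplus> y = \<zero> ==> y = (-1) \<odot> x"
 by (metis V.M.minus_equality V.M.minus_minus cvs_minus V.M.a_comm)

lemma cvs_finsum_closed [simp]: "(\<And>x. x \<in> A ==> f x \<in> carrier L) ==> finsum L f A \<in> carrier L" by (rule V.M.finsum_closed) auto

lemma subspI:
 assumes "N \<subseteq> carrier L" "\<zero> \<in> N"
  "\<And>x y. x \<in> N ==> y \<in> N ==> x \<oplus> y \<in> N" "\<And>c x. x \<in> N ==> c \<odot> x \<in> N"
 shows "subsp N L" using assms unfolding VectorSpace.subspace_def submodule_def by (simp add: L cvs_module)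

lemma subsp_carrier: "subsp (carrier L) L" by (rule subspI) auto

lemma span_of_subsp: "A \<subseteq> carrier L ==> subsp (span_of L A) L" by (rule V.span_is_subspace)

lemma span_of_base: "A \<subseteq> carrier L ==> a \<in> A ==> a \<in> span_of L A" using V.in_own_span by blast

lemma span_of_closed: "A \<subseteq> carrier L ==> x \<in> span_of L A ==> x \<in> carrier L" using V.span_is_subset2 by blast

lemma span_of_subset: "subsp N L ==> A \<subseteq> N ==> span_of L A \<subseteq> N" using V.span_is_subset by (simp add: VectorSpace.subspace_def)

lemma span_of_mono: "A \<subseteq> B ==> span_of L A \<subseteq> span_of L B" by (rule V.span_is_monotone)

lemma dim_le_card_span:
 assumes "finite A" "A \<subseteq> carrier L" "carrier L \<subseteq> span_of L A"
 shows "dim_of L \<le> card A"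
proof -
 have "V.gen_set A" using assms V.span_is_subset2[of A] by auto
 thus ?thesis using assms by (intro V.gen_ge_dim) auto
qed

lemma dim_spanning_set:
 assumes "finite A" "A \<subseteq> carrier L" "carrier L \<subseteq> span_of L A"
 shows "\<exists>B. finite B \<and> card B = dim_of L \<and> B \<subseteq> carrier L \<and> carrier L \<subseteq> span_of L B"
proof -
 have "V.gen_set A" using assms V.span_is_subset2[of A] by auto
 hence fd: "V.fin_dim" using assms unfolding V.fin_dim_def by auto
 obtain B where "finite B" "V.basis B" using V.finite_basis_exists[OF fd] by auto
 thus ?thesis using V.dim_basis[of B] unfolding V.basis_def by auto
qed

end

lemma span_of_induct [consumes 3, case_names zero base add smult]:
 assumes L: "cvs L" and "x \<in> span_of L A" "A \<subseteq> carrier L" "P \<zero>\<^bsub>L\<^esub>" "\<And>a. a \<in> A ==> P a"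
  "\<And>x y. x \<in> carrier L ==> y \<in> carrier L ==> P x ==> P y ==> P (x \<oplus>\<^bsub>L\<^esub> y)"
  "\<And>c x. x \<in> carrier L ==> P x ==> P (c \<odot>\<^bsub>L\<^esub> x)"
 shows "P x"
proof -
 have "subsp {x \<in> carrier L. P x} L" by (rule subspI[OF L]) (use assms cvs_zero[OF L] cvs_add[OF L] cvs_smult[OF L] in auto)
 hence "span_of L A \<subseteq> {x \<in> carrier L. P x}" by (rule span_of_subset[OF L]) (use assms cvs_zero[OF L] cvs_add[OF L] cvs_smult[OF L] in auto)
 thus ?thesis using assms by auto
qed

lemma subspD:
 assumes "subsp N L"
 shows "N \<subseteq> carrier L" "\<zero>\<^bsub>L\<^esub> \<in> N" "\<And>x y. x \<in> N ==> y \<in> N ==> x \<oplus>\<^bsub>L\<^esub> y \<in> N"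
  "\<And>c x. x \<in> N ==> c \<odot>\<^bsub>L\<^esub> x \<in> N" "cvs L" using assms unfolding VectorSpace.subspace_def submodule_def by auto

lemma subsp_cvs: "subsp N L ==> cvs (L\<lparr>carrier := N\<rparr>)" by (rule vectorspace.subspace_is_vs) (auto simp: subspD)

lemma subsp_diff: "subsp N L ==> x \<in> N ==> y \<in> N ==> x \<ominus>\<^bsub>L\<^esub> y \<in> N" using subspD[of N L] by (simp add: cvs_diff subset_iff)

lemma cvs_cong:
 assumes L: "cvs L" and "carrier M = carrier L" "add M = add L" "zero M = zero L" "smult M = smult L"
 shows "cvs M"
proof -
 have "\<exists>y\<in>carrier L. y \<oplus>\<^bsub>L\<^esub> x = \<zero>\<^bsub>L\<^esub>" if "x \<in> carrier L" for x
  using that abelian_group.l_neg[OF cvs_abelian_group[OF L]] cvs_minus_closed[OF L] by blast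
 thus ?thesis using assms by (intro cvsI)
   (auto simp: cvs_assoc cvs_smult_add cvs_add_smult cvs_smult_smult intro: cvs_comm)
qed

lemma lin_homI:
 assumes "\<And>x. x \<in> carrier L ==> f x \<in> carrier M"
  "\<And>x y. x \<in> carrier L ==> y \<in> carrier L ==> f (x \<oplus>\<^bsub>L\<^esub> y) = f x \<oplus>\<^bsub>M\<^esub> f y"
  "\<And>c x. x \<in> carrier L ==> f (c \<odot>\<^bsub>L\<^esub> x) = c \<odot>\<^bsub>M\<^esub> f x"
 shows "f \<in> lin_hom L M" using assms unfolding LinearCombinations.module_hom_def by auto

lemma lin_homD:
 assumes "f \<in> lin_hom L M"
 shows "\<And>x. x \<in> carrier L ==> f x \<in> carrier M"
  "\<And>x y. x \<in> carrier L ==> y \<in> carrier L ==> f (x \<oplus>\<^bsub>L\<^esub> y) = f x \<oplus>\<^bsub>M\<^esub> f y"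
  "\<And>c x. x \<in> carrier L ==> f (c \<odot>\<^bsub>L\<^esub> x) = c \<odot>\<^bsub>M\<^esub> f x" using assms unfolding LinearCombinations.module_hom_def by auto

lemma lin_hom_zero: "f \<in> lin_hom L M ==> cvs L ==> cvs M ==> f \<zero>\<^bsub>L\<^esub> = \<zero>\<^bsub>M\<^esub>"
 using lin_homD(3)[of f L M "\<zero>\<^bsub>L\<^esub>" 0] lin_homD(1)[of f L M "\<zero>\<^bsub>L\<^esub>"] by simp

lemma lin_hom_diff: "f \<in> lin_hom L M ==> cvs L ==> cvs M ==> x \<in> carrier L ==> y \<in> carrier L ==>
  f (x \<ominus>\<^bsub>L\<^esub> y) = f x \<ominus>\<^bsub>M\<^esub> f y"
 by (simp add: cvs_diff lin_homD)

lemma lin_hom_comp: "f \<in> lin_hom L M ==> g \<in> lin_hom M N ==> (\<lambda>x. g (f x)) \<in> lin_hom L N" by (rule lin_homI) (simp_all add: lin_homD)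

lemma lin_vimage:
 assumes "f \<in> lin_hom L M" "cvs L" "subsp N M"
 shows "subsp {x \<in> carrier L. f x \<in> N} L" by (rule subspI) (use assms subspD[OF assms(3)] in "auto simp: lin_homD lin_hom_zero")

lemma lin_hom_image:
 assumes "f \<in> lin_hom L M" "cvs M" "subsp N L"
 shows "subsp (f ` N) M"
proof (rule subspI)
 note N = subspD[OF assms(3)]
 show "f ` N \<subseteq> carrier M" using N assms by (auto simp: lin_homD subset_iff)
 show "\<zero>\<^bsub>M\<^esub> \<in> f ` N" using N lin_hom_zero[OF assms(1)] assms(2) by (metis image_eqI)
 fix x y assume "x \<in> f ` N" "y \<in> f ` N"
 then obtain a b where "a \<in> N" "b \<in> N" "x = f a" "y = f b" by auto
 thus "x \<oplus>\<^bsub>M\<^esub> y \<in> f ` N" using N lin_homD(2)[OF assms(1), of a b] by (metis image_eqI subsetD)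
next
 note N = subspD[OF assms(3)]
 fix c x assume "x \<in> f ` N"
 then obtain a where "a \<in> N" "x = f a" by auto
 thus "c \<odot>\<^bsub>M\<^esub> x \<in> f ` N" using N lin_homD(3)[OF assms(1), of a c] by (metis image_eqI subsetD)
qed (use assms in auto)

lemma span_of_image:
 assumes "f \<in> lin_hom L M" "cvs L" "cvs M" "A \<subseteq> carrier L" "x \<in> span_of L A" "f ` A \<subseteq> N" "subsp N M"
 shows "f x \<in> N"
proof -
 have "A \<subseteq> {x \<in> carrier L. f x \<in> N}" using assms by auto
 with span_of_subset[OF assms(2) lin_vimage[OF assms(1,2,7)]] assms(5) show ?thesis by auto
qed

text \<open>The kernel condition makes \<open>p2\<close> factor through \<open>p1\<close>, so
  \<open>W\<close> is a quotient of \<open>V\<close>: lifts of a spanning set of \<open>V\<close> of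
  size dim V are sent by \<open>p2\<close> to a spanning set of \<open>W\<close>. The second claim
  is kept because finite-dimensionality is handed on from space to space in this way.\<close>

lemma dim_le_of_kernels:
 fixes V (structure)
 assumes V: "cvs V" and W: "cvs W" and U: "cvs U"
  and p1: "p1 \<in> lin_hom U V" and p2: "p2 \<in> lin_hom U W"
  and on1: "p1 ` carrier U = carrier V" and on2: "p2 ` carrier U = carrier W"
  and ker: "\<And>u. u \<in> carrier U ==> p1 u = \<zero> ==> p2 u = \<zero>\<^bsub>W\<^esub>"
  and fin: "finite A" "A \<subseteq> carrier V" "carrier V \<subseteq> span_of V A"
 shows "dim_of W \<le> dim_of V" "\<exists>B. finite B \<and> B \<subseteq> carrier W \<and> carrier W \<subseteq> span_of W B"
proof -
 obtain B where B: "finite B" "card B = dim_of V" "B \<subseteq> carrier V" "carrier V \<subseteq> span_of V B" using dim_spanning_set[OF V fin] by auto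
 \<comment> \<open>A merely set-theoretic section of \<open>p1\<close>; linearity is recovered
   afterwards from \<open>same\<close>.\<close>
 define s where "s b = (SOME u. u \<in> carrier U \<and> p1 u = b)" for b
 have s: "s b \<in> carrier U" "p1 (s b) = b" if "b \<in> carrier V" for b
 proof -
  have "\<exists>u. u \<in> carrier U \<and> p1 u = b" using that on1 by force
  from someI_ex[OF this] show "s b \<in> carrier U" "p1 (s b) = b" unfolding s_def by auto
 qed
 define C where "C = (\<lambda>b. p2 (s b)) ` B"
 have C: "C \<subseteq> carrier W" unfolding C_def using B s lin_homD(1)[OF p2] by auto
 have sC: "subsp (span_of W C) W" by (rule span_of_subsp[OF W C])
 note SC = subspD[OF sC]
 have same: "p2 u = p2 v" if "u \<in> carrier U" "v \<in> carrier U" "p1 u = p1 v" for u v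
 proof -
  have "p1 (u \<ominus>\<^bsub>U\<^esub> v) = \<zero>" using that lin_homD(1)[OF p1] by (simp add: lin_hom_diff[OF p1 U V] cvs_diff_eq_zero[OF V])
  hence "p2 (u \<ominus>\<^bsub>U\<^esub> v) = \<zero>\<^bsub>W\<^esub>" using that ker U by simp
  thus ?thesis using that lin_homD(1)[OF p2] by (simp add: lin_hom_diff[OF p2 U W] cvs_diff_eq_zero[OF W])
 qed
 \<comment> \<open>All preimages of \<open>v\<close> are treated at once, since the sum of two
   chosen lifts need not be the chosen lift of the sum.\<close>
 have main: "\<forall>u\<in>carrier U. p1 u = v \<longrightarrow> p2 u \<in> span_of W C" if "v \<in> span_of V B" for v using V that B(3)
 proof (induction rule: span_of_induct)
  case zero
  have "p1 \<zero>\<^bsub>U\<^esub> = \<zero>" by (rule lin_hom_zero[OF p1 U V])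
  thus ?case using ker SC(2) by auto
 next
  case (base a)
  hence "p2 (s a) \<in> span_of W C" using span_of_base[OF W C] unfolding C_def by auto
  moreover have "s a \<in> carrier U" "p1 (s a) = a" using base B s by auto
  ultimately show ?case using same by metis
 next
  case (add x y)
  show ?case
  proof (intro ballI impI)
   fix u assume u: "u \<in> carrier U" "p1 u = x \<oplus> y"
   have "p1 u = p1 (s x \<oplus>\<^bsub>U\<^esub> s y)" using u add s by (simp add: lin_homD[OF p1])
   hence "p2 u = p2 (s x \<oplus>\<^bsub>U\<^esub> s y)" using u add s U by (intro same) auto
   also have "\<dots> = p2 (s x) \<oplus>\<^bsub>W\<^esub> p2 (s y)" using add s by (simp add: lin_homD[OF p2])
   finally show "p2 u \<in> span_of W C" using add s SC by auto
  qed
 next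
  case (smult c x)
  show ?case
  proof (intro ballI impI)
   fix u assume u: "u \<in> carrier U" "p1 u = c \<odot> x"
   have "p1 u = p1 (c \<odot>\<^bsub>U\<^esub> s x)" using u smult s by (simp add: lin_homD[OF p1])
   hence "p2 u = p2 (c \<odot>\<^bsub>U\<^esub> s x)" using u smult s U by (intro same) auto
   also have "\<dots> = c \<odot>\<^bsub>W\<^esub> p2 (s x)" using smult s by (simp add: lin_homD[OF p2])
   finally show "p2 u \<in> span_of W C" using smult s SC by auto
  qed
 qed
 have "carrier W \<subseteq> span_of W C"
 proof
  fix w assume "w \<in> carrier W"
  then obtain u where u: "u \<in> carrier U" "w = p2 u" using on2 by force
  hence "p1 u \<in> span_of V B" using B lin_homD(1)[OF p1] by auto
  thus "w \<in> span_of W C" using main u by auto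
 qed
 moreover have "finite C" "card C \<le> dim_of V" unfolding C_def using B card_image_le[of B] by auto
 ultimately show "dim_of W \<le> dim_of V" "\<exists>B. finite B \<and> B \<subseteq> carrier W \<and> carrier W \<subseteq> span_of W B"
  using dim_le_card_span[OF W, of C] C by auto
qed

text \<open>A finite spanning set is given on one side only; the first comparison produces one on
  the other side, and then the roles are exchanged.\<close>

lemma dim_eq_of_kernels:
 assumes "cvs V" "cvs W" "cvs U" "p1 \<in> lin_hom U V" "p2 \<in> lin_hom U W"
  "p1 ` carrier U = carrier V" "p2 ` carrier U = carrier W"
  "\<And>u. u \<in> carrier U ==> p1 u = \<zero>\<^bsub>V\<^esub> \<longleftrightarrow> p2 u = \<zero>\<^bsub>W\<^esub>"
  "finite A" "A \<subseteq> carrier V" "carrier V \<subseteq> span_of V A"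
 shows "dim_of W = dim_of V"
proof -
 obtain B where B: "finite B" "B \<subseteq> carrier W" "carrier W \<subseteq> span_of W B" using dim_le_of_kernels(2)[of V W U p1 p2 A] assms by blast
 have "dim_of W \<le> dim_of V" using dim_le_of_kernels(1)[of V W U p1 p2 A] assms by blast
 moreover have "dim_of V \<le> dim_of W" using dim_le_of_kernels(1)[of W V U p2 p1 B] assms B by blast
 ultimately show ?thesis by simp
qed

section \<open>Quotients of algebras\<close>

lemma cvs_lcomm:
 fixes L (structure)
 assumes "cvs L" "x \<in> carrier L" "y \<in> carrier L" "z \<in> carrier L"
 shows "x \<oplus> (y \<oplus> z) = y \<oplus> (x \<oplus> z)" using assms by (metis cvs_assoc cvs_comm)

lemma quot_simps:
 "carrier (quot L I) = (\<lambda>x. I +>\<^bsub>L\<^esub> x) ` carrier L"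
 "\<zero>\<^bsub>quot L I\<^esub> = I" "add (quot L I) = set_add L" "mult (quot L I) = rcoset_mult L I"
 "\<one>\<^bsub>quot L I\<^esub> = I +>\<^bsub>L\<^esub> \<one>\<^bsub>L\<^esub>" by (auto simp: quot_def A_RCOSETS_def' image_def)

lemma graded_quot_simps:
 "carrier (graded_quot L I) = (\<lambda>x. I +>\<^bsub>L\<^esub> x) ` carrier L"
 "\<zero>\<^bsub>graded_quot L I\<^esub> = I" "add (graded_quot L I) = set_add L"
 "mult (graded_quot L I) = rcoset_mult L I" "smult (graded_quot L I) = smult (quot L I)"
 "homog (graded_quot L I) k = (\<lambda>x. I +>\<^bsub>L\<^esub> x) ` homog L k"
 by (auto simp: graded_quot_def module.extend_def graded_lie.fields_def A_RCOSETS_def' image_def quot_def)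

lemma the_elem_image_const:
 assumes "X \<noteq> {}" "\<And>x. x \<in> X ==> f x = a"
 shows "the_elem (f ` X) = a"
proof -
 have "f ` X = {a}" using assms by force
 thus ?thesis by simp
qed

lemma UN_const2:
 "A \<noteq> {} ==> B \<noteq> {} ==> (\<And>a b. a \<in> A ==> b \<in> B ==> F a b = c) ==> (\<Union>a\<in>A. \<Union>b\<in>B. F a b) = c" by auto

context
 fixes L :: "(complex, 'l, 'm) module_scheme" (structure) and I
 assumes I: "subsp I L"
begin

interpretation V: vectorspace class_ring L using subspD(5)[OF I] .

lemma subsp_abelian_subgroup: "abelian_subgroup I L"
proof (rule abelian_subgroupI3)
 show "additive_subgroup I L"
 proof (rule additive_subgroupI)
  show "subgroup I (add_monoid L)"
  proof (rule V.M.add.subgroupI)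
   fix a assume a: "a \<in> I"
   thus "\<ominus> a \<in> I" using subspD[OF I] cvs_minus[OF subspD(5)[OF I], of a] by auto
  qed (use subspD[OF I] in auto)
 qed
qed (rule V.M.abelian_group_axioms)

interpretation A: abelian_subgroup I L by (rule subsp_abelian_subgroup)

lemma coset_eq_iff:
 assumes "x \<in> carrier L" "y \<in> carrier L"
 shows "I +> x = I +> y \<longleftrightarrow> x \<ominus> y \<in> I"
proof -
 have "x \<in> I +> y \<longleftrightarrow> x \<ominus> y \<in> I" using A.a_rcos_module[OF assms(2,1)] by (simp add: a_minus_def)
 thus ?thesis using A.a_repr_independence'[OF _ assms(2), of x] A.a_rcos_self[OF assms(1)] by metis
qed

lemma coset_mem_iff: "y \<in> I +> x \<longleftrightarrow> (\<exists>i\<in>I. y = i \<oplus> x)" by (auto simp: a_r_coset_def')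

lemma coset_self: "x \<in> carrier L ==> x \<in> I +> x" by (rule A.a_rcos_self)

lemma coset_zero: "I +> \<zero> = I" using V.M.a_coset_add_zero subspD(1)[OF I] by blast

lemma coset_eq_zero_iff: "x \<in> carrier L ==> I +> x = I \<longleftrightarrow> x \<in> I"
 using coset_eq_iff[of x "\<zero>"] coset_zero subspD[OF I] by (simp add: cvs_diff)

lemma coset_add: "x \<in> carrier L ==> y \<in> carrier L ==>
  (I +> x) \<oplus>\<^bsub>quot L I\<^esub> (I +> y) = I +> (x \<oplus> y)"
 by (simp add: quot_simps A.a_rcos_sum)

text \<open>\<open>induced\<close> takes the single element of an image, so being well defined means
  that \<open>h\<close> is invariant under translation by \<open>I\<close>. Most maps out of a
  quotient are evaluated through this.\<close>

lemma induced_coset: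
 assumes "x \<in> carrier L" "\<And>i. i \<in> I ==> h (i \<oplus> x) = h x"
 shows "induced h (I +> x) = h x" unfolding induced_def
proof (rule the_elem_image_const)
 show "I +> x \<noteq> {}" using coset_self[OF assms(1)] by blast
qed (use assms in "auto simp: coset_mem_iff")

lemma coset_smult: "x \<in> carrier L ==>
  c \<odot>\<^bsub>quot L I\<^esub> (I +> x) = I +> (c \<odot> x)"
proof -
 assume x: "x \<in> carrier L"
 note D = subspD[OF I]
 have "I +> c \<odot> (i \<oplus> x) = I +> c \<odot> x" if "i \<in> I" for i
 proof -
  have i: "i \<in> carrier L" using that D by auto
  have "c \<odot> (i \<oplus> x) \<ominus> c \<odot> x = c \<odot> i" using i x D(5) by (simp add: cvs_smult_add cvs_add_diff)
  thus ?thesis using i x D that by (subst coset_eq_iff) auto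
 qed
 from induced_coset[of x "\<lambda>x. I +> c \<odot> x", OF x this] show ?thesis by (simp add: quot_def)
qed

lemma quot_cvs: "cvs (quot L I)"
proof -
 note D = subspD[OF I]
 let ?Q = "quot L I"
 have q: "\<exists>y\<in>carrier ?Q. y \<oplus>\<^bsub>?Q\<^esub> (I +> x) = I" if "x \<in> carrier L" for x
  using that by (intro bexI[of _ "I +> (\<ominus> x)"]) (simp_all add: coset_add V.M.l_neg coset_zero quot_simps(1))
 have z: "I \<oplus>\<^bsub>?Q\<^esub> (I +> x) = I +> x" if "x \<in> carrier L" for x using coset_add[of "\<zero>" x] that by (simp add: coset_zero)
 have c: "I \<in> carrier ?Q" unfolding quot_simps(1) using coset_zero V.M.zero_closed by (metis image_eqI)
 have comm: "(I +> x) \<oplus>\<^bsub>?Q\<^esub> (I +> y) = (I +> y) \<oplus>\<^bsub>?Q\<^esub> (I +> x)"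
  if "x \<in> carrier L" "y \<in> carrier L" for x y
  using that by (simp add: coset_add V.M.a_comm)
 show ?thesis
 proof (rule cvsI, unfold quot_simps(2))
  fix x assume "x \<in> carrier ?Q"
  then obtain a where a: "a \<in> carrier L" "x = I +> a" by (auto simp: quot_simps(1))
  show "I \<oplus>\<^bsub>?Q\<^esub> x = x" using z a by simp
  show "\<exists>y\<in>carrier ?Q. y \<oplus>\<^bsub>?Q\<^esub> x = I" using q a by simp
  show "1 \<odot>\<^bsub>?Q\<^esub> x = x" using a D(5) by (simp add: coset_smult)
  fix c d
  show "c \<odot>\<^bsub>?Q\<^esub> x \<in> carrier ?Q" using a D(5) by (simp add: coset_smult quot_simps(1))
  show "(c + d) \<odot>\<^bsub>?Q\<^esub> x = c \<odot>\<^bsub>?Q\<^esub> x \<oplus>\<^bsub>?Q\<^esub> d \<odot>\<^bsub>?Q\<^esub> x"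
   using a D(5) by (simp add: coset_smult coset_add cvs_add_smult)
  show "(c * d) \<odot>\<^bsub>?Q\<^esub> x = c \<odot>\<^bsub>?Q\<^esub> (d \<odot>\<^bsub>?Q\<^esub> x)" using a D(5) by (simp add: coset_smult cvs_smult_smult)
  fix y assume "y \<in> carrier ?Q"
  then obtain b where b: "b \<in> carrier L" "y = I +> b" by (auto simp: quot_simps(1))
  show "x \<oplus>\<^bsub>?Q\<^esub> y \<in> carrier ?Q" using a b by (simp add: coset_add quot_simps(1))
  show "x \<oplus>\<^bsub>?Q\<^esub> y = y \<oplus>\<^bsub>?Q\<^esub> x" using comm a b by simp
  show "c \<odot>\<^bsub>?Q\<^esub> (x \<oplus>\<^bsub>?Q\<^esub> y) = c \<odot>\<^bsub>?Q\<^esub> x \<oplus>\<^bsub>?Q\<^esub> c \<odot>\<^bsub>?Q\<^esub> y"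
   using a b D(5) by (simp add: coset_smult coset_add cvs_smult_add)
  fix w assume "w \<in> carrier ?Q"
  then obtain d where d: "d \<in> carrier L" "w = I +> d" by (auto simp: quot_simps(1))
  show "x \<oplus>\<^bsub>?Q\<^esub> y \<oplus>\<^bsub>?Q\<^esub> w = x \<oplus>\<^bsub>?Q\<^esub> (y \<oplus>\<^bsub>?Q\<^esub> w)"
   using a b d D(5) by (simp add: coset_add cvs_assoc)
 qed (rule c)
qed

lemma coset_lin_hom: "(\<lambda>x. I +> x) \<in> lin_hom L (quot L I)" by (rule lin_homI) (auto simp: quot_simps(1) coset_add coset_smult)

end

lemma induced_lin_hom:
 assumes f: "f \<in> lin_hom L M" and I: "subsp I L" and M: "cvs M"
  and k: "\<And>i. i \<in> I ==> f i = \<zero>\<^bsub>M\<^esub>"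
 shows "x \<in> carrier L ==> induced f (I +>\<^bsub>L\<^esub> x) = f x" "induced f \<in> lin_hom (quot L I) M"
proof -
 note D = subspD[OF I]
 show *: "induced f (I +>\<^bsub>L\<^esub> x) = f x" if "x \<in> carrier L" for x
  by (rule induced_coset[OF I that]) (use that D lin_homD[OF f] k M in "auto simp: subset_iff")
 show "induced f \<in> lin_hom (quot L I) M" by (rule lin_homI)
   (use D lin_homD[OF f] in "auto simp: quot_simps(1) coset_add[OF I] coset_smult[OF I] *")
qed

text \<open>Bilinearity and nothing more, so that the notion covers Lie algebras, the free
  nonassociative algebra and C[G] at once.\<close>

definition algebra_on :: "(complex, 'l, 'm) module_scheme => bool" where
 "algebra_on L \<longleftrightarrow> cvs L \<and>
  (\<forall>x\<in>carrier L. \<forall>y\<in>carrier L. x \<otimes>\<^bsub>L\<^esub> y \<in> carrier L \<and>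
    (\<forall>z\<in>carrier L. (x \<oplus>\<^bsub>L\<^esub> y) \<otimes>\<^bsub>L\<^esub> z = x \<otimes>\<^bsub>L\<^esub> z \<oplus>\<^bsub>L\<^esub> y \<otimes>\<^bsub>L\<^esub> z \<and>
     z \<otimes>\<^bsub>L\<^esub> (x \<oplus>\<^bsub>L\<^esub> y) = z \<otimes>\<^bsub>L\<^esub> x \<oplus>\<^bsub>L\<^esub> z \<otimes>\<^bsub>L\<^esub> y) \<and>
    (\<forall>c. (c \<odot>\<^bsub>L\<^esub> x) \<otimes>\<^bsub>L\<^esub> y = c \<odot>\<^bsub>L\<^esub> (x \<otimes>\<^bsub>L\<^esub> y) \<and> x \<otimes>\<^bsub>L\<^esub> (c \<odot>\<^bsub>L\<^esub> y) = c \<odot>\<^bsub>L\<^esub> (x \<otimes>\<^bsub>L\<^esub> y)))"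

lemma algD:
 fixes L (structure)
 assumes "algebra_on L"
 shows "cvs L" "\<And>x y. x \<in> carrier L ==> y \<in> carrier L ==> x \<otimes> y \<in> carrier L"
  "\<And>x y z. x \<in> carrier L ==> y \<in> carrier L ==> z \<in> carrier L ==> (x \<oplus> y) \<otimes> z = x \<otimes> z \<oplus> y \<otimes> z"
  "\<And>x y z. x \<in> carrier L ==> y \<in> carrier L ==> z \<in> carrier L ==> z \<otimes> (x \<oplus> y) = z \<otimes> x \<oplus> z \<otimes> y"
  "\<And>c x y. x \<in> carrier L ==> y \<in> carrier L ==> (c \<odot> x) \<otimes> y = c \<odot> (x \<otimes> y)"
  "\<And>c x y. x \<in> carrier L ==> y \<in> carrier L ==> x \<otimes> (c \<odot> y) = c \<odot> (x \<otimes> y)" using assms unfolding algebra_on_def by auto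

lemma algI:
 fixes L (structure)
 assumes "cvs L" "\<And>x y. x \<in> carrier L ==> y \<in> carrier L ==> x \<otimes> y \<in> carrier L"
  "\<And>x y z. x \<in> carrier L ==> y \<in> carrier L ==> z \<in> carrier L ==> (x \<oplus> y) \<otimes> z = x \<otimes> z \<oplus> y \<otimes> z"
  "\<And>x y z. x \<in> carrier L ==> y \<in> carrier L ==> z \<in> carrier L ==> z \<otimes> (x \<oplus> y) = z \<otimes> x \<oplus> z \<otimes> y"
  "\<And>c x y. x \<in> carrier L ==> y \<in> carrier L ==> (c \<odot> x) \<otimes> y = c \<odot> (x \<otimes> y)"
  "\<And>c x y. x \<in> carrier L ==> y \<in> carrier L ==> x \<otimes> (c \<odot> y) = c \<odot> (x \<otimes> y)"
 shows "algebra_on L" using assms unfolding algebra_on_def by auto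

lemma alg_mult_zero:
 fixes L (structure)
 assumes "algebra_on L" "x \<in> carrier L"
 shows "x \<otimes> \<zero> = \<zero>" "\<zero> \<otimes> x = \<zero>" using algD(6)[OF assms(1), of x "\<zero>" 0] algD(5)[OF assms(1), of "\<zero>" x 0]
  algD(1,2)[OF assms(1)] assms(2) by auto

definition alg_hom ::
 "(complex, 'l, 'm) module_scheme => (complex, 'k, 'n) module_scheme => ('l => 'k) set" where
 "alg_hom L M = {f \<in> lin_hom L M. \<forall>x\<in>carrier L. \<forall>y\<in>carrier L. f (x \<otimes>\<^bsub>L\<^esub> y) = f x \<otimes>\<^bsub>M\<^esub> f y}"

lemma alg_homD:
 assumes "f \<in> alg_hom L M"
 shows "f \<in> lin_hom L M" "\<And>x y. x \<in> carrier L ==> y \<in> carrier L ==> f (x \<otimes>\<^bsub>L\<^esub> y) = f x \<otimes>\<^bsub>M\<^esub> f y"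
  "\<And>x. x \<in> carrier L ==> f x \<in> carrier M" using assms lin_homD(1) unfolding alg_hom_def by auto

lemma algebra_idealD:
 assumes "algebra_ideal L I"
 shows "subsp I L" "\<And>x y. x \<in> carrier L ==> y \<in> I ==> x \<otimes>\<^bsub>L\<^esub> y \<in> I"
  "\<And>x y. x \<in> carrier L ==> y \<in> I ==> y \<otimes>\<^bsub>L\<^esub> x \<in> I" using assms unfolding algebra_ideal_def by auto

lemma kernel_algebra_ideal:
 assumes f: "f \<in> alg_hom L M" and L: "algebra_on L" and M: "algebra_on M"
 shows "algebra_ideal L {x \<in> carrier L. f x = \<zero>\<^bsub>M\<^esub>}"
proof -
 note D = algD[OF L] and E = algD[OF M]
 have "subsp {\<zero>\<^bsub>M\<^esub>} M" by (rule subspI) (use E(1) in auto)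
 from lin_vimage[OF alg_homD(1)[OF f] D(1) this]
 show ?thesis unfolding algebra_ideal_def using D alg_homD[OF f] alg_mult_zero[OF M] by auto
qed

lemma ideal_generated_least: "algebra_ideal L I ==> S \<subseteq> I ==> ideal_generated L S \<subseteq> I" unfolding ideal_generated_def by auto

lemma ideal_generated_superset: "x \<in> S ==> x \<in> ideal_generated L S" unfolding ideal_generated_def by auto

lemma ideal_generated_ideal:
 assumes L: "algebra_on L" and "S \<subseteq> carrier L"
 shows "algebra_ideal L (ideal_generated L S)"
proof -
 note D = algD[OF L]
 have c: "algebra_ideal L (carrier L)" unfolding algebra_ideal_def using D subsp_carrier by auto
 have "subsp (ideal_generated L S) L"
 proof (rule subspI[OF D(1)])
  show "ideal_generated L S \<subseteq> carrier L" using c assms by (auto simp: ideal_generated_def)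
  show "\<zero>\<^bsub>L\<^esub> \<in> ideal_generated L S" by (auto simp: ideal_generated_def intro: subspD(2)[OF algebra_idealD(1)])
  fix x assume x: "x \<in> ideal_generated L S"
  show "c \<odot>\<^bsub>L\<^esub> x \<in> ideal_generated L S" for c using x by (auto simp: ideal_generated_def intro: subspD(4)[OF algebra_idealD(1)])
  fix y assume y: "y \<in> ideal_generated L S"
  show "x \<oplus>\<^bsub>L\<^esub> y \<in> ideal_generated L S" using x y by (auto simp: ideal_generated_def intro: subspD(3)[OF algebra_idealD(1)])
 qed
 thus ?thesis unfolding algebra_ideal_def by (auto simp: ideal_generated_def algebra_idealD)
qed

text \<open>\<open>rcoset_mult\<close> is a union over all pairs of representatives. For a two-sided
  ideal all members of this union are one coset, because i b + x j lies in \<open>I\<close>.\<close>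

lemma rcoset_mult_coset:
 fixes L (structure)
 assumes L: "algebra_on L" and I: "algebra_ideal L I" and x: "x \<in> carrier L" and y: "y \<in> carrier L"
 shows "rcoset_mult L I (I +> x) (I +> y) = I +> (x \<otimes> y)"
proof -
 note D = algD[OF L] and J = algebra_idealD[OF I] and K = subspD[OF algebra_idealD(1)[OF I]]
 have eq: "I +> (a \<otimes> b) = I +> (x \<otimes> y)" if ab: "a \<in> I +> x" "b \<in> I +> y" for a b
 proof -
  obtain i j where ij: "i \<in> I" "j \<in> I" "a = i \<oplus> x" "b = j \<oplus> y" using ab coset_mem_iff[OF J(1)] by auto
  hence c: "i \<in> carrier L" "j \<in> carrier L" using K(1) by auto
  have "a \<otimes> b = (i \<otimes> b \<oplus> x \<otimes> j) \<oplus> x \<otimes> y"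
  proof -
   have b: "b \<in> carrier L" using ij c y D(1) by simp
   have "a \<otimes> b = i \<otimes> b \<oplus> x \<otimes> b" using D(3) c(1) x b ij(3) by simp
   also have "x \<otimes> b = x \<otimes> j \<oplus> x \<otimes> y" using D(4) c(2) x y ij(4) by simp
   finally show ?thesis using b c x y D(1,2) by (simp add: cvs_assoc)
  qed
  moreover have "b \<in> carrier L" using ij(4) c(2) y D(1) by simp
  hence I': "i \<otimes> b \<oplus> x \<otimes> j \<in> I" using J(2)[OF x ij(2)] J(3)[OF _ ij(1)] K(3) by blast
  moreover have xy: "x \<otimes> y \<in> carrier L" using D(2) x y by blast
  moreover have c': "i \<otimes> b \<oplus> x \<otimes> j \<in> carrier L" using I' K(1) by blast
  ultimately show ?thesis using coset_eq_iff[OF J(1) cvs_add[OF D(1) c' xy] xy] cvs_add_diff[OF D(1) c' xy] by simp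
 qed
 have "x \<in> I +> x" "y \<in> I +> y" using coset_self[OF J(1)] x y by auto
 hence "I +> x \<noteq> {}" "I +> y \<noteq> {}" by blast+
 thus ?thesis unfolding rcoset_mult_def by (rule UN_const2) (rule eq)
qed

context
 fixes L :: "'l graded_lie" (structure) and I
 assumes I: "subsp I L"
begin

lemma graded_quot_cvs: "cvs (graded_quot L I)" by (rule cvs_cong[OF quot_cvs[OF I]]) (simp_all add: graded_quot_simps quot_simps)

lemma graded_quot_add: "x \<in> carrier L ==> y \<in> carrier L ==>
  (I +> x) \<oplus>\<^bsub>graded_quot L I\<^esub> (I +> y) = I +> (x \<oplus> y)"
 using coset_add[OF I] by (simp add: graded_quot_simps quot_simps)

lemma graded_quot_smult: "x \<in> carrier L ==>
  c \<odot>\<^bsub>graded_quot L I\<^esub> (I +> x) = I +> (c \<odot> x)"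
 using coset_smult[OF I] by (simp add: graded_quot_simps quot_simps)

lemma graded_coset_lin_hom: "(\<lambda>x. I +> x) \<in> lin_hom L (graded_quot L I)"
 by (rule lin_homI) (auto simp: graded_quot_simps(1) graded_quot_add graded_quot_smult)

end

context
 fixes L :: "'l graded_lie" (structure) and I
 assumes L: "algebra_on L" and I: "algebra_ideal L I"
begin

lemma graded_quot_mult: "x \<in> carrier L ==> y \<in> carrier L ==>
  (I +> x) \<otimes>\<^bsub>graded_quot L I\<^esub> (I +> y) = I +> (x \<otimes> y)"
 using rcoset_mult_coset[OF L I] by (simp add: graded_quot_simps)

lemma graded_coset_alg_hom: "(\<lambda>x. I +> x) \<in> alg_hom L (graded_quot L I)" using graded_coset_lin_hom[OF algebra_idealD(1)[OF I]]
 by (simp add: alg_hom_def graded_quot_mult)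

lemma graded_quot_algebra: "algebra_on (graded_quot L I)" by (rule algI)
  (use algD[OF L] graded_quot_cvs[OF algebra_idealD(1)[OF I]] in
   \<open>auto simp: graded_quot_simps(1) graded_quot_mult graded_quot_add[OF algebra_idealD(1)[OF I]]
    graded_quot_smult[OF algebra_idealD(1)[OF I]]\<close>)

lemma induced_alg_hom:
 assumes f: "f \<in> alg_hom L M" and M: "cvs M" and k: "\<And>i. i \<in> I ==> f i = \<zero>\<^bsub>M\<^esub>"
 shows "x \<in> carrier L ==> induced f (I +> x) = f x" "induced f \<in> alg_hom (graded_quot L I) M"
proof -
 note J = algebra_idealD(1)[OF I]
 note * = induced_lin_hom[OF alg_homD(1)[OF f] J M k]
 show "x \<in> carrier L ==> induced f (I +> x) = f x" by (rule *)
 have "induced f \<in> lin_hom (graded_quot L I) M" by (rule lin_homI) (use lin_homD[OF *(2)] in "auto simp: graded_quot_simps quot_simps(1,3)")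
 thus "induced f \<in> alg_hom (graded_quot L I) M" using *(1) algD[OF L] alg_homD[OF f] by (auto simp: alg_hom_def graded_quot_simps(1) graded_quot_mult)
qed

end

section \<open>Derived subspaces of an algebra and their functoriality\<close>

lemma derived_lie_subsp:
 assumes "algebra_on L" "A \<subseteq> carrier L"
 shows "subsp (derived_lie L A) L" unfolding derived_lie_def by (rule span_of_subsp) (use algD[OF assms(1)] assms(2) in "auto simp: subset_iff")

lemma derived_lie_mult:
 assumes "algebra_on L" "A \<subseteq> carrier L" "x \<in> A" "y \<in> A"
 shows "x \<otimes>\<^bsub>L\<^esub> y \<in> derived_lie L A" unfolding derived_lie_def
 by (rule span_of_base) (use algD[OF assms(1)] assms(2-) in "auto simp: subset_iff")

lemma derived_lie_least:
 assumes "algebra_on L" "subsp N L" "\<And>x y. x \<in> A ==> y \<in> A ==> x \<otimes>\<^bsub>L\<^esub> y \<in> N"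
 shows "derived_lie L A \<subseteq> N" unfolding derived_lie_def by (rule span_of_subset) (use algD[OF assms(1)] assms(2-) in auto)

lemma derived_lie_mono:
 assumes "algebra_on L" "A \<subseteq> B"
 shows "derived_lie L A \<subseteq> derived_lie L B" unfolding derived_lie_def by (rule span_of_mono[OF algD(1)[OF assms(1)]]) (use assms(2) in blast)

lemma derived_lie_hom:
 assumes L: "algebra_on L" and M: "algebra_on M" and f: "f \<in> alg_hom L M"
  and A: "A \<subseteq> carrier L" and B: "B \<subseteq> carrier M" and AB: "f ` A \<subseteq> B"
 shows "f ` derived_lie L A \<subseteq> derived_lie M B"
proof -
 have "derived_lie L A \<subseteq> {x \<in> carrier L. f x \<in> derived_lie M B}"
 proof (rule derived_lie_least[OF L lin_vimage[OF alg_homD(1)[OF f]]])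
  fix x y assume xy: "x \<in> A" "y \<in> A"
  hence c: "x \<in> carrier L" "y \<in> carrier L" "f x \<in> B" "f y \<in> B" using A AB by auto
  thus "x \<otimes>\<^bsub>L\<^esub> y \<in> {x \<in> carrier L. f x \<in> derived_lie M B}"
   using algD(2)[OF L c(1,2)] alg_homD(2)[OF f c(1,2)] derived_lie_mult[OF M B c(3,4)] by simp
 qed (use derived_lie_subsp[OF M B] algD(1)[OF L] in auto)
 thus ?thesis by auto
qed

lemma second_derived_subsp: "algebra_on L ==> subsp (second_derived_lie L) L" unfolding second_derived_lie_def
 by (intro derived_lie_subsp subspD(1)[OF derived_lie_subsp]) auto

text \<open>Functoriality of L''. Applied to Psi it gives the inequality of part (1), to the inverse
  of Psi the graded-formal case, and to alpha the final comparison of kernels.\<close>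

lemma second_derived_hom:
 assumes L: "algebra_on L" and M: "algebra_on M" and f: "f \<in> alg_hom L M"
 shows "f ` second_derived_lie L \<subseteq> second_derived_lie M" unfolding second_derived_lie_def
 by (intro derived_lie_hom[OF L M f] subspD(1)[OF derived_lie_subsp] L M order_refl)
  (use alg_homD[OF f] in auto)

section \<open>Free vector spaces\<close>

abbreviation scl :: "complex => ('s \<Rightarrow>\<^sub>0 complex) => ('s \<Rightarrow>\<^sub>0 complex)" where
 "scl c u \<equiv> Poly_Mapping.map ((*) c) u"

abbreviation over (infix "over" 50) where
 "u over S \<equiv> keys u \<subseteq> S"

lemma lookup_scl [simp]: "lookup (scl c u) x = c * lookup u x" by (simp add: map.rep_eq when_def)

lemma scl_add: "scl c (u + v) = scl c u + scl c v" by (rule poly_mapping_eqI) (simp add: lookup_add algebra_simps)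

lemma scl_diff: "scl c (u - v) = scl c u - scl c v" by (rule poly_mapping_eqI) (simp add: lookup_minus algebra_simps)

lemma add_scl: "scl (c + d) u = scl c u + scl d u" by (rule poly_mapping_eqI) (simp add: lookup_add algebra_simps)

lemma scl_scl [simp]: "scl c (scl d u) = scl (c * d) u" by (rule poly_mapping_eqI) (simp add: algebra_simps)

lemma scl_one [simp]: "scl 1 u = u" by (rule poly_mapping_eqI) simp

lemma scl_zero [simp]: "scl 0 u = 0" "scl c 0 = 0" by (rule poly_mapping_eqI; simp)+

lemma scl_minus_one [simp]: "scl (-1) u = - u" by (rule poly_mapping_eqI) simp

lemma scl_sum: "scl c (sum f A) = (\<Sum>x\<in>A. scl c (f x))" by (rule poly_mapping_eqI) (simp add: lookup_sum sum_distrib_left)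

lemma scl_single [simp]: "scl c (single x d) = single x (c * d)" by (rule poly_mapping_eqI) (simp add: lookup_single when_def)

lemma keys_scl: "(scl c u) over keys u" by (auto simp: in_keys_iff)

lemma over_add: "u over S ==> v over S ==> (u + v) over S" using keys_add[of u v] by blast

lemma over_diff: "u over S ==> v over S ==> ((u :: 's \<Rightarrow>\<^sub>0 complex) - v) over S"
 by (auto simp: in_keys_iff lookup_minus) (metis diff_self in_keys_iff subsetD)

lemma keys_sum_subset:
 "(\<And>x. x \<in> A ==> (f x) over S) ==> (\<Sum>x\<in>A. f x :: 's \<Rightarrow>\<^sub>0 complex) over S"
 by (induction A rule: infinite_finite_induct) (auto dest!: subsetD[OF keys_add])

lemma free_module_simps [simp]:
 "carrier (free_module S) = {u. u over S}" "\<zero>\<^bsub>free_module S\<^esub> = 0"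
 "u \<oplus>\<^bsub>free_module S\<^esub> v = u + v" "c \<odot>\<^bsub>free_module S\<^esub> u = scl c u" by (auto simp: free_module_def)

lemma free_cvs [simp]: "cvs (free_module S)"
proof (rule cvsI)
 fix x assume "x \<in> carrier (free_module S)"
 thus "\<exists>y\<in>carrier (free_module S). y \<oplus>\<^bsub>free_module S\<^esub> x = \<zero>\<^bsub>free_module S\<^esub>" by (intro bexI[of _ "-x"]) auto
qed (auto simp: scl_add add_scl dest!: subsetD[OF keys_add] subsetD[OF keys_scl])

lemma free_module_diff [simp]:
 "u over S ==> v over S ==> u \<ominus>\<^bsub>free_module S\<^esub> v = u - v" by (simp add: cvs_diff)

lemma free_subspI:
 assumes "\<And>u. u \<in> N ==> u over S" "0 \<in> N" "\<And>u v. u \<in> N ==> v \<in> N ==> u + v \<in> N"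
  "\<And>c u. u \<in> N ==> scl c u \<in> N"
 shows "subsp N (free_module S)" by (rule subspI) (use assms in auto)

lemma free_subspD:
 assumes "subsp N (free_module S)"
 shows "\<And>u. u \<in> N ==> u over S" "0 \<in> N" "\<And>u v. u \<in> N ==> v \<in> N ==> u + v \<in> N"
  "\<And>c u. u \<in> N ==> scl c u \<in> N" "\<And>u v. u \<in> N ==> v \<in> N ==> u - v \<in> N"
  "\<And>u. u \<in> N ==> - u \<in> N"
proof -
 note D = subspD[OF assms, simplified]
 show D1: "\<And>u. u \<in> N ==> u over S" "0 \<in> N" "\<And>u v. u \<in> N ==> v \<in> N ==> u + v \<in> N"
  "\<And>c u. u \<in> N ==> scl c u \<in> N" using D by auto
 show m: "\<And>u. u \<in> N ==> - u \<in> N" using D1(4)[of _ "-1"] by simp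
 show "\<And>u v. u \<in> N ==> v \<in> N ==> u - v \<in> N" using D1(3)[of _ "- _"] m by force
qed

lemma poly_mapping_as_sum: "finite A ==> u over A ==> u = (\<Sum>x\<in>A. single x (lookup u x))"
 for u :: "'s \<Rightarrow>\<^sub>0 complex"
proof (rule poly_mapping_eqI)
 fix k assume "finite A" "u over A"
 thus "lookup u k = lookup (\<Sum>x\<in>A. single x (lookup u x)) k" by (auto simp: lookup_sum lookup_single when_def in_keys_iff)
qed

lemma pm_induct [consumes 1, case_names zero single add]:
 fixes u :: "'s \<Rightarrow>\<^sub>0 complex"
 assumes "u over S" "P 0" "\<And>x c. x \<in> S ==> P (single x c)"
  "\<And>u v. u over S ==> v over S ==> P u ==> P v ==> P (u + v)"
 shows "P u"
proof -
 have "P (\<Sum>x\<in>A. single x (lookup u x)) \<and> (\<Sum>x\<in>A. single x (lookup u x)) over S"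
  if "finite A" "A \<subseteq> S" for A
  using that
 proof (induction A rule: finite_induct)
  case (insert a A)
  have k: "(single a (lookup u a)) over S" using insert by (auto split: if_splits)
  moreover have "P (single a (lookup u a))" using insert by (intro assms(3)) auto
  ultimately show ?case using insert assms(4) over_add[OF k] by simp
 qed (simp add: assms(2))
 from this[of "keys u"] show ?thesis using assms(1) poly_mapping_as_sum[of "keys u" u] by simp
qed

text \<open>Applied mostly with \<open>N\<close> the preimage of a subspace under a linear map: a
  linear claim about chains is then checked on basis elements only.\<close>

lemma span_free_module:
 assumes "u over S" "subsp N (free_module S')" "\<And>x. x \<in> S ==> single x 1 \<in> N"
 shows "u \<in> N" using assms(1)
proof (induction u rule: pm_induct)
 case (single x c)
 thus ?case using free_subspD(4)[OF assms(2) assms(3), of x c] by simp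
qed (use free_subspD[OF assms(2)] in auto)

section \<open>Linear and bilinear extension of maps between bases\<close>

lemma push_superset:
 assumes "finite A" "u over A"
 shows "pushforward h u = (\<Sum>x\<in>A. single (h x) (lookup u x))" unfolding pushforward_def
 by (rule sum.mono_neutral_left) (use assms in "auto simp: in_keys_iff")

lemma push_add: "pushforward h (u + v) = pushforward h u + pushforward h v"
proof -
 let ?A = "keys u \<union> keys v"
 have "pushforward h w = (\<Sum>x\<in>?A. single (h x) (lookup w x))" if "w = u + v \<or> w = u \<or> w = v" for w
  using that keys_add[of u v] by (intro push_superset) auto
 thus ?thesis by (simp add: lookup_add single_add sum.distrib)
qed

lemma push_scl: "pushforward h (scl c u) = scl c (pushforward h u)" using push_superset[of "keys u" "scl c u" h] keys_scl[of c u] by (simp add: pushforward_def scl_sum)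

lemma push_simps [simp]: "pushforward h 0 = 0" "pushforward h (single x c) = single (h x) c" by (auto simp: pushforward_def)

lemma push_minus: "pushforward h (- u) = - pushforward h u" using push_scl[of h "-1" u] by simp

lemma push_diff: "pushforward h (u - v) = pushforward h u - pushforward h v" using push_add[of h u "-v"] by (simp add: push_minus)

lemma keys_pushforward: "u over S ==> h ` S \<subseteq> T ==> (pushforward h u) over T" unfolding pushforward_def by (rule keys_sum_subset) (auto split: if_splits)

lemma push_lin_hom: "h ` S \<subseteq> T ==> pushforward h \<in> lin_hom (free_module S) (free_module T)"
 by (rule lin_homI) (simp_all add: push_add push_scl keys_pushforward)

lemma push_cong: "(\<And>x. x \<in> keys u ==> f x = g x) ==> pushforward f u = pushforward g u" unfolding pushforward_def by (rule sum.cong) auto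

lemma push_comp: "pushforward f (pushforward g u) = pushforward (\<lambda>x. f (g x)) u"
proof -
 have "u over UNIV" by simp
 thus ?thesis by (induction u rule: pm_induct) (auto simp: push_add)
qed

text \<open>Supports change under addition; summing over common finite supersets makes additivity a
  termwise matter.\<close>

lemma bilinear_superset:
 assumes "finite A" "u over A" "finite B" "v over B"
 shows "bilinear m u v = (\<Sum>x\<in>A. \<Sum>y\<in>B. single (m x y) (lookup u x * lookup v y))"
proof -
 have "bilinear m u v = (\<Sum>x\<in>keys u. \<Sum>y\<in>B. single (m x y) (lookup u x * lookup v y))" unfolding bilinear_def
  by (intro sum.cong refl sum.mono_neutral_left) (use assms in "auto simp: in_keys_iff")
 also have "\<dots> = (\<Sum>x\<in>A. \<Sum>y\<in>B. single (m x y) (lookup u x * lookup v y))"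
  by (intro sum.mono_neutral_left) (use assms in "auto simp: in_keys_iff")
 finally show ?thesis .
qed

lemma bilin_addL: "bilinear m (u + u') v = bilinear m u v + bilinear m u' v"
proof -
 let ?A = "keys u \<union> keys u'"
 have "bilinear m w v = (\<Sum>x\<in>?A. \<Sum>y\<in>keys v. single (m x y) (lookup w x * lookup v y))"
  if "w = u + u' \<or> w = u \<or> w = u'" for w
  using that keys_add[of u u'] by (intro bilinear_superset) auto
 thus ?thesis by (simp add: lookup_add single_add sum.distrib algebra_simps)
qed

lemma bilinear_flip: "bilinear m u v = bilinear (\<lambda>x y. m y x) v u" unfolding bilinear_def by (subst sum.swap) (simp add: mult.commute)

lemma bilin_addR: "bilinear m u (v + v') = bilinear m u v + bilinear m u v'" by (simp add: bilinear_flip[of m u] bilin_addL)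

lemma bilin_sclL: "bilinear m (scl c u) v = scl c (bilinear m u v)" using bilinear_superset[of "keys u" "scl c u" "keys v" v m] keys_scl[of c u]
 by (simp add: bilinear_def scl_sum mult.assoc)

lemma bilin_sclR: "bilinear m u (scl c v) = scl c (bilinear m u v)" by (simp add: bilinear_flip[of m u] bilin_sclL)

lemma bilinear_zero [simp]: "bilinear m 0 v = 0" "bilinear m u 0 = 0" by (auto simp: bilinear_def)

lemma bilinear_single [simp]: "bilinear m (single x c) (single y d) = single (m x y) (c * d)" by (auto simp: bilinear_def)

lemma bilinear_minus_left: "bilinear m (- u) v = - bilinear m u v" using bilin_sclL[of m "-1"] by simp

lemma bilinear_minus_right: "bilinear m u (- v) = - bilinear m u v" using bilin_sclR[of m u "-1"] by simp

lemma bilinear_diff_left: "bilinear m (u - u') v = bilinear m u v - bilinear m u' v" using bilin_addL[of m u "-u'" v] by (simp add: bilinear_minus_left)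

lemma bilinear_diff_right: "bilinear m u (v - v') = bilinear m u v - bilinear m u v'" using bilin_addR[of m u v "-v'"] by (simp add: bilinear_minus_right)

lemma keys_bilinear:
 assumes "u over S" "v over T" "\<And>x y. x \<in> S ==> y \<in> T ==> m x y \<in> R"
 shows "(bilinear m u v) over R" unfolding bilinear_def by (intro keys_sum_subset) (use assms in "auto split: if_splits")

lemma bilinear_cong:
 "(\<And>x y. x \<in> keys u ==> y \<in> keys v ==> m x y = m' x y) ==> bilinear m u v = bilinear m' u v" unfolding bilinear_def by (intro sum.cong) auto

lemma bilinear_pushforward:
 "bilinear m (pushforward f u) (pushforward g v) = bilinear (\<lambda>x y. m (f x) (g y)) u v"
proof -
 have "u over UNIV" "v over UNIV" by auto
 from this(1) show ?thesis
 proof (induction u rule: pm_induct)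
  case (single x c)
  show ?case using \<open>v over UNIV\<close> by (induction v rule: pm_induct) (auto simp: push_add bilin_addR)
 qed (auto simp: push_add bilin_addL)
qed

lemma push_bilinear: "pushforward f (bilinear m u v) = bilinear (\<lambda>x y. f (m x y)) u v"
proof -
 have "u over UNIV" "v over UNIV" by auto
 from this(1) show ?thesis
 proof (induction u rule: pm_induct)
  case (single x c)
  show ?case using \<open>v over UNIV\<close> by (induction v rule: pm_induct) (auto simp: push_add bilin_addR)
 qed (auto simp: push_add bilin_addL)
qed

context
 fixes L :: "(complex, 'l, 'm) module_scheme" (structure) and h :: "'s => 'l" and S :: "'s set"
 assumes L: "cvs L" and h: "\<And>x. x \<in> S ==> h x \<in> carrier L"
begin

interpretation V: vectorspace class_ring L by (rule L)

lemma lin_ext_superset: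
 assumes "finite A" "u over A" "A \<subseteq> S"
 shows "linear_extension L h u = (\<Oplus>x\<in>A. lookup u x \<odot> h x)" unfolding linear_extension_def
proof (rule V.M.add.finprod_mono_neutral_cong_left)
 show "\<And>i. i \<in> A - keys u ==> lookup u i \<odot> h i = \<zero>" using assms h L by (auto simp: in_keys_iff)
qed (use assms h L in "auto simp: subset_iff")

lemma lin_ext_closed [simp]: "u over S ==> linear_extension L h u \<in> carrier L"
 unfolding linear_extension_def by (rule cvs_finsum_closed[OF L]) (use h L in "auto simp: subset_iff")

lemma lin_ext_add:
 assumes "u over S" "v over S"
 shows "linear_extension L h (u + v) = linear_extension L h u \<oplus> linear_extension L h v"
proof -
 let ?A = "keys u \<union> keys v"
 have "linear_extension L h w = (\<Oplus>x\<in>?A. lookup w x \<odot> h x)" if "w = u + v \<or> w = u \<or> w = v" for w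
  using that keys_add[of u v] assms by (intro lin_ext_superset) auto
 moreover have "(\<Oplus>x\<in>?A. lookup (u + v) x \<odot> h x) =
   (\<Oplus>x\<in>?A. lookup u x \<odot> h x \<oplus> lookup v x \<odot> h x)"
  by (rule V.M.add.finprod_cong') (use assms h L in "auto simp: lookup_add cvs_add_smult subset_iff")
 moreover have "\<dots> = (\<Oplus>x\<in>?A. lookup u x \<odot> h x) \<oplus> (\<Oplus>x\<in>?A. lookup v x \<odot> h x)"
  by (rule V.M.finsum_addf) (use assms h L in "auto simp: subset_iff")
 ultimately show ?thesis by simp
qed

lemma lin_ext_single: "x \<in> S ==> linear_extension L h (single x c) = c \<odot> h x" using lin_ext_superset[of "{x}" "single x c"] h L by (simp split: if_splits)

lemma lin_ext_zero: "linear_extension L h 0 = \<zero>" by (simp add: linear_extension_def)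

lemma lin_ext_scl:
 assumes "u over S"
 shows "linear_extension L h (scl c u) = c \<odot> linear_extension L h u" using assms
proof (induction u rule: pm_induct)
 case (add u v)
 thus ?case using keys_scl[of c u] keys_scl[of c v] by (simp add: scl_add lin_ext_add cvs_smult_add[OF L] subset_trans)
qed (simp_all add: lin_ext_zero lin_ext_single cvs_smult_smult[OF L] h L)

lemma lin_ext_lin_hom: "linear_extension L h \<in> lin_hom (free_module S) L" by (rule lin_homI) (auto simp: lin_ext_add lin_ext_scl)

end

lemma lin_hom_eq_on_free_module:
 assumes "f \<in> lin_hom (free_module S) L" "g \<in> lin_hom (free_module S) L" "cvs L"
  "\<And>x. x \<in> S ==> f (single x 1) = g (single x 1)" "u over S"
 shows "f u = g u" using assms(5)
proof (induction u rule: pm_induct)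
 case (single x c)
 thus ?case using lin_homD(3)[OF assms(1), of "single x 1" c] lin_homD(3)[OF assms(2), of "single x 1" c] assms(4) by simp
next
 case (add u v)
 thus ?case using lin_homD(2)[OF assms(1), of u v] lin_homD(2)[OF assms(2), of u v] by simp
qed (use lin_hom_zero[OF assms(1)] lin_hom_zero[OF assms(2)] assms(3) in simp)

section \<open>The lower central series\<close>

context group
begin

abbreviation "GA \<equiv> group_algebra G"
abbreviation "gr2 \<equiv> second_derived_lie (gr G)"
abbreviation carrier_G ("\<G>") where "\<G> \<equiv> carrier G"
abbreviation "com \<equiv> commutator G"
abbreviation "grC \<equiv> carrier (gr G)"
abbreviation "CG \<equiv> free_module \<G>"
abbreviation "zgr k \<equiv> \<zero>\<^bsub>gr_comp G k\<^esub>"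
abbreviation gr_zero ("\<zero>\<^sub>g") where "\<zero>\<^sub>g \<equiv> \<zero>\<^bsub>gr G\<^esub>"
abbreviation gr_plus (infixl "\<oplus>\<^sub>g" 65) where "x \<oplus>\<^sub>g y \<equiv> x \<oplus>\<^bsub>gr G\<^esub> y"
abbreviation gr_minus (infixl "\<ominus>\<^sub>g" 65) where "x \<ominus>\<^sub>g y \<equiv> x \<ominus>\<^bsub>gr G\<^esub> y"
abbreviation gr_bracket_op (infixl "\<otimes>\<^sub>g" 70) where "x \<otimes>\<^sub>g y \<equiv> x \<otimes>\<^bsub>gr G\<^esub> y"
abbreviation gr_smult (infixl "\<odot>\<^sub>g" 70) where "c \<odot>\<^sub>g y \<equiv> c \<odot>\<^bsub>gr G\<^esub> y"
abbreviation gr_coset (infixl "+>\<^sub>g" 60) where "I +>\<^sub>g y \<equiv> I +>\<^bsub>gr G\<^esub> y"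

lemma inv_cancel_left [simp]:
 "x \<in> \<G> ==> y \<in> \<G> ==> inv x \<otimes> (x \<otimes> y) = y"
 "x \<in> \<G> ==> y \<in> \<G> ==> x \<otimes> (inv x \<otimes> y) = y" by (simp_all add: m_assoc[symmetric])

lemma middle_factor:
 assumes "a \<in> \<G>" "b \<in> \<G>" "c \<in> \<G>" "a \<otimes> (b \<otimes> c) = \<one>"
 shows "b = inv a \<otimes> inv c"
proof -
 have "b \<otimes> c = inv a \<otimes> (a \<otimes> (b \<otimes> c))" using assms(1-3) by simp
 also have "\<dots> = inv a" using assms by simp
 finally have "(b \<otimes> c) \<otimes> inv c = inv a \<otimes> inv c" by simp
 thus ?thesis using assms(1-3) by (simp add: m_assoc)
qed

lemma com_closed [simp]: "x \<in> \<G> ==> y \<in> \<G> ==> com x y \<in> \<G>" by (simp add: commutator_def)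

lemma com_one [simp]: "x \<in> \<G> ==> com x \<one> = \<one>"
 "x \<in> \<G> ==> com \<one> x = \<one>" by (simp_all add: commutator_def)

lemma com_inv: "x \<in> \<G> ==> y \<in> \<G> ==> inv (com x y) = com y x" by (simp add: commutator_def m_assoc inv_mult_group)

lemma com_swap: "x \<in> \<G> ==> y \<in> \<G> ==> com x y \<otimes> (y \<otimes> x) = x \<otimes> y" by (simp add: commutator_def m_assoc)

lemma com_conj:
 assumes "x \<in> \<G>" "y \<in> \<G>" "g \<in> \<G>"
 shows "g \<otimes> com x y \<otimes> inv g = com (g \<otimes> x \<otimes> inv g) (g \<otimes> y \<otimes> inv g)"
 using assms by (simp add: commutator_def m_assoc inv_mult_group)

text \<open>The double commutator is placed on the left, where \<open>lcs_coset_eqI\<close> removes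
  it as soon as it lies deep enough.\<close>

lemma com_mult_left:
 assumes "x \<in> \<G>" "x' \<in> \<G>" "y \<in> \<G>"
 shows "com (x \<otimes> x') y = com x (com x' y) \<otimes> (com x' y \<otimes> com x y)" using assms by (simp add: commutator_def m_assoc inv_mult_group)

lemma com_mult_right:
 assumes "x \<in> \<G>" "y \<in> \<G>" "y' \<in> \<G>"
 shows "com x (y \<otimes> y') = com x y \<otimes> (com y (com x y') \<otimes> com x y')" using assms by (simp add: commutator_def m_assoc inv_mult_group)

lemma conj_eq_commutator: "x \<in> \<G> ==> g \<in> \<G> ==> g \<otimes> x \<otimes> inv g = com g x \<otimes> x" by (simp add: commutator_def m_assoc)

text \<open>The conjugates in the outer slots are harmless: they stay in the same normal subgroup,
  which suffices for \<open>com_lcs_pos\<close>, and they change the commutators only in higher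
  weight, which suffices for \<open>jacobi_lcs\<close>.\<close>

lemma Hall_Witt:
 assumes "x \<in> \<G>" "y \<in> \<G>" "z \<in> \<G>"
 shows "com (com x y) (y \<otimes> z \<otimes> inv y) \<otimes>
  (com (com y z) (z \<otimes> x \<otimes> inv z) \<otimes>
  com (com z x) (x \<otimes> y \<otimes> inv x)) = \<one>"
 using assms by (simp add: commutator_def m_assoc inv_mult_group)

lemma lcs_normal: "lcs G k \<lhd> G"
proof (induction k)
 case 0
 show ?case using normal_self by simp
next
 case (Suc k)
 show ?case
 proof (cases "k = 0")
  case True
  thus ?thesis using normal_self by simp
 next
  case False
  interpret N: normal "lcs G k" G by (rule Suc)
  have "generate G {com x y | x y. x \<in> lcs G k \<and> y \<in> \<G>} \<lhd> G"
  proof (rule normal_generateI)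
   fix h g assume "h \<in> {com x y | x y. x \<in> lcs G k \<and> y \<in> \<G>}" and g: "g \<in> \<G>"
   then obtain x y where h: "h = com x y" "x \<in> lcs G k" "y \<in> \<G>" by auto
   hence "g \<otimes> h \<otimes> inv g = com (g \<otimes> x \<otimes> inv g) (g \<otimes> y \<otimes> inv g)" using g N.mem_carrier by (simp add: com_conj)
   moreover have "g \<otimes> x \<otimes> inv g \<in> lcs G k" using g h N.inv_op_closed2 by simp
   ultimately show "g \<otimes> h \<otimes> inv g \<in> {com x y | x y. x \<in> lcs G k \<and> y \<in> \<G>}" using g h by blast
  qed (auto simp: N.mem_carrier)
  thus ?thesis using False by simp
 qed
qed

lemma lcs_subgroup: "subgroup (lcs G k) G" using lcs_normal normal_imp_subgroup by blast

lemma lcs_mem: "x \<in> lcs G k ==> x \<in> \<G>" using subgroup.mem_carrier[OF lcs_subgroup] by blast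

lemma lcs_mult: "x \<in> lcs G k ==> y \<in> lcs G k ==> x \<otimes> y \<in> lcs G k" using subgroup.m_closed[OF lcs_subgroup] by blast

lemma lcs_inv: "x \<in> lcs G k ==> inv x \<in> lcs G k" using subgroup.m_inv_closed[OF lcs_subgroup] by blast

lemma lcs_one: "\<one> \<in> lcs G k" using subgroup.one_closed[OF lcs_subgroup] by blast

lemma lcs_conj: "x \<in> lcs G k ==> g \<in> \<G> ==> g \<otimes> x \<otimes> inv g \<in> lcs G k" using normal.inv_op_closed2[OF lcs_normal] by blast

lemma lcs_1 [simp]: "lcs G (Suc 0) = \<G>" by simp

lemma lcs_Suc: "k \<ge> 1 ==> lcs G (Suc k) = generate G {com x y | x y. x \<in> lcs G k \<and> y \<in> \<G>}" by simp

declare lcs.simps(2) [simp del]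

lemma com_lcs_carrier:
 assumes "k \<ge> 1" "x \<in> lcs G k" "y \<in> \<G>"
 shows "com x y \<in> lcs G (Suc k)" unfolding lcs_Suc[OF assms(1)] using assms by (intro generate.incl) blast

lemma lcs_Suc_subset: "lcs G (Suc k) \<subseteq> lcs G k"
proof (cases "k = 0")
 case False
 have "generate G {com x y | x y. x \<in> lcs G k \<and> y \<in> \<G>} \<subseteq> lcs G k"
 proof (rule generate_subgroup_incl[OF _ lcs_subgroup], clarify)
  fix x y assume "x \<in> lcs G k" "y \<in> \<G>"
  hence "x \<otimes> (y \<otimes> inv x \<otimes> inv y) \<in> lcs G k" by (intro lcs_mult lcs_conj lcs_inv)
  thus "com x y \<in> lcs G k" using \<open>x \<in> lcs G k\<close> \<open>y \<in> \<G>\<close> lcs_mem by (simp add: commutator_def m_assoc)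
 qed
 thus ?thesis using False lcs_Suc[of k] by simp
qed (simp add: lcs.simps)

lemma lcs_antimono: "i \<le> j ==> lcs G j \<subseteq> lcs G i" using lift_Suc_antimono_le[of "lcs G" i j] lcs_Suc_subset by blast

text \<open>The three subgroups argument, by induction on the second degree: Hall-Witt writes
  [[b,c],a] as a product of inverses of two commutators, to which the induction hypothesis applies
  with first degree \<open>i\<close> and \<open>Suc i\<close>. Hence \<open>i\<close> is arbitrary
  in the induction.\<close>

lemma com_lcs_pos:
 "i \<ge> 1 ==> x \<in> lcs G i ==> y \<in> lcs G (Suc j) ==> com x y \<in> lcs G (Suc (i + j))"
proof (induction j arbitrary: i x y)
 case 0
 thus ?case using com_lcs_carrier lcs_mem by simp
next
 case (Suc j)
 let ?N = "lcs G (Suc (i + Suc j))"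
 interpret N: normal ?N G by (rule lcs_normal)
 have base: "com (com b c) a \<in> ?N" if a: "a \<in> lcs G i" and b: "b \<in> lcs G (Suc j)" and c: "c \<in> \<G>" for a b c
 proof -
  \<comment> \<open>Chosen so that the conjugation by \<open>c\<close> in the middle factor of
    Hall-Witt turns \<open>a'\<close> back into \<open>a\<close>.\<close>
  define a' where "a' = inv c \<otimes> a \<otimes> c"
  have a': "a' \<in> lcs G i" unfolding a'_def using lcs_conj[OF a, of "inv c"] c by simp
  have cc: "a \<in> \<G>" "b \<in> \<G>" "a' \<in> \<G>" using a b a' lcs_mem by auto
  have ca: "c \<otimes> a' \<otimes> inv c = a" unfolding a'_def using cc(1) c by (simp add: m_assoc)
  let ?p = "com (com a' b) (b \<otimes> c \<otimes> inv b)"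
  let ?q = "com (com b c) (c \<otimes> a' \<otimes> inv c)"
  let ?r = "com (com c a') (a' \<otimes> b \<otimes> inv a')"
  have p: "?p \<in> ?N" using com_lcs_carrier[OF _ Suc.IH[OF Suc.prems(1) a' b], of "b \<otimes> c \<otimes> inv b"] cc c by simp
  have "com a' c \<in> lcs G (Suc i)" using Suc.prems(1) a' c by (rule com_lcs_carrier)
  hence "com c a' \<in> lcs G (Suc i)" using lcs_inv com_inv cc c by metis
  hence r: "?r \<in> ?N" using Suc.IH[of "Suc i" "com c a'" "a' \<otimes> b \<otimes> inv a'"] lcs_conj[OF b cc(3)] by simp
  have "?p \<otimes> (?q \<otimes> ?r) = \<one>" by (rule Hall_Witt) (use cc c in auto)
  moreover have "?p \<in> \<G>" "?q \<in> \<G>" "?r \<in> \<G>" using cc c by auto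
  ultimately have q: "?q = inv ?p \<otimes> inv ?r" using middle_factor[of ?p ?q ?r] by blast
  have "?q \<in> ?N" unfolding q by (intro lcs_mult lcs_inv p r)
  thus ?thesis by (simp only: ca)
 qed
 have "y \<in> generate G {com x y | x y. x \<in> lcs G (Suc j) \<and> y \<in> \<G>}" using Suc.prems(3) lcs_Suc[of "Suc j"] by simp
 hence "y \<in> \<G> \<and> (\<forall>a\<in>lcs G i. com a y \<in> ?N)"
 proof (induction y rule: generate.induct)
  case one
  thus ?case using lcs_one lcs_mem by auto
 next
  case (incl h)
  then obtain b c where h: "h = com b c" "b \<in> lcs G (Suc j)" "c \<in> \<G>" by auto
  have hc: "h \<in> \<G>" using h lcs_mem by auto
  moreover have "com a h \<in> ?N" if "a \<in> lcs G i" for a using base[OF that h(2,3)] h(1) that hc lcs_inv com_inv lcs_mem by metis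
  ultimately show ?case by blast
 next
  case (inv h)
  then obtain b c where h: "h = com b c" "b \<in> lcs G (Suc j)" "c \<in> \<G>" by auto
  have hc: "h \<in> \<G>" using h lcs_mem by auto
  moreover have "com a (inv h) \<in> ?N" if "a \<in> lcs G i" for a
  proof -
   have ac: "a \<in> \<G>" using that lcs_mem by auto
   have eq: "com a (inv h) = inv h \<otimes> com h a \<otimes> inv (inv h)" using ac hc by (simp add: commutator_def m_assoc)
   have "com h a \<in> ?N" using base[OF that h(2,3)] h(1) by simp
   thus ?thesis unfolding eq using hc by (intro lcs_conj) auto
  qed
  ultimately show ?case by blast
 next
  case (eng h1 h2)
  moreover have "com a (h1 \<otimes> h2) \<in> ?N" if "a \<in> lcs G i" for a
  proof -
   have ac: "a \<in> \<G>" using that lcs_mem by auto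
   have eq: "com a (h1 \<otimes> h2) = com a h1 \<otimes> (h1 \<otimes> com a h2 \<otimes> inv h1)" using ac eng by (simp add: commutator_def m_assoc inv_mult_group)
   show ?thesis unfolding eq using eng that by (intro lcs_mult lcs_conj) auto
  qed
  ultimately show ?case by blast
 qed
 thus ?case using Suc.prems by blast
qed

text \<open>Degree 0 is included because \<open>lcs G 0\<close> is the whole group; replacing it by
  degree 1 shows that the weights still add up.\<close>

lemma com_lcs:
 assumes "x \<in> lcs G i" "y \<in> lcs G j"
 shows "com x y \<in> lcs G (i + j)"
proof (cases "i = 0")
 case True
 show ?thesis
 proof (cases j)
  case (Suc j')
  have "com y x \<in> lcs G (Suc j)" using com_lcs_carrier[of j y x] assms Suc lcs_mem by auto
  hence "com x y \<in> lcs G (Suc j)" using lcs_inv com_inv assms lcs_mem by metis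
  thus ?thesis using True lcs_Suc_subset by auto
 qed (use True assms lcs_mem in "simp add: com_closed")
next
 case False
 hence i: "i \<ge> 1" by simp
 show ?thesis
 proof (cases j)
  case 0
  thus ?thesis using com_lcs_carrier[OF i assms(1), of y] assms lcs_mem lcs_Suc_subset by auto
 next
  case (Suc j')
  thus ?thesis using com_lcs_pos[OF i assms(1), of y j'] assms by simp
 qed
qed

text \<open>A factor in degree 0 may be counted in degree 1. The degree gained makes the class of
  the commutator zero, in accordance with gr_0 = 0.\<close>

lemma com_lcs_degenerate:
 assumes "x \<in> lcs G i" "y \<in> lcs G j" "i = 0 \<or> j = 0"
 shows "com x y \<in> lcs G (Suc (i + j))"
proof (cases "i + j = 0")
 case True
 thus ?thesis using assms lcs_mem by simp
next
 case False
 have "x \<in> lcs G (max i 1)" "y \<in> lcs G (max j 1)" using assms by (auto simp: max_def lcs_mem not_le)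
 moreover have "max i 1 + max j 1 = Suc (i + j)" using assms(3) False by auto
 ultimately show ?thesis using com_lcs by metis
qed

section \<open>Commutators modulo the next term of the lower central series\<close>

lemma lcs_quot_carrier: "carrier (lcs_quot G k) = (\<lambda>x. lcs G (Suc k) #> x) ` lcs G k" by (auto simp: lcs_quot_def FactGroup_def RCOSETS_def r_coset_def)

lemma lcs_quot_mult:
 assumes "x \<in> lcs G k" "y \<in> lcs G k"
 shows "(lcs G (Suc k) #> x) \<otimes>\<^bsub>lcs_quot G k\<^esub> (lcs G (Suc k) #> y) = lcs G (Suc k) #> (x \<otimes> y)"
proof -
 have "(lcs G (Suc k) #> x) <#> (lcs G (Suc k) #> y) = lcs G (Suc k) #> (x \<otimes> y)" using normal.rcos_sum[OF lcs_normal] assms lcs_mem by blast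
 thus ?thesis by (simp add: lcs_quot_def FactGroup_def set_mult_def)
qed

lemma lcs_coset_eq:
 assumes "x \<in> \<G>" "y \<in> \<G>" "lcs G k #> x = lcs G k #> y"
 shows "\<exists>e\<in>lcs G k. x = e \<otimes> y"
proof -
 have "x \<in> lcs G k #> x" using rcos_self[OF assms(1) lcs_subgroup] .
 thus ?thesis using assms by (auto simp: r_coset_def)
qed

lemma lcs_coset_eqI:
 assumes "y \<in> \<G>" "e \<in> lcs G k"
 shows "lcs G k #> (e \<otimes> y) = lcs G k #> y"
proof -
 have "e \<otimes> y \<in> lcs G k #> y" using assms by (auto simp: r_coset_def)
 thus ?thesis using repr_independence[OF _ assms(1) lcs_subgroup] by metis
qed

text \<open>The representatives are changed one argument at a time. Each change multiplies the
  commutator by factors of weight above i + j, which stand on the left or have the trivial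
  coset.\<close>

lemma com_coset_cong:
 assumes x: "x \<in> lcs G i" "x' \<in> lcs G i" and y: "y \<in> lcs G j" "y' \<in> lcs G j"
  and "lcs G (Suc i) #> x = lcs G (Suc i) #> x'" "lcs G (Suc j) #> y = lcs G (Suc j) #> y'"
 shows "lcs G (Suc (i + j)) #> com x y = lcs G (Suc (i + j)) #> com x' y'"
proof -
 interpret N: normal "lcs G (Suc (i + j))" G by (rule lcs_normal)
 let ?c = "\<lambda>x. lcs G (Suc (i + j)) #> x"
 note cc = x[THEN lcs_mem] y[THEN lcs_mem]
 obtain e where e: "e \<in> lcs G (Suc i)" "x = e \<otimes> x'" using lcs_coset_eq assms cc by blast
 obtain f where f: "f \<in> lcs G (Suc j)" "y = f \<otimes> y'" using lcs_coset_eq assms cc by blast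
 note ef = e(1)[THEN lcs_mem] f(1)[THEN lcs_mem]
 have 1: "com e (com x' y) \<in> lcs G (Suc (i + j))" using com_lcs[OF e(1) com_lcs[OF x(2) y(1)]] lcs_antimono[of "Suc (i + j)" "Suc i + (i + j)"] by auto
 have 2: "com e y \<in> lcs G (Suc (i + j))" using com_lcs[OF e(1) y(1)] by simp
 have 3: "com x' f \<in> lcs G (Suc (i + j))" using com_lcs[OF x(2) f(1)] by simp
 have 4: "com f (com x' y') \<in> lcs G (Suc (i + j))" using com_lcs[OF f(1) com_lcs[OF x(2) y(2)]] lcs_antimono[of "Suc (i + j)" "Suc j + (i + j)"] by auto
 have "com x y = com e (com x' y) \<otimes> (com x' y \<otimes> com e y)" using e ef cc com_mult_left by simp
 also have "?c \<dots> = ?c (com x' y \<otimes> com e y)" using 1 ef cc by (intro lcs_coset_eqI) auto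
 also have "\<dots> = ?c (com x' y) <#> ?c (com e y)" using ef cc by (simp add: N.rcos_sum)
 also have "?c (com e y) = ?c \<one>" using 2 lcs_coset_eqI[of \<one> "com e y"] ef cc by simp
 also have "?c (com x' y) <#> ?c \<one> = ?c (com x' y)" using cc by (simp add: N.rcos_sum)
 also have "com x' y = com x' f \<otimes> (com f (com x' y') \<otimes> com x' y')" using f ef cc com_mult_right by simp
 also have "?c \<dots> = ?c (com x' y')" using 3 4 ef cc by (simp add: lcs_coset_eqI)
 finally show ?thesis .
qed

lemma com_mult_left_lcs:
 assumes "x \<in> lcs G i" "x' \<in> lcs G i" "y \<in> lcs G j" "i \<ge> 1"
 shows "com x (com x' y) \<in> lcs G (Suc (i + j))" using com_lcs[OF assms(1) com_lcs[OF assms(2,3)]]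
  lcs_antimono[of "Suc (i + j)" "i + (i + j)"] assms(4) by auto

text \<open>Hall-Witt without its conjugations: replacing b c b^-1 by c as second entry of a
  commutator with [a,b] costs factors of weight at least p + 2q + r, which exceeds i + j + k since q
  >= 1.\<close>

lemma jacobi_lcs:
 assumes x: "x \<in> lcs G i" "i \<ge> 1" and y: "y \<in> lcs G j" "j \<ge> 1" and z: "z \<in> lcs G k" "k \<ge> 1"
 shows "com (com x y) z \<otimes> (com (com y z) x \<otimes>
  com (com z x) y) \<in> lcs G (Suc (i + j + k))"
proof -
 let ?N = "lcs G (Suc (i + j + k))"
 interpret N: normal ?N G by (rule lcs_normal)
 have red: "?N #> com (com a b) (b \<otimes> c \<otimes> inv b) = ?N #> com (com a b) c"
  if a: "a \<in> lcs G p" "p \<ge> 1" and b: "b \<in> lcs G q" "q \<ge> 1" and c: "c \<in> lcs G r" "r \<ge> 1" and "p + q + r = i + j + k"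
  for a b c p q r
 proof -
  note cc = a(1)[THEN lcs_mem] b(1)[THEN lcs_mem] c(1)[THEN lcs_mem]
  note ab = com_lcs[OF a(1) b(1)] and bc = com_lcs[OF b(1) c(1)]
  have 1: "com (com a b) (com b c) \<in> ?N" using com_lcs[OF ab bc] lcs_antimono[of "Suc (i + j + k)" "p + q + (q + r)"] that by auto
  have 2: "com (com b c) (com (com a b) c) \<in> ?N" using com_lcs[OF bc com_lcs[OF ab c(1)]]
    lcs_antimono[of "Suc (i + j + k)" "q + r + (p + q + r)"] that by auto
  have "com (com a b) (b \<otimes> c \<otimes> inv b) = com (com a b) (com b c) \<otimes>
   (com (com b c) (com (com a b) c) \<otimes> com (com a b) c)"
   using cc by (simp add: conj_eq_commutator com_mult_right)
  thus ?thesis using 1 2 cc by (simp add: lcs_coset_eqI)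
 qed
 note cc = x(1)[THEN lcs_mem] y(1)[THEN lcs_mem] z(1)[THEN lcs_mem]
 let ?p = "com (com x y) z" and ?q = "com (com y z) x"
  and ?r = "com (com z x) y"
 have "?N #> (?p \<otimes> (?q \<otimes> ?r)) = (?N #> ?p) <#> ((?N #> ?q) <#> (?N #> ?r))" using cc by (simp add: N.rcos_sum)
 also have "\<dots> = (?N #> com (com x y) (y \<otimes> z \<otimes> inv y)) <#>
  ((?N #> com (com y z) (z \<otimes> x \<otimes> inv z)) <#>
   (?N #> com (com z x) (x \<otimes> y \<otimes> inv x)))"
  using red[OF x y z] red[OF y z x] red[OF z x y] by (simp add: add.commute add.left_commute add.assoc)
 also have "\<dots> = ?N #> \<one>" using cc Hall_Witt[of x y z] by (simp add: N.rcos_sum)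
 finally show ?thesis using lcs_coset_eq[of "?p \<otimes> (?q \<otimes> ?r)" \<one>] cc by (metis com_closed m_closed one_closed r_one lcs_mem)
qed

lemma derived_carrier_eq_lcs: "derived G (\<G>) = lcs G 2"
proof -
 have "(\<Union>h1\<in>\<G>. \<Union>h2\<in>\<G>. {h1 \<otimes> h2 \<otimes> inv h1 \<otimes> inv h2}) =
   {com x y | x y. x \<in> lcs G 1 \<and> y \<in> \<G>}"
  by (auto simp: commutator_def)
 thus ?thesis using lcs_Suc[of 1] by (simp add: derived_def numeral_2_eq_2)
qed

lemma second_derived_normal: "second_derived G \<lhd> G" unfolding second_derived_def by (intro derived_is_normal normal_self)

lemma second_derived_subset: "second_derived G \<subseteq> lcs G 4" unfolding second_derived_def derived_carrier_eq_lcs unfolding derived_def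
proof (rule generate_subgroup_incl[OF _ lcs_subgroup], clarify)
 fix x y assume "x \<in> lcs G 2" "y \<in> lcs G 2"
 from com_lcs[OF this] show "x \<otimes> y \<otimes> inv x \<otimes> inv y \<in> lcs G 4" by (simp add: commutator_def)
qed

end

lemma lcs_hom_image:
 assumes "group_hom G H h" "h ` carrier G = carrier H"
 shows "h ` lcs G k = lcs H k"
proof -
 interpret group_hom G H h by (rule assms(1))
 show ?thesis
 proof (induction k)
  case (Suc k)
  show ?case
  proof (cases "k = 0")
   case False
   have c: "h (commutator G x y) = commutator H (h x) (h y)" if "x \<in> carrier G" "y \<in> carrier G" for x y using that by (simp add: commutator_def)
   have "h ` {commutator G x y | x y. x \<in> lcs G k \<and> y \<in> carrier G} =
     {commutator H x y | x y. x \<in> lcs H k \<and> y \<in> carrier H}" (is "?A = ?B")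
   proof
    show "?A \<subseteq> ?B" proof clarify fix x y assume "x \<in> lcs G k" "y \<in> carrier G" thus "\<exists>xa ya. h (commutator G x y) = commutator H xa ya \<and> xa \<in> lcs H k \<and> ya \<in> carrier H" using c[of x y] G.lcs_mem[of x k] Suc hom_closed[of y] by blast qed
    show "?B \<subseteq> ?A"
    proof clarify
     fix x y assume "x \<in> lcs H k" "y \<in> carrier H"
     then obtain a b where "a \<in> lcs G k" "x = h a" "b \<in> carrier G" "y = h b" using Suc assms(2) by (metis imageE)
     thus "commutator H x y \<in> ?A" using c[of a b] G.lcs_mem[of a k] by (intro image_eqI[of _ _ "commutator G a b"]) auto
    qed
   qed
   moreover have "{commutator G x y | x y. x \<in> lcs G k \<and> y \<in> carrier G} \<subseteq> carrier G" using G.lcs_mem by auto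
   ultimately show ?thesis using False generate_img[of "{commutator G x y | x y. x \<in> lcs G k \<and> y \<in> carrier G}"] by (simp add: G.lcs_Suc H.lcs_Suc)
  qed (use assms(2) in "simp add: lcs.simps")
 qed (use assms(2) in simp)
qed

section \<open>The associated graded Lie algebra\<close>

lemma additivity_relations_generators:
 assumes "\<And>x y. x \<in> carrier A ==> y \<in> carrier A ==> x \<otimes>\<^bsub>A\<^esub> y \<in> carrier A"
 shows "{single (x \<otimes>\<^bsub>A\<^esub> y) (1::complex) - single x 1 - single y 1 | x y. x \<in> carrier A \<and> y \<in> carrier A}
  \<subseteq> carrier (free_module (carrier A))"
proof clarify
 fix x y assume "x \<in> carrier A" "y \<in> carrier A"
 hence "(single (x \<otimes>\<^bsub>A\<^esub> y) (1::complex) - single x 1 - single y 1) over carrier A" using assms by (intro over_diff) auto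
 thus "single (x \<otimes>\<^bsub>A\<^esub> y) (1::complex) - single x 1 - single y 1 \<in> carrier (free_module (carrier A))" by simp
qed

lemma additivity_relations_subsp:
 assumes "\<And>x y. x \<in> carrier A ==> y \<in> carrier A ==> x \<otimes>\<^bsub>A\<^esub> y \<in> carrier A"
 shows "subsp (additivity_relations A) (free_module (carrier A))" unfolding additivity_relations_def
 by (rule span_of_subsp[OF free_cvs additivity_relations_generators]) (rule assms)

text \<open>The composite C[Gamma_k] -> C[Gamma_k/Gamma_(k+1)] -> gr_k. Chains of group elements
  replace chains of cosets, so that computations take place in the group itself.\<close>

definition gr_class :: "('a, 'b) monoid_scheme => nat => ('a \<Rightarrow>\<^sub>0 complex) => ('a set \<Rightarrow>\<^sub>0 complex) set" where
 "gr_class G k u = tensor_class (lcs_quot G k) (pushforward (\<lambda>x. lcs G (Suc k) #>\<^bsub>G\<^esub> x) u)"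

context group
begin

abbreviation "cls \<equiv> gr_class G"

abbreviation lcs_coset :: "nat => 'a => 'a set" where
 "lcs_coset k x \<equiv> lcs G (Suc k) #> x"

lemma lcs_quot_closed: "X \<in> carrier (lcs_quot G k) ==> Y \<in> carrier (lcs_quot G k) ==>
  X \<otimes>\<^bsub>lcs_quot G k\<^esub> Y \<in> carrier (lcs_quot G k)"
 by (auto simp: lcs_quot_carrier lcs_quot_mult lcs_mult)

lemmas lcs_quot_subsp = additivity_relations_subsp[of "lcs_quot G k" for k, OF lcs_quot_closed]

lemma gr_comp_cvs [simp]: "cvs (gr_comp G k)" unfolding gr_comp_def tensor_complex_def by (rule quot_cvs[OF lcs_quot_subsp])

lemma gr_class_lin_hom: "cls k \<in> lin_hom (free_module (lcs G k)) (gr_comp G k)"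
proof -
 have "pushforward (lcs_coset k) \<in> lin_hom (free_module (lcs G k)) (free_module (carrier (lcs_quot G k)))" by (rule push_lin_hom) (auto simp: lcs_quot_carrier)
 from lin_hom_comp[OF this coset_lin_hom[OF lcs_quot_subsp]]
 show ?thesis unfolding gr_class_def gr_comp_def tensor_complex_def tensor_class_def .
qed

lemma gr_class_closed [simp]: "u over lcs G k ==> cls k u \<in> carrier (gr_comp G k)" using lin_homD(1)[OF gr_class_lin_hom] by simp

lemma gr_class_add: "u over lcs G k ==> v over lcs G k ==>
  cls k (u + v) = cls k u \<oplus>\<^bsub>gr_comp G k\<^esub> cls k v"
 using lin_homD(2)[OF gr_class_lin_hom] by simp

lemma gr_class_scl: "u over lcs G k ==> cls k (scl c u) = c \<odot>\<^bsub>gr_comp G k\<^esub> cls k u" using lin_homD(3)[OF gr_class_lin_hom] by simp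

lemma gr_class_zero [simp]: "cls k 0 = zgr k" using lin_hom_zero[OF gr_class_lin_hom] by simp

lemma gr_class_diff_eq_zero:
 assumes "u over lcs G k" "v over lcs G k"
 shows "cls k (u - v) = zgr k \<longleftrightarrow> cls k u = cls k v" using lin_hom_diff[OF gr_class_lin_hom[of k] free_cvs gr_comp_cvs, of u v] assms
 by (simp add: cvs_diff_eq_zero)

lemma push_lift:
 assumes "w over carrier (lcs_quot G k)"
 shows "\<exists>u. u over lcs G k \<and> w = pushforward (lcs_coset k) u"
proof -
 define s where "s X = (SOME x. x \<in> lcs G k \<and> lcs_coset k x = X)" for X
 have s: "s X \<in> lcs G k \<and> lcs_coset k (s X) = X" if "X \<in> carrier (lcs_quot G k)" for X
  unfolding s_def by (rule someI_ex) (use that in "auto simp: lcs_quot_carrier")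
 have "pushforward (lcs_coset k) (pushforward s w) = pushforward (\<lambda>X. X) w" unfolding push_comp by (rule push_cong) (use s assms in auto)
 also have "\<dots> = w" using poly_mapping_as_sum[of "keys w" w] by (simp add: pushforward_def)
 finally have "w = pushforward (lcs_coset k) (pushforward s w)" by simp
 moreover have "(pushforward s w) over lcs G k" by (rule keys_pushforward[OF assms]) (use s in auto)
 ultimately show ?thesis by blast
qed

lemma gr_comp_cases:
 assumes "X \<in> carrier (gr_comp G k)"
 obtains u where "u over lcs G k" "X = cls k u"
proof -
 obtain w where w: "w over carrier (lcs_quot G k)" "X = tensor_class (lcs_quot G k) w"
  using assms by (auto simp: gr_comp_def tensor_complex_def quot_simps tensor_class_def)
 thus ?thesis using push_lift[OF w(1)] that by (auto simp: gr_class_def)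
qed

lemma gr_class_eq_zero_iff:
 assumes "u over lcs G k"
 shows "cls k u = zgr k \<longleftrightarrow> pushforward (lcs_coset k) u \<in> additivity_relations (lcs_quot G k)"
proof -
 have "(pushforward (lcs_coset k) u) over carrier (lcs_quot G k)" by (rule keys_pushforward[OF assms]) (auto simp: lcs_quot_carrier)
 thus ?thesis using coset_eq_zero_iff[OF lcs_quot_subsp, of k "pushforward (lcs_coset k) u"]
  by (simp add: gr_class_def tensor_class_def gr_comp_def tensor_complex_def quot_simps)
qed

lemma gr_class_mult:
 assumes "x \<in> lcs G k" "y \<in> lcs G k"
 shows "cls k (single (x \<otimes> y) 1 - single x 1 - single y 1) = zgr k"
proof -
 let ?X = "lcs_coset k x" and ?Y = "lcs_coset k y"
 have "single (?X \<otimes>\<^bsub>lcs_quot G k\<^esub> ?Y) 1 - single ?X 1 - single ?Y 1 \<in> additivity_relations (lcs_quot G k)" unfolding additivity_relations_def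
  by (rule span_of_base[OF free_cvs additivity_relations_generators])
   (use assms lcs_quot_closed in "auto simp: lcs_quot_carrier")
 moreover have "(single (x \<otimes> y) 1 - single x 1 - single y (1::complex)) over lcs G k" using assms lcs_mult by (intro over_diff) auto
 ultimately show ?thesis using assms by (subst gr_class_eq_zero_iff) (auto simp: push_diff lcs_quot_mult)
qed

lemma gr_class_single_mult:
 assumes "x \<in> lcs G k" "y \<in> lcs G k"
 shows "cls k (single (x \<otimes> y) c) = cls k (single x c + single y c)"
proof -
 let ?u = "single (x \<otimes> y) 1 - single x 1 - single y (1::complex)"
 have k: "?u over lcs G k" using assms lcs_mult by (intro over_diff) auto
 have "cls k (scl c ?u + (single x c + single y c)) = cls k (single x c + single y c)" using gr_class_mult[OF assms] k assms
  by (simp add: gr_class_add gr_class_scl over_add order_trans[OF keys_scl] del: scl_single)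
 moreover have "scl c ?u + (single x c + single y c) = single (x \<otimes> y) c" by (simp add: scl_diff)
 ultimately show ?thesis by simp
qed

lemma gr_class_one: "cls k (single \<one> c) = zgr k"
proof -
 have "cls k (scl (-c) (single (\<one> \<otimes> \<one>) 1 - single \<one> 1 - single \<one> 1)) = zgr k" using gr_class_mult[OF lcs_one lcs_one, of k] lcs_one
  by (subst gr_class_scl) (auto intro!: over_diff)
 moreover have "scl (-c) (single (\<one> \<otimes> \<one>) 1 - single \<one> 1 - single \<one> 1) = single \<one> c"
  by (rule poly_mapping_eqI) (simp add: lookup_minus lookup_single when_def)
 ultimately show ?thesis by simp
qed

lemma gr_class_single_zero:
 assumes "e \<in> lcs G (Suc k)"
 shows "cls k (single e c) = zgr k"
proof -
 have "lcs_coset k e = lcs_coset k \<one>" using lcs_coset_eqI[of \<one> e "Suc k"] assms lcs_mem by simp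
 hence "cls k (single e c) = cls k (single \<one> c)" by (simp add: gr_class_def)
 thus ?thesis using gr_class_one by simp
qed

text \<open>A presentation of gr_k by C[Gamma_k]: the relations are the defects of additivity and
  the elements of Gamma_(k+1). Modulo \<open>M\<close> a chain depends only on its image on cosets,
  and every additivity relation between cosets lifts to one between elements.\<close>

lemma gr_class_kernel:
 assumes M: "subsp M (free_module (lcs G k))"
  and M1: "\<And>x y. x \<in> lcs G k ==> y \<in> lcs G k ==> single (x \<otimes> y) 1 - single x 1 - single y 1 \<in> M"
  and M2: "\<And>e. e \<in> lcs G (Suc k) ==> single e 1 \<in> M"
  and u: "u over lcs G k" "cls k u = zgr k"
 shows "u \<in> M"
proof -
 let ?q = "lcs_coset k"
 note D = free_subspD[OF M]
 define s where "s X = (SOME x. x \<in> lcs G k \<and> ?q x = X)" for X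
 have s: "s (?q x) \<in> lcs G k \<and> ?q (s (?q x)) = ?q x" if "x \<in> lcs G k" for x unfolding s_def by (rule someI_ex) (use that in auto)
 \<comment> \<open>Modulo \<open>M\<close> every element may be replaced by the chosen
   representative of its coset; a chain whose image on cosets is zero therefore lies in
   \<open>M\<close>, as \<open>k0\<close> records.\<close>
 have d: "w - pushforward (\<lambda>x. s (?q x)) w \<in> M" if "w over lcs G k" for w using that
 proof (induction w rule: pm_induct)
  case (single x c)
  let ?y = "s (?q x)"
  obtain e where e: "e \<in> lcs G (Suc k)" "x = e \<otimes> ?y" using lcs_coset_eq[of x ?y "Suc k"] s[OF single] single lcs_mem by metis
  have "e \<in> lcs G k" using e lcs_Suc_subset by auto
  from D(3)[OF M1[OF this conjunct1[OF s[OF single]]] M2[OF e(1)]]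
  have "single x 1 - single ?y 1 \<in> M" using e(2) by (simp add: algebra_simps)
  from D(4)[OF this, of c] show ?case by (simp add: scl_diff)
 next
  case (add u v)
  from D(3)[OF add(3,4)] show ?case by (simp add: push_add algebra_simps)
 qed (use D in simp)
 have k0: "w \<in> M" if "w over lcs G k" "pushforward ?q w = 0" for w using d[OF that(1)] push_comp[of s ?q w] that(2) by simp
 have "pushforward ?q u \<in> additivity_relations (lcs_quot G k)" using u gr_class_eq_zero_iff by simp
 hence "\<exists>v\<in>M. pushforward ?q v = pushforward ?q u" unfolding additivity_relations_def
 proof (rule span_of_induct[OF free_cvs _ additivity_relations_generators[OF lcs_quot_closed]])
  fix a :: "'a set \<Rightarrow>\<^sub>0 complex" assume "a \<in> {single (x \<otimes>\<^bsub>lcs_quot G k\<^esub> y) 1 - single x 1 - single y 1 | x y.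
   x \<in> carrier (lcs_quot G k) \<and> y \<in> carrier (lcs_quot G k)}"
  then obtain x y where xy: "x \<in> lcs G k" "y \<in> lcs G k"
   "a = single (?q x \<otimes>\<^bsub>lcs_quot G k\<^esub> ?q y) 1 - single (?q x) 1 - single (?q y) 1" by (auto simp: lcs_quot_carrier)
  thus "\<exists>v\<in>M. pushforward ?q v = a" by (intro bexI[OF _ M1[OF xy(1,2)]]) (simp add: push_diff lcs_quot_mult)
 next
  fix x y :: "'a set \<Rightarrow>\<^sub>0 complex" assume "\<exists>v\<in>M. pushforward ?q v = x" "\<exists>v\<in>M. pushforward ?q v = y"
  then obtain v w where "v \<in> M" "w \<in> M" "pushforward ?q v = x" "pushforward ?q w = y" by auto
  thus "\<exists>v\<in>M. pushforward ?q v = x \<oplus>\<^bsub>free_module (carrier (lcs_quot G k))\<^esub> y"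
   by (intro bexI[of _ "v + w"]) (simp_all add: push_add D(3))
 next
  fix c and x :: "'a set \<Rightarrow>\<^sub>0 complex" assume "\<exists>v\<in>M. pushforward ?q v = x"
  then obtain v where "v \<in> M" "pushforward ?q v = x" by auto
  thus "\<exists>v\<in>M. pushforward ?q v = c \<odot>\<^bsub>free_module (carrier (lcs_quot G k))\<^esub> x" by (intro bexI[OF _ D(4)]) (auto simp: push_scl)
 qed (use D in "auto intro!: bexI[of _ 0]")
 then obtain v where v: "v \<in> M" "pushforward ?q v = pushforward ?q u" by auto
 have "u - v \<in> M" using k0[of "u - v"] v u over_diff[OF u(1) D(1)[OF v(1)]] by (simp add: push_diff)
 from D(3)[OF this v(1)] show ?thesis by simp
qed

text \<open>The kernel of \<open>f\<close> is a subspace to which \<open>gr_class_kernel\<close>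
  applies. Maps out of gr_k are obtained in this way: the bracket, alpha, and both directions of the
  comparison with G/G''.\<close>

lemma gr_class_universal:
 assumes f: "f \<in> lin_hom (free_module (lcs G k)) W" and W: "cvs W"
  and "\<And>x y. x \<in> lcs G k ==> y \<in> lcs G k ==> f (single (x \<otimes> y) 1 - single x 1 - single y 1) = \<zero>\<^bsub>W\<^esub>"
  and "\<And>e. e \<in> lcs G (Suc k) ==> f (single e 1) = \<zero>\<^bsub>W\<^esub>"
  and "u over lcs G k" "cls k u = zgr k"
 shows "f u = \<zero>\<^bsub>W\<^esub>"
proof -
 have "subsp {\<zero>\<^bsub>W\<^esub>} W" by (rule subspI) (use W in auto)
 from lin_vimage[OF f free_cvs this]
 have M: "subsp {u. u over lcs G k \<and> f u = \<zero>\<^bsub>W\<^esub>} (free_module (lcs G k))" by simp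
 have "u \<in> {u. u over lcs G k \<and> f u = \<zero>\<^bsub>W\<^esub>}"
 proof (rule gr_class_kernel[OF M _ _ assms(5,6)])
  fix x y assume xy: "x \<in> lcs G k" "y \<in> lcs G k"
  have "(single (x \<otimes> y) 1 - single x 1 - single y (1::complex)) over lcs G k" using xy lcs_mult by (intro over_diff) auto
  thus "single (x \<otimes> y) 1 - single x 1 - single y 1 \<in> {u. u over lcs G k \<and> f u = \<zero>\<^bsub>W\<^esub>}" using assms(3)[OF xy] by simp
 next
  fix e assume "e \<in> lcs G (Suc k)"
  thus "single e 1 \<in> {u. u over lcs G k \<and> f u = \<zero>\<^bsub>W\<^esub>}" using assms(4) lcs_Suc_subset by auto
 qed
 thus ?thesis by simp
qed

section \<open>The bracket of classes induced by the commutator\<close>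

lemma keys_com: "u over lcs G i ==> v over lcs G j ==>
  (bilinear (com) u v) over lcs G (i + j)"
 by (erule (1) keys_bilinear) (rule com_lcs)

lemma gr_class_bilinear_swap:
 assumes "u over lcs G i" "v over lcs G j"
 shows "cls (i + j) (bilinear (com) u v + bilinear (com) v u) = zgr (i + j)" using assms(1)
proof (induction u rule: pm_induct)
 case zero
 thus ?case by simp
next
 case (single x c)
 from assms(2) show ?case
 proof (induction v rule: pm_induct)
  case zero
  thus ?case by simp
 next
  case (single y d)
  note xy = com_lcs[OF \<open>x \<in> lcs G i\<close> \<open>y \<in> lcs G j\<close>]
  have i: "com y x = inv (com x y)" using \<open>x \<in> lcs G i\<close> \<open>y \<in> lcs G j\<close> lcs_mem com_inv by metis
  have "cls (i + j) (single (com x y) (c * d) + single (com y x) (c * d))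
   = cls (i + j) (single (com x y \<otimes> com y x) (c * d))"
   using gr_class_single_mult[OF xy lcs_inv[OF xy]] i by simp
  also have "com x y \<otimes> com y x = \<one>" using i lcs_mem[OF xy] by simp
  finally show ?case using gr_class_one by (simp add: mult.commute)
 next
  case (add v w)
  let ?b = "bilinear (com)"
  have k: "(?b (single x c) a + ?b a (single x c)) over lcs G (i + j)" if "a over lcs G j" for a using keys_com[of "single x c" i a j] keys_com[of a j "single x c" i]
    that \<open>x \<in> lcs G i\<close> by (intro over_add) (auto simp: add.commute)
  have "?b (single x c) (v + w) + ?b (v + w) (single x c) =
   (?b (single x c) v + ?b v (single x c)) + (?b (single x c) w + ?b w (single x c))"
   by (simp add: bilin_addL bilin_addR)
  thus ?case using gr_class_add[OF k k] add by simp
 qed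
next
 case (add u w)
 let ?b = "bilinear (com)"
 have k: "(?b a v + ?b v a) over lcs G (i + j)" if "a over lcs G i" for a using keys_com[of a i v j] keys_com[of v j a i]
   that assms(2) by (intro over_add) (auto simp: add.commute)
 have "?b (u + w) v + ?b v (u + w) = (?b u v + ?b v u) + (?b w v + ?b v w)" by (simp add: bilin_addL bilin_addR)
 thus ?case using gr_class_add[OF k k] add by simp
qed

lemma bilinear_commutator_lin_hom_left:
 assumes "v over lcs G j"
 shows "(\<lambda>u. cls (i + j) (bilinear (com) u v)) \<in> lin_hom (free_module (lcs G i)) (gr_comp G (i + j))" by (rule lin_homI)
  (use assms in "auto simp: bilin_addL bilin_sclL keys_com gr_class_add gr_class_scl")

text \<open>By \<open>gr_class_universal\<close> two facts about group elements suffice: [e,y] is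
  deep when e is, and [x x',y] agrees with the product of [x',y] and [x,y] up to the deeper factor
  [x,[x',y]]. The second argument is reached later by antisymmetry.\<close>

lemma gr_class_bilinear_zero_left:
 assumes u: "u over lcs G i" "cls i u = zgr i" and v: "v over lcs G j"
 shows "cls (i + j) (bilinear (com) u v) = zgr (i + j)"
proof (rule gr_class_universal[OF bilinear_commutator_lin_hom_left[OF v] gr_comp_cvs _ _ u])
 let ?n = "i + j"
 have sing: "cls ?n (bilinear (com) (single x 1) w) =
  cls ?n (pushforward (com x) w)" for x w
  by (simp add: bilinear_def pushforward_def)
 {
  fix e assume e: "e \<in> lcs G (Suc i)"
  have "v over lcs G j ==> cls ?n (bilinear (com) (single e 1) v) = zgr ?n"
  proof (induction v rule: pm_induct)
   case (single y c)
   thus ?case using com_lcs[OF e, of y j] gr_class_single_zero by simp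
  next
   case (add v w)
   thus ?case using keys_com[of "single e 1" i v j] keys_com[of "single e 1" i w j] e lcs_Suc_subset[of i] by (simp add: bilin_addR gr_class_add subset_iff)
  qed simp
  thus "cls ?n (bilinear (com) (single e 1) v) = zgr ?n" using v by simp
 }
 fix x x' assume x: "x \<in> lcs G i" "x' \<in> lcs G i"
 let ?d = "single (x \<otimes> x') 1 - single x 1 - single x' (1::complex)"
 have kd: "?d over lcs G i" using x lcs_mult by (intro over_diff) auto
 from v show "cls ?n (bilinear (com) ?d v) = zgr ?n"
 proof (induction v rule: pm_induct)
  case (single y c)
  note xy = com_lcs[OF x(1) single] com_lcs[OF x(2) single] com_lcs[OF lcs_mult[OF x] single]
  have eq: "bilinear (com) ?d (single y c) =
   single (com (x \<otimes> x') y) c - single (com x y) c - single (com x' y) c"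
   by (simp add: bilinear_diff_left)
  show ?case
  \<comment> \<open>If one of the degrees is 0, all commutators concerned have class zero by
    \<open>com_lcs_degenerate\<close>.\<close>
  proof (cases "i = 0 \<or> j = 0")
   case True
   have "cls ?n (single (com a y) d) = zgr ?n" if "a \<in> lcs G i" for a d using gr_class_single_zero com_lcs_degenerate[OF that single True] by simp
   note * = this[OF x(1)] this[OF x(2)] this[OF lcs_mult[OF x]]
   have "cls ?n (single (com (x \<otimes> x') y) c + (single (com x y) (-c) + single (com x' y) (-c))) =
    (zgr ?n)"
    using * xy by (simp add: gr_class_add over_add del: single_uminus)
   thus ?thesis unfolding eq by (simp add: single_uminus algebra_simps)
  next
   case False
   let ?e = "com x (com x' y)"
   have e: "?e \<in> lcs G (Suc ?n)" using com_mult_left_lcs[OF x single] False by simp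
   hence e': "?e \<in> lcs G ?n" using lcs_Suc_subset by auto
   have "com (x \<otimes> x') y = ?e \<otimes> (com x' y \<otimes> com x y)" using com_mult_left x single lcs_mem by simp
   hence "cls ?n (single (com (x \<otimes> x') y) c) =
    cls ?n (single ?e c) \<oplus>\<^bsub>gr_comp G ?n\<^esub> (cls ?n (single (com x' y) c) \<oplus>\<^bsub>gr_comp G ?n\<^esub> cls ?n (single (com x y) c))"
    using xy e' by (simp add: gr_class_single_mult lcs_mult gr_class_add)
   also have "\<dots> = cls ?n (single (com x' y) c) \<oplus>\<^bsub>gr_comp G ?n\<^esub> cls ?n (single (com x y) c)" using gr_class_single_zero[OF e] xy by simp
   also have "\<dots> = cls ?n (single (com x y) c + single (com x' y) c)" using xy by (simp add: gr_class_add cvs_comm)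
   finally have "cls ?n (single (com (x \<otimes> x') y) c) = \<dots>" .
   hence "cls ?n (single (com (x \<otimes> x') y) c - (single (com x y) c + single (com x' y) c))
    = zgr ?n"
    using xy by (subst gr_class_diff_eq_zero) (simp_all add: over_add)
   thus ?thesis unfolding eq by (simp only: diff_diff_eq)
  qed
 next
  case (add v w)
  thus ?case using keys_com[OF kd, of v j] keys_com[OF kd, of w j] by (simp add: bilin_addR gr_class_add)
 qed simp
qed

lemma gr_class_bilinear_cong_left:
 assumes "u over lcs G i" "u' over lcs G i" "v over lcs G j" "cls i u = cls i u'"
 shows "cls (i + j) (bilinear (com) u v) = cls (i + j) (bilinear (com) u' v)"
proof -
 have "cls i (u - u') = zgr i" using lin_hom_diff[OF gr_class_lin_hom[of i] free_cvs gr_comp_cvs, of u u'] assms by (simp add: cvs_diff_eq_zero)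
 from gr_class_bilinear_zero_left[OF over_diff[OF assms(1,2)] this assms(3)]
 have "cls (i + j) (bilinear (com) u v) \<ominus>\<^bsub>gr_comp G (i + j)\<^esub> cls (i + j) (bilinear (com) u' v)
  = zgr (i + j)"
  using lin_hom_diff[OF bilinear_commutator_lin_hom_left[OF assms(3), of i] free_cvs gr_comp_cvs, of u u'] assms by simp
 thus ?thesis using assms by (simp add: cvs_diff_eq_zero keys_com)
qed

lemma gr_class_bilinear_flip:
 assumes "u over lcs G i" "v over lcs G j"
 shows "cls (i + j) (bilinear (com) u v) = (-1) \<odot>\<^bsub>gr_comp G (i + j)\<^esub> cls (i + j) (bilinear (com) v u)"
 using gr_class_bilinear_swap[OF assms] keys_com[OF assms] keys_com[OF assms(2,1)]
  cvs_add_eq_zero[OF gr_comp_cvs, of "cls (i + j) (bilinear (com) v u)" "i + j" "cls (i + j) (bilinear (com) u v)"]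
 by (simp add: gr_class_add add.commute cvs_comm)

lemma gr_class_bilinear_cong:
 assumes "u over lcs G i" "u' over lcs G i" "v over lcs G j" "v' over lcs G j"
  "cls i u = cls i u'" "cls j v = cls j v'"
 shows "cls (i + j) (bilinear (com) u v) = cls (i + j) (bilinear (com) u' v')"
 using gr_class_bilinear_cong_left[OF assms(1-3,5)] gr_class_bilinear_cong_left[OF assms(3,4,2,6)]
  gr_class_bilinear_flip[OF assms(2,3)] gr_class_bilinear_flip[OF assms(2,4)]
 by (simp add: add.commute)

lemma lcs_commutator_coset:
 assumes "x \<in> lcs G i" "y \<in> lcs G j"
 shows "lcs_commutator G i j (lcs_coset i x) (lcs_coset j y) = lcs_coset (i + j) (com x y)" unfolding lcs_commutator_def induced2_def
proof (rule the_elem_image_const)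
 show "lcs_coset i x \<times> lcs_coset j y \<noteq> {}" using rcos_self[OF _ lcs_subgroup] assms lcs_mem by blast
next
 fix p assume "p \<in> lcs_coset i x \<times> lcs_coset j y"
 then obtain x' y' where p: "p = (x', y')" "x' \<in> lcs_coset i x" "y' \<in> lcs_coset j y" by auto
 then obtain e f where ef: "e \<in> lcs G (Suc i)" "x' = e \<otimes> x" "f \<in> lcs G (Suc j)" "y' = f \<otimes> y" by (auto simp: r_coset_def)
 have "lcs_coset (i + j) (com x' y') = lcs_coset (i + j) (com x y)" using ef assms lcs_Suc_subset[of i] lcs_Suc_subset[of j] lcs_mem
  by (intro com_coset_cong) (auto intro!: lcs_mult lcs_coset_eqI)
 thus "(case p of (x, y) => lcs G (i + j + 1) #> com x y) = lcs_coset (i + j) (com x y)" using p by simp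
qed

text \<open>\<open>induced2\<close> ranges over all members of the two classes, which are chains of
  cosets. Each is lifted to a chain on the group with the same class (\<open>rep\<close>), and then
  \<open>gr_class_bilinear_cong\<close> makes the value constant.\<close>

lemma gr_bracket_class:
 assumes u: "u over lcs G i" and v: "v over lcs G j"
 shows "gr_bracket G i j (cls i u) (cls j v) = cls (i + j) (bilinear (com) u v)" unfolding gr_bracket_def induced2_def
proof (rule the_elem_image_const)
 have rep: "w \<in> cls k a ==> \<exists>b. b over lcs G k \<and> w = pushforward (lcs_coset k) b \<and> cls k b = cls k a"
  if a: "a over lcs G k" for a k w
 proof -
  assume w: "w \<in> cls k a"
  have k: "(pushforward (lcs_coset k) a) over carrier (lcs_quot G k)" by (rule keys_pushforward[OF a]) (auto simp: lcs_quot_carrier)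
  obtain r where r: "r \<in> additivity_relations (lcs_quot G k)" "w = r + pushforward (lcs_coset k) a"
   using w coset_mem_iff[OF lcs_quot_subsp] unfolding gr_class_def tensor_class_def by auto
  have kr: "r over carrier (lcs_quot G k)" using free_subspD(1)[OF lcs_quot_subsp r(1)] .
  have kw: "w over carrier (lcs_quot G k)" unfolding r(2) by (rule over_add[OF kr k])
  have eq: "tensor_class (lcs_quot G k) w = cls k a" unfolding gr_class_def tensor_class_def
   using coset_eq_iff[OF lcs_quot_subsp, of k w "pushforward (lcs_coset k) a"] k kw r by simp
  obtain b where "b over lcs G k" "w = pushforward (lcs_coset k) b" using push_lift[OF kw] by auto
  thus ?thesis using eq by (auto simp: gr_class_def)
 qed
 show "cls i u \<times> cls j v \<noteq> {}"
 proof -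
  have "(pushforward (lcs_coset k) a) over carrier (lcs_quot G k)" if "a over lcs G k" for k a by (rule keys_pushforward[OF that]) (auto simp: lcs_quot_carrier)
  hence "pushforward (lcs_coset k) a \<in> cls k a" if "a over lcs G k" for k a using coset_self[OF lcs_quot_subsp, of k "pushforward (lcs_coset k) a"] that
   by (simp add: gr_class_def tensor_class_def)
  thus ?thesis using u v by blast
 qed
 fix p assume "p \<in> cls i u \<times> cls j v"
 then obtain a b where p: "p = (a, b)" "a \<in> cls i u" "b \<in> cls j v" by auto
 obtain a' where a': "a' over lcs G i" "a = pushforward (lcs_coset i) a'" "cls i a' = cls i u" using rep[OF u p(2)] by auto
 obtain b' where b': "b' over lcs G j" "b = pushforward (lcs_coset j) b'" "cls j b' = cls j v" using rep[OF v p(3)] by auto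
 have "bilinear (lcs_commutator G i j) a b = pushforward (lcs_coset (i + j)) (bilinear (com) a' b')" unfolding a'(2) b'(2) bilinear_pushforward push_bilinear
  by (rule bilinear_cong) (use a' b' in "auto intro!: lcs_commutator_coset")
 hence "tensor_class (lcs_quot G (i + j)) (bilinear (lcs_commutator G i j) a b) =
  cls (i + j) (bilinear (com) a' b')" by (simp add: gr_class_def)
 also have "\<dots> = cls (i + j) (bilinear (com) u v)" by (rule gr_class_bilinear_cong) (use u v a' b' in auto)
 finally show "(case p of (u, v) => tensor_class (lcs_quot G (i + j)) (bilinear (lcs_commutator G i j) u v)) =
  cls (i + j) (bilinear (com) u v)" using p by simp
qed

end

section \<open>The degree k part of L/L''\<close>

context
 fixes L :: "'l graded_lie" (structure) and k :: nat
 assumes L: "algebra_on L" and H: "subsp (homog L k) L"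
begin

abbreviation "chen_space \<equiv> (graded_quot L (second_derived_lie L))\<lparr>carrier := homog (graded_quot L (second_derived_lie L)) k\<rparr>"

lemma chen_rank_lie_eq: "chen_rank_lie L k = dim_of chen_space" by (simp add: chen_rank_lie_def Let_def)

lemma chen_space_cvs: "cvs chen_space"
proof -
 note S = second_derived_subsp[OF L]
 have "subsp ((\<lambda>x. second_derived_lie L +> x) ` homog L k) (graded_quot L (second_derived_lie L))"
  by (rule lin_hom_image[OF graded_coset_lin_hom[OF S] graded_quot_cvs[OF S] H])
 thus ?thesis unfolding graded_quot_simps(6) by (rule subsp_cvs)
qed

text \<open>Any linear parametrisation of the degree k part of \<open>L\<close> also parametrises
  that of L/L'', with the preimage of L'' as kernel. Chen ranks become comparable once a single
  \<open>U\<close> parametrises both spaces.\<close>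

lemma chen_space_presentation:
 assumes f: "f \<in> lin_hom U L" and on: "f ` carrier U = homog L k"
 defines "p \<equiv> (\<lambda>u. second_derived_lie L +> f u)"
 shows "p \<in> lin_hom U chen_space" "p ` carrier U = carrier chen_space"
  "u \<in> carrier U ==> p u = \<zero>\<^bsub>chen_space\<^esub> \<longleftrightarrow> f u \<in> second_derived_lie L"
proof -
 note S = second_derived_subsp[OF L]
 have c: "\<And>u. u \<in> carrier U ==> f u \<in> carrier L" using lin_homD(1)[OF f] .
 show im: "p ` carrier U = carrier chen_space" unfolding p_def by (simp add: graded_quot_simps(6) on[symmetric] image_image)
 show "p \<in> lin_hom U chen_space"
 proof (rule lin_homI)
  show "\<And>x. x \<in> carrier U ==> p x \<in> carrier chen_space" using im by blast
 qed (simp_all add: p_def lin_homD(2,3)[OF f] c graded_quot_add[OF S] graded_quot_smult[OF S])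
 show "u \<in> carrier U ==> p u = \<zero>\<^bsub>chen_space\<^esub> \<longleftrightarrow> f u \<in> second_derived_lie L"
  using coset_eq_zero_iff[OF S c] by (simp add: p_def graded_quot_simps)
qed

end

section \<open>The axioms of a Lie algebra, verified for gr(G)\<close>

definition lie_algebra :: "(complex, 'l, 'm) module_scheme => bool" where
 "lie_algebra L \<longleftrightarrow> algebra_on L \<and> (\<forall>x\<in>carrier L. x \<otimes>\<^bsub>L\<^esub> x = \<zero>\<^bsub>L\<^esub>) \<and>
  (\<forall>x\<in>carrier L. \<forall>y\<in>carrier L. \<forall>z\<in>carrier L.
    x \<otimes>\<^bsub>L\<^esub> (y \<otimes>\<^bsub>L\<^esub> z) \<oplus>\<^bsub>L\<^esub> y \<otimes>\<^bsub>L\<^esub> (z \<otimes>\<^bsub>L\<^esub> x) \<oplus>\<^bsub>L\<^esub> z \<otimes>\<^bsub>L\<^esub> (x \<otimes>\<^bsub>L\<^esub> y) = \<zero>\<^bsub>L\<^esub>)"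

text \<open>Linearity carries the identities from \<open>A\<close> to its span one argument at a
  time; the cyclic symmetry of the Jacobi sum and the symmetry of xy + yx bring each argument into
  first place.\<close>

lemma lie_algebra_from_generators:
 fixes L (structure)
 assumes L: "algebra_on L" and A: "A \<subseteq> carrier L" "carrier L \<subseteq> span_of L A"
  and anti: "\<And>x y. x \<in> A ==> y \<in> A ==> x \<otimes> y \<oplus> y \<otimes> x = \<zero>"
  and jac: "\<And>x y z. x \<in> A ==> y \<in> A ==> z \<in> A ==>
   x \<otimes> (y \<otimes> z) \<oplus> y \<otimes> (z \<otimes> x) \<oplus> z \<otimes> (x \<otimes> y) = \<zero>"
 shows "lie_algebra L"
proof -
 note D = algD[OF L] and Z = alg_mult_zero[OF L]
 interpret V: vectorspace class_ring L by (rule D(1))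
 define J where "J x y z = x \<otimes> (y \<otimes> z) \<oplus> y \<otimes> (z \<otimes> x) \<oplus> z \<otimes> (x \<otimes> y)" for x y z
 have J_cyc: "J x y z = J y z x" if "x \<in> carrier L" "y \<in> carrier L" "z \<in> carrier L" for x y z unfolding J_def using that D(2) by (simp add: V.M.a_ac)
 have J_add: "J (x \<oplus> x') y z = J x y z \<oplus> J x' y z"
  if "x \<in> carrier L" "x' \<in> carrier L" "y \<in> carrier L" "z \<in> carrier L" for x x' y z
  unfolding J_def using that D(2-4) by (simp add: V.M.a_ac)
 have J_smult: "J (c \<odot> x) y z = c \<odot> J x y z"
  if "x \<in> carrier L" "y \<in> carrier L" "z \<in> carrier L" for x y z c
  unfolding J_def using that D(2,5,6) cvs_smult[OF D(1)] cvs_add[OF D(1)] by (simp add: cvs_smult_add[OF D(1)])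
 have J_span: "J x y z = \<zero>" if yz: "y \<in> carrier L" "z \<in> carrier L" and gen: "\<And>a. a \<in> A ==> J a y z = \<zero>"
   and x: "x \<in> carrier L" for x y z
 proof -
  from x A(2) have "x \<in> span_of L A" by auto
  from D(1) this A(1) show ?thesis
  proof (induction rule: span_of_induct)
   case zero
   show ?case unfolding J_def using yz D(2) Z by (simp add: D(2))
  qed (use gen J_add J_smult yz in "simp_all add: D(1)")
 qed
 have AC: "a \<in> carrier L" if "a \<in> A" for a using A(1) that by blast
 have 0: "J x y z = \<zero>" if "x \<in> A" "y \<in> A" "z \<in> A" for x y z unfolding J_def using jac that by simp
 have 1: "J x y z = \<zero>" if "x \<in> carrier L" "y \<in> A" "z \<in> A" for x y z by (rule J_span[OF _ _ _ that(1)]) (simp_all add: AC that 0)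
 have 2: "J x y z = \<zero>" if "x \<in> carrier L" "y \<in> carrier L" "z \<in> A" for x y z
 proof (rule J_span[OF _ _ _ that(1)])
  fix a assume a: "a \<in> A"
  have "J a y z = J y z a" using J_cyc AC a that by blast
  thus "J a y z = \<zero>" using 1 a that by simp
 qed (simp_all add: AC that)
 have 3: "J x y z = \<zero>" if "x \<in> carrier L" "y \<in> carrier L" "z \<in> carrier L" for x y z
 proof (rule J_span[OF _ _ _ that(1)])
  fix a assume a: "a \<in> A"
  have "J a y z = J y z a" using J_cyc AC a that by blast
  thus "J a y z = \<zero>" using 2 a that by simp
 qed (simp_all add: that)
 define S where "S x y = x \<otimes> y \<oplus> y \<otimes> x" for x y
 have S_comm: "S x y = S y x" if "x \<in> carrier L" "y \<in> carrier L" for x y unfolding S_def using that D(2) by (simp add: V.M.a_comm)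
 have S_span: "S x y = \<zero>" if y: "y \<in> carrier L" and gen: "\<And>a. a \<in> A ==> S a y = \<zero>"
   and x: "x \<in> carrier L" for x y
 proof -
  from x A(2) have "x \<in> span_of L A" by auto
  from D(1) this A(1) show ?thesis
  proof (induction rule: span_of_induct)
   case zero
   show ?case unfolding S_def using y Z by simp
  next
   case (add a b)
   have "S (a \<oplus> b) y = S a y \<oplus> S b y" unfolding S_def using add(1,2) y D(2-4) by (simp add: V.M.a_ac)
   thus ?case using add by simp
  next
   case (smult c a)
   have "S (c \<odot> a) y = c \<odot> S a y" unfolding S_def using smult(1) y D(2,5,6) by (simp add: cvs_smult_add[OF D(1)])
   thus ?case using smult D(1) by simp
  qed (rule gen)
 qed
 have S1: "S x y = \<zero>" if "x \<in> carrier L" "y \<in> A" for x y by (rule S_span[OF _ _ that(1)]) (use AC that anti in "simp_all add: S_def")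
 have S2: "S x y = \<zero>" if "x \<in> carrier L" "y \<in> carrier L" for x y
 proof (rule S_span[OF that(2) _ that(1)])
  fix a assume a: "a \<in> A"
  show "S a y = \<zero>" using S_comm[OF AC[OF a] that(2)] S1[OF that(2) a] by simp
 qed
 have "x \<otimes> x = \<zero>" if x: "x \<in> carrier L" for x
 proof -
  \<comment> \<open>In characteristic 0 antisymmetry gives the alternating law.\<close>
  have "2 \<odot> (x \<otimes> x) = \<zero>" using S2[OF x x] cvs_add_smult[OF D(1), of "x \<otimes> x" 1 1] D(2)[OF x x] D(1) by (simp add: S_def)
  hence "(1/2) \<odot> (2 \<odot> (x \<otimes> x)) = \<zero>" using D(1) by simp
  thus ?thesis using D(1,2) x by (simp add: cvs_smult_smult)
 qed
 thus ?thesis unfolding lie_algebra_def using L 3 J_def by auto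
qed

definition gr_elem :: "('a, 'b) monoid_scheme => nat => ('a \<Rightarrow>\<^sub>0 complex) => nat => ('a set \<Rightarrow>\<^sub>0 complex) set" where
 "gr_elem G k u = (\<lambda>i. if i = k then gr_class G k u else \<zero>\<^bsub>gr_comp G i\<^esub>)"

lemma gr_simps:
 "carrier (gr G) = {f. (\<forall>k. f k \<in> carrier (gr_comp G k)) \<and> finite {k. f k \<noteq> \<zero>\<^bsub>gr_comp G k\<^esub>}}"
 "\<zero>\<^bsub>gr G\<^esub> = (\<lambda>k. \<zero>\<^bsub>gr_comp G k\<^esub>)"
 "f \<oplus>\<^bsub>gr G\<^esub> g = (\<lambda>k. f k \<oplus>\<^bsub>gr_comp G k\<^esub> g k)"
 "c \<odot>\<^bsub>gr G\<^esub> f = (\<lambda>k. c \<odot>\<^bsub>gr_comp G k\<^esub> f k)"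
 "f \<otimes>\<^bsub>gr G\<^esub> g = (\<lambda>k. \<Oplus>\<^bsub>gr_comp G k\<^esub>i\<in>{..k}. gr_bracket G i (k - i) (f i) (g (k - i)))"
 "homog (gr G) k = {f \<in> carrier (gr G). \<forall>i. i \<noteq> k \<longrightarrow> f i = \<zero>\<^bsub>gr_comp G i\<^esub>}" by (simp_all add: gr_def Let_def)

context group
begin

abbreviation "elt \<equiv> gr_elem G"

lemma gr_bracket_closed [simp]:
 assumes "X \<in> carrier (gr_comp G i)" "Y \<in> carrier (gr_comp G j)"
 shows "gr_bracket G i j X Y \<in> carrier (gr_comp G (i + j))" using assms by (auto elim!: gr_comp_cases simp: gr_bracket_class keys_com)

lemma gr_bracket_bilinear:
 assumes "X \<in> carrier (gr_comp G i)" "X' \<in> carrier (gr_comp G i)" "Y \<in> carrier (gr_comp G j)" "Y' \<in> carrier (gr_comp G j)"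
 shows "gr_bracket G i j (X \<oplus>\<^bsub>gr_comp G i\<^esub> X') Y = gr_bracket G i j X Y \<oplus>\<^bsub>gr_comp G (i + j)\<^esub> gr_bracket G i j X' Y"
  "gr_bracket G i j X (Y \<oplus>\<^bsub>gr_comp G j\<^esub> Y') = gr_bracket G i j X Y \<oplus>\<^bsub>gr_comp G (i + j)\<^esub> gr_bracket G i j X Y'"
  "gr_bracket G i j (c \<odot>\<^bsub>gr_comp G i\<^esub> X) Y = c \<odot>\<^bsub>gr_comp G (i + j)\<^esub> gr_bracket G i j X Y"
  "gr_bracket G i j X (c \<odot>\<^bsub>gr_comp G j\<^esub> Y) = c \<odot>\<^bsub>gr_comp G (i + j)\<^esub> gr_bracket G i j X Y"
proof -
 obtain u u' where u: "u over lcs G i" "X = cls i u" "u' over lcs G i" "X' = cls i u'" using assms by (metis gr_comp_cases)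
 obtain v v' where v: "v over lcs G j" "Y = cls j v" "v' over lcs G j" "Y' = cls j v'" using assms by (metis gr_comp_cases)
 note k = keys_com[of _ i _ j] order_trans[OF keys_scl]
 show "gr_bracket G i j (X \<oplus>\<^bsub>gr_comp G i\<^esub> X') Y = gr_bracket G i j X Y \<oplus>\<^bsub>gr_comp G (i + j)\<^esub> gr_bracket G i j X' Y"
  using u v by (simp add: gr_class_add[symmetric] gr_bracket_class over_add k bilin_addL)
 show "gr_bracket G i j X (Y \<oplus>\<^bsub>gr_comp G j\<^esub> Y') = gr_bracket G i j X Y \<oplus>\<^bsub>gr_comp G (i + j)\<^esub> gr_bracket G i j X Y'"
  using u v by (simp add: gr_class_add[symmetric] gr_bracket_class over_add k bilin_addR)
 show "gr_bracket G i j (c \<odot>\<^bsub>gr_comp G i\<^esub> X) Y = c \<odot>\<^bsub>gr_comp G (i + j)\<^esub> gr_bracket G i j X Y"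
  using u v by (simp add: gr_class_scl[symmetric] gr_bracket_class k bilin_sclL)
 show "gr_bracket G i j X (c \<odot>\<^bsub>gr_comp G j\<^esub> Y) = c \<odot>\<^bsub>gr_comp G (i + j)\<^esub> gr_bracket G i j X Y"
  using u v by (simp add: gr_class_scl[symmetric] gr_bracket_class k bilin_sclR)
qed

lemma gr_bracket_zero [simp]:
 assumes "X \<in> carrier (gr_comp G i)"
 shows "gr_bracket G i j X (zgr j) = zgr (i + j)"
  "gr_bracket G j i (zgr j) X = zgr (j + i)" using assms gr_bracket_class[of _ i 0 j] gr_bracket_class[of 0 j _ i] by (auto elim!: gr_comp_cases)

lemma gr_cvs: "cvs (gr G)"
proof -
 note c = gr_comp_cvs[of k for k]
 have add: "finite {k. f k \<oplus>\<^bsub>gr_comp G k\<^esub> g k \<noteq> zgr k}"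
  if "finite {k. f k \<noteq> zgr k}" "finite {k. g k \<noteq> zgr k}" for f g
  by (rule finite_subset[OF _ finite_UnI[OF that]]) (auto simp: cvs_zero_left[OF c] cvs_zero[OF c])
 have smult: "finite {k. a \<odot>\<^bsub>gr_comp G k\<^esub> f k \<noteq> zgr k}"
  if "finite {k. f k \<noteq> zgr k}" for f a
 proof (rule finite_subset[OF _ that], clarify)
  fix k assume "a \<odot>\<^bsub>gr_comp G k\<^esub> f k \<noteq> zgr k" "f k = zgr k"
  thus False using cvs_smult_zero[OF c, of k a] by metis
 qed
 show ?thesis
 proof (rule cvsI)
  show "\<zero>\<^sub>g \<in> grC" by (simp add: gr_simps cvs_zero[OF c])
  fix x assume "x \<in> grC"
  hence x: "x k \<in> carrier (gr_comp G k)" "finite {k. x k \<noteq> zgr k}" for k by (auto simp: gr_simps)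
  show "\<zero>\<^sub>g \<oplus>\<^sub>g x = x" using x by (simp add: gr_simps cvs_zero_left[OF c])
  show "1 \<odot>\<^sub>g x = x" using x by (simp add: gr_simps cvs_one[OF c])
  have neg: "((-1) \<odot>\<^bsub>gr_comp G k\<^esub> x k) \<oplus>\<^bsub>gr_comp G k\<^esub> x k = zgr k" for k
   using cvs_add_smult[OF c, of "x k" k "-1" 1] x by (simp add: cvs_one[OF c] cvs_smult_zero_left[OF c])
  show smc: "a \<odot>\<^sub>g x \<in> grC" for a using x smult by (simp add: gr_simps cvs_smult[OF c])
  show "\<exists>y\<in>grC. y \<oplus>\<^sub>g x = \<zero>\<^sub>g" by (rule bexI[OF _ smc[of "-1"]]) (simp add: gr_simps neg)
  show "(a + b) \<odot>\<^sub>g x = a \<odot>\<^sub>g x \<oplus>\<^sub>g b \<odot>\<^sub>g x" for a b using x by (simp add: gr_simps cvs_add_smult[OF c])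
  show "(a * b) \<odot>\<^sub>g x = a \<odot>\<^sub>g (b \<odot>\<^sub>g x)" for a b using x by (simp add: gr_simps cvs_smult_smult[OF c])
  fix y assume "y \<in> grC"
  hence y: "y k \<in> carrier (gr_comp G k)" "finite {k. y k \<noteq> zgr k}" for k by (auto simp: gr_simps)
  show "x \<oplus>\<^sub>g y \<in> grC" using x y add by (simp add: gr_simps cvs_add[OF c])
  have comm: "x k \<oplus>\<^bsub>gr_comp G k\<^esub> y k = y k \<oplus>\<^bsub>gr_comp G k\<^esub> x k" for k by (rule cvs_comm[OF c x(1) y(1)])
  show "x \<oplus>\<^sub>g y = y \<oplus>\<^sub>g x" unfolding gr_simps using comm by (rule ext)
  show "a \<odot>\<^sub>g (x \<oplus>\<^sub>g y) = a \<odot>\<^sub>g x \<oplus>\<^sub>g a \<odot>\<^sub>g y" for a using x y by (simp add: gr_simps cvs_smult_add[OF c])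
  fix z assume "z \<in> grC"
  hence z: "z k \<in> carrier (gr_comp G k)" for k by (auto simp: gr_simps)
  show "x \<oplus>\<^sub>g y \<oplus>\<^sub>g z = x \<oplus>\<^sub>g (y \<oplus>\<^sub>g z)" using x y z by (simp add: gr_simps cvs_assoc[OF c])
 qed
qed

lemma gr_closed: "f \<in> grC ==> f k \<in> carrier (gr_comp G k)" by (simp add: gr_simps)

lemma gr_term_closed: "f \<in> grC ==> g \<in> grC ==> i \<le> k ==>
  gr_bracket G i (k - i) (f i) (g (k - i)) \<in> carrier (gr_comp G k)"
 using gr_bracket_closed[of "f i" i "g (k - i)" "k - i"] by (simp add: gr_closed)

lemma gr_mult_zero_at:
 assumes "f \<in> grC" "g \<in> grC"
  and "\<And>i. i \<le> k ==> f i = zgr i \<or> g (k - i) = zgr (k - i)"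
 shows "(f \<otimes>\<^sub>g g) k = zgr k"
proof -
 interpret V: vectorspace class_ring "gr_comp G k" by simp
 have "gr_bracket G i (k - i) (f i) (g (k - i)) = zgr k" if "i \<le> k" for i
  using assms(3)[OF that] gr_closed[OF assms(1), of i] gr_closed[OF assms(2), of "k - i"] that
   gr_bracket_zero(1)[of "f i" i "k - i"] gr_bracket_zero(2)[of "g (k - i)" "k - i" i] by auto
 thus ?thesis unfolding gr_simps by (intro V.M.add.finprod_one_eqI) auto
qed

lemma gr_mult_single_term:
 assumes "f \<in> grC" "g \<in> grC" "i \<le> k"
  and "\<And>i'. i' \<le> k ==> i' \<noteq> i ==> f i' = zgr i' \<or> g (k - i') = zgr (k - i')"
 shows "(f \<otimes>\<^sub>g g) k = gr_bracket G i (k - i) (f i) (g (k - i))"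
proof -
 interpret V: vectorspace class_ring "gr_comp G k" by simp
 let ?t = "\<lambda>i. gr_bracket G i (k - i) (f i) (g (k - i))"
 have "?t i' = zgr k" if "i' \<le> k" "i' \<noteq> i" for i' using assms(4)[OF that] gr_closed[OF assms(1), of i'] gr_closed[OF assms(2), of "k - i'"] that
   gr_bracket_zero(1)[of "f i'" i' "k - i'"] gr_bracket_zero(2)[of "g (k - i')" "k - i'" i'] by auto
 hence "(\<Oplus>\<^bsub>gr_comp G k\<^esub>i'\<in>{..k}. ?t i') = (\<Oplus>\<^bsub>gr_comp G k\<^esub>i'\<in>{..k}. if i = i' then ?t i' else (zgr k))"
  using gr_term_closed[OF assms(1,2)] by (intro V.M.add.finprod_cong') auto
 also have "\<dots> = ?t i" using gr_term_closed[OF assms(1,2)] assms(3) by (intro V.M.add.finprod_singleton) auto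
 finally show ?thesis by (simp add: gr_simps)
qed

lemma gr_mult_closed: "f \<in> grC ==> g \<in> grC ==> f \<otimes>\<^sub>g g \<in> grC"
proof -
 assume f: "f \<in> grC" and g: "g \<in> grC"
 have c: "(f \<otimes>\<^sub>g g) k \<in> carrier (gr_comp G k)" for k
  unfolding gr_simps by (rule cvs_finsum_closed[OF gr_comp_cvs]) (use gr_term_closed[OF f g] in auto)
 let ?F = "{k. f k \<noteq> zgr k}" and ?H = "{k. g k \<noteq> zgr k}"
 have "{k. (f \<otimes>\<^sub>g g) k \<noteq> zgr k} \<subseteq> (\<lambda>(i, j). i + j) ` (?F \<times> ?H)"
 proof
  fix k assume "k \<in> {k. (f \<otimes>\<^sub>g g) k \<noteq> zgr k}"
  then obtain i where "i \<le> k" "i \<in> ?F" "k - i \<in> ?H" using gr_mult_zero_at[OF f g, of k] by auto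
  thus "k \<in> (\<lambda>(i, j). i + j) ` (?F \<times> ?H)" by (intro image_eqI[of _ _ "(i, k - i)"]) auto
 qed
 moreover have "finite ((\<lambda>(i, j). i + j) ` (?F \<times> ?H))" using f g by (simp add: gr_simps)
 ultimately show ?thesis using c finite_subset unfolding gr_simps(1) by auto
qed

lemma gr_algebra: "algebra_on (gr G)"
proof (rule algI[OF gr_cvs gr_mult_closed])
 fix x y z assume c: "x \<in> grC" "y \<in> grC" "z \<in> grC"
 note t = gr_term_closed[OF c(1,3)] gr_term_closed[OF c(2,3)] gr_term_closed[OF c(3,1)] gr_term_closed[OF c(3,2)]
 show "(x \<oplus>\<^sub>g y) \<otimes>\<^sub>g z = x \<otimes>\<^sub>g z \<oplus>\<^sub>g y \<otimes>\<^sub>g z" unfolding gr_simps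
 proof
  fix k interpret V: vectorspace class_ring "gr_comp G k" by simp
  have "(\<Oplus>\<^bsub>gr_comp G k\<^esub>i\<in>{..k}. gr_bracket G i (k - i) (x i \<oplus>\<^bsub>gr_comp G i\<^esub> y i) (z (k - i))) =
   (\<Oplus>\<^bsub>gr_comp G k\<^esub>i\<in>{..k}. gr_bracket G i (k - i) (x i) (z (k - i)) \<oplus>\<^bsub>gr_comp G k\<^esub> gr_bracket G i (k - i) (y i) (z (k - i)))"
  proof (rule V.M.add.finprod_cong')
   fix i assume "i \<in> {..k}"
   thus "gr_bracket G i (k - i) (x i \<oplus>\<^bsub>gr_comp G i\<^esub> y i) (z (k - i)) =
    gr_bracket G i (k - i) (x i) (z (k - i)) \<oplus>\<^bsub>gr_comp G k\<^esub> gr_bracket G i (k - i) (y i) (z (k - i))"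
    using gr_bracket_bilinear(1)[of "x i" i "y i" "z (k - i)" "k - i" "z (k - i)"] c by (simp add: gr_closed)
  qed (use t in auto)
  also have "\<dots> = (\<Oplus>\<^bsub>gr_comp G k\<^esub>i\<in>{..k}. gr_bracket G i (k - i) (x i) (z (k - i))) \<oplus>\<^bsub>gr_comp G k\<^esub>
   (\<Oplus>\<^bsub>gr_comp G k\<^esub>i\<in>{..k}. gr_bracket G i (k - i) (y i) (z (k - i)))"
   by (rule V.M.finsum_addf) (use t in auto)
  finally show "(\<Oplus>\<^bsub>gr_comp G k\<^esub>i\<in>{..k}. gr_bracket G i (k - i) (x i \<oplus>\<^bsub>gr_comp G i\<^esub> y i) (z (k - i))) = \<dots>" .
 qed
 show "z \<otimes>\<^sub>g (x \<oplus>\<^sub>g y) = z \<otimes>\<^sub>g x \<oplus>\<^sub>g z \<otimes>\<^sub>g y" unfolding gr_simps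
 proof
  fix k interpret V: vectorspace class_ring "gr_comp G k" by simp
  have "(\<Oplus>\<^bsub>gr_comp G k\<^esub>i\<in>{..k}. gr_bracket G i (k - i) (z i) (x (k - i) \<oplus>\<^bsub>gr_comp G (k - i)\<^esub> y (k - i))) =
   (\<Oplus>\<^bsub>gr_comp G k\<^esub>i\<in>{..k}. gr_bracket G i (k - i) (z i) (x (k - i)) \<oplus>\<^bsub>gr_comp G k\<^esub> gr_bracket G i (k - i) (z i) (y (k - i)))"
  proof (rule V.M.add.finprod_cong')
   fix i assume "i \<in> {..k}"
   thus "gr_bracket G i (k - i) (z i) (x (k - i) \<oplus>\<^bsub>gr_comp G (k - i)\<^esub> y (k - i)) =
    gr_bracket G i (k - i) (z i) (x (k - i)) \<oplus>\<^bsub>gr_comp G k\<^esub> gr_bracket G i (k - i) (z i) (y (k - i))"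
    using gr_bracket_bilinear(2)[of "z i" i "z i" "x (k - i)" "k - i" "y (k - i)"] c by (simp add: gr_closed)
  qed (use t in auto)
  also have "\<dots> = (\<Oplus>\<^bsub>gr_comp G k\<^esub>i\<in>{..k}. gr_bracket G i (k - i) (z i) (x (k - i))) \<oplus>\<^bsub>gr_comp G k\<^esub>
   (\<Oplus>\<^bsub>gr_comp G k\<^esub>i\<in>{..k}. gr_bracket G i (k - i) (z i) (y (k - i)))"
   by (rule V.M.finsum_addf) (use t in auto)
  finally show "(\<Oplus>\<^bsub>gr_comp G k\<^esub>i\<in>{..k}. gr_bracket G i (k - i) (z i) (x (k - i) \<oplus>\<^bsub>gr_comp G (k - i)\<^esub> y (k - i))) = \<dots>" .
 qed
next
 fix c x y assume c: "x \<in> grC" "y \<in> grC"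
 note t = gr_term_closed[OF c]
 have s: "(\<Oplus>\<^bsub>gr_comp G k\<^esub>i\<in>{..k}. c \<odot>\<^bsub>gr_comp G k\<^esub> gr_bracket G i (k - i) (x i) (y (k - i))) =
  c \<odot>\<^bsub>gr_comp G k\<^esub> (\<Oplus>\<^bsub>gr_comp G k\<^esub>i\<in>{..k}. gr_bracket G i (k - i) (x i) (y (k - i)))" for k c
 proof -
  interpret V: vectorspace class_ring "gr_comp G k" by simp
  show ?thesis by (rule V.finsum_smult_ldistr[symmetric]) (use t in auto)
 qed
 have b: "gr_bracket G i (k - i) (c \<odot>\<^bsub>gr_comp G i\<^esub> x i) (y (k - i)) = c \<odot>\<^bsub>gr_comp G k\<^esub> gr_bracket G i (k - i) (x i) (y (k - i))"
  "gr_bracket G i (k - i) (x i) (c \<odot>\<^bsub>gr_comp G (k - i)\<^esub> y (k - i)) = c \<odot>\<^bsub>gr_comp G k\<^esub> gr_bracket G i (k - i) (x i) (y (k - i))"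
  if "i \<le> k" for i k
  using gr_bracket_bilinear(3,4)[of "x i" i "x i" "y (k - i)" "k - i" "y (k - i)" c] c that by (simp_all add: gr_closed)
 show "c \<odot>\<^sub>g x \<otimes>\<^sub>g y = c \<odot>\<^sub>g (x \<otimes>\<^sub>g y)" unfolding gr_simps
 proof
  fix k interpret V: vectorspace class_ring "gr_comp G k" by simp
  show "(\<Oplus>\<^bsub>gr_comp G k\<^esub>i\<in>{..k}. gr_bracket G i (k - i) (c \<odot>\<^bsub>gr_comp G i\<^esub> x i) (y (k - i))) =
   c \<odot>\<^bsub>gr_comp G k\<^esub> (\<Oplus>\<^bsub>gr_comp G k\<^esub>i\<in>{..k}. gr_bracket G i (k - i) (x i) (y (k - i)))"
   unfolding s[symmetric] by (rule V.M.add.finprod_cong') (use b t in auto)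
 qed
 show "x \<otimes>\<^sub>g (c \<odot>\<^sub>g y) = c \<odot>\<^sub>g (x \<otimes>\<^sub>g y)" unfolding gr_simps
 proof
  fix k interpret V: vectorspace class_ring "gr_comp G k" by simp
  show "(\<Oplus>\<^bsub>gr_comp G k\<^esub>i\<in>{..k}. gr_bracket G i (k - i) (x i) (c \<odot>\<^bsub>gr_comp G (k - i)\<^esub> y (k - i))) =
   c \<odot>\<^bsub>gr_comp G k\<^esub> (\<Oplus>\<^bsub>gr_comp G k\<^esub>i\<in>{..k}. gr_bracket G i (k - i) (x i) (y (k - i)))"
   unfolding s[symmetric] by (rule V.M.add.finprod_cong') (use b t in auto)
 qed
qed

lemma gr_elem_homog: "u over lcs G k ==> elt k u \<in> homog (gr G) k"
proof -
 assume u: "u over lcs G k"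
 have "finite {i. elt k u i \<noteq> zgr i}" by (rule finite_subset[of _ "{k}"]) (auto simp: gr_elem_def)
 thus ?thesis using u by (auto simp: gr_simps gr_elem_def cvs_zero[OF gr_comp_cvs])
qed

lemma gr_elem_closed [simp]: "u over lcs G k ==> elt k u \<in> grC" using gr_elem_homog by (auto simp: gr_simps(6))

lemma gr_elem_lin_hom: "elt k \<in> lin_hom (free_module (lcs G k)) (gr G)" by (rule lin_homI)
  (auto simp: gr_simps(3,4) gr_elem_def gr_class_add gr_class_scl cvs_smult_zero[OF gr_comp_cvs]
   cvs_zero_left[OF gr_comp_cvs cvs_zero[OF gr_comp_cvs]] intro!: ext gr_elem_closed[unfolded gr_elem_def])

lemma gr_elem_onto: "elt k ` carrier (free_module (lcs G k)) = homog (gr G) k"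
proof
 show "homog (gr G) k \<subseteq> elt k ` carrier (free_module (lcs G k))"
 proof
  fix f assume f: "f \<in> homog (gr G) k"
  then obtain u where u: "u over lcs G k" "f k = cls k u" using gr_comp_cases[of "f k" k] by (auto simp: gr_simps)
  have "f = elt k u"
  proof
   fix i show "f i = elt k u i" using u f by (cases "i = k") (simp_all add: gr_elem_def gr_simps(6))
  qed
  thus "f \<in> elt k ` carrier (free_module (lcs G k))" using u by auto
 qed
qed (use gr_elem_homog in auto)

lemma gr_homog_subsp: "subsp (homog (gr G) k) (gr G)" using lin_hom_image[OF gr_elem_lin_hom gr_cvs subsp_carrier[OF free_cvs]] gr_elem_onto by metis

lemma gr_elem_cong: "cls k u = cls k v ==> elt k u = elt k v" by (rule ext) (simp add: gr_elem_def)

lemma gr_elem_eq_zero: "elt k u = \<zero>\<^sub>g \<longleftrightarrow> cls k u = zgr k" by (auto simp: gr_simps gr_elem_def fun_eq_iff)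

lemma gr_elem_mult:
 assumes "u over lcs G i" "v over lcs G j"
 shows "elt i u \<otimes>\<^sub>g elt j v = elt (i + j) (bilinear (com) u v)"
proof
 fix k
 note c = gr_elem_closed[OF assms(1)] gr_elem_closed[OF assms(2)]
 show "(elt i u \<otimes>\<^sub>g elt j v) k = elt (i + j) (bilinear (com) u v) k"
 proof (cases "k = i + j")
  case True
  have "(elt i u \<otimes>\<^sub>g elt j v) k = gr_bracket G i (k - i) (elt i u i) (elt j v (k - i))"
   by (rule gr_mult_single_term[OF c]) (use True in "auto simp: gr_elem_def")
  thus ?thesis using True gr_bracket_class[OF assms] by (simp add: gr_elem_def)
 next
  case False
  have "(elt i u \<otimes>\<^sub>g elt j v) k = zgr k" by (rule gr_mult_zero_at[OF c]) (use False in "auto simp: gr_elem_def")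
  thus ?thesis using False by (simp add: gr_elem_def)
 qed
qed

text \<open>\<open>lcs G 0\<close> and \<open>lcs G 1\<close> coincide, so every group element has
  class zero in degree 0.\<close>

lemma gr_elem_0 [simp]: "u over lcs G 0 ==> elt 0 u = \<zero>\<^sub>g"
proof -
 assume "u over lcs G 0"
 hence "cls 0 u = zgr 0"
 proof (induction u rule: pm_induct)
  case (single x c)
  thus ?case using gr_class_single_zero[of x 0] by simp
 next
  case (add u v)
  thus ?case by (simp add: gr_class_add)
 qed simp
 thus ?thesis using gr_elem_eq_zero by simp
qed

text \<open>Induction over the finite support, splitting off one homogeneous component at a time;
  gr_0 = 0, so \<open>N\<close> is tested in positive degrees.\<close>

lemma gr_decompose: "f \<in> grC ==> subsp N (gr G) ==>
  (\<And>k u. k \<ge> 1 ==> u over lcs G k ==> elt k u \<in> N) ==> f \<in> N"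
proof -
 assume f: "f \<in> grC" and N: "subsp N (gr G)" and e: "\<And>k u. k \<ge> 1 ==> u over lcs G k ==> elt k u \<in> N"
 have e: "elt k u \<in> N" if "u over lcs G k" for k u using e[of k u] that subspD(2)[OF N] by (cases "k = 0") auto
 have "finite A ==> \<forall>f\<in>grC. {k. f k \<noteq> zgr k} = A \<longrightarrow> f \<in> N" for A
 proof (induction A rule: finite_induct)
  case empty
  have "f = \<zero>\<^sub>g" if "{k. f k \<noteq> zgr k} = {}" for f using that by (auto simp: gr_simps fun_eq_iff)
  thus ?case using subspD(2)[OF N] by auto
 next
  case (insert a A)
  show ?case
  proof (intro ballI impI)
   fix f assume f: "f \<in> grC" "{k. f k \<noteq> zgr k} = insert a A"
   let ?g = "f(a := zgr a)"
   have gs: "{k. ?g k \<noteq> zgr k} = A" using f(2) insert(2) by auto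
   hence g: "?g \<in> grC" using f(1) insert(1) by (auto simp: gr_simps cvs_zero[OF gr_comp_cvs])
   obtain u where u: "u over lcs G a" "f a = cls a u" using gr_comp_cases[OF gr_closed[OF f(1)]] by metis
   have "f = ?g \<oplus>\<^sub>g elt a u"
    using u gr_closed[OF f(1)] by (auto simp: gr_simps gr_elem_def fun_eq_iff cvs_zero_left[OF gr_comp_cvs] cvs_zero_right[OF gr_comp_cvs])
   moreover have "?g \<in> N" using insert.IH g gs by blast
   ultimately show "f \<in> N" using subspD(3)[OF N] e[OF u(1)] by metis
  qed
 qed
 from this[of "{k. f k \<noteq> zgr k}"] show "f \<in> N" using f by (auto simp: gr_simps)
qed

lemma gr_elem_subsp:
 assumes "subsp N (gr G)" "\<And>x. x \<in> lcs G k ==> elt k (single x 1) \<in> N" "u over lcs G k"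
 shows "elt k u \<in> N" using span_free_module[OF assms(3) lin_vimage[OF gr_elem_lin_hom free_cvs assms(1)]] assms(2) by auto

definition gr_generators :: "(nat => ('a set \<Rightarrow>\<^sub>0 complex) set) set" where
 "gr_generators = {elt k (single x 1) | k x. k \<ge> 1 \<and> x \<in> lcs G k}"

lemma gr_generators_span: "gr_generators \<subseteq> grC" "grC \<subseteq> span_of (gr G) gr_generators"
proof -
 show c: "gr_generators \<subseteq> grC" by (auto simp: gr_generators_def)
 show "grC \<subseteq> span_of (gr G) gr_generators"
 proof
  fix f assume "f \<in> grC"
  thus "f \<in> span_of (gr G) gr_generators"
  proof (rule gr_decompose[OF _ span_of_subsp[OF gr_cvs c]])
   fix k and u :: "'a \<Rightarrow>\<^sub>0 complex" assume "k \<ge> 1" and u: "u over lcs G k"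
   show "elt k u \<in> span_of (gr G) gr_generators" by (rule gr_elem_subsp[OF span_of_subsp[OF gr_cvs c] span_of_base[OF gr_cvs c] u])
     (use \<open>k \<ge> 1\<close> in "auto simp: gr_generators_def")
  qed
 qed
qed

lemma gr_elem_add: "u over lcs G k ==> v over lcs G k ==>
  elt k u \<oplus>\<^sub>g elt k v = elt k (u + v)"
 using lin_homD(2)[OF gr_elem_lin_hom] by simp

lemma gr_class_inv:
 assumes "x \<in> lcs G k"
 shows "cls k (single (inv x) c) = cls k (single x (- c))"
proof -
 have "cls k (single (x \<otimes> inv x) c) = cls k (single x c + single (inv x) c)" using gr_class_single_mult assms lcs_inv by blast
 hence "cls k (single (inv x) c - single x (- c)) = zgr k" using gr_class_one lcs_mem[OF assms] by (simp add: single_uminus add.commute)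
 thus ?thesis using assms lcs_inv by (subst (asm) gr_class_diff_eq_zero) auto
qed

lemma gr_lie_algebra: "lie_algebra (gr G)"
proof (rule lie_algebra_from_generators[OF gr_algebra gr_generators_span])
 fix f g assume "f \<in> gr_generators" "g \<in> gr_generators"
 then obtain i x j y where x: "x \<in> lcs G i" "f = elt i (single x 1)" and y: "y \<in> lcs G j" "g = elt j (single y 1)" by (auto simp: gr_generators_def)
 show "f \<otimes>\<^sub>g g \<oplus>\<^sub>g g \<otimes>\<^sub>g f = \<zero>\<^sub>g"
  using x y gr_elem_mult[of "single x 1" i "single y 1" j] gr_elem_mult[of "single y 1" j "single x 1" i]
   gr_elem_add[of "bilinear (com) (single x 1) (single y 1)" "i + j" "bilinear (com) (single y 1) (single x 1)"]
   keys_com[of "single x 1" i "single y 1" j] keys_com[of "single y 1" j "single x 1" i]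
   gr_class_bilinear_swap[of "single x 1" i "single y 1" j]
  by (simp add: gr_elem_eq_zero add.commute)
next
 fix f g h assume "f \<in> gr_generators" "g \<in> gr_generators" "h \<in> gr_generators"
 then obtain i x j y k z where x: "x \<in> lcs G i" "i \<ge> 1" "f = elt i (single x 1)"
  and y: "y \<in> lcs G j" "j \<ge> 1" "g = elt j (single y 1)"
  and z: "z \<in> lcs G k" "k \<ge> 1" "h = elt k (single z 1)" by (auto simp: gr_generators_def)
 let ?n = "i + j + k" and ?c = "com"
 \<comment> \<open>[p,[q,r]] is inverse to [[q,r],p], whence the coefficient -1; the left-normed
   form is the one that \<open>jacobi_lcs\<close> handles.\<close>
 have m: "elt a (single p 1) \<otimes>\<^sub>g (elt b (single q 1) \<otimes>\<^sub>g elt c (single r 1)) =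
   elt ?n (single (?c (?c q r) p) (-1))" and l: "?c (?c q r) p \<in> lcs G ?n"
  if "p \<in> lcs G a" "q \<in> lcs G b" "r \<in> lcs G c" "a + (b + c) = ?n" for a b c p q r
 proof -
  note qr = com_lcs[OF that(2,3)]
  show l: "?c (?c q r) p \<in> lcs G ?n" using com_lcs[OF qr that(1)] that(4) by (simp add: add.commute)
  have "?c p (?c q r) = inv (?c (?c q r) p)" using com_inv that qr lcs_mem by metis
  hence "elt ?n (single (?c p (?c q r)) 1) = elt ?n (single (?c (?c q r) p) (-1))" using gr_class_inv[OF l, of 1] by (intro gr_elem_cong) simp
  thus "elt a (single p 1) \<otimes>\<^sub>g (elt b (single q 1) \<otimes>\<^sub>g elt c (single r 1)) =
   elt ?n (single (?c (?c q r) p) (-1))"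
   using that qr by (simp add: gr_elem_mult)
 qed
 let ?p = "?c (?c x y) z" and ?q = "?c (?c y z) x" and ?r = "?c (?c z x) y"
 have pqr: "?p \<in> lcs G ?n" "?q \<in> lcs G ?n" "?r \<in> lcs G ?n" using l[of z k x i y j] l[of x i y j z k] l[of y j z k x i] x y z by auto
 have "f \<otimes>\<^sub>g (g \<otimes>\<^sub>g h) \<oplus>\<^sub>g g \<otimes>\<^sub>g (h \<otimes>\<^sub>g f) \<oplus>\<^sub>g h \<otimes>\<^sub>g (f \<otimes>\<^sub>g g) =
  elt ?n (single ?q (-1) + single ?r (-1) + single ?p (-1))"
  using m[of z k x i y j] m[of x i y j z k] m[of y j z k x i] x y z pqr by (simp add: gr_elem_add over_add del: single_uminus)
 moreover have "cls ?n (single ?q (-1) + single ?r (-1) + single ?p (-1)) = cls ?n (single (?p \<otimes> (?q \<otimes> ?r)) (-1))"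
  using pqr by (simp add: gr_class_single_mult gr_class_add lcs_mult over_add cvs_comm cvs_assoc del: single_uminus)
 moreover have "\<dots> = zgr ?n" using gr_class_single_zero jacobi_lcs[OF x(1,2) y(1,2) z(1,2)] by simp
 ultimately show "f \<otimes>\<^sub>g (g \<otimes>\<^sub>g h) \<oplus>\<^sub>g g \<otimes>\<^sub>g (h \<otimes>\<^sub>g f) \<oplus>\<^sub>g h \<otimes>\<^sub>g (f \<otimes>\<^sub>g g) = \<zero>\<^sub>g"
  by (simp add: gr_elem_eq_zero)
qed

text \<open>Gamma_(k+1) is generated by the commutators [x,y] with x in Gamma_k, and products in the
  group become sums of classes. \<open>N\<close> will be the image of a space of monomials.\<close>

lemma gr_generated_in_degree_1:
 assumes N: "subsp N (gr G)" and k: "k \<ge> 1"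
  and m: "\<And>x y. x \<in> lcs G k ==> y \<in> \<G> ==> elt k (single x 1) \<otimes>\<^sub>g elt 1 (single y 1) \<in> N"
  and u: "u over lcs G (Suc k)"
 shows "elt (Suc k) u \<in> N"
proof (rule gr_elem_subsp[OF N _ u])
 fix e assume "e \<in> lcs G (Suc k)"
 hence "e \<in> generate G {com x y | x y. x \<in> lcs G k \<and> y \<in> \<G>}" using lcs_Suc[OF k] by simp
 hence "e \<in> lcs G (Suc k) \<and> elt (Suc k) (single e 1) \<in> N"
 proof (induction e rule: generate.induct)
  case one
  have "elt (Suc k) (single \<one> 1) = \<zero>\<^sub>g" using gr_class_one by (simp add: gr_elem_eq_zero)
  thus ?case using subspD(2)[OF N] lcs_one by simp
 next
  case (incl h)
  then obtain x y where h: "h = com x y" "x \<in> lcs G k" "y \<in> \<G>" by auto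
  thus ?case using m[OF h(2,3)] com_lcs_carrier[OF k] gr_elem_mult[of "single x 1" k "single y 1" 1] by simp
 next
  case (inv h)
  then obtain x y where h: "h = com x y" "x \<in> lcs G k" "y \<in> \<G>" by auto
  have hl: "h \<in> lcs G (Suc k)" using h com_lcs_carrier[OF k] by simp
  have "elt (Suc k) (single (inv h) 1) = (-1) \<odot>\<^sub>g elt (Suc k) (single h 1)"
   using lin_homD(3)[OF gr_elem_lin_hom, of "single h 1" "Suc k" "-1"] hl gr_elem_cong[OF gr_class_inv[OF hl, of 1]] by simp
  moreover have "elt (Suc k) (single h 1) \<in> N" using h m[OF h(2,3)] gr_elem_mult[of "single x 1" k "single y 1" 1] by simp
  ultimately show ?case using subspD(4)[OF N, of "elt (Suc k) (single h 1)" "-1"] lcs_inv[OF hl] by simp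
 next
  case (eng h1 h2)
  hence h: "h1 \<in> lcs G (Suc k)" "h2 \<in> lcs G (Suc k)" by auto
  have "elt (Suc k) (single (h1 \<otimes> h2) 1) = elt (Suc k) (single h1 1 + single h2 1)" by (rule gr_elem_cong[OF gr_class_single_mult[OF h]])
  also have "\<dots> = elt (Suc k) (single h1 1) \<oplus>\<^sub>g elt (Suc k) (single h2 1)" using h by (simp add: gr_elem_add)
  finally have "elt (Suc k) (single (h1 \<otimes> h2) 1) = \<dots>" .
  thus ?case using eng subspD(3)[OF N] lcs_mult by simp
 qed
 thus "elt (Suc k) (single e 1) \<in> N" by simp
qed

lemma gr_vanishing_subsp: "subsp {f \<in> grC. \<forall>i<n. f i = zgr i} (gr G)" by (rule subspI[OF gr_cvs])
  (use subspD[OF subsp_carrier[OF gr_cvs]] in "auto simp: gr_simps(2-4) cvs_smult_zero[OF gr_comp_cvs] cvs_zero_left[OF gr_comp_cvs cvs_zero[OF gr_comp_cvs]]")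

text \<open>If a + b < 2n, then a < n or b < n. Starting from n = 1, two applications show that gr''
  lives in degrees at least 4, on which the case k <= 2 of part (1) rests.\<close>

lemma gr_derived_vanishing:
 assumes "A \<subseteq> {f \<in> grC. \<forall>i<n. f i = zgr i}"
 shows "derived_lie (gr G) A \<subseteq> {f \<in> grC. \<forall>i<2 * n. f i = zgr i}"
proof (rule derived_lie_least[OF gr_algebra gr_vanishing_subsp])
 fix x y assume "x \<in> A" "y \<in> A"
 hence xy: "x \<in> grC" "y \<in> grC" "\<And>i. i < n ==> x i = zgr i" "\<And>i. i < n ==> y i = zgr i" using assms by auto
 have "(x \<otimes>\<^sub>g y) i = zgr i" if "i < 2 * n" for i
 proof (rule gr_mult_zero_at[OF xy(1,2)])
  fix a assume "a \<le> i"
  hence "a < n \<or> i - a < n" using that by auto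
  thus "x a = zgr a \<or> y (i - a) = zgr (i - a)" using xy by blast
 qed
 thus "x \<otimes>\<^sub>g y \<in> {f \<in> grC. \<forall>i<2 * n. f i = zgr i}" using gr_mult_closed[OF xy(1,2)] by simp
qed

lemma gr_at_0: "f \<in> grC ==> f 0 = zgr 0"
proof -
 assume "f \<in> grC"
 then obtain u where u: "u over lcs G 0" "f 0 = cls 0 u" using gr_comp_cases[OF gr_closed] by metis
 show ?thesis using gr_elem_0[OF u(1)] gr_elem_eq_zero[of 0 u] u(2) by simp
qed

lemma second_derived_gr_vanishing:
 assumes "f \<in> gr2" "i < 4"
 shows "f i = zgr i"
proof -
 have "grC \<subseteq> {f \<in> grC. \<forall>i<1. f i = zgr i}" using gr_at_0 by auto
 from gr_derived_vanishing[OF gr_derived_vanishing[OF this]] assms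
 show ?thesis unfolding second_derived_lie_def by auto
qed

end

section \<open>Free Lie algebras\<close>

lemma subsp_trans:
 assumes "subsp N (Q\<lparr>carrier := H\<rparr>)" "subsp H Q"
 shows "subsp N Q" by (rule subspI) (use subspD[OF assms(1)] subspD[OF assms(2)] in "auto simp: subset_iff")

lemma free_na_simps:
 "carrier (free_nonassoc_algebra S) = {u. u over {t. set_monomial t \<subseteq> S}}"
 "\<zero>\<^bsub>free_nonassoc_algebra S\<^esub> = 0"
 "u \<oplus>\<^bsub>free_nonassoc_algebra S\<^esub> v = u + v"
 "c \<odot>\<^bsub>free_nonassoc_algebra S\<^esub> u = scl c u"
 "u \<otimes>\<^bsub>free_nonassoc_algebra S\<^esub> v = bilinear Br u v"
 "homog (free_nonassoc_algebra S) k = {u. u over {t. set_monomial t \<subseteq> S \<and> monomial_degree t = k}}"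
 by (simp_all add: free_nonassoc_algebra_def module.extend_def graded_lie.fields_def free_module_def)

lemma free_nonassoc_cvs: "cvs (free_nonassoc_algebra S)" by (rule cvs_cong[OF free_cvs[of "{t. set_monomial t \<subseteq> S}"]])
  (auto simp: free_na_simps free_nonassoc_algebra_def module.extend_def free_module_def)

lemma free_nonassoc_alg: "algebra_on (free_nonassoc_algebra S)"
proof (rule algI[OF free_nonassoc_cvs])
 fix u v assume "u \<in> carrier (free_nonassoc_algebra S)" "v \<in> carrier (free_nonassoc_algebra S)"
 hence "u over {t. set_monomial t \<subseteq> S}" "v over {t. set_monomial t \<subseteq> S}" by (simp_all add: free_na_simps)
 hence "(bilinear Br u v) over {t. set_monomial t \<subseteq> S}" by (rule keys_bilinear) auto
 thus "u \<otimes>\<^bsub>free_nonassoc_algebra S\<^esub> v \<in> carrier (free_nonassoc_algebra S)" by (simp add: free_na_simps)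
qed (simp_all add: free_na_simps(3-5) bilin_addL bilin_addR bilin_sclL bilin_sclR)

lemma eval_monomial_closed:
 assumes "algebra_on L" "\<And>x. x \<in> S ==> h x \<in> carrier L" "set_monomial t \<subseteq> S"
 shows "eval_monomial L h t \<in> carrier L" using assms(3) by (induction t) (auto simp: assms(2) algD(2)[OF assms(1)])

lemma free_lie_relations_carrier:
 assumes "cvs V"
 shows "free_lie_relations V \<subseteq> carrier (free_nonassoc_algebra (carrier V))"
proof
 let ?F = "free_nonassoc_algebra (carrier V)"
 note D = algD[OF free_nonassoc_alg[of "carrier V"]]
 have g: "(single (Gen x) (c::complex)) over {t. set_monomial t \<subseteq> carrier V}" if "x \<in> carrier V" for x c using that by simp
 fix r assume r: "r \<in> free_lie_relations V"
 then consider (a) x y where "r = single (Gen (x \<oplus>\<^bsub>V\<^esub> y)) 1 - single (Gen x) 1 - single (Gen y) 1" "x \<in> carrier V" "y \<in> carrier V"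
  | (b) c x where "r = single (Gen (c \<odot>\<^bsub>V\<^esub> x)) 1 - single (Gen x) c" "x \<in> carrier V"
  | (c) u where "r = u \<otimes>\<^bsub>?F\<^esub> u" "u \<in> carrier ?F"
  | (d) u v w where "r = u \<otimes>\<^bsub>?F\<^esub> (v \<otimes>\<^bsub>?F\<^esub> w) \<oplus>\<^bsub>?F\<^esub> v \<otimes>\<^bsub>?F\<^esub> (w \<otimes>\<^bsub>?F\<^esub> u) \<oplus>\<^bsub>?F\<^esub> w \<otimes>\<^bsub>?F\<^esub> (u \<otimes>\<^bsub>?F\<^esub> v)"
    "u \<in> carrier ?F" "v \<in> carrier ?F" "w \<in> carrier ?F" unfolding free_lie_relations_def Let_def by blast
 thus "r \<in> carrier ?F"
 proof cases
  case a
  thus ?thesis using cvs_add[OF assms] by (simp add: free_na_simps(1) over_diff)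
 next
  case b
  thus ?thesis using cvs_smult[OF assms] by (simp add: free_na_simps(1) over_diff)
 next
  case c
  thus ?thesis using D(2) by simp
 next
  case d
  thus ?thesis by (simp add: D(2) cvs_add[OF D(1)])
 qed
qed

lemma free_lie_ideal_ideal: "cvs V ==> algebra_ideal (free_nonassoc_algebra (carrier V)) (free_lie_ideal V)" unfolding free_lie_ideal_def
 by (rule ideal_generated_ideal[OF free_nonassoc_alg free_lie_relations_carrier])

lemma free_lie_algebra: "cvs V ==> algebra_on (free_lie V)" unfolding free_lie_def by (rule graded_quot_algebra[OF free_nonassoc_alg free_lie_ideal_ideal])

definition fl_class where
 "fl_class V u = free_lie_ideal V +>\<^bsub>free_nonassoc_algebra (carrier V)\<^esub> u"

lemma fl_class_alg_hom:
 "cvs V ==> fl_class V \<in> alg_hom (free_nonassoc_algebra (carrier V)) (free_lie V)" using graded_coset_alg_hom[OF free_nonassoc_alg free_lie_ideal_ideal]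
 unfolding fl_class_def[abs_def] free_lie_def .

lemma free_lie_gen_eq: "free_lie_gen V x = fl_class V (single (Gen x) 1)" by (simp add: free_lie_gen_def fl_class_def)

lemma free_lie_class_cong:
 assumes V: "cvs V" and u: "u \<in> carrier (free_nonassoc_algebra (carrier V))"
  and v: "v \<in> carrier (free_nonassoc_algebra (carrier V))" and uv: "u - v \<in> free_lie_relations V"
 shows "fl_class V u = fl_class V v"
proof -
 have "u - v \<in> free_lie_ideal V" unfolding free_lie_ideal_def using uv by (rule ideal_generated_superset)
 moreover have "u \<ominus>\<^bsub>free_nonassoc_algebra (carrier V)\<^esub> v = u - v" using cvs_diff[OF free_nonassoc_cvs u v] by (simp add: free_na_simps(3,4))
 ultimately show ?thesis using coset_eq_iff[OF algebra_idealD(1)[OF free_lie_ideal_ideal[OF V]] u v] by (simp add: fl_class_def)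
qed

lemma free_lie_gen_lin_hom:
 fixes V (structure)
 assumes V: "cvs V"
 shows "free_lie_gen V \<in> lin_hom V (free_lie V)"
proof (rule lin_homI)
 let ?F = "free_nonassoc_algebra (carrier V)"
 note H = alg_homD(1)[OF fl_class_alg_hom[OF V]]
 have g: "single (Gen x) c \<in> carrier ?F" if "x \<in> carrier V" for x c using that by (simp add: free_na_simps)
 show "free_lie_gen V x \<in> carrier (free_lie V)" if "x \<in> carrier V" for x using lin_homD(1)[OF H g[OF that]] by (simp add: free_lie_gen_eq)
 fix x assume x: "x \<in> carrier V"
 {
  fix y assume y: "y \<in> carrier V"
  have "single (Gen (x \<oplus> y)) 1 - (single (Gen x) 1 + single (Gen y) 1) \<in> free_lie_relations V"
   unfolding free_lie_relations_def Let_def diff_diff_eq[symmetric] using x y by blast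
  hence "fl_class V (single (Gen (x \<oplus> y)) 1) = fl_class V (single (Gen x) 1 + single (Gen y) 1)"
   using x y g cvs_add[OF V x y] cvs_add[OF free_nonassoc_cvs g[OF x] g[OF y]] by (intro free_lie_class_cong[OF V]) (simp_all add: free_na_simps(3))
  also have "\<dots> = free_lie_gen V x \<oplus>\<^bsub>free_lie V\<^esub> free_lie_gen V y"
   using lin_homD(2)[OF H g[OF x] g[OF y]] by (simp add: free_na_simps(3) free_lie_gen_eq)
  finally show "free_lie_gen V (x \<oplus> y) = free_lie_gen V x \<oplus>\<^bsub>free_lie V\<^esub> free_lie_gen V y" by (simp add: free_lie_gen_eq)
 }
 {
  fix c
  have "single (Gen (c \<odot> x)) 1 - single (Gen x) c \<in> free_lie_relations V" unfolding free_lie_relations_def Let_def using x by blast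
  hence "fl_class V (single (Gen (c \<odot> x)) 1) = fl_class V (single (Gen x) c)" using x g cvs_smult[OF V x] by (intro free_lie_class_cong[OF V]) simp_all
  also have "\<dots> = c \<odot>\<^bsub>free_lie V\<^esub> free_lie_gen V x" using lin_homD(3)[OF H g[OF x], of c 1] by (simp add: free_na_simps(4) free_lie_gen_eq)
  finally show "free_lie_gen V (c \<odot> x) = c \<odot>\<^bsub>free_lie V\<^esub> free_lie_gen V x" by (simp add: free_lie_gen_eq)
 }
qed

section \<open>Evaluation of monomials and the universal property of the free Lie algebra\<close>

context
 fixes L :: "(complex, 'l, 'm) module_scheme" (structure) and h :: "'v => 'l" and V :: "(complex, 'v, 'n) module_scheme"
 assumes L: "lie_algebra L" and h: "h \<in> lin_hom V L" and V: "cvs V"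
begin

abbreviation "ev \<equiv> linear_extension L (eval_monomial L h)"

lemma L_alg: "algebra_on L" using L by (simp add: lie_algebra_def)

lemma eval_closed: "t \<in> {t. set_monomial t \<subseteq> carrier V} ==> eval_monomial L h t \<in> carrier L"
 by (rule eval_monomial_closed[OF L_alg, where S = "carrier V"]) (auto simp: lin_homD(1)[OF h])

lemma ev_add: "u over {t. set_monomial t \<subseteq> carrier V} ==> v over {t. set_monomial t \<subseteq> carrier V} ==>
  ev (u + v) = ev u \<oplus> ev v"
 by (rule lin_ext_add[OF algD(1)[OF L_alg] eval_closed])

lemma ev_scl: "u over {t. set_monomial t \<subseteq> carrier V} ==> ev (scl c u) = c \<odot> ev u" by (rule lin_ext_scl[OF algD(1)[OF L_alg] eval_closed])

lemma ev_single: "set_monomial t \<subseteq> carrier V ==> ev (single t c) = c \<odot> eval_monomial L h t"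
 by (rule lin_ext_single[OF algD(1)[OF L_alg], where S = "{t. set_monomial t \<subseteq> carrier V}"])
  (auto intro: eval_closed)

lemma ev_zero: "ev 0 = \<zero>" by (rule lin_ext_zero[OF algD(1)[OF L_alg] eval_closed])

lemma ev_closed: "u over {t. set_monomial t \<subseteq> carrier V} ==> ev u \<in> carrier L" by (rule lin_ext_closed[OF algD(1)[OF L_alg] eval_closed])

lemma ev_lin_hom: "ev \<in> lin_hom (free_nonassoc_algebra (carrier V)) L" by (rule lin_homI) (simp_all add: free_na_simps ev_add ev_scl ev_closed)

lemma ev_alg_hom: "ev \<in> alg_hom (free_nonassoc_algebra (carrier V)) L"
proof -
 let ?S = "{t. set_monomial t \<subseteq> carrier V}"
 note D = algD[OF L_alg]
 have br: "(bilinear Br u v) over ?S" if "u over ?S" "v over ?S" for u v :: "'v monomial \<Rightarrow>\<^sub>0 complex" using that by (rule keys_bilinear) auto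
 have "ev (bilinear Br u v) = ev u \<otimes> ev v" if u: "u over ?S" and v: "v over ?S" for u v using u
 proof (induction u rule: pm_induct)
  case zero
  show ?case using alg_mult_zero[OF L_alg] ev_closed[OF v] by (simp add: ev_zero)
 next
  case (single t c)
  note t = single
  from v show ?case
  proof (induction v rule: pm_induct)
   case zero
   have "ev (single t c) \<in> carrier L" using t by (intro ev_closed) simp
   thus ?case using alg_mult_zero[OF L_alg] by (simp add: ev_zero)
  next
   case (single s d)
   have cl: "eval_monomial L h t \<in> carrier L" "eval_monomial L h s \<in> carrier L" using t single eval_closed by auto
   have "Br t s \<in> ?S" using t single by simp
   thus ?case using t single cl D(2) by (simp add: ev_single D(5,6) cvs_smult[OF D(1)] cvs_smult_smult[OF D(1)] mult.commute)
  next
   case (add v w)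
   have "(single t c) over ?S" using t by simp
   thus ?case using add br[OF _ add(1)] br[OF _ add(2)] ev_closed by (simp add: bilin_addR ev_add D(4))
  qed
 next
  case (add u w)
  thus ?case using br[OF _ v] v ev_closed by (simp add: bilin_addL ev_add D(3))
 qed
 thus ?thesis unfolding alg_hom_def using ev_lin_hom by (simp add: free_na_simps)
qed

text \<open>The kernel of \<open>ev\<close> is an ideal, so only the four families of defining
  relations have to be killed; each is an axiom of the Lie algebra \<open>L\<close> or an instance
  of the linearity of \<open>h\<close>.\<close>

lemma ev_free_lie_ideal: "u \<in> free_lie_ideal V ==> ev u = \<zero>"
proof -
 let ?F = "free_nonassoc_algebra (carrier V)"
 let ?K = "{u \<in> carrier ?F. ev u = \<zero>}"
 note D = algD[OF L_alg] and A = alg_homD[OF ev_alg_hom] and FD = algD[OF free_nonassoc_alg[of "carrier V"]]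
 have alt: "x \<otimes> x = \<zero>" if "x \<in> carrier L" for x using L that by (simp add: lie_algebra_def)
 have jac: "x \<otimes> (y \<otimes> z) \<oplus> y \<otimes> (z \<otimes> x) \<oplus> z \<otimes> (x \<otimes> y) = \<zero>"
  if "x \<in> carrier L" "y \<in> carrier L" "z \<in> carrier L" for x y z using L that by (simp add: lie_algebra_def)
 have g: "ev (single (Gen x) c) = c \<odot> h x" "single (Gen x) c \<in> carrier ?F" if "x \<in> carrier V" for x c using that by (simp_all add: ev_single free_na_simps)
 have "r \<in> ?K" if r: "r \<in> free_lie_relations V" for r
 proof -
  have rc: "r \<in> carrier ?F" using r free_lie_relations_carrier[OF V] by auto
  from r consider (a) x y where "r = single (Gen (x \<oplus>\<^bsub>V\<^esub> y)) 1 - single (Gen x) 1 - single (Gen y) 1" "x \<in> carrier V" "y \<in> carrier V"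
   | (b) c x where "r = single (Gen (c \<odot>\<^bsub>V\<^esub> x)) 1 - single (Gen x) c" "x \<in> carrier V"
   | (c) u where "r = u \<otimes>\<^bsub>?F\<^esub> u" "u \<in> carrier ?F"
   | (d) u v w where "r = u \<otimes>\<^bsub>?F\<^esub> (v \<otimes>\<^bsub>?F\<^esub> w) \<oplus>\<^bsub>?F\<^esub> v \<otimes>\<^bsub>?F\<^esub> (w \<otimes>\<^bsub>?F\<^esub> u) \<oplus>\<^bsub>?F\<^esub> w \<otimes>\<^bsub>?F\<^esub> (u \<otimes>\<^bsub>?F\<^esub> v)"
     "u \<in> carrier ?F" "v \<in> carrier ?F" "w \<in> carrier ?F" unfolding free_lie_relations_def Let_def by blast
  hence "ev r = \<zero>"
  proof cases
   case a
   let ?s = "single (Gen (x \<oplus>\<^bsub>V\<^esub> y)) (1::complex)" and ?t = "single (Gen x) 1 + single (Gen y) (1::complex)"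
   have t: "?t = single (Gen x) 1 \<oplus>\<^bsub>?F\<^esub> single (Gen y) 1" by (simp add: free_na_simps)
   have s: "?s \<in> carrier ?F" using a cvs_add[OF V] g by simp
   have tc: "?t \<in> carrier ?F" unfolding t by (rule cvs_add[OF free_nonassoc_cvs g(2)[OF a(2)] g(2)[OF a(3)]])
   have "ev ?t = h x \<oplus> h y" unfolding t using a g lin_homD(1)[OF h] D(1) by (simp add: lin_homD(2)[OF A(1)])
   moreover have "ev ?s = h x \<oplus> h y" using a g(1)[of "x \<oplus>\<^bsub>V\<^esub> y" 1] cvs_add[OF V] lin_homD(1,2)[OF h] D(1) by simp
   moreover have "r = ?s \<ominus>\<^bsub>?F\<^esub> ?t" using a s tc by (simp add: cvs_diff[OF free_nonassoc_cvs] free_na_simps(3,4))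
   ultimately have "ev r = ev ?s \<ominus> ev ?t" "ev ?s = ev ?t" using lin_hom_diff[OF A(1) free_nonassoc_cvs D(1) s tc] by simp_all
   thus ?thesis using cvs_diff_eq_zero[OF D(1) A(3)[OF s] A(3)[OF tc]] by simp
  next
   case b
   let ?s = "single (Gen (c \<odot>\<^bsub>V\<^esub> x)) (1::complex)" and ?t = "single (Gen x) c"
   have s: "?s \<in> carrier ?F" using b cvs_smult[OF V] g by simp
   have tc: "?t \<in> carrier ?F" using b g by simp
   have "ev ?s = ev ?t" using b g(1) cvs_smult[OF V] lin_homD(1,3)[OF h] D(1) by simp
   moreover have "r = ?s \<ominus>\<^bsub>?F\<^esub> ?t" using b s tc by (simp add: cvs_diff[OF free_nonassoc_cvs] free_na_simps(3,4) single_uminus)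
   ultimately show ?thesis using s tc lin_hom_diff[OF A(1) free_nonassoc_cvs D(1)] A(3) D(1) by (simp add: cvs_diff_eq_zero)
  next
   case c
   thus ?thesis using A(2,3) alt by simp
  next
   case d
   have "ev r = ev u \<otimes> (ev v \<otimes> ev w) \<oplus> ev v \<otimes> (ev w \<otimes> ev u) \<oplus> ev w \<otimes> (ev u \<otimes> ev v)"
    unfolding d(1) using d(2-4) FD(2) cvs_add[OF FD(1)] by (simp only: A(2) lin_homD(2)[OF A(1)])
   thus ?thesis using jac A(3) d by simp
  qed
  thus ?thesis using rc by simp
 qed
 hence "free_lie_ideal V \<subseteq> ?K" unfolding free_lie_ideal_def by (intro ideal_generated_least kernel_algebra_ideal[OF ev_alg_hom free_nonassoc_alg L_alg]) auto
 thus "u \<in> free_lie_ideal V ==> ev u = \<zero>" by auto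
qed

lemma free_lie_lift:
 shows "u \<in> carrier (free_nonassoc_algebra (carrier V)) ==> free_lie_lift L h (fl_class V u) = ev u"
  "free_lie_lift L h \<in> alg_hom (free_lie V) L" using induced_alg_hom[OF free_nonassoc_alg free_lie_ideal_ideal[OF V] ev_alg_hom
   algD(1)[OF L_alg] ev_free_lie_ideal]
 unfolding free_lie_lift_def fl_class_def free_lie_def by auto

lemma free_lie_lift_gen: "x \<in> carrier V ==> free_lie_lift L h (free_lie_gen V x) = h x"
 using free_lie_lift(1)[of "single (Gen x) 1"] lin_homD(1)[OF h] algD(1)[OF L_alg] by (simp add: free_lie_gen_eq free_na_simps ev_single)

end

text \<open>Every monomial has positive degree, so both factors of a bracket have smaller degree.
  The induction runs over all degrees up to a bound, because those of the two factors vary.\<close>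

lemma finite_monomials_of_degree:
 assumes "finite T"
 shows "finite {t. set_monomial t \<subseteq> T \<and> monomial_degree t = k}"
proof -
 have pos: "monomial_degree t \<ge> 1" for t :: "'a monomial" by (induction t) auto
 have "finite {t. set_monomial t \<subseteq> T \<and> monomial_degree t \<le> k}" for k
 proof (induction k)
  case 0
  have "{t. set_monomial t \<subseteq> T \<and> monomial_degree t \<le> 0} = {}" using pos by (auto simp: Suc_le_eq)
  thus ?case by (simp only: finite.emptyI)
 next
  case (Suc k)
  let ?A = "{t. set_monomial t \<subseteq> T \<and> monomial_degree t \<le> k}"
  have "{t. set_monomial t \<subseteq> T \<and> monomial_degree t \<le> Suc k} \<subseteq> Gen ` T \<union> (\<lambda>(s, t). Br s t) ` (?A \<times> ?A)"
  proof
   fix t assume t: "t \<in> {t. set_monomial t \<subseteq> T \<and> monomial_degree t \<le> Suc k}"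
   show "t \<in> Gen ` T \<union> (\<lambda>(s, t). Br s t) ` (?A \<times> ?A)"
   proof (cases t)
    case (Br s r)
    hence "s \<in> ?A" "r \<in> ?A" using t pos[of s] pos[of r] by auto
    thus ?thesis using Br by auto
   qed (use t in auto)
  qed
  thus ?case by (rule finite_subset) (use Suc assms in simp)
 qed
 from this[of k] show ?thesis by (rule rev_finite_subset) auto
qed

text \<open>All vectors of \<open>V\<close> are generators, in general infinitely many. Linearity of
  \<open>free_lie_gen\<close> reduces them to \<open>T\<close>, and bilinearity does the same inside
  monomials without changing their degree; this is the source of finite-dimensionality.\<close>

lemma fl_class_monomial_span:
 assumes V: "cvs V" and T: "T \<subseteq> carrier V" "carrier V \<subseteq> span_of V T" and t: "set_monomial t \<subseteq> carrier V"
 shows "fl_class V (single t 1) \<in>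
  span_of (free_lie V) ((\<lambda>s. fl_class V (single s 1)) ` {s. set_monomial s \<subseteq> T \<and> monomial_degree s = monomial_degree t})"
proof -
 let ?F = "free_nonassoc_algebra (carrier V)"
 define A where "A k = (\<lambda>s. fl_class V (single s 1)) ` {s. set_monomial s \<subseteq> T \<and> monomial_degree s = k}" for k
 note D = algD[OF free_lie_algebra[OF V]] and H = alg_homD[OF fl_class_alg_hom[OF V]]
 have sc: "single s (1::complex) \<in> carrier ?F" if "set_monomial s \<subseteq> carrier V" for s using that by (simp add: free_na_simps)
 have AC: "A k \<subseteq> carrier (free_lie V)" for k unfolding A_def using H(3) sc T(1) by auto
 note S = subspD[OF span_of_subsp[OF D(1) AC]]
 have br: "fl_class V (single (Br s r) 1) = fl_class V (single s 1) \<otimes>\<^bsub>free_lie V\<^esub> fl_class V (single r 1)"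
  if "set_monomial s \<subseteq> carrier V" "set_monomial r \<subseteq> carrier V" for s r
  using H(2)[OF sc[OF that(1)] sc[OF that(2)]] by (simp add: free_na_simps)
 \<comment> \<open>Products of the two spans lie in the span of the products, and a product of
   monomials in \<open>T\<close> is a monomial in \<open>T\<close> whose degree is the sum.\<close>
 have prod: "x \<otimes>\<^bsub>free_lie V\<^esub> y \<in> span_of (free_lie V) (A (i + j))"
  if x: "x \<in> span_of (free_lie V) (A i)" and y: "y \<in> span_of (free_lie V) (A j)" for x y i j
 proof -
  have yc: "y \<in> carrier (free_lie V)" using y S(1) by auto
  from D(1) x AC show ?thesis
  proof (induction rule: span_of_induct)
   case zero
   thus ?case using alg_mult_zero[OF free_lie_algebra[OF V] yc] S(2) by simp
  next
   case (base a)
   from D(1) y AC show ?case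
   proof (induction rule: span_of_induct)
    case zero
    have "a \<in> carrier (free_lie V)" using base AC by auto
    thus ?case using alg_mult_zero(1)[OF free_lie_algebra[OF V]] S(2) by simp
   next
    case (base b)
    from \<open>a \<in> A i\<close> obtain s where s: "a = fl_class V (single s 1)" "set_monomial s \<subseteq> T" "monomial_degree s = i" unfolding A_def by auto
    from base obtain r where r: "b = fl_class V (single r 1)" "set_monomial r \<subseteq> T" "monomial_degree r = j" unfolding A_def by auto
    have "a \<otimes>\<^bsub>free_lie V\<^esub> b = fl_class V (single (Br s r) 1)" using s r T(1) br[of s r] by auto
    also have "\<dots> \<in> A (i + j)" unfolding A_def using s r by (intro imageI) auto
    finally show ?case using span_of_base[OF D(1) AC] by blast
   next
    case (add b b')
    have "a \<in> carrier (free_lie V)" using base AC by auto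
    thus ?case using add D(4) S(3) by simp
   next
    case (smult c b)
    have "a \<in> carrier (free_lie V)" using base AC by auto
    thus ?case using smult D(6) S(4) by simp
   qed
  next
   case (add x x')
   thus ?case using yc D(3) S(3) by simp
  next
   case (smult c x)
   thus ?case using yc D(5) S(4) by simp
  qed
 qed
 have "fl_class V (single t 1) \<in> span_of (free_lie V) (A (monomial_degree t))" using t
 proof (induction t)
  case (Gen x)
  hence "x \<in> span_of V T" using T by auto
  hence "free_lie_gen V x \<in> span_of (free_lie V) (A 1)"
  proof (rule span_of_image[OF free_lie_gen_lin_hom[OF V] V D(1) T(1)])
   show "free_lie_gen V ` T \<subseteq> span_of (free_lie V) (A 1)"
   proof
    fix y assume "y \<in> free_lie_gen V ` T"
    then obtain x where x: "x \<in> T" "y = fl_class V (single (Gen x) 1)" by (auto simp: free_lie_gen_eq)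
    hence "y \<in> A 1" unfolding A_def by (intro image_eqI[of _ _ "Gen x"]) auto
    thus "y \<in> span_of (free_lie V) (A 1)" by (rule span_of_base[OF D(1) AC])
   qed
  qed (rule span_of_subsp[OF D(1) AC])
  thus ?case by (simp add: free_lie_gen_eq)
 next
  case (Br s r)
  thus ?case using prod br by simp
 qed
 thus ?thesis unfolding A_def .
qed

section \<open>First homology and quadratic extensions\<close>

text \<open>A basis of \<open>N\<close> together with \<open>z\<close> is independent, and
  prescribed values on it extend linearly to all finitely supported functions; the functional is
  thus defined on every chain.\<close>

lemma separating_functional:
 fixes z :: "'s \<Rightarrow>\<^sub>0 complex"
 assumes N: "subsp N (free_module S)" and z: "z \<notin> N"
 shows "\<exists>g. (\<forall>u v. g (u + v) = g u + g v) \<and> (\<forall>c u. g (scl c u) = c * g u) \<and> (\<forall>u\<in>N. g u = 0) \<and> g z = (1::complex)"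
proof -
 interpret P: vector_space_pair "scl :: complex => ('s \<Rightarrow>\<^sub>0 complex) => _" "(*) :: complex => complex => complex"
  by unfold_locales (simp_all add: scl_add add_scl algebra_simps)
 note D = free_subspD[OF N]
 have sub: "P.vs1.subspace N" unfolding P.vs1.subspace_def using D by auto
 obtain B where B: "B \<subseteq> N" "\<not> P.vs1.dependent B" "N \<subseteq> P.vs1.span B" using P.vs1.basis_exists[of N] by metis
 have "P.vs1.span B \<subseteq> N" using P.vs1.span_minimal[OF B(1) sub] .
 hence zB: "z \<notin> P.vs1.span B" using z by auto
 hence "\<not> P.vs1.dependent (insert z B)" using P.vs1.independent_insertI B(2) by blast
 from P.linear_independent_extend[OF this, of "\<lambda>x. if x = z then 1 else 0"]
 obtain g where g: "Vector_Spaces.linear scl (*) g" "\<And>x. x \<in> insert z B ==> g x = (if x = z then 1 else 0)" by metis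
 interpret g: Vector_Spaces.linear scl "(*)" g by (rule g(1))
 have "z \<notin> B" using zB P.vs1.span_base by blast
 hence "\<forall>x\<in>B. g x = 0" using g(2) by auto
 hence "\<forall>u\<in>N. g u = 0" using P.linear_eq_0_on_span[OF g(1)] B(3) by blast
 thus ?thesis using g(2)[of z] by (intro exI[of _ g]) (simp add: g.add g.scale)
qed

section \<open>Evaluation of functions on chains\<close>

definition pairing :: "('s => complex) => ('s \<Rightarrow>\<^sub>0 complex) => complex" where
 "pairing f u = (\<Sum>x\<in>keys u. lookup u x * f x)"

lemma pairing_superset: "finite A ==> u over A ==> pairing f u = (\<Sum>x\<in>A. lookup u x * f x)"
 unfolding pairing_def by (rule sum.mono_neutral_left) (auto simp: in_keys_iff)

lemma pairing_simps [simp]: "pairing f 0 = 0" "pairing f (single x c) = c * f x" by (auto simp: pairing_def)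

lemma pairing_add: "pairing f (u + v) = pairing f u + pairing f v"
 using pairing_superset[of "keys u \<union> keys v" "u + v" f] pairing_superset[of "keys u \<union> keys v" u f]
  pairing_superset[of "keys u \<union> keys v" v f] keys_add[of u v]
 by (simp add: lookup_add distrib_right sum.distrib)

lemma pairing_scl: "pairing f (scl c u) = c * pairing f u" using pairing_superset[of "keys u" "scl c u" f] keys_scl[of c u]
 by (simp add: pairing_def sum_distrib_left mult.assoc)

lemma pairing_minus: "pairing f (- u) = - pairing f u" using pairing_scl[of f "-1" u] by simp

lemma pairing_diff: "pairing f (u - v) = pairing f u - pairing f v" using pairing_add[of f u "- v"] by (simp add: pairing_minus)

lemma pairing_cong: "(\<And>x. x \<in> keys u ==> f x = g x) ==> pairing f u = pairing g u" by (simp add: pairing_def)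

lemma pairing_bilinear: "pairing f (bilinear m u v) = (\<Sum>x\<in>keys u. \<Sum>y\<in>keys v. lookup u x * lookup v y * f (m x y))"
proof -
 have s: "pairing f (sum h A) = (\<Sum>x\<in>A. pairing f (h x))" for h and A :: "'x set" by (induction A rule: infinite_finite_induct) (simp_all add: pairing_add)
 have s': "pairing f (sum h A) = (\<Sum>x\<in>A. pairing f (h x))" for h and A :: "'y set" by (induction A rule: infinite_finite_induct) (simp_all add: pairing_add)
 show ?thesis unfolding bilinear_def by (simp add: s s')
qed

lemma pairing_bilinear_prod:
 assumes "\<And>x y. x \<in> keys u ==> y \<in> keys v ==> f (m x y) = a x * b y"
 shows "pairing f (bilinear m u v) = pairing a u * pairing b v" unfolding pairing_bilinear unfolding pairing_def sum_product
 by (intro sum.cong refl) (simp add: assms mult_ac)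

lemma pairing_lin_hom_zero:
 assumes "u \<in> span_of (free_module S) A" "A \<subseteq> carrier (free_module S)" "\<And>a. a \<in> A ==> pairing f a = 0"
 shows "pairing f u = 0" using free_cvs assms(1,2) by (induction rule: span_of_induct) (simp_all add: assms(3) pairing_add pairing_scl)

text \<open>The ground field as a vector space, so that the functionals in \<open>dual\<close> are
  linear maps in the sense of \<open>lin_hom\<close>.\<close>

definition complex_space :: "(complex, complex) module" where
 "complex_space = \<lparr>carrier = UNIV, mult = (*), one = 1, zero = 0, add = (+), smult = (*)\<rparr>"

lemma complex_space_cvs: "cvs complex_space" by (rule cvsI) (auto simp: complex_space_def algebra_simps intro: exI[of _ "- _"])

lemma dual_iff: "\<phi> \<in> dual V \<longleftrightarrow> \<phi> \<in> lin_hom V complex_space"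
 unfolding dual_def LinearCombinations.module_hom_def by (auto simp: complex_space_def)

section \<open>H_1, its identification with gr_1 and its dual basis\<close>

context group
begin

definition H1_class :: "('a \<Rightarrow>\<^sub>0 complex) => ('a \<Rightarrow>\<^sub>0 complex) set" where
 "H1_class u = boundaries1 G +>\<^bsub>CG\<^esub> u"

lemma boundaries1_generators: "{single y 1 - single (x \<otimes> y) 1 + single x (1::complex) | x y. x \<in> \<G> \<and> y \<in> \<G>}
 \<subseteq> carrier CG"
proof clarify
 fix x y assume "x \<in> \<G>" "y \<in> \<G>"
 hence "(single y 1 - single (x \<otimes> y) 1 + single x (1::complex)) over \<G>" by (intro over_add over_diff) auto
 thus "single y 1 - single (x \<otimes> y) 1 + single x (1::complex) \<in> carrier CG" by simp
qed

lemma boundaries1_subsp: "subsp (boundaries1 G) CG" unfolding boundaries1_def by (rule span_of_subsp[OF free_cvs boundaries1_generators])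

lemma boundaries1_base: "x \<in> \<G> ==> y \<in> \<G> ==> single y 1 - single (x \<otimes> y) 1 + single x 1 \<in> boundaries1 G"
 unfolding boundaries1_def by (rule span_of_base[OF free_cvs boundaries1_generators]) blast

lemmas boundaries1D = free_subspD[OF boundaries1_subsp]

lemma boundaries1_mult: "x \<in> \<G> ==> y \<in> \<G> ==> single (x \<otimes> y) 1 - single x 1 - single y 1 \<in> boundaries1 G"
 using boundaries1D(6)[OF boundaries1_base[of x y]] by (simp add: algebra_simps)

lemma H1_cvs: "cvs (H1 G)" unfolding H1_def by (rule quot_cvs[OF boundaries1_subsp])

lemma H1_class_lin_hom: "H1_class \<in> lin_hom CG (H1 G)" unfolding H1_class_def[abs_def] H1_def by (rule coset_lin_hom[OF boundaries1_subsp])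

lemma H1_cases:
 assumes "X \<in> carrier (H1 G)"
 obtains u where "u over \<G>" "X = H1_class u" using assms by (auto simp: H1_def quot_simps H1_class_def)

lemma H1_class_eq_iff: "u over \<G> ==> v over \<G> ==> H1_class u = H1_class v \<longleftrightarrow> u - v \<in> boundaries1 G"
 using coset_eq_iff[OF boundaries1_subsp, of u v] by (simp add: H1_class_def)

lemma H1_class_eq_zero: "u over \<G> ==> H1_class u = \<zero>\<^bsub>H1 G\<^esub> \<longleftrightarrow> u \<in> boundaries1 G"
 using coset_eq_zero_iff[OF boundaries1_subsp, of u] by (simp add: H1_class_def H1_def quot_simps)

lemma gr_class_boundary: "u \<in> boundaries1 G ==> cls 1 u = zgr 1"
proof -
 assume u: "u \<in> boundaries1 G"
 have 1: "lcs G 1 = \<G>" by simp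
 have s: "subsp {(zgr 1)} (gr_comp G 1)" by (rule subspI) (auto simp: cvs_zero[OF gr_comp_cvs] cvs_smult_zero[OF gr_comp_cvs])
 have "cls 1 u \<in> {(zgr 1)}"
 proof (rule span_of_image[OF gr_class_lin_hom[of 1, unfolded 1] free_cvs gr_comp_cvs boundaries1_generators u[unfolded boundaries1_def] _ s])
  show "cls 1 ` {single y 1 - single (x \<otimes> y) 1 + single x 1 | x y. x \<in> \<G> \<and> y \<in> \<G>} \<subseteq> {(zgr 1)}"
  proof clarify
   fix x y assume xy: "x \<in> \<G>" "y \<in> \<G>"
   have k: "(single (x \<otimes> y) 1 - single x 1 - single y (1::complex)) over lcs G 1" using xy by (intro over_diff) auto
   have "cls 1 (scl (-1) (single (x \<otimes> y) 1 - single x 1 - single y 1)) = zgr 1"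
    using gr_class_mult[of x 1 y] xy k by (subst gr_class_scl) (auto simp: cvs_smult_zero[OF gr_comp_cvs])
   thus "cls 1 (single y 1 - single (x \<otimes> y) 1 + single x 1) = zgr 1" by (simp add: algebra_simps)
  qed
 qed
 thus ?thesis by simp
qed

lemma H1_to_gr_class:
 assumes u: "u over \<G>"
 shows "H1_to_gr G (H1_class u) = elt 1 u"
proof -
 let ?f = "\<lambda>u. tensor_class (lcs_quot G 1) (pushforward (\<lambda>x. lcs G 2 #> x) u)"
 have f: "?f = cls 1" by (simp add: gr_class_def fun_eq_iff numeral_2_eq_2)
 have "cls 1 (i \<oplus>\<^bsub>CG\<^esub> u) = cls 1 u" if "i \<in> boundaries1 G" for i using gr_class_boundary[OF that] boundaries1D(1)[OF that] u
  by (simp add: gr_class_add cvs_zero_left[OF gr_comp_cvs] del: One_nat_def) (simp add: gr_class_add cvs_zero_left[OF gr_comp_cvs])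
 hence "induced (cls 1) (H1_class u) = cls 1 u" unfolding H1_class_def using u by (intro induced_coset[OF boundaries1_subsp]) auto
 thus ?thesis unfolding H1_to_gr_def f by (intro ext) (simp add: gr_elem_def)
qed

lemma H1_to_gr_lin_hom: "H1_to_gr G \<in> lin_hom (H1 G) (gr G)"
proof (rule lin_homI)
 have 1: "lcs G 1 = \<G>" by simp
 note H = lin_homD[OF H1_class_lin_hom] and E = lin_homD[OF gr_elem_lin_hom[of 1, unfolded 1]]
 fix x assume "x \<in> carrier (H1 G)"
 then obtain u where u: "u over \<G>" "x = H1_class u" by (rule H1_cases)
 show "H1_to_gr G x \<in> grC" using E(1) u by (simp add: H1_to_gr_class)
 show "H1_to_gr G (c \<odot>\<^bsub>H1 G\<^esub> x) = c \<odot>\<^sub>g H1_to_gr G x" for c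
  using u H(3)[of u c] E(3)[of u c] H1_to_gr_class[of "scl c u"] order_trans[OF keys_scl u(1)] by (simp add: H1_to_gr_class)
 fix y assume "y \<in> carrier (H1 G)"
 then obtain v where v: "v over \<G>" "y = H1_class v" by (rule H1_cases)
 show "H1_to_gr G (x \<oplus>\<^bsub>H1 G\<^esub> y) = H1_to_gr G x \<oplus>\<^sub>g H1_to_gr G y"
  using u v H(2)[of u v] E(2)[of u v] H1_to_gr_class[of "u + v"] over_add[OF u(1) v(1)] by (simp add: H1_to_gr_class)
qed

text \<open>Modulo boundaries the map from the group to chains is additive, hence trivial on
  commutators. With \<open>gr_class_kernel\<close> this makes H_1 -> gr_1 injective.\<close>

lemma boundaries1_lcs_2: "x \<in> lcs G 2 ==> single x 1 \<in> boundaries1 G"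
proof -
 let ?B = "boundaries1 G"
 note D = boundaries1D
 have one: "single \<one> 1 \<in> ?B" using boundaries1_base[of \<one> \<one>] by simp
 have mult: "single (x \<otimes> y) 1 \<in> ?B \<longleftrightarrow> single x 1 + single y 1 \<in> ?B" if "x \<in> \<G>" "y \<in> \<G>" for x y
 proof -
  note b = boundaries1_mult[OF that]
  show ?thesis
  proof
   assume "single (x \<otimes> y) 1 \<in> ?B"
   from D(5)[OF this b] show "single x 1 + single y 1 \<in> ?B" by (simp add: algebra_simps)
  next
   assume "single x 1 + single y 1 \<in> ?B"
   from D(3)[OF this b] show "single (x \<otimes> y) 1 \<in> ?B" by (simp add: algebra_simps)
  qed
 qed
 have inv: "single x 1 + single (inv x) 1 \<in> ?B" if "x \<in> \<G>" for x using mult[OF that inv_closed[OF that]] one that by simp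
 assume "x \<in> lcs G 2"
 hence "x \<in> generate G {com x y | x y. x \<in> lcs G 1 \<and> y \<in> \<G>}" using lcs_Suc[of 1] by (simp add: numeral_2_eq_2)
 hence "x \<in> \<G> \<and> single x 1 \<in> ?B"
 proof (induction x rule: generate.induct)
  case (incl h)
  then obtain x y where h: "h = x \<otimes> y \<otimes> inv x \<otimes> inv y" "x \<in> \<G>" "y \<in> \<G>" by (auto simp: commutator_def)
  have s: "single (x \<otimes> y) 1 - single x 1 - single y 1 \<in> ?B" by (rule boundaries1_mult) (use h in auto)
  have s2: "single (x \<otimes> y \<otimes> inv x) 1 - single (x \<otimes> y) 1 - single (inv x) 1 \<in> ?B" by (rule boundaries1_mult) (use h in auto)
  have s3: "single h 1 - single (x \<otimes> y \<otimes> inv x) 1 - single (inv y) 1 \<in> ?B" unfolding h(1) by (rule boundaries1_mult) (use h in auto)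
  \<comment> \<open>Three additivity relations build up \<open>h\<close> from x, y and their
    inverses; adding the relations for the two inverses cancels everything but
    \<open>h\<close>.\<close>
  have "(single (x \<otimes> y) 1 - single x 1 - single y 1) + (single (x \<otimes> y \<otimes> inv x) 1 - single (x \<otimes> y) 1 - single (inv x) 1) +
   (single h 1 - single (x \<otimes> y \<otimes> inv x) 1 - single (inv y) 1) + ((single x 1 + single (inv x) 1) + (single y 1 + single (inv y) 1)) \<in> ?B"
   by (intro D(3) s s2 s3 inv h)
  thus ?case using h by (simp add: algebra_simps)
 next
  case (inv h)
  then obtain x y where h: "h = com x y" "x \<in> \<G>" "y \<in> \<G>" by auto
  have i: "inv h = y \<otimes> x \<otimes> inv y \<otimes> inv x" unfolding h(1) using com_inv[OF h(2,3)] by (simp add: commutator_def)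
  have s: "single (y \<otimes> x) 1 - single y 1 - single x 1 \<in> ?B" by (rule boundaries1_mult) (use h in auto)
  have s2: "single (y \<otimes> x \<otimes> inv y) 1 - single (y \<otimes> x) 1 - single (inv y) 1 \<in> ?B" by (rule boundaries1_mult) (use h in auto)
  have s3: "single (inv h) 1 - single (y \<otimes> x \<otimes> inv y) 1 - single (inv x) 1 \<in> ?B" unfolding i by (rule boundaries1_mult) (use h in auto)
  have "(single (y \<otimes> x) 1 - single y 1 - single x 1) + (single (y \<otimes> x \<otimes> inv y) 1 - single (y \<otimes> x) 1 - single (inv y) 1) +
   (single (inv h) 1 - single (y \<otimes> x \<otimes> inv y) 1 - single (inv x) 1) + ((single x 1 + single (inv x) 1) + (single y 1 + single (inv y) 1)) \<in> ?B"
   by (intro D(3) s s2 s3 \<open>\<And>x. x \<in> \<G> ==> single x 1 + single (inv x) 1 \<in> ?B\<close> h)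
  thus ?case using h by (simp add: algebra_simps)
 next
  case (eng a b)
  thus ?case using mult[of a b] D(3) by simp
 qed (simp add: one)
 thus ?thesis by simp
qed

lemma gr_class_1_eq_zero: "u over \<G> ==> cls 1 u = zgr 1 ==> u \<in> boundaries1 G"
proof -
 assume u: "u over \<G>" "cls 1 u = zgr 1"
 have 1: "lcs G 1 = \<G>" by simp
 show ?thesis by (rule gr_class_kernel[of _ 1, unfolded 1, OF boundaries1_subsp boundaries1_mult _ u])
   (use boundaries1_lcs_2 in "auto simp: numeral_2_eq_2")
qed

text \<open>Homomorphisms to C, that is, the cocycles of degree 1 apart from their values outside
  the group.\<close>

definition additive_map :: "('a => complex) => bool" where
 "additive_map a \<longleftrightarrow> (\<forall>x\<in>\<G>. \<forall>y\<in>\<G>. a (x \<otimes> y) = a x + a y)"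

lemma additive_map_boundaries1: "additive_map a ==> u \<in> boundaries1 G ==> pairing a u = 0" unfolding boundaries1_def
 by (erule pairing_lin_hom_zero[OF _ boundaries1_generators]) (auto simp: additive_map_def pairing_add pairing_diff)

lemma additive_map_lcs_2: "additive_map a ==> x \<in> lcs G 2 ==> a x = 0" using additive_map_boundaries1[OF _ boundaries1_lcs_2, of a x] by simp

lemma kronecker_class:
 assumes "additive_map a" "u over \<G>"
 shows "kronecker a (H1_class u) = pairing a u" unfolding kronecker_def H1_class_def pairing_def[symmetric]
 by (rule induced_coset[OF boundaries1_subsp]) (use assms in "auto simp: pairing_add additive_map_boundaries1")

text \<open>A set \<open>T\<close> of least cardinality among the finite sets spanning H_1 gives a
  basis, and the \<open>a t\<close> are its coordinate functions. The formula for \<open>b g\<close>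
  expresses a homomorphism through its values on \<open>T\<close>.\<close>

lemma dual_basis:
 assumes fg: "finite S" "S \<subseteq> \<G>" "generate G S = \<G>"
 shows "\<exists>T a. finite T \<and> T \<subseteq> \<G> \<and> (\<forall>t\<in>T. additive_map (a t)) \<and>
  (\<forall>b g. additive_map b \<longrightarrow> g \<in> \<G> \<longrightarrow> b g = (\<Sum>t\<in>T. a t g * b t)) \<and>
  (\<forall>g\<in>\<G>. \<exists>w. w over T \<and> single g 1 - w \<in> boundaries1 G)"
proof -
 let ?B = "boundaries1 G"
 define P where "P T \<longleftrightarrow> finite T \<and> T \<subseteq> \<G> \<and> (\<forall>g\<in>\<G>. \<exists>w. w over T \<and> single g 1 - w \<in> ?B)" for T
 note D = boundaries1D
 have "\<exists>w. w over S \<and> single g 1 - w \<in> ?B" if "g \<in> generate G S" for g using that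
 proof (induction g rule: generate.induct)
  case one
  show ?case using boundaries1_base[of \<one> \<one>] by (intro exI[of _ 0]) simp
 next
  case (incl h)
  thus ?case using D(2) by (intro exI[of _ "single h 1"]) simp
 next
  case (inv h)
  have h: "h \<in> \<G>" using inv fg by auto
  have "single \<one> 1 \<in> ?B" using boundaries1_base[of \<one> \<one>] by simp
  from D(5)[OF this boundaries1_mult[OF h inv_closed[OF h]]] have "single (inv h) 1 - (- single h 1) \<in> ?B" using h by (simp add: algebra_simps)
  thus ?case using inv by (intro exI[of _ "- single h 1"]) (simp add: single_uminus[symmetric])
 next
  case (eng g h)
  then obtain v w where vw: "v over S" "single g 1 - v \<in> ?B" "w over S" "single h 1 - w \<in> ?B" by auto
  have c: "g \<in> \<G>" "h \<in> \<G>" using eng(1,2) fg(3) by auto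
  from D(3)[OF D(3)[OF vw(2,4)] boundaries1_mult[OF c]]
  have "single (g \<otimes> h) 1 - (v + w) \<in> ?B" by (simp add: algebra_simps)
  thus ?case using over_add[OF vw(1,3)] by blast
 qed
 hence "P S" unfolding P_def using fg by auto
 then obtain T where T: "P T" "\<And>T'. P T' ==> card T \<le> card T'" using ex_has_least_nat[of P S card] by auto
 have Tf: "finite T" "T \<subseteq> \<G>" using T(1) unfolding P_def by auto
 have indep: "w = 0" if w: "w over T" "w \<in> ?B" for w
 proof (rule ccontr)
  assume "w \<noteq> 0"
  then obtain t where t: "lookup w t \<noteq> 0" by (metis lookup_zero poly_mapping_eqI)
  hence tT: "t \<in> T" using w by (auto simp: in_keys_iff)
  have "P (T - {t})" unfolding P_def
  proof (intro conjI ballI)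
   fix g assume "g \<in> \<G>"
   then obtain v where v: "v over T" "single g 1 - v \<in> ?B" using T(1) unfolding P_def by auto
   \<comment> \<open>Subtracting a multiple of the relation \<open>w\<close> eliminates
     \<open>t\<close>, against the minimality of \<open>T\<close>.\<close>
   let ?v = "v - scl (lookup v t / lookup w t) w"
   have "?v over T" using v w by (intro over_diff order_trans[OF keys_scl]) auto
   moreover have "t \<notin> keys ?v" using t by (simp add: in_keys_iff lookup_minus)
   moreover have "single g 1 - ?v \<in> ?B" using D(3)[OF v(2) D(4)[OF w(2), of "lookup v t / lookup w t"]] by (simp add: algebra_simps)
   ultimately show "\<exists>w. w over T - {t} \<and> single g 1 - w \<in> ?B" by blast
  qed (use Tf in auto)
  from T(2)[OF this] show False using Tf tT by (metis card_Diff1_less not_less)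
 qed
 define c where "c g = (SOME w. w over T \<and> single g 1 - w \<in> ?B)" for g
 have c: "(c g) over T" "single g 1 - c g \<in> ?B" if "g \<in> \<G>" for g
  using someI_ex[of "\<lambda>w. w over T \<and> single g 1 - w \<in> ?B"] T(1) that unfolding P_def c_def by auto
 \<comment> \<open>Coordinates with respect to a basis are unique, so those of a product are the
   sums of those of its factors.\<close>
 have "additive_map (\<lambda>g. lookup (c g) t)" for t unfolding additive_map_def
 proof (intro ballI)
  fix g h assume gh: "g \<in> \<G>" "h \<in> \<G>"
  have "c (g \<otimes> h) - c g - c h = 0"
  proof (rule indep)
   show "(c (g \<otimes> h) - c g - c h) over T" using c(1) gh by (intro over_diff) auto
   from D(5)[OF D(5)[OF D(5)[OF boundaries1_mult[OF gh] c(2)[OF m_closed[OF gh]]] D(6)[OF c(2)[OF gh(1)]]] D(6)[OF c(2)[OF gh(2)]]]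
   show "c (g \<otimes> h) - c g - c h \<in> ?B" by (simp add: algebra_simps)
  qed
  hence "c (g \<otimes> h) = c g + c h" by (simp add: algebra_simps)
  thus "lookup (c (g \<otimes> h)) t = lookup (c g) t + lookup (c h) t" by (simp add: lookup_add)
 qed
 moreover have "b g = (\<Sum>t\<in>T. lookup (c g) t * b t)" if "additive_map b" "g \<in> \<G>" for b g
  using additive_map_boundaries1[OF that(1) c(2)[OF that(2)]] pairing_superset[OF Tf(1) c(1)[OF that(2)], of b] by (simp add: pairing_diff)
 ultimately show ?thesis using Tf T(1) unfolding P_def by (intro exI[of _ T] exI[of _ "\<lambda>t g. lookup (c g) t"]) auto
qed

end

text \<open>Every homomorphism \<open>f\<close> on \<open>\<Gamma>\<^sub>2\<close> that vanishes on \<open>\<Gamma>\<^sub>3\<close> extends to a quadratic function on the group;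
 the extension is built by adjoining one generator at a time.\<close>

locale quadratic_extension = group G for G (structure) +
 fixes f :: "'a => complex"
 assumes f_mult: "x \<in> lcs G 2 ==> y \<in> lcs G 2 ==> f (x \<otimes> y) = f x + f y"
  and f_lcs_3: "x \<in> lcs G 3 ==> f x = 0"
begin

text \<open>The alternating form that \<open>f\<close> induces on the group through the commutator;
  it is additive in each argument because \<open>f\<close> vanishes on Gamma_3.\<close>

definition B :: "'a => 'a => complex" where "B x y = f (commutator G x y)"

lemma comm_2: "x \<in> carrier G ==> y \<in> carrier G ==> commutator G x y \<in> lcs G 2" using com_lcs[of x 1 y 1] by (simp add: numeral_2_eq_2)

lemma f_one: "f \<one> = 0" using f_lcs_3 lcs_one by blast

lemma B_mult_left:
 assumes "x \<in> carrier G" "x' \<in> carrier G" "y \<in> carrier G"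
 shows "B (x \<otimes> x') y = B x y + B x' y"
proof -
 have "commutator G x (commutator G x' y) \<in> lcs G 3" using com_lcs[of x 1 "commutator G x' y" 2] comm_2 assms by (simp add: numeral_3_eq_3 numeral_2_eq_2)
 moreover from this have "commutator G x (commutator G x' y) \<in> lcs G 2" using lcs_Suc_subset[of 2] by (auto simp: numeral_3_eq_3 numeral_2_eq_2)
 ultimately show ?thesis using assms by (simp add: B_def com_mult_left f_mult f_lcs_3 comm_2 lcs_mult)
qed

lemma B_swap: "x \<in> carrier G ==> y \<in> carrier G ==> B y x = - B x y"
proof -
 assume xy: "x \<in> carrier G" "y \<in> carrier G"
 have "f (commutator G x y \<otimes> inv (commutator G x y)) = B x y + f (inv (commutator G x y))" unfolding B_def using xy comm_2 lcs_inv by (intro f_mult) auto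
 moreover have "commutator G x y \<otimes> inv (commutator G x y) = \<one>" using xy by simp
 ultimately show ?thesis using xy f_one com_inv[OF xy] by (simp add: B_def add_eq_0_iff)
qed

lemma B_mult_right: "x \<in> carrier G ==> x' \<in> carrier G ==> y \<in> carrier G ==> B y (x \<otimes> x') = B y x + B y x'"
 using B_swap[of "x \<otimes> x'" y] B_swap[of x y] B_swap[of x' y] B_mult_left[of x x' y] by simp

lemma B_self: "x \<in> carrier G ==> B x x = 0" using B_swap[of x x] by simp

lemma B_lcs_2: "x \<in> lcs G 2 ==> y \<in> carrier G ==> B x y = 0"
 unfolding B_def using com_lcs[of x 2 y 1] by (intro f_lcs_3) (simp add: numeral_3_eq_3 numeral_2_eq_2)

lemma B_lcs_2': "x \<in> lcs G 2 ==> y \<in> carrier G ==> B y x = 0" using B_swap[of y x] B_swap[of x y] B_lcs_2[of x y] lcs_mem by auto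

lemma B_pow: "x \<in> carrier G ==> y \<in> carrier G ==> B (x [^] (m::int)) y = of_int m * B x y"
proof -
 assume xy: "x \<in> carrier G" "y \<in> carrier G"
 have nat: "B (x [^] (n::nat)) y = of_nat n * B x y" for n
 proof (induction n)
  case 0
  have "B (\<one> \<otimes> \<one>) y = B \<one> y + B \<one> y" using xy by (intro B_mult_left) auto
  thus ?case by simp
 next
  case (Suc n)
  thus ?case using xy by (simp add: B_mult_left algebra_simps)
 qed
 have inv: "B (inv z) y = - B z y" if "z \<in> carrier G" for z
 proof -
  have "B (z \<otimes> inv z) y = B z y + B (inv z) y" using that xy by (intro B_mult_left) auto
  moreover have "B \<one> y = 0" using nat[of 0] by simp
  ultimately show ?thesis using that by (simp add: add_eq_0_iff)
 qed
 show ?thesis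
 proof (cases m rule: int_cases2)
  case (nonneg n)
  thus ?thesis using nat by (simp add: int_pow_int)
 next
  case (nonpos n)
  hence "x [^] m = inv (x [^] n)" using xy by (simp add: int_pow_neg int_pow_int)
  thus ?thesis using nat inv xy nonpos by simp
 qed
qed

text \<open>The factor 1/2 is forced: with F = f on Gamma_2, the relation xy = [x,y] yx requires
  F(xy) - F(yx) = B x y, and \<open>B\<close> is alternating.\<close>

definition extends_to :: "'a set => ('a => complex) => bool" where
 "extends_to H F \<longleftrightarrow> subgroup H G \<and> lcs G 2 \<subseteq> H \<and> (\<forall>x\<in>lcs G 2. F x = f x) \<and>
  (\<forall>h\<in>H. \<forall>k\<in>H. F (h \<otimes> k) = F h + F k + B h k / 2)"

lemma extends_to_lcs_2: "extends_to (lcs G 2) f" unfolding extends_to_def using lcs_subgroup by (auto simp: f_mult B_lcs_2 lcs_mem)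

text \<open>On the powers of one element the correction term vanishes, since
  \<open>B y y = 0\<close>.\<close>

lemma extends_to_pow:
 assumes "extends_to H F" "y \<in> H"
 shows "F (y [^] (m::int)) = of_int m * F y"
proof -
 interpret H: subgroup H G using assms unfolding extends_to_def by auto
 have mult: "F (h \<otimes> k) = F h + F k + B h k / 2" if "h \<in> H" "k \<in> H" for h k using assms that unfolding extends_to_def by auto
 have y: "y \<in> carrier G" using assms H.mem_carrier by auto
 have pow: "y [^] (n::nat) \<in> H" for n by (induction n) (use assms in auto)
 have F1: "F \<one> = 0" using assms f_one lcs_one unfolding extends_to_def by auto
 have Bp: "B (y [^] (n::nat)) y = 0" for n using B_pow[OF y y, of "int n"] B_self[OF y] by (simp add: int_pow_int)
 have nat: "F (y [^] (n::nat)) = of_nat n * F y" for n by (induction n) (use F1 mult pow assms Bp in "simp_all add: algebra_simps")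
 have inv: "F (inv z) = - F z" if "z \<in> H" for z
 proof -
  have zc: "z \<in> carrier G" using that H.mem_carrier by auto
  have "B z (inv z) = 0" using B_pow[OF zc zc, of "-1"] B_self[OF zc] B_swap[of "inv z" z] zc by (simp add: int_pow_neg int_pow_1)
  hence "F (z \<otimes> inv z) = F z + F (inv z)" using mult[of z "inv z"] that by simp
  thus ?thesis using zc F1 by (simp add: add_eq_0_iff)
 qed
 show ?thesis
 proof (cases m rule: int_cases2)
  case (nonneg n)
  thus ?thesis using nat by (simp add: int_pow_int)
 next
  case (nonpos n)
  hence "y [^] m = inv (y [^] n)" using y by (simp add: int_pow_neg int_pow_int)
  thus ?thesis using nat inv pow nonpos by simp
 qed
qed

text \<open>\<open>H\<close> contains Gamma_2, so the products h x^m form a subgroup. The quadratic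
  rule dictates the value at h x^m once the value \<tau> at x is chosen, and that choice is
  constrained only when a nontrivial power of x lies in \<open>H\<close>.\<close>

lemma extends_to_insert:
 assumes E: "extends_to H F" and x: "x \<in> carrier G"
 shows "\<exists>H' F'. extends_to H' F' \<and> H \<subseteq> H' \<and> x \<in> H'"
proof -
 interpret H: subgroup H G using E unfolding extends_to_def by auto
 have mult: "F (h \<otimes> k) = F h + F k + B h k / 2" if "h \<in> H" "k \<in> H" for h k using E that unfolding extends_to_def by auto
 have Ff: "F c = f c" "c \<in> H" if "c \<in> lcs G 2" for c using E that unfolding extends_to_def by auto
 note Hc = H.mem_carrier
 \<comment> \<open>If x^d lies in \<open>H\<close> with d nonzero, \<tau> has to be F(x^d)/d;
   otherwise 0 serves.\<close>
 obtain \<tau> where \<tau>: "F (x [^] n) = of_int n * \<tau>" if "x [^] n \<in> H" for n :: int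
 proof (cases "\<exists>d::int. d \<noteq> 0 \<and> x [^] d \<in> H")
  case False
  hence "F (x [^] n) = of_int n * 0" if "x [^] n \<in> H" for n :: int using that f_one Ff(1)[OF lcs_one] by (cases "n = 0") auto
  thus ?thesis using that by blast
 next
  case True
  then obtain d :: int where d: "d \<noteq> 0" "x [^] d \<in> H" by auto
  have "F (x [^] n) = of_int n * (F (x [^] d) / of_int d)" if n: "x [^] n \<in> H" for n :: int
  proof -
   have "(x [^] n) [^] d = (x [^] d) [^] n" using x by (simp add: int_pow_pow mult.commute)
   hence "of_int d * F (x [^] n) = of_int n * F (x [^] d)" using extends_to_pow[OF E n, of d] extends_to_pow[OF E d(2), of n] by simp
   thus ?thesis using d(1) by (simp add: field_simps)
  qed
  thus ?thesis using that by blast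
 qed
 define val where "val h m = F h + of_int m * \<tau> + of_int m * B h x / 2" for h m
 \<comment> \<open>Two expressions of one element differ by a power of \<open>x\<close> inside
   \<open>H\<close>. There \<open>F\<close> is the exponent times \<tau>, and
   \<open>B x x = 0\<close> makes the last terms agree.\<close>
 have wd: "val h m = val k n" if hk: "h \<in> H" "k \<in> H" and eq: "h \<otimes> x [^] m = k \<otimes> x [^] n" for h k and m n :: int
 proof -
  let ?p = "x [^] (n - m)"
  have pc: "x [^] i \<in> carrier G" for i :: int using x by simp
  have h: "h = k \<otimes> ?p"
  proof -
   have "(h \<otimes> x [^] m) \<otimes> x [^] (-m) = (k \<otimes> x [^] n) \<otimes> x [^] (-m)" using eq by simp
   thus ?thesis using hk[THEN Hc] x by (simp add: m_assoc int_pow_mult[symmetric] del: int_pow_mult)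
  qed
  hence "?p = inv k \<otimes> h" using hk[THEN Hc] x by simp
  hence pH: "?p \<in> H" using hk by simp
  have "F h = F k + of_int (n - m) * \<tau> + of_int (n - m) * B k x / 2"
   using mult[OF hk(2) pH] \<tau>[OF pH] B_pow[OF x Hc[OF hk(2)], of "n - m"] B_swap[OF Hc[OF hk(2)] x] B_swap[of "?p" k] hk[THEN Hc] pc h by simp
  moreover have "B h x = B k x" unfolding h using B_mult_left[OF Hc[OF hk(2)] pc x] B_pow[OF x x] B_self[OF x] by simp
  ultimately show ?thesis by (simp add: val_def field_simps)
 qed
 define H' where "H' = {h \<otimes> x [^] m | h m. h \<in> H \<and> (m::int) \<in> UNIV}"
 define F' where "F' g = (THE v. \<exists>h m. h \<in> H \<and> g = h \<otimes> x [^] (m::int) \<and> v = val h m)" for g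
 have F': "F' (h \<otimes> x [^] m) = val h m" if "h \<in> H" for h and m :: int unfolding F'_def
 proof (rule the_equality)
  show "\<exists>k n. k \<in> H \<and> h \<otimes> x [^] m = k \<otimes> x [^] (n::int) \<and> val h m = val k n" using that by blast
  fix v assume "\<exists>k n. k \<in> H \<and> h \<otimes> x [^] m = k \<otimes> x [^] (n::int) \<and> v = val k n"
  then obtain k and n :: int where kn: "k \<in> H" "h \<otimes> x [^] m = k \<otimes> x [^] n" "v = val k n" by auto
  show "v = val h m" unfolding kn(3) by (rule wd[OF that kn(1,2), symmetric])
 qed
 \<comment> \<open>Moving x^m past k creates the factor [x^m,k] in Gamma_2, where \<open>F\<close>
   equals \<open>f\<close>; it contributes m B(x,k).\<close>
 have prod: "\<exists>q. q \<in> H \<and> (h \<otimes> x [^] m) \<otimes> (k \<otimes> x [^] n) = q \<otimes> x [^] (m + n) \<and>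
   F q = F h + F k + of_int m * B x k + B h k / 2 \<and> B q x = B h x + B k x"
  if hk: "h \<in> H" "k \<in> H" for h k and m n :: int
 proof -
  note cc = hk[THEN Hc]
  have pc: "x [^] i \<in> carrier G" for i :: int using x by simp
  let ?c = "commutator G (x [^] m) k"
  have c2: "?c \<in> lcs G 2" using comm_2 cc pc by simp
  note cH = Ff(2)[OF c2]
  have ccc: "?c \<in> carrier G" using cc pc by simp
  let ?q = "h \<otimes> (?c \<otimes> k)"
  have "(h \<otimes> x [^] m) \<otimes> (k \<otimes> x [^] n) = h \<otimes> ((x [^] m \<otimes> k) \<otimes> x [^] n)" using cc pc by (simp add: m_assoc)
  also have "x [^] m \<otimes> k = (?c \<otimes> k) \<otimes> x [^] m" using com_swap[of "x [^] m" k] cc pc ccc by (simp add: m_assoc)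
  also have "h \<otimes> ((?c \<otimes> k) \<otimes> x [^] m \<otimes> x [^] n) = ?q \<otimes> (x [^] m \<otimes> x [^] n)"
   using cc pc[of m] pc[of n] ccc by (simp add: m_assoc)
  also have "x [^] m \<otimes> x [^] n = x [^] (m + n)" using x by (simp add: int_pow_mult)
  finally have 1: "(h \<otimes> x [^] m) \<otimes> (k \<otimes> x [^] n) = ?q \<otimes> x [^] (m + n)" .
  have "F (?c \<otimes> k) = of_int m * B x k + F k" using mult[OF cH hk(2)] Ff(1)[OF c2] B_lcs_2[OF c2 cc(2)] B_pow[OF x cc(2), of m] by (simp add: B_def)
  moreover have "B h (?c \<otimes> k) = B h k" using B_mult_right[OF ccc cc(2,1)] B_lcs_2'[OF c2 cc(1)] by simp
  ultimately have 2: "F ?q = F h + F k + of_int m * B x k + B h k / 2" using mult[of h "?c \<otimes> k"] hk cH by simp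
  have "B ?q x = B h x + B k x" using B_mult_left[of h "?c \<otimes> k" x] B_mult_left[of ?c k x] B_lcs_2[OF c2 x] cc ccc x by simp
  thus ?thesis using 1 2 hk cH by blast
 qed
 have HH': "H \<subseteq> H'"
 proof
  fix h assume "h \<in> H"
  thus "h \<in> H'" unfolding H'_def using Hc by (intro CollectI exI[of _ h] exI[of _ "0::int"]) simp
 qed
 have "subgroup H' G"
 proof (rule subgroupI)
  show "H' \<subseteq> carrier G" unfolding H'_def using Hc x by auto
  show "H' \<noteq> {}" using HH' H.one_closed by blast
  fix a assume "a \<in> H'"
  then obtain h m where a: "a = h \<otimes> x [^] (m::int)" "h \<in> H" unfolding H'_def by auto
  have "inv a = x [^] (-m) \<otimes> inv h" using a Hc x by (simp add: inv_mult_group int_pow_neg)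
  also have "\<dots> = (\<one> \<otimes> x [^] (-m)) \<otimes> (inv h \<otimes> x [^] (0::int))" using a Hc x by simp
  finally show "inv a \<in> H'" using prod[of \<one> "inv h" "-m" 0] a unfolding H'_def by auto
  fix b assume "b \<in> H'"
  then obtain k n where b: "b = k \<otimes> x [^] (n::int)" "k \<in> H" unfolding H'_def by auto
  show "a \<otimes> b \<in> H'" using prod[OF a(2) b(2), of m n] a b unfolding H'_def by auto
 qed
 moreover have "F' (a \<otimes> b) = F' a + F' b + B a b / 2" if ab: "a \<in> H'" "b \<in> H'" for a b
 proof -
  obtain h m where a: "a = h \<otimes> x [^] (m::int)" "h \<in> H" using ab unfolding H'_def by auto
  obtain k n where b: "b = k \<otimes> x [^] (n::int)" "k \<in> H" using ab unfolding H'_def by auto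
  note cc = a(2)[THEN Hc] b(2)[THEN Hc]
  have pc: "x [^] i \<in> carrier G" for i :: int using x by simp
  obtain q where q: "q \<in> H" "a \<otimes> b = q \<otimes> x [^] (m + n)" "F q = F h + F k + of_int m * B x k + B h k / 2" "B q x = B h x + B k x"
   using prod[OF a(2) b(2), of m n] a(1) b(1) by auto
  have s: "B k x = - B x k" "B x h = - B h x" by (rule B_swap[OF x cc(2)], rule B_swap[OF cc(1) x])
  have p: "B h (x [^] n) = of_int n * B h x" unfolding B_swap[OF pc cc(1), of n] B_pow[OF x cc(1), of n] s(2) by (simp only: mult_minus_right minus_minus)
  have "B (x [^] m) (x [^] n) = 0" unfolding B_pow[OF x pc, of m n] B_swap[OF pc x, of n] B_pow[OF x x, of n] B_self[OF x] by (simp only: mult_zero_right minus_zero)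
  hence Bab: "B a b = B h k + of_int n * B h x + of_int m * B x k"
   using a b cc x pc p B_mult_left[of h "x [^] m" "k \<otimes> x [^] n"] B_mult_right[of k "x [^] n" h] B_mult_right[of k "x [^] n" "x [^] m"] B_pow[OF x cc(2), of m]
   by simp
  have F'': "F' (a \<otimes> b) = val q (m + n)" "F' a = val h m" "F' b = val k n"
   using F'[OF q(1), of "m + n"] F'[OF a(2), of m] F'[OF b(2), of n] q(2) a(1) b(1) by simp_all
  show ?thesis unfolding F'' Bab val_def q(3,4) s(1) by (simp add: field_simps)
 qed
 moreover have "F' c = f c" if "c \<in> lcs G 2" for c using F'[OF Ff(2)[OF that], of 0] Ff[OF that] Hc[OF Ff(2)[OF that]] by (simp add: val_def)
 moreover have "x \<in> H'" unfolding H'_def using x by (intro CollectI exI[of _ \<one>] exI[of _ "1::int"]) simp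
 moreover have "lcs G 2 \<subseteq> H'" using Ff HH' by auto
 ultimately show ?thesis using HH' unfolding extends_to_def by blast
qed

lemma exists_quadratic_extension:
 assumes "finite S" "S \<subseteq> carrier G" "generate G S = carrier G"
 shows "\<exists>F. \<forall>x\<in>carrier G. \<forall>y\<in>carrier G. F (x \<otimes> y) = F x + F y + B x y / 2"
proof -
 have "\<exists>H F. extends_to H F \<and> T \<subseteq> H" if "finite T" "T \<subseteq> carrier G" for T using that
 proof (induction T rule: finite_induct)
  case empty
  thus ?case using extends_to_lcs_2 by blast
 next
  case (insert x T)
  then obtain H F where "extends_to H F" "T \<subseteq> H" by auto
  with extends_to_insert[of H F x] insert show ?case by (metis insert_subset order_trans)
 qed
 from this[OF assms(1,2)] obtain H F where HF: "extends_to H F" "S \<subseteq> H" by auto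
 hence "carrier G \<subseteq> H" using generate_subgroup_incl[of S H] assms(3) unfolding extends_to_def by auto
 thus ?thesis using HF unfolding extends_to_def by blast
qed

end

section \<open>The dual of the cup product\<close>

lemma cochains_simps:
 "carrier (cochains1 G) = carrier G \<rightarrow>\<^sub>E UNIV"
 "f \<oplus>\<^bsub>cochains1 G\<^esub> g = restrict (\<lambda>v. f v + g v) (carrier G)"
 "c \<odot>\<^bsub>cochains1 G\<^esub> f = restrict (\<lambda>v. c * f v) (carrier G)"
 "\<zero>\<^bsub>cochains1 G\<^esub> = restrict (\<lambda>v. 0) (carrier G)"
 "carrier (cochains2 G) = carrier G \<times> carrier G \<rightarrow>\<^sub>E UNIV"
 "k \<oplus>\<^bsub>cochains2 G\<^esub> l = restrict (\<lambda>v. k v + l v) (carrier G \<times> carrier G)"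
 "c \<odot>\<^bsub>cochains2 G\<^esub> k = restrict (\<lambda>v. c * k v) (carrier G \<times> carrier G)"
 "\<zero>\<^bsub>cochains2 G\<^esub> = restrict (\<lambda>v. 0) (carrier G \<times> carrier G)"
 by (simp_all add: cochains1_def cochains2_def ring.func_space_def[OF class_ring.ring_axioms])

lemma cochains_cvs: "cvs (cochains1 G)" "cvs (cochains2 G)" unfolding cochains1_def cochains2_def vectorspace_def
 using class_cring.func_space_is_module class_field by blast+

section \<open>Cocycles, cup products and chains of commutators\<close>

context group
begin

abbreviation "cocycle_space \<equiv> (cochains2 G)\<lparr>carrier := cocycles2 G\<rparr>"

lemma cocycles2_subsp: "subsp (cocycles2 G) (cochains2 G)"
 by (rule subspI[OF cochains_cvs(2)]) (auto simp: cocycles2_def cochains_simps distrib_left[symmetric] right_diff_distrib[symmetric] simp del: distrib_left_numeral, auto simp: algebra_simps)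

lemma coboundary1_apply: "x \<in> \<G> ==> y \<in> \<G> ==> coboundary1 G a (x, y) = a y - a (x \<otimes> y) + a x" by (simp add: coboundary1_def)

lemma coboundaries2_subsp: "subsp (coboundaries2 G) cocycle_space"
proof (rule subspI[OF subsp_cvs[OF cocycles2_subsp]])
 show "coboundaries2 G \<subseteq> carrier cocycle_space" by (auto simp: coboundaries2_def cocycles2_def cochains_simps coboundary1_apply m_assoc coboundary1_def)
 have "coboundary1 G (restrict (\<lambda>v. 0) (\<G>)) = restrict (\<lambda>v. 0) (\<G> \<times> \<G>)" by (rule ext) (auto simp: coboundary1_def)
 thus "\<zero>\<^bsub>cocycle_space\<^esub> \<in> coboundaries2 G" unfolding coboundaries2_def by (simp add: cochains_simps) (metis UNIV_I image_eqI restrict_PiE_iff)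
 fix x y assume "x \<in> coboundaries2 G" "y \<in> coboundaries2 G"
 then obtain a b where ab: "x = coboundary1 G a" "y = coboundary1 G b" by (auto simp: coboundaries2_def)
 have "x \<oplus>\<^bsub>cocycle_space\<^esub> y = coboundary1 G (restrict (\<lambda>v. a v + b v) (\<G>))" by (rule ext) (auto simp: ab cochains_simps coboundary1_def)
 thus "x \<oplus>\<^bsub>cocycle_space\<^esub> y \<in> coboundaries2 G" unfolding coboundaries2_def by (auto simp: cochains_simps intro!: imageI)
next
 fix c x assume "x \<in> coboundaries2 G"
 then obtain a where ab: "x = coboundary1 G a" by (auto simp: coboundaries2_def)
 have "c \<odot>\<^bsub>cocycle_space\<^esub> x = coboundary1 G (restrict (\<lambda>v. c * a v) (\<G>))"
  by (rule ext) (auto simp: ab cochains_simps coboundary1_def algebra_simps)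
 thus "c \<odot>\<^bsub>cocycle_space\<^esub> x \<in> coboundaries2 G" unfolding coboundaries2_def by (auto simp: cochains_simps intro!: imageI)
qed

definition H2_class :: "('a \<times> 'a => complex) => ('a \<times> 'a => complex) set" where
 "H2_class c = coboundaries2 G +>\<^bsub>cochains2 G\<^esub> c"

lemma H2_class_eq: "H2_class c = coboundaries2 G +>\<^bsub>cocycle_space\<^esub> c" by (simp add: H2_class_def a_r_coset_def')

lemma H2_class_lin_hom: "H2_class \<in> lin_hom cocycle_space (H2 G)" unfolding H2_def H2_class_eq[abs_def] by (rule coset_lin_hom[OF coboundaries2_subsp])

definition cup_cochain :: "('a => complex) => ('a => complex) => 'a \<times> 'a => complex" where
 "cup_cochain a b = restrict (\<lambda>(x, y). a x * b y) (\<G> \<times> \<G>)"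

lemma cup_eq: "cup G a b = H2_class (cup_cochain a b)" by (simp add: cup_def H2_class_def cup_cochain_def)

lemma cocycles1_additive: "a \<in> cocycles1 G ==> additive_map a" unfolding cocycles1_def additive_map_def by (auto simp: coboundary1_apply algebra_simps)

lemma additive_cocycles1: "additive_map a ==> restrict a (\<G>) \<in> cocycles1 G"
 unfolding cocycles1_def additive_map_def by (auto simp: coboundary1_apply cochains_simps)

lemma cup_cochain_cocycle: "additive_map a ==> additive_map b ==> cup_cochain a b \<in> cocycles2 G"
 unfolding cocycles2_def cup_cochain_def additive_map_def by (auto simp: cochains_simps algebra_simps)

definition rep :: "('a \<Rightarrow>\<^sub>0 complex) set => ('a \<Rightarrow>\<^sub>0 complex)" where
 "rep X = (SOME u. u over \<G> \<and> X = H1_class u)"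

lemma rep: "X \<in> carrier (H1 G) ==> (rep X) over \<G>" "X \<in> carrier (H1 G) ==> H1_class (rep X) = X"
proof -
 assume "X \<in> carrier (H1 G)"
 hence "\<exists>u. u over \<G> \<and> X = H1_class u" by (metis H1_cases)
 from someI_ex[OF this] show "(rep X) over \<G>" "H1_class (rep X) = X" unfolding rep_def by auto
qed

text \<open>Formal sums of pairs of homology classes are evaluated on chosen representing chains.
  With commutators this gives \<open>wedge_com\<close>, with \<open>com_chain\<close> a chain of the
  bar complex whose boundary is \<open>wedge_com\<close>.\<close>

definition bilinear_sum :: "(('a \<Rightarrow>\<^sub>0 complex) => ('a \<Rightarrow>\<^sub>0 complex) => ('s \<Rightarrow>\<^sub>0 complex)) =>
  (('a \<Rightarrow>\<^sub>0 complex) set \<times> ('a \<Rightarrow>\<^sub>0 complex) set \<Rightarrow>\<^sub>0 complex) => ('s \<Rightarrow>\<^sub>0 complex)" where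
 "bilinear_sum m = linear_extension (free_module UNIV) (\<lambda>(X, Y). m (rep X) (rep Y))"

lemma bilinear_sum_simps:
 "bilinear_sum m 0 = 0" "bilinear_sum m (single (X, Y) c) = scl c (m (rep X) (rep Y))"
 "bilinear_sum m (p + q) = bilinear_sum m p + bilinear_sum m q" unfolding bilinear_sum_def
 using lin_ext_zero[OF free_cvs, of UNIV "\<lambda>(X, Y). m (rep X) (rep Y)" UNIV]
  lin_ext_single[OF free_cvs, of UNIV "\<lambda>(X, Y). m (rep X) (rep Y)" UNIV "(X, Y)" c]
  lin_ext_add[OF free_cvs, of UNIV "\<lambda>(X, Y). m (rep X) (rep Y)" UNIV p q]
 by simp_all

abbreviation "H1_pairs \<equiv> carrier (H1 G) \<times> carrier (H1 G)"

definition wedge_com where "wedge_com = bilinear_sum (bilinear (com))"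

lemmas wedge_com_simps = bilinear_sum_simps[of "bilinear (com)", folded wedge_com_def]

lemma keys_commutator_2: "u over \<G> ==> v over \<G> ==> (bilinear (com) u v) over lcs G 2" using keys_com[of u 1 v 1] by (simp add: numeral_2_eq_2)

lemma wedge_com_keys: "p over H1_pairs ==> (wedge_com p) over lcs G 2"
proof (induction p rule: pm_induct)
 case (single XY c)
 obtain X Y where XY: "XY = (X, Y)" by fastforce
 hence "(bilinear (com) (rep X) (rep Y)) over lcs G 2" using single rep by (intro keys_commutator_2) auto
 thus ?case using XY order_trans[OF keys_scl] by (simp add: wedge_com_simps)
qed (simp_all add: wedge_com_simps over_add)

abbreviation "lift_gr \<equiv> free_lie_lift (gr G) (H1_to_gr G)"

lemmas lift_gr_alg_hom = free_lie_lift(2)[OF gr_lie_algebra H1_to_gr_lin_hom H1_cvs]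
lemmas lift_gr_gen = free_lie_lift_gen[OF gr_lie_algebra H1_to_gr_lin_hom H1_cvs]
lemmas free_lie_H1 = algD[OF free_lie_algebra[OF H1_cvs]]

lemma gen_bracket_closed: "XY \<in> H1_pairs ==>
  (\<lambda>(X, Y). free_lie_gen (H1 G) X \<otimes>\<^bsub>free_lie (H1 G)\<^esub> free_lie_gen (H1 G) Y) XY \<in> carrier (free_lie (H1 G))"
 using lin_homD(1)[OF free_lie_gen_lin_hom[OF H1_cvs]] free_lie_H1(2) by auto

lemma wedge_to_free_lie_lin_hom: "wedge_to_free_lie G \<in> lin_hom (free_module H1_pairs) (free_lie (H1 G))"
 unfolding wedge_to_free_lie_def by (rule lin_ext_lin_hom[OF free_lie_H1(1) gen_bracket_closed])

lemma wedge_to_free_lie_single: "X \<in> carrier (H1 G) ==> Y \<in> carrier (H1 G) ==>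
  wedge_to_free_lie G (single (X, Y) c) =
   c \<odot>\<^bsub>free_lie (H1 G)\<^esub> (free_lie_gen (H1 G) X \<otimes>\<^bsub>free_lie (H1 G)\<^esub> free_lie_gen (H1 G) Y)"
 unfolding wedge_to_free_lie_def using lin_ext_single[OF free_lie_H1(1) gen_bracket_closed, of H1_pairs "\<lambda>x. x" "(X, Y)" c] by simp

text \<open>Both sides are linear in \<open>p\<close>, and on a single pair both are the bracket of
  two classes of degree 1. This turns statements about the quadratic part of the free Lie algebra
  into statements about chains on Gamma_2.\<close>

lemma lift_wedge:
 assumes "p over H1_pairs"
 shows "lift_gr (wedge_to_free_lie G p) = elt 2 (wedge_com p)"
proof -
 note A = alg_homD[OF lift_gr_alg_hom]
 note g = lin_homD(1)[OF free_lie_gen_lin_hom[OF H1_cvs]]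
 have "(\<lambda>p. lift_gr (wedge_to_free_lie G p)) p = (\<lambda>p. elt 2 (wedge_com p)) p"
 proof (rule lin_hom_eq_on_free_module[OF _ _ gr_cvs _ assms])
  show "(\<lambda>p. lift_gr (wedge_to_free_lie G p)) \<in> lin_hom (free_module H1_pairs) (gr G)" by (rule lin_hom_comp[OF wedge_to_free_lie_lin_hom A(1)])
  have scl: "wedge_com (scl c p) = scl c (wedge_com p)" for c p unfolding wedge_com_def bilinear_sum_def
   using lin_ext_scl[OF free_cvs, of UNIV "\<lambda>(X, Y). bilinear (com) (rep X) (rep Y)" UNIV p c] by simp
  have "wedge_com \<in> lin_hom (free_module H1_pairs) (free_module (lcs G 2))" by (rule lin_homI) (simp_all add: wedge_com_keys wedge_com_simps scl)
  from lin_hom_comp[OF this gr_elem_lin_hom]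
  show "(\<lambda>p. elt 2 (wedge_com p)) \<in> lin_hom (free_module H1_pairs) (gr G)" .
  fix XY assume "XY \<in> H1_pairs"
  then obtain X Y where XY: "XY = (X, Y)" "X \<in> carrier (H1 G)" "Y \<in> carrier (H1 G)" by auto
  have "lift_gr (wedge_to_free_lie G (single XY 1)) = H1_to_gr G X \<otimes>\<^sub>g H1_to_gr G Y"
   using XY g free_lie_H1(1,2) by (simp add: wedge_to_free_lie_single A(2) lift_gr_gen)
  also have "\<dots> = elt 1 (rep X) \<otimes>\<^sub>g elt 1 (rep Y)"
   using H1_to_gr_class[OF rep(1)[OF XY(2)]] H1_to_gr_class[OF rep(1)[OF XY(3)]] XY by (simp add: rep(2))
  also have "\<dots> = elt 2 (bilinear (com) (rep X) (rep Y))" using gr_elem_mult[of "rep X" 1 "rep Y" 1] rep(1) XY by (simp add: numeral_2_eq_2)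
  finally show "lift_gr (wedge_to_free_lie G (single XY 1)) = elt 2 (wedge_com (single XY 1))" using XY by (simp add: wedge_com_simps)
 qed
 thus ?thesis by simp
qed

lemma wedge_pairing_simps:
 "wedge_pairing a b 0 = 0" "wedge_pairing a b (p + q) = wedge_pairing a b p + wedge_pairing a b q"
 "wedge_pairing a b (single (X, Y) c) = c * (kronecker a X * kronecker b Y - kronecker a Y * kronecker b X)"
proof -
 have e: "wedge_pairing a b = pairing (\<lambda>(X, Y). kronecker a X * kronecker b Y - kronecker a Y * kronecker b X)"
  by (rule ext) (auto simp: wedge_pairing_def pairing_def intro!: sum.cong)
 show "wedge_pairing a b 0 = 0" "wedge_pairing a b (p + q) = wedge_pairing a b p + wedge_pairing a b q"
  "wedge_pairing a b (single (X, Y) c) = c * (kronecker a X * kronecker b Y - kronecker a Y * kronecker b X)" unfolding e by (simp_all add: pairing_add)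
qed

lemma kronecker_rep: "additive_map a ==> X \<in> carrier (H1 G) ==> kronecker a X = pairing a (rep X)" using kronecker_class[of a "rep X"] rep by simp

text \<open>A functional \<open>f\<close> on \<open>\<Gamma>\<^sub>2/\<Gamma>\<^sub>3\<close> separates the class from \<open>0\<close>; writing \<open>f[x, y] = \<Sum> a\<^sub>t(x) b\<^sub>t(y)\<close>, the
 quadratic extension of \<open>f\<close> shows that \<open>\<Sum> a\<^sub>t \<union> b\<^sub>t\<close> is a coboundary.\<close>

lemma dual_cup_image_kernel:
 assumes fg: "finite S" "S \<subseteq> \<G>" "generate G S = \<G>"
  and p: "p over H1_pairs" and \<phi>: "\<phi> \<in> dual (H2 G)"
  and eq: "\<And>a b. a \<in> cocycles1 G ==> b \<in> cocycles1 G ==> wedge_pairing a b p = \<phi> (cup G a b)"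
 shows "cls 2 (wedge_com p) = zgr 2"
proof (rule ccontr)
 let ?z = "wedge_com p"
 assume nz: "cls 2 ?z \<noteq> zgr 2"
 have "subsp {(zgr 2)} (gr_comp G 2)" by (rule subspI) (auto simp: cvs_zero[OF gr_comp_cvs] cvs_smult_zero[OF gr_comp_cvs])
 from lin_vimage[OF gr_class_lin_hom free_cvs this]
 have N: "subsp {u. u over lcs G 2 \<and> cls 2 u = zgr 2} (free_module (lcs G 2))" by simp
 obtain g where g: "\<And>u v. g (u + v) = g u + g v" "\<And>c u. g (scl c u) = c * g u"
  "\<And>u. u over lcs G 2 ==> cls 2 u = zgr 2 ==> g u = 0" "g ?z = (1::complex)" using separating_functional[OF N, of ?z] nz by blast
 define f where "f x = g (single x 1)" for x
 have g_pairing: "g u = pairing f u" for u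
 proof -
  have "u over UNIV" by simp
  thus ?thesis
  proof (induction u rule: pm_induct)
   case zero
   show ?case using g(2)[of 0 0] by simp
  next
   case (single x c)
   show ?case using g(2)[of c "single x 1"] by (simp add: f_def)
  qed (simp add: g(1) pairing_add)
 qed
 interpret Q: quadratic_extension G f
 proof unfold_locales
  fix x y assume xy: "x \<in> lcs G 2" "y \<in> lcs G 2"
  have "(single (x \<otimes> y) 1 - single x 1 - single y (1::complex)) over lcs G 2" using xy lcs_mult by (intro over_diff) auto
  hence "pairing f (single (x \<otimes> y) 1 - single x 1 - single y 1) = 0" using g(3) gr_class_mult[OF xy] g_pairing by metis
  thus "f (x \<otimes> y) = f x + f y" by (simp add: pairing_diff diff_eq_eq add.commute)
 next
  fix x assume x: "x \<in> lcs G 3"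
  hence "x \<in> lcs G (Suc 2)" by (simp add: numeral_3_eq_3 numeral_2_eq_2)
  hence "cls 2 (single x 1) = zgr 2" "x \<in> lcs G 2" using gr_class_single_zero lcs_Suc_subset by blast+
  thus "f x = 0" unfolding f_def using g(3) by simp
 qed
 obtain F where F: "\<And>x y. x \<in> \<G> ==> y \<in> \<G> ==> F (x \<otimes> y) = F x + F y + Q.B x y / 2"
 proof -
  from Q.exists_quadratic_extension[OF fg] obtain F where
   "\<forall>x\<in>\<G>. \<forall>y\<in>\<G>. F (x \<otimes> y) = F x + F y + Q.B x y / 2" by auto
  with that[of F] show thesis by simp
 qed
 obtain T a where T: "finite T" "T \<subseteq> \<G>" "\<And>t. t \<in> T ==> additive_map (a t)"
  "\<And>b g. additive_map b ==> g \<in> \<G> ==> b g = (\<Sum>t\<in>T. a t g * b t)"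
 proof -
  from dual_basis[OF fg] obtain T a where "finite T \<and> T \<subseteq> \<G> \<and> (\<forall>t\<in>T. additive_map (a t)) \<and>
   (\<forall>b g. additive_map b \<longrightarrow> g \<in> \<G> \<longrightarrow> b g = (\<Sum>t\<in>T. a t g * b t)) \<and>
   (\<forall>g\<in>\<G>. \<exists>w. w over T \<and> single g 1 - w \<in> boundaries1 G)"
   by (elim exE)
  thus thesis by (intro that[of T a]) blast+
 qed
 have Badd: "additive_map (\<lambda>y. Q.B t y)" if "t \<in> \<G>" for t unfolding additive_map_def using Q.B_mult_right that by simp
 have Badd': "additive_map (\<lambda>x. Q.B x y)" if "y \<in> \<G>" for y unfolding additive_map_def using Q.B_mult_left that by simp
 \<comment> \<open>The dual basis splits the form \<open>B\<close> into a sum of products of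
   homomorphisms, that is, of cup products.\<close>
 have Bsum: "Q.B x y = (\<Sum>t\<in>T. a t x * Q.B t y)" if "x \<in> \<G>" "y \<in> \<G>" for x y using T(4)[OF Badd'[OF that(2)] that(1)] .
 define a' where "a' t = restrict (a t) (\<G>)" for t
 define b' where "b' t = restrict (Q.B t) (\<G>)" for t
 have co: "a' t \<in> cocycles1 G" "b' t \<in> cocycles1 G" if "t \<in> T" for t unfolding a'_def b'_def using additive_cocycles1 T(3) Badd that T(2) by auto
 note ad = co[THEN cocycles1_additive]
 \<comment> \<open>The wedge pairing antisymmetrises while \<open>B\<close> is already alternating,
   whence the factor 2.\<close>
 have "(\<Sum>t\<in>T. wedge_pairing (a' t) (b' t) p) = 2 * pairing f ?z" using p
 proof (induction p rule: pm_induct)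
  case zero
  show ?case by (simp add: wedge_pairing_simps wedge_com_simps)
 next
  case (single XY c)
  then obtain X Y where XY: "XY = (X, Y)" "X \<in> carrier (H1 G)" "Y \<in> carrier (H1 G)" by auto
  let ?u = "rep X" and ?v = "rep Y"
  have half: "(\<Sum>t\<in>T. pairing (a' t) u * pairing (b' t) v) = (\<Sum>x\<in>keys u. \<Sum>y\<in>keys v. lookup u x * lookup v y * Q.B x y)"
   if uv: "u over \<G>" "v over \<G>" for u v
  proof -
   have "(\<Sum>t\<in>T. pairing (a' t) u * pairing (b' t) v) =
    (\<Sum>t\<in>T. \<Sum>x\<in>keys u. \<Sum>y\<in>keys v. lookup u x * lookup v y * (a t x * Q.B t y))"
    unfolding pairing_def sum_product using uv by (intro sum.cong refl) (auto simp: a'_def b'_def subset_iff mult_ac)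
   also have "\<dots> = (\<Sum>x\<in>keys u. \<Sum>t\<in>T. \<Sum>y\<in>keys v. lookup u x * lookup v y * (a t x * Q.B t y))" by (rule sum.swap)
   also have "\<dots> = (\<Sum>x\<in>keys u. \<Sum>y\<in>keys v. \<Sum>t\<in>T. lookup u x * lookup v y * (a t x * Q.B t y))" by (intro sum.cong refl sum.swap)
   also have "\<dots> = (\<Sum>x\<in>keys u. \<Sum>y\<in>keys v. lookup u x * lookup v y * Q.B x y)"
    using uv by (intro sum.cong refl) (auto simp: sum_distrib_left[symmetric] Bsum[symmetric] subset_iff)
   finally show ?thesis .
  qed
  have "(\<Sum>t\<in>T. pairing (a' t) ?v * pairing (b' t) ?u) = (\<Sum>y\<in>keys ?v. \<Sum>x\<in>keys ?u. lookup ?v y * lookup ?u x * Q.B y x)"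
   using half rep XY by simp
  also have "\<dots> = (\<Sum>x\<in>keys ?u. \<Sum>y\<in>keys ?v. lookup ?v y * lookup ?u x * Q.B y x)" by (rule sum.swap)
  also have "\<dots> = - (\<Sum>x\<in>keys ?u. \<Sum>y\<in>keys ?v. lookup ?u x * lookup ?v y * Q.B x y)"
   unfolding sum_negf[symmetric] using rep(1)[OF XY(2)] rep(1)[OF XY(3)]
  proof (intro sum.cong refl)
   fix x y assume "x \<in> keys ?u" "y \<in> keys ?v"
   hence "Q.B y x = - Q.B x y" using rep(1)[OF XY(2)] rep(1)[OF XY(3)] by (intro Q.B_swap) auto
   thus "lookup ?v y * lookup ?u x * Q.B y x = - (lookup ?u x * lookup ?v y * Q.B x y)" by simp
  qed
  finally have h2: "(\<Sum>t\<in>T. pairing (a' t) ?v * pairing (b' t) ?u) = \<dots>" .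
  have "(\<Sum>t\<in>T. wedge_pairing (a' t) (b' t) (single XY c)) =
   (\<Sum>t\<in>T. c * (pairing (a' t) ?u * pairing (b' t) ?v - pairing (a' t) ?v * pairing (b' t) ?u))"
   using XY ad by (intro sum.cong refl) (simp add: wedge_pairing_simps kronecker_rep)
  also have "\<dots> = c * ((\<Sum>t\<in>T. pairing (a' t) ?u * pairing (b' t) ?v) - (\<Sum>t\<in>T. pairing (a' t) ?v * pairing (b' t) ?u))"
   unfolding sum_subtractf[symmetric] sum_distrib_left ..
  also have "\<dots> = 2 * pairing f (wedge_com (single XY c))" unfolding h2 using half[OF rep(1)[OF XY(2)] rep(1)[OF XY(3)]] XY
   by (simp add: wedge_com_simps pairing_scl pairing_bilinear Q.B_def)
  finally show ?case .
 next
  case (add p q)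
  thus ?case by (simp add: wedge_pairing_simps wedge_com_simps sum.distrib pairing_add algebra_simps)
 qed
 moreover have "(\<Sum>t\<in>T. wedge_pairing (a' t) (b' t) p) = 0"
 proof -
  have psi: "(\<lambda>c. \<phi> (H2_class c)) \<in> lin_hom cocycle_space complex_space" by (rule lin_hom_comp[OF H2_class_lin_hom \<phi>[unfolded dual_iff]])
  note P = lin_homD[OF psi]
  have part: "(\<Sum>t\<in>T'. \<phi> (cup G (a' t) (b' t))) = \<phi> (H2_class (restrict (\<lambda>v. \<Sum>t\<in>T'. cup_cochain (a' t) (b' t) v) (\<G> \<times> \<G>))) \<and>
   restrict (\<lambda>v. \<Sum>t\<in>T'. cup_cochain (a' t) (b' t) v) (\<G> \<times> \<G>) \<in> cocycles2 G" if "T' \<subseteq> T" for T'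
   using finite_subset[OF that T(1)] that
  proof (induction T' rule: finite_induct)
   case empty
   have "\<phi> (H2_class \<zero>\<^bsub>cocycle_space\<^esub>) = 0"
    using lin_hom_zero[OF psi subsp_cvs[OF cocycles2_subsp] complex_space_cvs] by (simp add: complex_space_def)
   thus ?case using subspD(2)[OF cocycles2_subsp] by (simp add: cochains_simps restrict_def)
  next
   case (insert t T')
   let ?r = "restrict (\<lambda>v. \<Sum>t\<in>T'. cup_cochain (a' t) (b' t) v) (\<G> \<times> \<G>)"
   have c1: "cup_cochain (a' t) (b' t) \<in> cocycles2 G" using insert ad by (intro cup_cochain_cocycle) auto
   have e: "restrict (\<lambda>v. \<Sum>t\<in>insert t T'. cup_cochain (a' t) (b' t) v) (\<G> \<times> \<G>) =
    cup_cochain (a' t) (b' t) \<oplus>\<^bsub>cocycle_space\<^esub> ?r"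
    using insert(1,2) by (auto simp: cochains_simps fun_eq_iff)
   have "T' \<subseteq> T" using insert(4) by simp
   note ih = insert(3)[OF this]
   note c2 = conjunct2[OF ih]
   have "\<phi> (H2_class (cup_cochain (a' t) (b' t) \<oplus>\<^bsub>cocycle_space\<^esub> ?r)) =
    \<phi> (H2_class (cup_cochain (a' t) (b' t))) + \<phi> (H2_class ?r)"
    using P(2)[of "cup_cochain (a' t) (b' t)" ?r] c1 c2 by (simp add: complex_space_def)
   moreover have "(\<Sum>t\<in>insert t T'. \<phi> (cup G (a' t) (b' t))) = \<phi> (H2_class (cup_cochain (a' t) (b' t))) + \<phi> (H2_class ?r)"
    unfolding sum.insert[OF insert(1,2)] conjunct1[OF ih] unfolding cup_eq ..
   moreover have "cup_cochain (a' t) (b' t) \<oplus>\<^bsub>cocycle_space\<^esub> ?r \<in> cocycles2 G"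
    using cvs_add[OF subsp_cvs[OF cocycles2_subsp], of "cup_cochain (a' t) (b' t)" ?r] c1 c2 by simp
   ultimately show ?case unfolding e by (intro conjI) (simp_all only:)
  qed
  let ?b = "restrict (\<lambda>v. \<Sum>t\<in>T. cup_cochain (a' t) (b' t) v) (\<G> \<times> \<G>)"
  \<comment> \<open>By the quadratic rule the coboundary of \<open>F\<close> is -B/2, so -2 F has
    coboundary \<open>B\<close>.\<close>
  have "?b = coboundary1 G (restrict (\<lambda>x. -2 * F x) (\<G>))"
  proof
   fix v show "?b v = coboundary1 G (restrict (\<lambda>x. -2 * F x) (\<G>)) v"
   proof (cases "v \<in> \<G> \<times> \<G>")
    case True
    then obtain x y where v: "v = (x, y)" "x \<in> \<G>" "y \<in> \<G>" by auto
    have "?b v = Q.B x y" using v Bsum[OF v(2,3)] by (simp add: cup_cochain_def a'_def b'_def)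
    thus ?thesis using v F[OF v(2,3)] by (simp add: coboundary1_apply)
   qed (simp add: coboundary1_def)
  qed
  hence "?b \<in> coboundaries2 G" unfolding coboundaries2_def by (simp add: cochains_simps)
  moreover have bc: "?b \<in> cocycles2 G" using part[OF order_refl] by simp
  ultimately have "H2_class ?b = \<zero>\<^bsub>H2 G\<^esub>" using coset_eq_zero_iff[OF coboundaries2_subsp, of ?b] by (simp add: H2_class_eq H2_def quot_simps)
  hence "\<phi> (H2_class ?b) = 0" using lin_hom_zero[OF \<phi>[unfolded dual_iff] _ complex_space_cvs] quot_cvs[OF coboundaries2_subsp]
   by (simp add: H2_def complex_space_def)
  thus ?thesis using part[OF order_refl] eq co by simp
 qed
 ultimately show False using g(4) g_pairing by simp
qed

section \<open>Two-chains of the bar complex\<close>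

definition bar_d :: "('a \<times> 'a \<Rightarrow>\<^sub>0 complex) => ('a \<Rightarrow>\<^sub>0 complex)" where
 "bar_d \<zeta> = pushforward fst \<zeta> + pushforward snd \<zeta> - pushforward (\<lambda>(x, y). x \<otimes> y) \<zeta>"

lemma bar_d_simps:
 "bar_d 0 = 0" "bar_d (single (x, y) c) = single x c + single y c - single (x \<otimes> y) c"
 "bar_d (\<zeta> + \<xi>) = bar_d \<zeta> + bar_d \<xi>" "bar_d (scl c \<zeta>) = scl c (bar_d \<zeta>)"
 "bar_d (\<zeta> - \<xi>) = bar_d \<zeta> - bar_d \<xi>" by (simp_all add: bar_d_def push_add push_scl push_diff scl_add scl_diff)

text \<open>The bar chain \<open>([x,y], yx) - (x,y) + (y,x)\<close> has boundary \<open>[x,y]\<close>.\<close>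

definition com_chain :: "('a \<Rightarrow>\<^sub>0 complex) => ('a \<Rightarrow>\<^sub>0 complex) => ('a \<times> 'a \<Rightarrow>\<^sub>0 complex)" where
 "com_chain u v = bilinear (\<lambda>x y. (com x y, y \<otimes> x)) u v - bilinear Pair u v + bilinear (\<lambda>x y. (y, x)) u v"

lemma com_chain_boundary:
 assumes "u over \<G>" "v over \<G>"
 shows "bar_d (com_chain u v) = bilinear (com) u v"
proof -
 have "bilinear (\<lambda>x y. com x y \<otimes> (y \<otimes> x)) u v = bilinear (\<lambda>x y. x \<otimes> y) u v" by (rule bilinear_cong) (use assms com_swap in auto)
 thus ?thesis by (simp add: bar_d_def com_chain_def push_add push_diff push_bilinear)
qed

lemma keys_commutator_chain: "u over \<G> ==> v over \<G> ==> (com_chain u v) over \<G> \<times> \<G>" unfolding com_chain_def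
 by (intro over_add over_diff keys_bilinear[of u "\<G>" v "\<G>"]) auto

text \<open>Homomorphisms vanish on commutators, so only the two chains of pairs contribute; they
  enter \<open>com_chain\<close> with the signs - and +, hence the minus.\<close>

lemma com_chain_pairing:
 assumes "additive_map a" "additive_map b" "u over \<G>" "v over \<G>"
 shows "pairing (\<lambda>(x, y). a x * b y) (com_chain u v) = - (pairing a u * pairing b v - pairing a v * pairing b u)"
proof -
 have "a (com x y) = 0" if "x \<in> keys u" "y \<in> keys v" for x y
  using additive_map_lcs_2[OF assms(1)] com_lcs[of x 1 y 1] that assms(3,4) by (auto simp: numeral_2_eq_2)
 hence "pairing (\<lambda>(x, y). a x * b y) (bilinear (\<lambda>x y. (com x y, y \<otimes> x)) u v) = pairing (\<lambda>_. 0) u * pairing (\<lambda>_. 0) v"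
  by (intro pairing_bilinear_prod) auto
 moreover have "pairing (\<lambda>(x, y). a x * b y) (bilinear Pair u v) = pairing a u * pairing b v" by (rule pairing_bilinear_prod) auto
 moreover have "pairing (\<lambda>(x, y). a x * b y) (bilinear (\<lambda>x y. (y, x)) u v) = pairing b u * pairing a v" by (rule pairing_bilinear_prod) auto
 moreover have "pairing (\<lambda>_. 0) u = 0" by (simp add: pairing_def)
 ultimately show ?thesis by (simp add: com_chain_def pairing_add pairing_diff)
qed

text \<open>Chains that no product of two homomorphisms detects; adding one to a filling does not
  change how cup products evaluate on it.\<close>

definition degenerate :: "('a \<times> 'a \<Rightarrow>\<^sub>0 complex) => bool" where
 "degenerate \<zeta> \<longleftrightarrow> \<zeta> over \<G> \<times> \<G> \<and>
  (\<forall>a b. additive_map a \<longrightarrow> additive_map b \<longrightarrow> pairing (\<lambda>(x, y). a x * b y) \<zeta> = 0)"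

text \<open>The relations of gr_2 come from pairs in Gamma_2 and from [c,y] with c in Gamma_2. The
  first are bounded by multiples of (x,y), the second by the commutator chain; homomorphisms vanish
  on Gamma_2, so both fillings are degenerate.\<close>

lemma degenerate_filling:
 assumes "u over lcs G 2" "cls 2 u = zgr 2"
 shows "\<exists>\<zeta>. degenerate \<zeta> \<and> bar_d \<zeta> = u"
proof -
 define M where "M = {u. u over lcs G 2 \<and> (\<exists>\<zeta>. degenerate \<zeta> \<and> bar_d \<zeta> = u)}"
 have d: "degenerate 0" "\<And>\<zeta> \<xi>. degenerate \<zeta> ==> degenerate \<xi> ==> degenerate (\<zeta> + \<xi>)" "\<And>c \<zeta>. degenerate \<zeta> ==> degenerate (scl c \<zeta>)"
  by (simp_all add: degenerate_def over_add pairing_add pairing_scl order_trans[OF keys_scl])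
 have M: "subsp M (free_module (lcs G 2))"
 proof (rule free_subspI)
  show "0 \<in> M" unfolding M_def using d(1) bar_d_simps(1) by auto
  show "u + v \<in> M" if "u \<in> M" "v \<in> M" for u v using that d(2) bar_d_simps(3) over_add unfolding M_def by blast
  show "scl c u \<in> M" if "u \<in> M" for c u using that d(3) bar_d_simps(4) order_trans[OF keys_scl] unfolding M_def by blast
 qed (simp add: M_def)
 note MD = free_subspD[OF M]
 note lc = lcs_mem
 have mult: "single (x \<otimes> y) 1 - single x 1 - single y 1 \<in> M" if xy: "x \<in> lcs G 2" "y \<in> lcs G 2" for x y
 proof -
  have "degenerate (single (x, y) (-1))" unfolding degenerate_def using xy lc additive_map_lcs_2 by (auto simp del: single_uminus)
  moreover have "bar_d (single (x, y) (-1)) = single (x \<otimes> y) 1 - single x 1 - single y 1" using bar_d_simps(2)[of x y "-1"] by (simp add: single_uminus)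
  moreover have "(single (x \<otimes> y) 1 - single x 1 - single y (1::complex)) over lcs G 2" using xy lcs_mult by (intro over_diff) auto
  ultimately show ?thesis unfolding M_def by blast
 qed
 have one: "single \<one> 1 \<in> M" using MD(6)[OF mult[OF lcs_one lcs_one]] by simp
 have com: "h \<in> lcs G 2 \<and> single h 1 \<in> M" if h: "h = com c y" "c \<in> lcs G 2" "y \<in> \<G>" for h c y
 proof -
  have k: "(single c (1::complex)) over \<G>" "(single y (1::complex)) over \<G>" using h lc by auto
  have h2: "h \<in> lcs G 2" unfolding h(1) using com_lcs[OF h(2), of y 1] h(3) lcs_Suc_subset[of 2] by auto
  have "degenerate (com_chain (single c 1) (single y 1))" unfolding degenerate_def
  proof (intro conjI allI impI keys_commutator_chain[OF k])
   fix a b :: "'a => complex"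
   assume ab: "additive_map a" "additive_map b"
   have "a c = 0" "b c = 0" using additive_map_lcs_2[OF ab(1) h(2)] additive_map_lcs_2[OF ab(2) h(2)] .
   thus "pairing (\<lambda>(x, y). a x * b y) (com_chain (single c 1) (single y 1)) = 0" using com_chain_pairing[OF ab k] by simp
  qed
  moreover have "bar_d (com_chain (single c 1) (single y 1)) = single h 1" using com_chain_boundary[OF k] h(1) by simp
  ultimately show ?thesis using h2 unfolding M_def by auto
 qed
 have "single e 1 \<in> M" if "e \<in> lcs G (Suc 2)" for e
 proof -
  have "e \<in> generate G {com x y | x y. x \<in> lcs G 2 \<and> y \<in> \<G>}" using that lcs_Suc[of 2] by simp
  hence "e \<in> lcs G 2 \<and> single e 1 \<in> M"
  proof (induction e rule: generate.induct)
   case one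
   thus ?case using \<open>single \<one> 1 \<in> M\<close> lcs_one by simp
  next
   case (incl h)
   thus ?case using com by blast
  next
   case (inv h)
   hence h2: "h \<in> lcs G 2" and hM: "single h 1 \<in> M" using com by blast+
   have "single (h \<otimes> inv h) 1 - single h 1 - single (inv h) 1 \<in> M" by (rule mult[OF h2 lcs_inv[OF h2]])
   hence i: "single \<one> 1 - single h 1 - single (inv h) 1 \<in> M" using lc[OF h2] by simp
   from MD(5)[OF MD(5)[OF \<open>single \<one> 1 \<in> M\<close> hM] i] have "single (inv h) 1 \<in> M" by simp
   thus ?case using lcs_inv[OF h2] by simp
  next
   case (eng x y)
   hence "single (x \<otimes> y) 1 - single x 1 - single y 1 \<in> M" using mult by blast
   from MD(3)[OF this MD(3)[of "single x 1" "single y 1"]] eng show ?case using lcs_mult by simp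
  qed
  thus ?thesis by simp
 qed
 from gr_class_kernel[OF M mult this assms] show ?thesis unfolding M_def by auto
qed

text \<open>The commutator chain of \<open>p\<close> has two fillings: \<open>Z\<close>, on which
  cup products evaluate to minus the wedge pairing, and the degenerate \<zeta>. Their difference is
  a cycle, and evaluation on it is the functional on H^2 from which \<open>p\<close> comes.\<close>

lemma kernel_in_dual_cup_image:
 assumes p: "p over H1_pairs" and z: "cls 2 (wedge_com p) = zgr 2"
 shows "wedge_to_free_lie G p \<in> dual_cup_image G"
proof -
 obtain \<zeta> where \<zeta>: "degenerate \<zeta>" "bar_d \<zeta> = wedge_com p" using degenerate_filling[OF wedge_com_keys[OF p] z] by auto
 define Z where "Z = bilinear_sum com_chain p"
 note s = bilinear_sum_simps[of com_chain]
 have Z: "Z over \<G> \<times> \<G> \<and> bar_d Z = wedge_com p \<and>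
  (\<forall>a b. additive_map a \<longrightarrow> additive_map b \<longrightarrow> pairing (\<lambda>(x, y). a x * b y) Z = - wedge_pairing a b p)"
  unfolding Z_def using p
 proof (induction p rule: pm_induct)
  case zero
  show ?case by (simp add: s bar_d_simps wedge_com_simps wedge_pairing_simps)
 next
  case (single XY c)
  then obtain X Y where XY: "XY = (X, Y)" "X \<in> carrier (H1 G)" "Y \<in> carrier (H1 G)" by auto
  note r = rep(1)[OF XY(2)] rep(1)[OF XY(3)]
  show ?case using XY order_trans[OF keys_scl keys_commutator_chain[OF r]] com_chain_boundary[OF r] com_chain_pairing[OF _ _ r]
   by (simp add: s bar_d_simps wedge_com_simps wedge_pairing_simps pairing_scl kronecker_rep right_diff_distrib)
 next
  case (add p q)
  thus ?case by (simp add: s bar_d_simps wedge_com_simps wedge_pairing_simps pairing_add over_add)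
 qed
 define W where "W = \<zeta> - Z"
 have W: "W over \<G> \<times> \<G>" "bar_d W = 0"
 proof -
  show "W over \<G> \<times> \<G>" using Z \<zeta>(1) unfolding W_def degenerate_def by (intro over_diff) simp_all
  show "bar_d W = 0" unfolding W_def using Z \<zeta>(2) by (simp add: bar_d_simps)
 qed
 have W': "pairing (\<lambda>(x, y). a x * b y) W = wedge_pairing a b p" if "additive_map a" "additive_map b" for a b
  unfolding W_def using Z \<zeta> that by (simp add: degenerate_def pairing_diff)
 \<comment> \<open>With this duality coboundaries vanish on the cycle \<open>W\<close>, so
   evaluation on \<open>W\<close> descends to H^2.\<close>
 have stokes: "pairing (coboundary1 G F) \<xi> = pairing F (bar_d \<xi>)" if "\<xi> over \<G> \<times> \<G>" for F \<xi> using that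
 proof (induction \<xi> rule: pm_induct)
  case (single xy c)
  then obtain x y where "xy = (x, y)" "x \<in> \<G>" "y \<in> \<G>" by auto
  thus ?case by (simp add: bar_d_simps coboundary1_apply pairing_add pairing_diff algebra_simps)
 qed (simp_all add: bar_d_simps pairing_add)
 have hom: "(\<lambda>c. pairing c W) \<in> lin_hom cocycle_space complex_space"
 proof (rule lin_homI)
  have "pairing (x \<oplus>\<^bsub>cocycle_space\<^esub> y) W = (\<Sum>v\<in>keys W. lookup W v * x v + lookup W v * y v)" for x y unfolding pairing_def
   by (rule sum.cong) (use W(1) in "auto simp: cochains_simps subset_iff distrib_left mult.commute")
  thus "pairing (x \<oplus>\<^bsub>cocycle_space\<^esub> y) W = pairing x W \<oplus>\<^bsub>complex_space\<^esub> pairing y W" for x y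
   by (simp add: sum.distrib pairing_def complex_space_def mult.commute)
  have "pairing (c \<odot>\<^bsub>cocycle_space\<^esub> x) W = (\<Sum>v\<in>keys W. c * (lookup W v * x v))" for c x unfolding pairing_def
   by (rule sum.cong) (use W(1) in "auto simp: cochains_simps subset_iff")
  thus "pairing (c \<odot>\<^bsub>cocycle_space\<^esub> x) W = c \<odot>\<^bsub>complex_space\<^esub> pairing x W" for c x
   by (simp add: sum_distrib_left pairing_def complex_space_def mult.commute)
 qed (simp add: complex_space_def)
 have zero: "pairing i W = \<zero>\<^bsub>complex_space\<^esub>" if "i \<in> coboundaries2 G" for i
  using that stokes[OF W(1)] W(2) by (auto simp: coboundaries2_def complex_space_def)
 define \<phi> where "\<phi> = induced (\<lambda>c. pairing c W)"
 have \<phi>: "\<phi> \<in> dual (H2 G)" "c \<in> cocycles2 G ==> \<phi> (H2_class c) = pairing c W" for c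
  using induced_lin_hom[OF hom coboundaries2_subsp complex_space_cvs zero] unfolding dual_iff \<phi>_def H2_def H2_class_eq by simp_all
 have "wedge_pairing a b p = \<phi> (cup G a b)" if "a \<in> cocycles1 G" "b \<in> cocycles1 G" for a b
 proof -
  note ab = that[THEN cocycles1_additive]
  have "pairing (cup_cochain a b) W = pairing (\<lambda>(x, y). a x * b y) W" by (rule pairing_cong) (use W(1) in "auto simp: cup_cochain_def")
  thus ?thesis using \<phi>(2)[OF cup_cochain_cocycle[OF ab]] W'[OF ab] by (simp add: cup_eq)
 qed
 thus ?thesis unfolding dual_cup_image_def using p \<phi>(1) by blast
qed

end

section \<open>The holonomy Lie algebra\<close>

lemma subsp_finsum:
 assumes "subsp N L" "\<And>i. i \<in> A ==> f i \<in> N"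
 shows "finsum L f A \<in> N"
proof -
 note D = subspD[OF assms(1)]
 interpret V: vectorspace class_ring L by (rule D(5))
 show ?thesis using assms(2)
 proof (induction A rule: infinite_finite_induct)
  case (insert a A)
  hence "finsum L f (insert a A) = f a \<oplus>\<^bsub>L\<^esub> finsum L f A" using D(1) by (intro V.M.finsum_insert) (auto simp: subset_iff)
  thus ?case using insert D(3) by simp
 qed (use D(2) in simp_all)
qed

lemma lie_iso_second_derived:
 fixes L (structure)
 assumes L: "algebra_on L" and M: "algebra_on M" and f: "f \<in> lie_iso L M"
  and x: "x \<in> carrier L" "f x \<in> second_derived_lie M"
 shows "x \<in> second_derived_lie L"
proof -
 have bij: "bij_betw f (carrier L) (carrier M)" and fh: "f \<in> alg_hom L M" using f unfolding lie_iso_def alg_hom_def by auto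
 define g where "g = inv_into (carrier L) f"
 note D = algD[OF L] and F = alg_homD[OF fh] and FL = lin_homD[OF alg_homD(1)[OF fh]]
 have gf: "g (f x) = x" if "x \<in> carrier L" for x unfolding g_def using bij that by (simp add: bij_betw_inv_into_left)
 have fg: "f (g y) = y" "g y \<in> carrier L" if "y \<in> carrier M" for y
  unfolding g_def using bij that by (auto simp: bij_betw_inv_into_right bij_betw_def inv_into_into)
 have g: "g \<in> lin_hom M L"
 proof (rule lin_homI)
  fix a assume a: "a \<in> carrier M"
  show "g a \<in> carrier L" using fg a by simp
  show "g (c \<odot>\<^bsub>M\<^esub> a) = c \<odot> g a" for c using gf[of "c \<odot> g a"] FL(3)[of "g a" c] fg[OF a] D(1) by simp
  fix b assume b: "b \<in> carrier M"
  show "g (a \<oplus>\<^bsub>M\<^esub> b) = g a \<oplus> g b" using gf[of "g a \<oplus> g b"] FL(2)[of "g a" "g b"] fg[OF a] fg[OF b] D(1) by simp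
 qed
 have "g (a \<otimes>\<^bsub>M\<^esub> b) = g a \<otimes> g b" if "a \<in> carrier M" "b \<in> carrier M" for a b
  using gf[of "g a \<otimes> g b"] F(2)[of "g a" "g b"] fg[OF that(1)] fg[OF that(2)] D(2) by simp
 hence "g \<in> alg_hom M L" using g unfolding alg_hom_def by auto
 from second_derived_hom[OF M L this] have "g (f x) \<in> second_derived_lie L" using x(2) by auto
 thus ?thesis using gf x(1) by simp
qed

lemma monomial_degree_pos: "monomial_degree s \<ge> 1" by (induction s) auto

section \<open>Monomials of degree k in H_1 as the common source of h and gr\<close>

context group
begin

definition holonomy_ideal where "holonomy_ideal = ideal_generated (free_lie (H1 G)) (dual_cup_image G)"

lemma dual_cup_image_carrier: "dual_cup_image G \<subseteq> carrier (free_lie (H1 G))"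
 unfolding dual_cup_image_def using lin_homD(1)[OF wedge_to_free_lie_lin_hom] by auto

lemma holonomy_ideal_ideal: "algebra_ideal (free_lie (H1 G)) holonomy_ideal" unfolding holonomy_ideal_def
 by (rule ideal_generated_ideal[OF free_lie_algebra[OF H1_cvs] dual_cup_image_carrier])

lemma holonomy_eq: "holonomy G = graded_quot (free_lie (H1 G)) holonomy_ideal" by (simp add: holonomy_def holonomy_ideal_def)

lemma holonomy_algebra: "algebra_on (holonomy G)" unfolding holonomy_eq by (rule graded_quot_algebra[OF free_lie_algebra[OF H1_cvs] holonomy_ideal_ideal])

definition holonomy_class where "holonomy_class y = holonomy_ideal +>\<^bsub>free_lie (H1 G)\<^esub> y"

lemma holonomy_class_alg_hom: "holonomy_class \<in> alg_hom (free_lie (H1 G)) (holonomy G)" unfolding holonomy_class_def[abs_def] holonomy_eq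
 by (rule graded_coset_alg_hom[OF free_lie_algebra[OF H1_cvs] holonomy_ideal_ideal])

lemma holonomy_class_eq_zero: "y \<in> carrier (free_lie (H1 G)) ==> holonomy_class y = \<zero>\<^bsub>holonomy G\<^esub> \<longleftrightarrow> y \<in> holonomy_ideal"
 unfolding holonomy_class_def holonomy_eq graded_quot_simps by (rule coset_eq_zero_iff[OF algebra_idealD(1)[OF holonomy_ideal_ideal]])

abbreviation "H1_monomials k \<equiv> {t. set_monomial t \<subseteq> carrier (H1 G) \<and> monomial_degree t = k}"
abbreviation "holonomy_pres u \<equiv> holonomy_class (fl_class (H1 G) u)"
abbreviation "gr_pres \<equiv> linear_extension (gr G) (eval_monomial (gr G) (H1_to_gr G))"

lemma holonomy_homog: "homog (holonomy G) k = (\<lambda>u. holonomy_pres u) ` carrier (free_module (H1_monomials k))"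
 unfolding holonomy_eq graded_quot_simps(6) free_lie_def free_na_simps by (simp add: image_image holonomy_class_def fl_class_def free_lie_def)

lemma monomials_subset: "u over H1_monomials k ==> u \<in> carrier (free_nonassoc_algebra (carrier (H1 G)))" by (auto simp: free_na_simps)

lemma lin_hom_on_monomials:
 assumes "f \<in> lin_hom (free_nonassoc_algebra (carrier (H1 G))) L"
 shows "f \<in> lin_hom (free_module (H1_monomials k)) L" by (rule lin_homI)
  (use lin_homD[OF assms] monomials_subset in "simp_all add: free_na_simps(3,4)")

lemma holonomy_pres_lin_hom: "(\<lambda>u. holonomy_pres u) \<in> lin_hom (free_module (H1_monomials k)) (holonomy G)"
 by (rule lin_hom_on_monomials[OF lin_hom_comp[OF alg_homD(1)[OF fl_class_alg_hom[OF H1_cvs]] alg_homD(1)[OF holonomy_class_alg_hom]]])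

lemma holonomy_homog_subsp: "subsp (homog (holonomy G) k) (holonomy G)" unfolding holonomy_homog
 by (rule lin_hom_image[OF holonomy_pres_lin_hom algD(1)[OF holonomy_algebra] subsp_carrier[OF free_cvs]])

lemmas gr_pres_alg_hom = ev_alg_hom[OF gr_lie_algebra H1_to_gr_lin_hom H1_cvs]
lemmas lift_gr_class = free_lie_lift(1)[OF gr_lie_algebra H1_to_gr_lin_hom H1_cvs]

lemma gr_pres_lin_hom: "gr_pres \<in> lin_hom (free_module (H1_monomials k)) (gr G)" by (rule lin_hom_on_monomials[OF alg_homD(1)[OF gr_pres_alg_hom]])

lemma homog_gr_mult:
 assumes "x \<in> homog (gr G) i" "y \<in> homog (gr G) j"
 shows "x \<otimes>\<^sub>g y \<in> homog (gr G) (i + j)"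
proof -
 obtain u v where "u over lcs G i" "x = elt i u" "v over lcs G j" "y = elt j v" using assms unfolding gr_elem_onto[symmetric] by auto
 thus ?thesis using gr_elem_homog[OF keys_com] by (simp add: gr_elem_mult)
qed

lemma H1_to_gr_homog: "X \<in> carrier (H1 G) ==> H1_to_gr G X \<in> homog (gr G) 1" using gr_elem_homog[of _ 1] by (elim H1_cases) (simp add: H1_to_gr_class)

lemma gr_pres_homog: "u over H1_monomials k ==> gr_pres u \<in> homog (gr G) k"
proof -
 have "eval_monomial (gr G) (H1_to_gr G) t \<in> homog (gr G) (monomial_degree t)" if "set_monomial t \<subseteq> carrier (H1 G)" for t
  using that by (induction t) (auto simp: H1_to_gr_homog homog_gr_mult simp del: One_nat_def)
 hence s: "gr_pres (single t 1) \<in> homog (gr G) k" if "t \<in> H1_monomials k" for t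
  using that ev_single[OF gr_lie_algebra H1_to_gr_lin_hom H1_cvs, of t 1] subspD(4)[OF gr_homog_subsp] by auto
 assume u: "u over H1_monomials k"
 show ?thesis using span_free_module[OF u lin_vimage[OF gr_pres_lin_hom free_cvs gr_homog_subsp]] s by auto
qed

text \<open>Generation in degree 1: classes of degree k + 1 are combinations of brackets of classes
  of degrees k and 1, and these are images of products \<open>Br\<close> of a monomial with a
  generator.\<close>

lemma gr_pres_onto: "k \<ge> 1 ==> gr_pres ` carrier (free_module (H1_monomials k)) = homog (gr G) k"
proof (induction k rule: dec_induct)
 case base
 show ?case
 proof
  show "homog (gr G) 1 \<subseteq> gr_pres ` carrier (free_module (H1_monomials 1))"
  proof
   fix f assume "f \<in> homog (gr G) 1"
   then obtain u where u: "u over \<G>" "f = elt 1 u" unfolding gr_elem_onto[symmetric] by auto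
   let ?X = "H1_class u"
   have X: "?X \<in> carrier (H1 G)" using lin_homD(1)[OF H1_class_lin_hom] u by simp
   have "gr_pres (single (Gen ?X) 1) = H1_to_gr G ?X"
    using ev_single[OF gr_lie_algebra H1_to_gr_lin_hom H1_cvs, of "Gen ?X" 1] X lin_homD(1)[OF H1_to_gr_lin_hom] gr_cvs by simp
   hence "f = gr_pres (single (Gen ?X) 1)" using u by (simp add: H1_to_gr_class)
   thus "f \<in> gr_pres ` carrier (free_module (H1_monomials 1))" using X by (intro image_eqI[of _ _ "single (Gen ?X) 1"]) auto
  qed
 qed (use gr_pres_homog in auto)
next
 case (step k)
 have k: "k \<ge> 1" using step by simp
 let ?N = "gr_pres ` carrier (free_module (H1_monomials (Suc k)))"
 have N: "subsp ?N (gr G)" by (rule lin_hom_image[OF gr_pres_lin_hom gr_cvs subsp_carrier[OF free_cvs]])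
 show ?case
 proof
  show "homog (gr G) (Suc k) \<subseteq> ?N"
  proof
   fix f assume "f \<in> homog (gr G) (Suc k)"
   then obtain u where u: "u over lcs G (Suc k)" "f = elt (Suc k) u" unfolding gr_elem_onto[symmetric] by auto
   show "f \<in> ?N" unfolding u(2)
   proof (rule gr_generated_in_degree_1[OF N k _ u(1)])
    fix x y assume xy: "x \<in> lcs G k" "y \<in> \<G>"
    have "elt k (single x 1) \<in> homog (gr G) k" using xy by (intro gr_elem_homog) auto
    then obtain a where a: "a over H1_monomials k" "elt k (single x 1) = gr_pres a" unfolding step.IH[symmetric] by auto
    have "elt 1 (single y 1) = H1_to_gr G (H1_class (single y 1))" using xy by (intro H1_to_gr_class[symmetric]) auto
    moreover have X: "H1_class (single y 1) \<in> carrier (H1 G)" using lin_homD(1)[OF H1_class_lin_hom] xy by simp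
    ultimately have b: "elt 1 (single y 1) = gr_pres (single (Gen (H1_class (single y 1))) 1)"
     using ev_single[OF gr_lie_algebra H1_to_gr_lin_hom H1_cvs, of "Gen (H1_class (single y 1))" 1] lin_homD(1)[OF H1_to_gr_lin_hom] gr_cvs by simp
    let ?b = "single (Gen (H1_class (single y 1))) (1::complex)"
    have kb: "?b over H1_monomials 1" using X by simp
    have "gr_pres (bilinear Br a ?b) = gr_pres a \<otimes>\<^sub>g gr_pres ?b"
     using alg_homD(2)[OF gr_pres_alg_hom monomials_subset[OF a(1)] monomials_subset[OF kb]] by (simp add: free_na_simps(5))
    moreover have "(bilinear Br a ?b) over H1_monomials (Suc k)" by (rule keys_bilinear[OF a(1) kb]) auto
    ultimately show "elt k (single x 1) \<otimes>\<^sub>g elt 1 (single y 1) \<in> ?N" unfolding a(2) b by (intro image_eqI[of _ _ "bilinear Br a ?b"]) simp_all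
   qed
  qed
 qed (use gr_pres_homog in auto)
qed

context
 fixes S
 assumes fg: "finite S" "S \<subseteq> \<G>" "generate G S = \<G>"
begin

lemma lift_gr_dual_cup: "y \<in> dual_cup_image G ==> lift_gr y = \<zero>\<^sub>g"
 unfolding dual_cup_image_def using dual_cup_image_kernel[OF fg] lift_wedge gr_elem_eq_zero by auto

lemma lift_gr_holonomy_ideal: "y \<in> holonomy_ideal ==> lift_gr y = \<zero>\<^sub>g"
proof -
 have "holonomy_ideal \<subseteq> {y \<in> carrier (free_lie (H1 G)). lift_gr y = \<zero>\<^sub>g}" unfolding holonomy_ideal_def
  by (rule ideal_generated_least[OF kernel_algebra_ideal[OF lift_gr_alg_hom free_lie_algebra[OF H1_cvs] gr_algebra]])
   (use dual_cup_image_carrier lift_gr_dual_cup in auto)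
 thus "y \<in> holonomy_ideal ==> lift_gr y = \<zero>\<^sub>g" by auto
qed

lemma holonomy_to_gr:
 "y \<in> carrier (free_lie (H1 G)) ==> holonomy_to_gr G (holonomy_class y) = lift_gr y"
 "holonomy_to_gr G \<in> alg_hom (holonomy G) (gr G)"
 using induced_alg_hom[OF free_lie_algebra[OF H1_cvs] holonomy_ideal_ideal lift_gr_alg_hom gr_cvs lift_gr_holonomy_ideal]
 unfolding holonomy_to_gr_def holonomy_class_def holonomy_eq by auto

lemma fl_class_closed: "u over H1_monomials k ==> fl_class (H1 G) u \<in> carrier (free_lie (H1 G))" using alg_homD(3)[OF fl_class_alg_hom[OF H1_cvs] monomials_subset] .

lemma holonomy_to_gr_pres: "u over H1_monomials k ==> holonomy_to_gr G (holonomy_pres u) = gr_pres u"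
 using holonomy_to_gr(1)[OF fl_class_closed] lift_gr_class[OF monomials_subset] by simp

text \<open>A finite \<open>T\<close> represents a spanning set of H_1, so the finitely many
  monomials of degree k in it span. Finite-dimensionality is established here and inherited by
  gr/gr''.\<close>

lemma chen_space_holonomy_finite:
 "\<exists>A. finite A \<and> A \<subseteq> carrier (chen_space (holonomy G) k) \<and> carrier (chen_space (holonomy G) k) \<subseteq> span_of (chen_space (holonomy G) k) A"
proof -
 let ?W = "chen_space (holonomy G) k"
 note W = chen_space_cvs[OF holonomy_algebra holonomy_homog_subsp[of k]]
 define p where "p u = second_derived_lie (holonomy G) +>\<^bsub>holonomy G\<^esub> holonomy_pres u" for u
 note P = chen_space_presentation[OF holonomy_algebra holonomy_homog_subsp[of k] holonomy_pres_lin_hom[of k] holonomy_homog[symmetric], folded p_def]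
 obtain T where T: "finite T" "T \<subseteq> \<G>" "\<And>g. g \<in> \<G> ==> \<exists>w. w over T \<and> single g 1 - w \<in> boundaries1 G"
  using dual_basis[OF fg] by blast
 let ?T = "(\<lambda>t. H1_class (single t 1)) ` T"
 note HL = lin_homD[OF H1_class_lin_hom]
 have TC: "?T \<subseteq> carrier (H1 G)" using HL(1) T(2) by auto
 have span: "carrier (H1 G) \<subseteq> span_of (H1 G) ?T"
 proof
  fix X assume "X \<in> carrier (H1 G)"
  then obtain u where u: "u over \<G>" "X = H1_class u" by (rule H1_cases)
  note sub = span_of_subsp[OF H1_cvs TC]
  have "u \<in> {u \<in> carrier CG. H1_class u \<in> span_of (H1 G) ?T}"
  proof (rule span_free_module[OF u(1) lin_vimage[OF H1_class_lin_hom free_cvs sub]])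
   fix g assume g: "g \<in> \<G>"
   obtain w where w: "w over T" "single g 1 - w \<in> boundaries1 G" using T(3)[OF g] by auto
   have "H1_class w \<in> span_of (H1 G) ?T"
   proof -
    have wC: "w over \<G>" using w T(2) by auto
    have "w \<in> {u \<in> carrier CG. H1_class u \<in> span_of (H1 G) ?T}" by (rule span_free_module[OF w(1) lin_vimage[OF H1_class_lin_hom free_cvs sub]])
      (use T(2) span_of_base[OF H1_cvs TC] in auto)
    thus ?thesis by simp
   qed
   moreover have "H1_class (single g 1) = H1_class w" using w g T(2) by (subst H1_class_eq_iff) auto
   ultimately show "single g 1 \<in> {u \<in> carrier CG. H1_class u \<in> span_of (H1 G) ?T}" using g by simp
  qed
  thus "X \<in> span_of (H1 G) ?T" using u by simp
 qed
 let ?M = "{s. set_monomial s \<subseteq> ?T \<and> monomial_degree s = k}"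
 let ?A = "(\<lambda>s. p (single s 1)) ` ?M"
 have MC: "?M \<subseteq> H1_monomials k" using TC by auto
 have AC: "?A \<subseteq> carrier ?W"
 proof
  fix a assume "a \<in> ?A"
  then obtain s where "s \<in> ?M" "a = p (single s 1)" by auto
  thus "a \<in> carrier ?W" using lin_homD(1)[OF P(1), of "single s 1"] MC by auto
 qed
 have fin: "finite ?A" using finite_monomials_of_degree[of ?T k] T(1) by simp
 note subW = span_of_subsp[OF W AC]
 \<comment> \<open>The span is formed inside the component of degree k; it is viewed as a subspace
   of the whole quotient because \<open>r\<close> is defined on all of the free Lie algebra.\<close>
 have subQ: "subsp (span_of ?W ?A) (graded_quot (holonomy G) (second_derived_lie (holonomy G)))"
 proof (rule subsp_trans[OF subW])
  note SD = second_derived_subsp[OF holonomy_algebra]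
  show "subsp (homog (graded_quot (holonomy G) (second_derived_lie (holonomy G))) k) (graded_quot (holonomy G) (second_derived_lie (holonomy G)))"
   unfolding graded_quot_simps(6) by (rule lin_hom_image[OF graded_coset_lin_hom[OF SD] graded_quot_cvs[OF SD] holonomy_homog_subsp])
 qed
 define r where "r y = second_derived_lie (holonomy G) +>\<^bsub>holonomy G\<^esub> holonomy_class y" for y
 have r: "r \<in> lin_hom (free_lie (H1 G)) (graded_quot (holonomy G) (second_derived_lie (holonomy G)))"
  unfolding r_def by (rule lin_hom_comp[OF alg_homD(1)[OF holonomy_class_alg_hom] graded_coset_lin_hom[OF second_derived_subsp[OF holonomy_algebra]]])
 have "p (single t 1) \<in> span_of ?W ?A" if t: "t \<in> H1_monomials k" for t
 proof -
  let ?Z = "(\<lambda>s. fl_class (H1 G) (single s 1)) ` {s. set_monomial s \<subseteq> ?T \<and> monomial_degree s = monomial_degree t}"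
  have tk: "monomial_degree t = k" "set_monomial t \<subseteq> carrier (H1 G)" using t by auto
  have "r (fl_class (H1 G) (single t 1)) \<in> span_of ?W ?A"
  proof (rule span_of_image[OF r free_lie_H1(1) subspD(5)[OF subQ] _ fl_class_monomial_span[OF H1_cvs TC span tk(2)] _ subQ])
   show "?Z \<subseteq> carrier (free_lie (H1 G))" using fl_class_closed MC tk by auto
   have "r ` ?Z = ?A" unfolding tk(1) by (simp add: image_image r_def p_def)
   thus "r ` ?Z \<subseteq> span_of ?W ?A" using span_of_base[OF W AC] by auto
  qed
  thus ?thesis by (simp add: r_def p_def)
 qed
 hence "p u \<in> span_of ?W ?A" if "u over H1_monomials k" for u using span_free_module[OF that lin_vimage[OF P(1) free_cvs subW]] by auto
 hence "carrier ?W \<subseteq> span_of ?W ?A" unfolding P(2)[symmetric] by auto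
 thus ?thesis using fin AC by blast
qed

text \<open>Psi maps h'' into gr'', so among the two kernels in the space of monomials the one of h
  is the smaller. The finite spanning set in the second claim is what part (2) counts with.\<close>

lemma chen_rank_lie_gr_le_holonomy:
 assumes k: "k \<ge> 1"
 shows "chen_rank_lie (gr G) k \<le> chen_rank_lie (holonomy G) k"
  and "\<exists>B. finite B \<and> B \<subseteq> carrier (chen_space (gr G) k) \<and> carrier (chen_space (gr G) k) \<subseteq> span_of (chen_space (gr G) k) B"
  and "k \<le> 2 \<or> graded_formal G ==> chen_rank_lie (gr G) k = chen_rank_lie (holonomy G) k"
proof -
 note P1 = chen_space_presentation[OF holonomy_algebra holonomy_homog_subsp[of k] holonomy_pres_lin_hom[of k] holonomy_homog[symmetric]]
 note P2 = chen_space_presentation[OF gr_algebra gr_homog_subsp[of k] gr_pres_lin_hom gr_pres_onto[OF k]]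
 note W1 = chen_space_cvs[OF holonomy_algebra holonomy_homog_subsp[of k]]
 note W2 = chen_space_cvs[OF gr_algebra gr_homog_subsp[of k]]
 note E1 = chen_rank_lie_eq[OF holonomy_algebra holonomy_homog_subsp[of k]]
 note E2 = chen_rank_lie_eq[OF gr_algebra gr_homog_subsp[of k]]
 obtain A where A: "finite A" "A \<subseteq> carrier (chen_space (holonomy G) k)"
  "carrier (chen_space (holonomy G) k) \<subseteq> span_of (chen_space (holonomy G) k) A" using chen_space_holonomy_finite by blast
 have ker: "gr_pres u \<in> gr2" if "u over H1_monomials k" "holonomy_pres u \<in> second_derived_lie (holonomy G)" for u
  using second_derived_hom[OF holonomy_algebra gr_algebra holonomy_to_gr(2)] that holonomy_to_gr_pres[OF that(1)] by force
 show "chen_rank_lie (gr G) k \<le> chen_rank_lie (holonomy G) k" unfolding E1 E2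
  by (rule dim_le_of_kernels(1)[OF W1 W2 free_cvs P1(1) P2(1) P1(2) P2(2) _ A]) (use P1(3) P2(3) ker in auto)
 show "\<exists>B. finite B \<and> B \<subseteq> carrier (chen_space (gr G) k) \<and> carrier (chen_space (gr G) k) \<subseteq> span_of (chen_space (gr G) k) B"
  by (rule dim_le_of_kernels(2)[OF W1 W2 free_cvs P1(1) P2(1) P1(2) P2(2) _ A]) (use P1(3) P2(3) ker in auto)
 assume eq: "k \<le> 2 \<or> graded_formal G"
 have ker': "holonomy_pres u \<in> second_derived_lie (holonomy G)" if u: "u over H1_monomials k" and g: "gr_pres u \<in> gr2" for u
 proof (cases "graded_formal G")
  case True
  hence "holonomy_to_gr G \<in> lie_iso (holonomy G) (gr G)" by (simp add: graded_formal_def)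
  moreover have "holonomy_pres u \<in> carrier (holonomy G)" using lin_homD(1)[OF holonomy_pres_lin_hom] u by simp
  ultimately show ?thesis using lie_iso_second_derived[OF holonomy_algebra gr_algebra] holonomy_to_gr_pres[OF u] g by simp
 next
  case False
  hence k2: "k = 1 \<or> k = 2" using eq k by auto
  \<comment> \<open>gr'' vanishes below degree 4 and the element is homogeneous of degree k <= 2, so
    it is zero. It remains to see that Psi is injective in degrees 1 and 2.\<close>
  have z: "gr_pres u = \<zero>\<^sub>g"
  proof
   fix i show "gr_pres u i = \<zero>\<^sub>g i"
    using second_derived_gr_vanishing[OF g, of i] gr_pres_homog[OF u] k2 by (cases "i < 4") (auto simp: gr_simps(2,6))
  qed
  have lz: "lift_gr (fl_class (H1 G) u) = \<zero>\<^sub>g" using z lift_gr_class[OF monomials_subset[OF u]] by simp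
  have C: "fl_class (H1 G) \<in> lin_hom (free_module (H1_monomials k)) (free_lie (H1 G))"
   by (rule lin_hom_on_monomials[OF alg_homD(1)[OF fl_class_alg_hom[OF H1_cvs]]])
  have "holonomy_pres u = \<zero>\<^bsub>holonomy G\<^esub>" using k2
  proof
   assume k1: "k = 1"
   \<comment> \<open>A monomial of degree 1 is a generator; the value for brackets is never
     taken.\<close>
   define d where "d t = (case t of Gen X => X | Br _ _ => \<zero>\<^bsub>H1 G\<^esub>)" for t
   have g1: "\<exists>X. t = Gen X \<and> X \<in> carrier (H1 G)" if "t \<in> H1_monomials 1" for t
   proof -
    show ?thesis 
    proof (cases t)
     case (Br a b)
     thus ?thesis using that monomial_degree_pos[of a] monomial_degree_pos[of b] by auto
    qed (use that in auto)
   qed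
   have dc: "d t \<in> carrier (H1 G)" if "t \<in> H1_monomials 1" for t using g1[OF that] by (auto simp: d_def)
   have DL: "linear_extension (H1 G) d \<in> lin_hom (free_module (H1_monomials 1)) (H1 G)" by (rule lin_ext_lin_hom[OF H1_cvs dc])
   have "fl_class (H1 G) u = free_lie_gen (H1 G) (linear_extension (H1 G) d u)"
   proof (rule lin_hom_eq_on_free_module[OF C[unfolded k1] lin_hom_comp[OF DL free_lie_gen_lin_hom[OF H1_cvs]] free_lie_H1(1) _ u[unfolded k1]])
    fix t assume t: "t \<in> H1_monomials 1"
    then obtain X where X: "t = Gen X" "X \<in> carrier (H1 G)" using g1 by blast
    have "linear_extension (H1 G) d (single t 1) = 1 \<odot>\<^bsub>H1 G\<^esub> d t" by (rule lin_ext_single[OF H1_cvs dc t])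
    thus "fl_class (H1 G) (single t 1) = free_lie_gen (H1 G) (linear_extension (H1 G) d (single t 1))"
     using X cvs_one[OF H1_cvs X(2)] by (simp add: d_def free_lie_gen_eq)
   qed
   moreover have X: "linear_extension (H1 G) d u \<in> carrier (H1 G)" using lin_homD(1)[OF DL] u k1 by simp
   ultimately have "H1_to_gr G (linear_extension (H1 G) d u) = \<zero>\<^sub>g" using lz lift_gr_gen by simp
   hence "linear_extension (H1 G) d u = \<zero>\<^bsub>H1 G\<^esub>"
    using X gr_class_1_eq_zero gr_elem_eq_zero by (elim H1_cases) (simp add: H1_to_gr_class H1_class_eq_zero)
   hence "fl_class (H1 G) u = \<zero>\<^bsub>free_lie (H1 G)\<^esub>"
    using \<open>fl_class (H1 G) u = _\<close> lin_hom_zero[OF free_lie_gen_lin_hom[OF H1_cvs] H1_cvs free_lie_H1(1)] by simp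
   thus ?thesis using lin_hom_zero[OF alg_homD(1)[OF holonomy_class_alg_hom] free_lie_H1(1) algD(1)[OF holonomy_algebra]] by simp
  next
   assume k2: "k = 2"
   \<comment> \<open>A monomial of degree 2 is a bracket of two generators, so the default is never
     reached; \<open>d\<close> turns \<open>u\<close> into a formal sum of pairs, to which the
     results on the cup product apply.\<close>
   define d where "d t = (case t of Br (Gen X) (Gen Y) => (X, Y) | _ => undefined)" for t :: "('a \<Rightarrow>\<^sub>0 complex) set monomial"
   have g2: "\<exists>X Y. t = Br (Gen X) (Gen Y) \<and> X \<in> carrier (H1 G) \<and> Y \<in> carrier (H1 G)" if "t \<in> H1_monomials 2" for t
   proof -
    have deg1: "\<exists>X. s = Gen X" if "monomial_degree s = 1" for s :: "('a \<Rightarrow>\<^sub>0 complex) set monomial"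
    proof (cases s)
     case (Br a b)
     thus ?thesis using that monomial_degree_pos[of a] monomial_degree_pos[of b] by simp
    qed auto
    show ?thesis
    proof (cases t)
     case (Br a b)
     hence "monomial_degree a = 1" "monomial_degree b = 1" using that monomial_degree_pos[of a] monomial_degree_pos[of b] by auto
     thus ?thesis using deg1[of a] deg1[of b] Br that by auto
    qed (use that in auto)
   qed
   have dc: "d ` H1_monomials 2 \<subseteq> H1_pairs" using g2 by (fastforce simp: d_def)
   have p: "(pushforward d u) over H1_pairs" using keys_pushforward[OF u[unfolded k2] dc] .
   have w: "fl_class (H1 G) u = wedge_to_free_lie G (pushforward d u)"
   proof (rule lin_hom_eq_on_free_module[OF C[unfolded k2] lin_hom_comp[OF push_lin_hom[OF dc] wedge_to_free_lie_lin_hom] free_lie_H1(1) _ u[unfolded k2]])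
    fix t assume "t \<in> H1_monomials 2"
    then obtain X Y where t: "t = Br (Gen X) (Gen Y)" "X \<in> carrier (H1 G)" "Y \<in> carrier (H1 G)" using g2 by blast
    have "single t 1 = single (Gen X) 1 \<otimes>\<^bsub>free_nonassoc_algebra (carrier (H1 G))\<^esub> single (Gen Y) (1::complex)"
     using t by (simp add: free_na_simps)
    hence "fl_class (H1 G) (single t 1) = free_lie_gen (H1 G) X \<otimes>\<^bsub>free_lie (H1 G)\<^esub> free_lie_gen (H1 G) Y"
     using alg_homD(2)[OF fl_class_alg_hom[OF H1_cvs], of "single (Gen X) 1" "single (Gen Y) 1"] t by (simp add: free_na_simps(1) free_lie_gen_eq)
    thus "fl_class (H1 G) (single t 1) = wedge_to_free_lie G (pushforward d (single t 1))"
     using t gen_bracket_closed[of "(X, Y)"] free_lie_H1(1) by (simp add: d_def wedge_to_free_lie_single)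
   qed
   have "elt 2 (wedge_com (pushforward d u)) = \<zero>\<^sub>g" using lift_wedge[OF p] w lz by simp
   hence "wedge_to_free_lie G (pushforward d u) \<in> dual_cup_image G" using kernel_in_dual_cup_image[OF p] gr_elem_eq_zero by simp
   hence "fl_class (H1 G) u \<in> holonomy_ideal" unfolding w holonomy_ideal_def by (rule ideal_generated_superset)
   thus ?thesis using holonomy_class_eq_zero[OF fl_class_closed[OF u]] by simp
  qed
  thus ?thesis using subspD(2)[OF second_derived_subsp[OF holonomy_algebra]] by simp
 qed
 show "chen_rank_lie (gr G) k = chen_rank_lie (holonomy G) k" unfolding E1 E2
  by (rule dim_eq_of_kernels[OF W1 W2 free_cvs P1(1) P2(1) P1(2) P2(2) _ A]) (use P1(3) P2(3) ker ker' in auto)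
qed

end

end

section \<open>The maximal metabelian quotient\<close>

lemma push_id: "pushforward (\<lambda>x. x) u = u" unfolding pushforward_def by (rule poly_mapping_as_sum[symmetric]) auto

lemma push_onto: "v over h ` S ==> \<exists>u. u over S \<and> v = pushforward h u"
proof (intro exI conjI)
 assume v: "v over h ` S"
 let ?u = "pushforward (inv_into S h) v"
 show "?u over S" by (rule keys_pushforward[OF v]) (auto intro: inv_into_into)
 have "pushforward h ?u = pushforward (\<lambda>x. x) v" unfolding push_comp using v by (intro push_cong) (auto simp: f_inv_into_f)
 thus "v = pushforward h ?u" by (simp add: push_id)
qed

context group
begin

lemma com_second_derived: "x \<in> lcs G 2 ==> y \<in> lcs G 2 ==> com x y \<in> second_derived G" unfolding second_derived_def derived_carrier_eq_lcs
 unfolding derived_def commutator_def by (rule generate.incl) blast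

definition gr_class_image :: "'a set => nat => ('a set \<Rightarrow>\<^sub>0 complex) set set" where
 "gr_class_image A k = cls k ` {w. w over lcs G k \<inter> A}"

lemma gr_class_image_subsp: "subsp (gr_class_image A k) (gr_comp G k)" unfolding gr_class_image_def
proof (rule lin_hom_image[OF gr_class_lin_hom gr_comp_cvs], rule free_subspI)
 show "scl c u \<in> {w. w over lcs G k \<inter> A}" if "u \<in> {w. w over lcs G k \<inter> A}" for c u using order_trans[OF keys_scl[of c u]] that by simp
qed (simp_all add: over_add)

lemma gr_class_image_elements_subsp: "subsp {f \<in> grC. \<forall>k. f k \<in> gr_class_image A k} (gr G)"
proof (rule subspI[OF gr_cvs])
 note D = subspD[OF gr_class_image_subsp]
 show "\<zero>\<^sub>g \<in> {f \<in> grC. \<forall>k. f k \<in> gr_class_image A k}" using cvs_zero[OF gr_cvs] D(2) by (auto simp: gr_simps(2))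
 show "f \<oplus>\<^sub>g g \<in> {f \<in> grC. \<forall>k. f k \<in> gr_class_image A k}"
  if "f \<in> {f \<in> grC. \<forall>k. f k \<in> gr_class_image A k}" "g \<in> {f \<in> grC. \<forall>k. f k \<in> gr_class_image A k}" for f g
  using that cvs_add[OF gr_cvs, of f g] D(3) by (auto simp: gr_simps(3))
 show "c \<odot>\<^sub>g f \<in> {f \<in> grC. \<forall>k. f k \<in> gr_class_image A k}"
  if "f \<in> {f \<in> grC. \<forall>k. f k \<in> gr_class_image A k}" for c f
  using that cvs_smult[OF gr_cvs, of f c] D(4) by (auto simp: gr_simps(4))
qed auto

text \<open>In every degree gr' is represented by chains on Gamma_2: from degree 2 on because
  Gamma_i is contained in Gamma_2, below because gr' is zero there. Commutators of elements of
  Gamma_2 lie in G''.\<close>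

lemma second_derived_gr_class_image:
 assumes "f \<in> gr2"
 shows "f k \<in> gr_class_image (second_derived G) k"
proof -
 let ?N = "{f \<in> grC. \<forall>k. f k \<in> gr_class_image (second_derived G) k}"
 have "derived_lie (gr G) (derived_lie (gr G) (grC)) \<subseteq> ?N"
 proof (rule derived_lie_least[OF gr_algebra gr_class_image_elements_subsp])
  fix f g assume fg: "f \<in> derived_lie (gr G) (grC)" "g \<in> derived_lie (gr G) (grC)"
  have van: "h \<in> grC \<and> (\<forall>i. h i \<in> gr_class_image (lcs G 2) i)" if h: "h \<in> derived_lie (gr G) (grC)" for h
  proof (intro conjI allI)
   have v: "derived_lie (gr G) (grC) \<subseteq> {f \<in> grC. \<forall>i<2 * 1. f i = zgr i}" by (rule gr_derived_vanishing) (auto simp: gr_at_0)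
   thus hC: "h \<in> grC" using h by auto
   fix i show "h i \<in> gr_class_image (lcs G 2) i"
   proof (cases "i < 2")
    case True
    thus ?thesis using v h subspD(2)[OF gr_class_image_subsp] by auto
   next
    case False
    hence "lcs G i \<inter> lcs G 2 = lcs G i" using lcs_antimono[of 2 i] by auto
    moreover obtain u where "u over lcs G i" "h i = cls i u" using gr_closed[OF hC] by (rule gr_comp_cases)
    ultimately show ?thesis unfolding gr_class_image_def by auto
   qed
  qed
  have "gr_bracket G i (k - i) (f i) (g (k - i)) \<in> gr_class_image (second_derived G) k" if i: "i \<le> k" for i k
  proof -
   obtain w w' where w: "w over lcs G i \<inter> lcs G 2" "f i = cls i w"
    "w' over lcs G (k - i) \<inter> lcs G 2" "g (k - i) = cls (k - i) w'"
    using van[OF fg(1)] van[OF fg(2)] unfolding gr_class_image_def by (auto simp: image_iff) metis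
   have "(bilinear (com) w w') over lcs G k \<inter> second_derived G" by (rule keys_bilinear[OF w(1,3)]) (use com_lcs com_second_derived i in fastforce)
   moreover have "gr_bracket G i (k - i) (f i) (g (k - i)) = cls k (bilinear (com) w w')" using gr_bracket_class[of w i w' "k - i"] w i by simp
   ultimately show ?thesis unfolding gr_class_image_def by auto
  qed
  hence "(f \<otimes>\<^sub>g g) k \<in> gr_class_image (second_derived G) k" for k unfolding gr_simps(5) by (intro subsp_finsum[OF gr_class_image_subsp]) auto
  thus "f \<otimes>\<^sub>g g \<in> ?N" using gr_mult_closed van[OF fg(1)] van[OF fg(2)] by simp
 qed
 thus ?thesis using assms unfolding second_derived_lie_def by auto
qed

section \<open>The projection to G/G'' and the comparison with gr/gr''\<close>

abbreviation metabelianization ("\<Q>") where "\<Q> \<equiv> G Mod second_derived G"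
abbreviation "to_Q x \<equiv> second_derived G #> x"

lemma metabelianization_hom: "group_hom G \<Q> to_Q" unfolding group_hom_def group_hom_axioms_def
 using normal.r_coset_hom_Mod[OF second_derived_normal] normal.factorgroup_is_group[OF second_derived_normal] is_group by auto

lemma metabelianization_lcs: "to_Q ` lcs G k = lcs \<Q> k" by (rule lcs_hom_image[OF metabelianization_hom]) (auto simp: FactGroup_def RCOSETS_def)

lemma chen_rank_le:
 assumes fg: "finite S" "S \<subseteq> \<G>" "generate G S = \<G>" and k: "k \<ge> 1"
 shows "chen_rank G k \<le> chen_rank_lie (gr G) k"
  and "(\<And>c. c \<in> lcs G k ==> c \<in> second_derived G ==> elt k (single c 1) \<in> gr2) ==>
   chen_rank G k = chen_rank_lie (gr G) k"
proof -
 interpret h: group_hom G \<Q> to_Q by (rule metabelianization_hom)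
 let ?\<pi> = "pushforward to_Q"
 let ?s = "gr2"
 define p where "p u = gr_class \<Q> k (?\<pi> u)" for u
 note im = metabelianization_lcs
 have push: "?\<pi> \<in> lin_hom (free_module (lcs G k)) (free_module (lcs \<Q> k))" by (rule push_lin_hom) (simp add: im)
 have p: "p \<in> lin_hom (free_module (lcs G k)) (gr_comp \<Q> k)" unfolding p_def using lin_hom_comp[OF push h.H.gr_class_lin_hom] .
 have p_onto: "p ` carrier (free_module (lcs G k)) = carrier (gr_comp \<Q> k)"
 proof
  show "carrier (gr_comp \<Q> k) \<subseteq> p ` carrier (free_module (lcs G k))"
  proof
   fix X assume "X \<in> carrier (gr_comp \<Q> k)"
   then obtain v where v: "v over lcs \<Q> k" "X = gr_class \<Q> k v" by (rule h.H.gr_comp_cases)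
   with push_onto[of v to_Q "lcs G k"] im[of k] obtain u where "u over lcs G k" "v = ?\<pi> u" by auto
   with v show "X \<in> p ` carrier (free_module (lcs G k))" by (auto simp: p_def)
  qed
 qed (use lin_homD(1)[OF p] in auto)
 have one: "to_Q x = \<one>\<^bsub>\<Q>\<^esub>" if "x \<in> second_derived G" for x
  using that subgroup.rcos_const[OF normal_imp_subgroup[OF second_derived_normal] is_group that] by (simp add: FactGroup_def)
 note P = chen_space_presentation[OF gr_algebra gr_homog_subsp[of k] gr_elem_lin_hom gr_elem_onto]
 note W1 = chen_space_cvs[OF gr_algebra gr_homog_subsp[of k]]
 note E = chen_rank_lie_eq[OF gr_algebra gr_homog_subsp[of k]]
 note sD = subspD[OF second_derived_subsp[OF gr_algebra]]
 note Pz = lin_hom_zero[OF p free_cvs h.H.gr_comp_cvs]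
 \<comment> \<open>\<open>u\<close> has the class of a chain \<open>w\<close> on G''. The map
   \<open>p\<close> kills \<open>w\<close> because G'' becomes trivial in the quotient, and it kills
   \<open>u - w\<close> because the class of that is zero.\<close>
 have ker: "p u = \<zero>\<^bsub>gr_comp \<Q> k\<^esub>" if u: "u over lcs G k" and "elt k u \<in> ?s" for u
 proof -
  have "cls k u \<in> gr_class_image (second_derived G) k" using second_derived_gr_class_image[OF that(2), of k] by (simp add: gr_elem_def)
  then obtain w where w: "w over lcs G k \<inter> second_derived G" "cls k u = cls k w" unfolding gr_class_image_def by auto
  have wk: "w over lcs G k" using w by auto
  have z: "cls k (u - w) = zgr k" using w u wk by (simp add: gr_class_diff_eq_zero)
  have "p (u - w) = \<zero>\<^bsub>gr_comp \<Q> k\<^esub>"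
  proof (rule gr_class_universal[OF p h.H.gr_comp_cvs _ _ over_diff[OF u wk] z])
   fix x y assume xy: "x \<in> lcs G k" "y \<in> lcs G k"
   hence "to_Q (x \<otimes> y) = to_Q x \<otimes>\<^bsub>\<Q>\<^esub> to_Q y" using lcs_mem by (intro h.hom_mult) auto
   thus "p (single (x \<otimes> y) 1 - single x 1 - single y 1) = \<zero>\<^bsub>gr_comp \<Q> k\<^esub>"
    using xy h.H.gr_class_mult[of "to_Q x" k "to_Q y"] im[of k] by (auto simp: p_def push_diff)
  next
   fix e assume "e \<in> lcs G (Suc k)"
   hence "to_Q e \<in> lcs \<Q> (Suc k)" using im[of "Suc k"] by auto
   thus "p (single e 1) = \<zero>\<^bsub>gr_comp \<Q> k\<^esub>" by (simp add: p_def h.H.gr_class_single_zero)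
  qed
  moreover have "w \<in> {u \<in> carrier (free_module (lcs G k)). p u \<in> {\<zero>\<^bsub>gr_comp \<Q> k\<^esub>}}"
  proof (rule span_free_module[OF w(1) lin_vimage[OF p free_cvs]])
   show "subsp {\<zero>\<^bsub>gr_comp \<Q> k\<^esub>} (gr_comp \<Q> k)" by (rule subspI) (auto simp: cvs_smult_zero[OF h.H.gr_comp_cvs])
   show "single x 1 \<in> {u \<in> carrier (free_module (lcs G k)). p u \<in> {\<zero>\<^bsub>gr_comp \<Q> k\<^esub>}}" if "x \<in> lcs G k \<inter> second_derived G" for x
    using that one[of x] h.H.gr_class_one[of k 1] by (simp add: p_def)
  qed
  ultimately show ?thesis using lin_homD(2)[OF p, of "u - w" w] over_diff[OF u wk] wk by (simp add: cvs_zero[OF h.H.gr_comp_cvs])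
 qed
 from chen_rank_lie_gr_le_holonomy(2)[OF fg k] obtain B where B: "finite B" "B \<subseteq> carrier (chen_space (gr G) k)"
  "carrier (chen_space (gr G) k) \<subseteq> span_of (chen_space (gr G) k) B" by auto
 show "chen_rank G k \<le> chen_rank_lie (gr G) k" unfolding E chen_rank_def
  by (rule dim_le_of_kernels(1)[OF W1 h.H.gr_comp_cvs free_cvs P(1) p P(2) p_onto _ B]) (use P(3) ker in auto)
 assume lift: "\<And>c. c \<in> lcs G k ==> c \<in> second_derived G ==> elt k (single c 1) \<in> ?s"
 note S = second_derived_subsp[OF gr_algebra]
 let ?W = "quot (gr G) ?s"
 define c where "c u = ?s +>\<^sub>g elt k u" for u
 \<comment> \<open>A section of the projection on Gamma_k. It need not be multiplicative, but the
   assumption on G'' makes the resulting map to gr/gr'' independent of the choice, as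
   \<open>qc\<close> shows.\<close>
 define \<sigma> where "\<sigma> = inv_into (lcs G k) to_Q"
 define q where "q v = c (pushforward \<sigma> v)" for v
 have \<sigma>: "\<sigma> y \<in> lcs G k" "to_Q (\<sigma> y) = y" if "y \<in> lcs \<Q> k" for y
  using that unfolding im[symmetric] \<sigma>_def by (auto intro: inv_into_into simp: f_inv_into_f)
 have c: "c \<in> lin_hom (free_module (lcs G k)) ?W" unfolding c_def by (rule lin_hom_comp[OF gr_elem_lin_hom coset_lin_hom[OF S]])
 have q: "q \<in> lin_hom (free_module (lcs \<Q> k)) ?W" unfolding q_def by (rule lin_hom_comp[OF push_lin_hom c]) (use \<sigma> in auto)
 have cz: "c v = \<zero>\<^bsub>?W\<^esub> \<longleftrightarrow> elt k v \<in> ?s" if "v over lcs G k" for v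
  using coset_eq_zero_iff[OF S gr_elem_closed[OF that]] by (simp add: c_def quot_simps)
 have c0: "c v = \<zero>\<^bsub>?W\<^esub>" if "v over lcs G k" "cls k v = zgr k" for v using cz[OF that(1)] that(2) sD(2) gr_elem_eq_zero by metis
 have qc: "q (?\<pi> u) = c u" if "u over lcs G k" for u
 proof (rule lin_hom_eq_on_free_module[OF lin_hom_comp[OF push q] c quot_cvs[OF S] _ that])
  fix x assume x: "x \<in> lcs G k"
  let ?y = "\<sigma> (to_Q x)"
  have "to_Q x \<in> lcs \<Q> k" unfolding im[symmetric] using x by (rule imageI)
  note y = \<sigma>[OF this]
  note xy = lcs_mem[OF x] lcs_mem[OF y(1)]
  have "x \<in> to_Q ?y" using y(2) rcos_self[OF xy(1) normal_imp_subgroup[OF second_derived_normal]] by simp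
  then obtain n where n: "n \<in> second_derived G" "x = n \<otimes> ?y" by (auto simp: r_coset_def)
  have nC: "n \<in> \<G>" using n(1) normal_imp_subgroup[OF second_derived_normal, THEN subgroup.mem_carrier] by blast
  have "x \<otimes> inv ?y = n \<otimes> ?y \<otimes> inv ?y" by (rule arg_cong[OF n(2)])
  hence "n = x \<otimes> inv ?y" using xy(2) nC by (simp add: m_assoc)
  \<comment> \<open>Both elements over one coset lie in Gamma_k, hence so does \<open>n\<close>,
    which is also in G''; this is where the assumption applies.\<close>
  hence nk: "n \<in> lcs G k" using lcs_mult[OF x lcs_inv[OF y(1)]] by simp
  have "elt k (single x 1) = elt k (single n 1 + single ?y 1)" by (rule gr_elem_cong) (use gr_class_single_mult[OF nk y(1), of 1] n(2) in simp)
  hence "c (single x 1) = c (single n 1) \<oplus>\<^bsub>?W\<^esub> c (single ?y 1)" using lin_homD(2)[OF c, of "single n 1" "single ?y 1"] nk y(1) by (simp add: c_def)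
  also have "c (single n 1) = \<zero>\<^bsub>?W\<^esub>" using cz[of "single n 1"] lift[OF nk n(1)] nk by simp
  finally show "q (?\<pi> (single x 1)) = c (single x 1)" using lin_homD(1)[OF c, of "single ?y 1"] y(1) quot_cvs[OF S] by (simp add: q_def)
 qed
 have "elt k u \<in> ?s" if u: "u over lcs G k" and z: "p u = \<zero>\<^bsub>gr_comp \<Q> k\<^esub>" for u
 proof -
  have "q (?\<pi> u) = \<zero>\<^bsub>?W\<^esub>"
  proof (rule h.H.gr_class_universal[OF q quot_cvs[OF S]])
   show "(?\<pi> u) over lcs \<Q> k" using lin_homD(1)[OF push] u by simp
   show "gr_class \<Q> k (?\<pi> u) = \<zero>\<^bsub>gr_comp \<Q> k\<^esub>" using z by (simp add: p_def)
   show "q (single e 1) = \<zero>\<^bsub>?W\<^esub>" if e: "e \<in> lcs \<Q> (Suc k)" for e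
   proof -
    obtain e' where e': "e' \<in> lcs G (Suc k)" "e = to_Q e'" using e im[of "Suc k", symmetric] by auto
    hence k': "(single e' (1::complex)) over lcs G k" using lcs_Suc_subset[of k] by auto
    show ?thesis using qc[OF k'] c0[OF k' gr_class_single_zero[OF e'(1)]] e'(2) by simp
   qed
   fix x y assume "x \<in> lcs \<Q> k" "y \<in> lcs \<Q> k"
   then obtain a b where ab: "a \<in> lcs G k" "b \<in> lcs G k" "x = to_Q a" "y = to_Q b" using im[of k, symmetric] by auto
   have k': "(single (a \<otimes> b) (1::complex) - single a 1 - single b 1) over lcs G k" using ab lcs_mult by (intro over_diff) auto
   have "to_Q (a \<otimes> b) = x \<otimes>\<^bsub>\<Q>\<^esub> y" unfolding ab(3,4) using ab(1,2) lcs_mem by (intro h.hom_mult) auto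
   thus "q (single (x \<otimes>\<^bsub>\<Q>\<^esub> y) 1 - single x 1 - single y 1) = \<zero>\<^bsub>?W\<^esub>"
    using qc[OF k'] c0[OF k' gr_class_mult[OF ab(1,2)]] ab(3,4) by (simp add: push_diff)
  qed
  thus ?thesis using qc[OF u] cz[OF u] by simp
 qed
 thus "chen_rank G k = chen_rank_lie (gr G) k" unfolding E chen_rank_def
  by (intro dim_eq_of_kernels[OF W1 h.H.gr_comp_cvs free_cvs P(1) p P(2) p_onto _ B]) (use P(3) ker in auto)
qed

end

section \<open>The group algebra\<close>

context group
begin

definition star :: "('a \<Rightarrow>\<^sub>0 complex) => ('a \<Rightarrow>\<^sub>0 complex) => ('a \<Rightarrow>\<^sub>0 complex)" (infixl "\<star>" 70) where
 "u \<star> v = bilinear (mult G) u v"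

abbreviation unit where "unit \<equiv> single \<one> (1::complex)"

lemmas star_add = bilin_addL[of "mult G", folded star_def] bilin_addR[of "mult G", folded star_def]
lemmas star_diff = bilinear_diff_left[of "mult G", folded star_def] bilinear_diff_right[of "mult G", folded star_def]
lemmas star_scl = bilin_sclL[of "mult G", folded star_def] bilin_sclR[of "mult G", folded star_def]
lemmas star_zero [simp] = bilinear_zero[of "mult G", folded star_def]
lemmas star_single [simp] = bilinear_single[of "mult G", folded star_def]

lemma star_closed: "u over \<G> ==> v over \<G> ==> (u \<star> v) over \<G>" unfolding star_def by (rule keys_bilinear) auto

lemma star_assoc:
 assumes "u over \<G>" "v over \<G>" "w over \<G>"
 shows "(u \<star> v) \<star> w = u \<star> (v \<star> w)" using assms(1)
proof (induction u rule: pm_induct)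
 case (single x c)
 show ?case using assms(2)
 proof (induction v rule: pm_induct)
  case (single y d)
  show ?case using assms(3) by (induction w rule: pm_induct) (use single \<open>x \<in> \<G>\<close> in "simp_all add: m_assoc star_add mult.assoc")
 qed (simp_all add: star_add)
qed (simp_all add: star_add)

lemma star_unit [simp]:
 assumes "u over \<G>"
 shows "unit \<star> u = u" "u \<star> unit = u" using assms by (induction u rule: pm_induct; simp add: star_add)+

lemma push_star:
 assumes "\<And>x y. x \<in> \<G> ==> y \<in> \<G> ==> f (x \<otimes> y) = m (f x) (f y)" "u over \<G>" "v over \<G>"
 shows "pushforward f (u \<star> v) = bilinear m (pushforward f u) (pushforward f v)"
 unfolding star_def push_bilinear bilinear_pushforward using assms by (intro bilinear_cong) auto

text \<open>The augmentation is \<open>pairing (\<lambda>_. 1)\<close>.\<close>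

abbreviation Aug where "Aug \<equiv> augmentation_power G"

lemma ga_simps:
 "carrier GA = {u. u over \<G>}" "u \<otimes>\<^bsub>GA\<^esub> v = u \<star> v"
 "u \<oplus>\<^bsub>GA\<^esub> v = u + v" "\<zero>\<^bsub>GA\<^esub> = 0" "c \<odot>\<^bsub>GA\<^esub> u = scl c u"
 "\<one>\<^bsub>GA\<^esub> = unit" by (simp_all add: group_algebra_def star_def)

lemma aug_ideal_iff: "u \<in> augmentation_ideal G \<longleftrightarrow> u over \<G> \<and> pairing (\<lambda>_. 1) u = 0"
 by (simp add: augmentation_ideal_def ga_simps pairing_def)

lemma augmentation_star: "pairing (\<lambda>_. 1) (u \<star> v) = pairing (\<lambda>_. 1) u * pairing (\<lambda>_. 1) v"
 unfolding star_def by (rule pairing_bilinear_prod) simp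

lemma Aug_add: "u \<in> Aug r ==> v \<in> Aug r ==> u + v \<in> Aug r"
 using ideal_prod.sum[of u "group_algebra G" "augmentation_ideal G" _ v] by (cases r) (auto simp: ga_simps over_add subsetD)

lemma Aug_closed: "u \<in> Aug r ==> u over \<G>"
proof (induction r arbitrary: u)
 case (Suc r)
 have "u \<in> ideal_prod GA (augmentation_ideal G) (Aug r)" using Suc.prems by simp
 thus ?case
 proof (induction rule: ideal_prod.induct)
  case (prod i j)
  thus ?case using Suc.IH star_closed by (simp add: aug_ideal_iff ga_simps)
 qed (simp add: ga_simps over_add)
qed (simp add: ga_simps)

lemma Aug_Suc_prod: "u \<in> augmentation_ideal G ==> v \<in> Aug r ==> u \<star> v \<in> Aug (Suc r)"
 using ideal_prod.prod[of u "augmentation_ideal G" v "Aug r" "group_algebra G"] by (simp add: ga_simps)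

lemma Aug_Suc_induct [consumes 1, case_names prod add]:
 assumes "u \<in> Aug (Suc r)" "\<And>u v. u \<in> augmentation_ideal G ==> v \<in> Aug r ==> P (u \<star> v)"
  "\<And>u v. u \<in> Aug (Suc r) ==> v \<in> Aug (Suc r) ==> P u ==> P v ==> P (u + v)"
 shows "P u"
proof -
 have "u \<in> ideal_prod GA (augmentation_ideal G) (Aug r)" using assms(1) by simp
 hence "u \<in> Aug (Suc r) \<and> P u"
 proof (induction rule: ideal_prod.induct)
  case (prod i j)
  thus ?case using assms(2) Aug_Suc_prod by (simp add: ga_simps del: augmentation_power.simps)
 next
  case (sum a b)
  thus ?case using assms(3) Aug_add by (simp add: ga_simps del: augmentation_power.simps)
 qed
 thus ?thesis by simp
qed

declare augmentation_power.simps(2) [simp del]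

lemma Aug_0 [simp]: "u \<in> Aug 0 \<longleftrightarrow> u over \<G>" by (simp add: ga_simps)

declare augmentation_power.simps(1) [simp del]

lemma Aug_1: "Aug (Suc 0) = augmentation_ideal G"
proof
 show "Aug (Suc 0) \<subseteq> augmentation_ideal G"
 proof
  fix u assume "u \<in> Aug (Suc 0)"
  thus "u \<in> augmentation_ideal G" by (induction rule: Aug_Suc_induct)
    (simp_all add: aug_ideal_iff star_closed augmentation_star pairing_add over_add)
 qed
 show "augmentation_ideal G \<subseteq> Aug (Suc 0)"
 proof
  fix u assume u: "u \<in> augmentation_ideal G"
  thus "u \<in> Aug (Suc 0)" using Aug_Suc_prod[OF u, of unit 0] by (simp add: aug_ideal_iff)
 qed
qed

lemma Aug_scl: "u \<in> Aug r ==> scl c u \<in> Aug r"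
proof (cases r)
 case (Suc n)
 assume "u \<in> Aug r"
 hence "u \<in> Aug (Suc n)" using Suc by simp
 hence "scl c u \<in> Aug (Suc n)"
 proof (induction rule: Aug_Suc_induct)
  case (prod u v)
  hence "scl c u \<in> augmentation_ideal G" using order_trans[OF keys_scl[of c u]] by (simp add: aug_ideal_iff pairing_scl)
  from Aug_Suc_prod[OF this prod(2)] show ?case by (simp add: star_scl)
 qed (simp add: scl_add Aug_add)
 thus ?thesis using Suc by simp
qed (use order_trans[OF keys_scl[of c u]] in simp)

lemma Aug_subsp: "subsp (Aug r) CG"
proof (rule free_subspI)
 have "0 \<in> augmentation_ideal G" by (simp add: aug_ideal_iff)
 hence "0 \<in> Aug (Suc 0)" by (simp add: Aug_1)
 show "0 \<in> Aug r" by (induction r) (use Aug_Suc_prod[OF \<open>0 \<in> augmentation_ideal G\<close>] in auto)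
qed (use Aug_closed Aug_add Aug_scl in auto)

lemmas AugD = free_subspD[OF Aug_subsp]

lemma Aug_left: "a over \<G> ==> u \<in> Aug r ==> a \<star> u \<in> Aug r"
proof (cases r)
 case (Suc n)
 assume a: "a over \<G>" and "u \<in> Aug r"
 hence "u \<in> Aug (Suc n)" using Suc by simp
 hence "a \<star> u \<in> Aug (Suc n)"
 proof (induction rule: Aug_Suc_induct)
  case (prod u v)
  have "a \<star> u \<in> augmentation_ideal G" using prod a by (simp add: aug_ideal_iff star_closed augmentation_star)
  from Aug_Suc_prod[OF this prod(2)] show ?case using star_assoc[OF a, of u v] prod Aug_closed by (simp add: aug_ideal_iff)
 qed (simp add: star_add Aug_add)
 thus ?thesis using Suc by simp
qed (simp add: star_closed)

lemma Aug_right: "u \<in> Aug r ==> a over \<G> ==> u \<star> a \<in> Aug r"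
proof (induction r arbitrary: u)
 case (Suc r)
 from Suc.prems(1) show ?case
 proof (induction rule: Aug_Suc_induct)
  case (prod u v)
  thus ?case using Aug_Suc_prod[OF prod(1) Suc.IH[OF prod(2) Suc.prems(2)]] star_assoc[of u v a] Aug_closed Suc.prems(2) by (simp add: aug_ideal_iff)
 qed (simp add: star_add Aug_add)
qed (simp add: star_closed)

lemma Aug_Suc_subset: "u \<in> Aug (Suc r) ==> u \<in> Aug r" by (induction rule: Aug_Suc_induct) (auto simp: aug_ideal_iff intro: Aug_left Aug_add)

lemma Aug_antimono: "i \<le> j ==> u \<in> Aug j ==> u \<in> Aug i" by (induction j rule: dec_induct) (auto intro: Aug_Suc_subset)

lemma Aug_star: "u \<in> Aug i ==> v \<in> Aug j ==> u \<star> v \<in> Aug (i + j)"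
proof (induction i arbitrary: u)
 case (Suc i)
 from Suc.prems(1) show ?case
 proof (induction rule: Aug_Suc_induct)
  case (prod a b)
  thus ?case using Aug_Suc_prod[OF prod(1) Suc.IH[OF prod(2) Suc.prems(2)]] star_assoc[of a b v] Aug_closed Suc.prems(2) by (simp add: aug_ideal_iff)
 qed (simp add: star_add Aug_add)
qed (simp add: Aug_left)

section \<open>The elements x - 1 and the lower central series\<close>

abbreviation dlt where "dlt x \<equiv> single x (1::complex) - unit"

lemma dlt_closed: "x \<in> \<G> ==> (dlt x) over \<G>" by (rule over_diff) auto

lemma dlt_augmentation: "x \<in> \<G> ==> dlt x \<in> augmentation_ideal G" by (simp add: aug_ideal_iff dlt_closed pairing_diff)

lemma dlt_mult: "x \<in> \<G> ==> y \<in> \<G> ==> dlt (x \<otimes> y) = dlt x \<star> dlt y + dlt x + dlt y" by (simp add: star_diff)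

text \<open>[x,y] - 1 = (xy - yx)(yx)^-1, and xy - yx is unchanged when 1 is subtracted from both x
  and y.\<close>

lemma dlt_commutator:
 assumes "x \<in> \<G>" "y \<in> \<G>"
 shows "dlt (com x y) = (dlt x \<star> dlt y - dlt y \<star> dlt x) \<star> single (inv x \<otimes> inv y) 1"
proof -
 have e: "com x y = (x \<otimes> y) \<otimes> (inv x \<otimes> inv y)" "\<one> = (y \<otimes> x) \<otimes> (inv x \<otimes> inv y)"
  unfolding commutator_def using assms by (simp_all add: m_assoc)
 have d: "dlt x \<star> dlt y - dlt y \<star> dlt x = single (x \<otimes> y) 1 - single (y \<otimes> x) 1" using assms by (simp add: star_diff)
 show ?thesis unfolding d by (simp add: star_diff e[symmetric])
qed

text \<open>Induction on k through \<open>dlt_commutator\<close>. Both [a,b] and [b,a] are treated,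
  because the generated subgroup involves inverses of the generators.\<close>

lemma dlt_lcs: "x \<in> lcs G k ==> dlt x \<in> Aug k"
proof (induction k arbitrary: x)
 case 0
 thus ?case by (simp add: dlt_closed)
next
 case (Suc k)
 show ?case
 proof (cases "k = 0")
  case True
  thus ?thesis using Suc.prems by (simp add: Aug_1 dlt_augmentation)
 next
  case False
  hence "x \<in> generate G {com x y | x y. x \<in> lcs G k \<and> y \<in> \<G>}" using Suc.prems lcs_Suc[of k] by simp
  moreover have com: "dlt (com a b) \<in> Aug (Suc k) \<and> dlt (com b a) \<in> Aug (Suc k)" if ab: "a \<in> lcs G k" "b \<in> \<G>" for a b
  proof -
   have "dlt a \<star> dlt b - dlt b \<star> dlt a \<in> Aug (Suc k)"
    using Aug_star[OF Suc.IH[OF ab(1)], of "dlt b" 1] Aug_star[of "dlt b" 1, OF _ Suc.IH[OF ab(1)]] dlt_augmentation[OF ab(2)]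
    by (intro AugD(5)) (simp_all add: Aug_1)
   from this AugD(6)[OF this] show ?thesis using ab lcs_mem by (simp add: dlt_commutator Aug_right)
  qed
  ultimately have "x \<in> \<G> \<and> dlt x \<in> Aug (Suc k)"
  proof (induction rule: generate.induct)
   case one
   thus ?case using AugD(2) by simp
  next
   case (incl h)
   then obtain a b where "h = com a b" "a \<in> lcs G k" "b \<in> \<G>" by auto
   thus ?case using com[of a b] lcs_mem by simp
  next
   case (inv h)
   then obtain a b where ab: "h = com a b" "a \<in> lcs G k" "b \<in> \<G>" by auto
   thus ?case using com[of a b] lcs_mem by (simp add: com_inv)
  next
   case (eng a b)
   hence "dlt a \<star> dlt b + dlt a + dlt b \<in> Aug (Suc k)" by (intro AugD(3) Aug_left[OF dlt_closed]) simp_all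
   thus ?case using eng by (simp add: dlt_mult)
  qed
  thus ?thesis by simp
 qed
qed

text \<open>Subtracting its augmentation turns any chain into a combination of elements x -
  1.\<close>

lemma augmentation_ideal_span:
 assumes "u \<in> augmentation_ideal G" "subsp N (free_module S)" "\<And>x. x \<in> \<G> ==> dlt x \<in> N"
 shows "u \<in> N"
proof -
 note D = free_subspD[OF assms(2)]
 have "v - scl (pairing (\<lambda>_. 1) v) unit \<in> N" if "v over \<G>" for v :: "'a \<Rightarrow>\<^sub>0 complex" using that
 proof (induction v rule: pm_induct)
  case zero
  show ?case using D(2) by simp
 next
  case (single x c)
  thus ?case using D(4)[OF assms(3), of x c] by (simp add: scl_diff)
 next
  case (add u v)
  thus ?case using D(3)[OF add(3,4)] by (simp add: pairing_add single_add algebra_simps)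
 qed
 from this[of u] show ?thesis using assms(1) by (simp add: aug_ideal_iff)
qed

text \<open>\<open>\<complex>[G] \<otimes> \<complex>[G]\<close> as the group algebra of \<open>G \<times> G\<close>.\<close>

abbreviation tens where "tens u v \<equiv> bilinear Pair u v"
abbreviation "square_mult x y \<equiv> x \<otimes>\<^bsub>G \<times>\<times> G\<^esub> y"
abbreviation star2 (infixl "\<star>\<star>" 70) where "u \<star>\<star> v \<equiv> bilinear square_mult u v"
abbreviation "T2 \<equiv> tensor_filtration G"
abbreviation "\<Delta> \<equiv> pushforward (\<lambda>g. (g, g))"
abbreviation "\<mu> \<equiv> pushforward (\<lambda>(x, y). x \<otimes> y)"

interpretation GG: group "G \<times>\<times> G" by (rule DirProd_group[OF is_group is_group])

lemma tens_star2: "tens u v \<star>\<star> tens u' v' = tens (u \<star> u') (v \<star> v')"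
proof -
 have k: "w over UNIV" for w :: "'a \<Rightarrow>\<^sub>0 complex" by simp
 show ?thesis using k[of u]
 proof (induction u rule: pm_induct)
  case (single a p)
  show ?case using k[of v]
  proof (induction v rule: pm_induct)
   case (single b q)
   show ?case using k[of u']
   proof (induction u' rule: pm_induct)
    case (single c r)
    show ?case using k[of v'] by (induction v' rule: pm_induct)
      (simp_all add: bilin_addL bilin_addR star_add mult_ac)
   qed (simp_all add: bilin_addL bilin_addR star_add)
  qed (simp_all add: bilin_addL bilin_addR star_add)
 qed (simp_all add: bilin_addL bilin_addR star_add)
qed

lemma tens_closed: "u over \<G> ==> v over \<G> ==> (tens u v) over \<G> \<times> \<G>" by (rule keys_bilinear) auto

lemma T2_generators: "{tens u v | u v i j. i + j = r \<and> u \<in> Aug i \<and> v \<in> Aug j} \<subseteq> carrier (free_module (\<G> \<times> \<G>))"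
 using tens_closed Aug_closed by fastforce

lemma T2_subsp: "subsp (T2 r) (free_module (\<G> \<times> \<G>))" unfolding tensor_filtration_def by (rule span_of_subsp[OF free_cvs T2_generators])

lemmas T2D = free_subspD[OF T2_subsp]

lemma T2_base: "u \<in> Aug i ==> v \<in> Aug j ==> tens u v \<in> T2 (i + j)" unfolding tensor_filtration_def by (rule span_of_base[OF free_cvs T2_generators]) auto

lemma T2_induct:
 assumes "w \<in> T2 r" "subsp N (free_module S)"
  "\<And>u v i j. i + j = r ==> u \<in> Aug i ==> v \<in> Aug j ==> f (tens u v) \<in> N"
  "f \<in> lin_hom (free_module (\<G> \<times> \<G>)) (free_module S)"
 shows "f w \<in> N" using span_of_image[OF assms(4) free_cvs free_cvs T2_generators assms(1)[unfolded tensor_filtration_def] _ assms(2)] assms(3) by fastforce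

lemma T2_star2: "w \<in> T2 r ==> w' \<in> T2 s ==> w \<star>\<star> w' \<in> T2 (r + s)"
proof -
 have c: "(w \<star>\<star> w') over \<G> \<times> \<G>" if "w over \<G> \<times> \<G>" "w' over \<G> \<times> \<G>" for w w'
  using GG.star_closed[of w w'] that by (simp add: GG.star_def)
 have 1: "tens u v \<star>\<star> w' \<in> T2 (r + s)" if uv: "i + j = r" "u \<in> Aug i" "v \<in> Aug j" and w': "w' \<in> T2 s" for u v i j w'
 proof (rule T2_induct[OF w' T2_subsp, where f = "\<lambda>w'. tens u v \<star>\<star> w'"])
  show "tens u v \<star>\<star> tens u' v' \<in> T2 (r + s)" if "i' + j' = s" "u' \<in> Aug i'" "v' \<in> Aug j'" for u' v' i' j'
  proof -
   have e: "(i + i') + (j + j') = r + s" using that(1) uv(1) by simp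
   from T2_base[OF Aug_star[OF uv(2) that(2)] Aug_star[OF uv(3) that(3)]] show ?thesis unfolding tens_star2 e .
  qed
  show "(\<lambda>w'. tens u v \<star>\<star> w') \<in> lin_hom (free_module (\<G> \<times> \<G>)) (free_module (\<G> \<times> \<G>))"
   by (rule lin_homI) (use c tens_closed[of u v] Aug_closed uv in "simp_all add: bilin_addR bilin_sclR")
 qed
 assume w: "w \<in> T2 r" and w': "w' \<in> T2 s"
 show "w \<star>\<star> w' \<in> T2 (r + s)" by (rule T2_induct[OF w T2_subsp, where f = "\<lambda>w. w \<star>\<star> w'"])
   (use 1[OF _ _ _ w'] c T2D(1)[OF w'] in "auto intro!: lin_homI simp: bilin_addL bilin_sclL")
qed

lemma T2_all: "w over \<G> \<times> \<G> ==> w \<in> T2 0"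
proof (erule span_free_module[OF _ T2_subsp])
 fix z assume "z \<in> \<G> \<times> \<G>"
 thus "single z 1 \<in> T2 0" using T2_base[of "single (fst z) 1" 0 "single (snd z) 1" 0] by (auto simp: prod_eq_iff)
qed

lemma T2_ideal:
 assumes "w \<in> T2 r" "a over \<G> \<times> \<G>"
 shows "a \<star>\<star> w \<in> T2 r" "w \<star>\<star> a \<in> T2 r"
 using T2_star2[OF T2_all[OF assms(2)] assms(1)] T2_star2[OF assms(1) T2_all[OF assms(2)]] by simp_all

lemma T2_tens_unit: "u \<in> Aug r ==> tens u unit \<in> T2 r" "u \<in> Aug r ==> tens unit u \<in> T2 r" using T2_base[of u r unit 0] T2_base[of unit 0 u r] by simp_all

lemma comult_star: "u over \<G> ==> v over \<G> ==> \<Delta> (u \<star> v) = \<Delta> u \<star>\<star> \<Delta> v" by (rule push_star) auto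

lemma comult_closed: "u over \<G> ==> (\<Delta> u) over \<G> \<times> \<G>" by (erule keys_pushforward) auto

text \<open>\<open>dlt x\<close> is sent to
  \<open>tens (dlt x) (single x 1) + tens unit (dlt x)\<close>, which has filtration degree 1;
  \<Delta> is multiplicative, and so is the filtration.\<close>

lemma comult_Aug: "u \<in> Aug r ==> \<Delta> u \<in> T2 r"
proof (induction r arbitrary: u)
 case 0
 thus ?case by (simp add: T2_all comult_closed)
next
 case (Suc r)
 have I: "\<Delta> u \<in> T2 1" if "u \<in> augmentation_ideal G" for u
 proof -
  have L: "\<Delta> \<in> lin_hom CG (free_module (\<G> \<times> \<G>))" by (rule push_lin_hom) auto
  have "u \<in> {u \<in> carrier CG. \<Delta> u \<in> T2 1}"
  proof (rule augmentation_ideal_span[OF that lin_vimage[OF L free_cvs T2_subsp]])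
   fix x assume x: "x \<in> \<G>"
   have "\<Delta> (dlt x) = tens (dlt x) (single x 1) + tens unit (dlt x)" by (simp add: push_diff bilinear_diff_left bilinear_diff_right)
   moreover have "tens (dlt x) (single x 1) \<in> T2 (1 + 0)" "tens unit (dlt x) \<in> T2 (0 + 1)" using x by (intro T2_base; simp add: Aug_1 dlt_augmentation)+
   ultimately show "dlt x \<in> {u \<in> carrier CG. \<Delta> u \<in> T2 1}" using x T2D(3) dlt_closed by simp
  qed
  thus ?thesis by simp
 qed
 from Suc.prems show ?case
 proof (induction rule: Aug_Suc_induct)
  case (prod u v)
  thus ?case using T2_star2[OF I[OF prod(1)] Suc.IH[OF prod(2)]] comult_star[of u v] Aug_closed by (simp add: aug_ideal_iff)
 qed (simp add: push_add T2D(3))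
qed

lemma mu_T2: "w \<in> T2 r ==> \<mu> w \<in> Aug r"
proof (erule T2_induct[OF _ Aug_subsp])
 show "\<mu> (tens u v) \<in> Aug r" if "i + j = r" "u \<in> Aug i" "v \<in> Aug j" for u v i j
  using Aug_star[OF that(2,3)] that(1) by (simp add: push_bilinear star_def)
 show "\<mu> \<in> lin_hom (free_module (\<G> \<times> \<G>)) CG" by (rule push_lin_hom) auto
qed

text \<open>Primitivity modulo the r-th step of the tensor filtration: the condition that a
  primitive element of the completion imposes on its representative at level r. It holds on all of
  I^r.\<close>

definition Prim :: "nat => ('a \<Rightarrow>\<^sub>0 complex) set" where
 "Prim r = {u. u over \<G> \<and> \<Delta> u - tens u unit - tens unit u \<in> T2 r}"

lemma Prim_subsp: "subsp (Prim r) CG"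
proof (rule free_subspI)
 show "0 \<in> Prim r" using T2D(2) by (simp add: Prim_def)
 fix u assume u: "u \<in> Prim r"
 thus "u over \<G>" by (simp add: Prim_def)
 show "scl c u \<in> Prim r" for c using u order_trans[OF keys_scl[of c u]] T2D(4)[of "\<Delta> u - tens u unit - tens unit u" r c]
  by (simp add: Prim_def push_scl bilin_sclL bilin_sclR scl_diff)
 fix v assume v: "v \<in> Prim r"
 have "\<Delta> (u + v) - tens (u + v) unit - tens unit (u + v) = (\<Delta> u - tens u unit - tens unit u) + (\<Delta> v - tens v unit - tens unit v)"
  by (simp add: push_add bilin_addL bilin_addR)
 thus "u + v \<in> Prim r" using u v T2D(3) by (simp add: Prim_def over_add)
qed

lemmas PrimD = free_subspD[OF Prim_subsp]

lemma Aug_Prim: "u \<in> Aug r ==> u \<in> Prim r" unfolding Prim_def using T2D(5)[OF T2D(5)[OF comult_Aug T2_tens_unit(1)] T2_tens_unit(2)] Aug_closed by auto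

abbreviation "prim_part u \<equiv> tens u unit + tens unit u"

lemma Prim_iff: "u \<in> Prim r \<longleftrightarrow> u over \<G> \<and> \<Delta> u - prim_part u \<in> T2 r" by (simp add: Prim_def diff_diff_eq)

lemma prim_part_closed: "u over \<G> ==> (prim_part u) over \<G> \<times> \<G>" by (intro over_add tens_closed) auto

lemma T2_star2_cong:
 assumes "a - a' \<in> T2 r" "b - b' \<in> T2 r" "a over \<G> \<times> \<G>" "b' over \<G> \<times> \<G>"
 shows "a \<star>\<star> b - a' \<star>\<star> b' \<in> T2 r"
proof -
 have "a \<star>\<star> b - a' \<star>\<star> b' = a \<star>\<star> (b - b') + (a - a') \<star>\<star> b'" by (simp add: bilinear_diff_left bilinear_diff_right)
 thus ?thesis using T2D(3)[OF T2_ideal(1)[OF assms(2,3)] T2_ideal(2)[OF assms(1,4)]] by simp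
qed

text \<open>In the product of two primitive parts the mixed terms \<open>tens u v + tens v u\<close>
  are symmetric in u and v and cancel in the commutator.\<close>

lemma Prim_bracket:
 assumes "u \<in> Prim r" "v \<in> Prim r"
 shows "u \<star> v - v \<star> u \<in> Prim r"
proof -
 note k = PrimD(1)[OF assms(1)] PrimD(1)[OF assms(2)]
 note P = assms[unfolded Prim_iff, THEN conjunct2]
 have pp: "prim_part u \<star>\<star> prim_part v - prim_part v \<star>\<star> prim_part u = prim_part (u \<star> v - v \<star> u)"
  using k by (simp add: bilin_addL bilin_addR bilinear_diff_left bilinear_diff_right tens_star2)
 have gen: "(a - b) - (c - d) = (a - c) - (b - d)" for a b c d :: "'a \<times> 'a \<Rightarrow>\<^sub>0 complex" by simp
 have A: "\<Delta> u \<star>\<star> \<Delta> v - prim_part u \<star>\<star> prim_part v \<in> T2 r"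
  by (rule T2_star2_cong[OF P comult_closed[OF k(1)] prim_part_closed[OF k(2)]])
 have B: "\<Delta> v \<star>\<star> \<Delta> u - prim_part v \<star>\<star> prim_part u \<in> T2 r"
  by (rule T2_star2_cong[OF P(2,1) comult_closed[OF k(2)] prim_part_closed[OF k(1)]])
 have "(\<Delta> u \<star>\<star> \<Delta> v - prim_part u \<star>\<star> prim_part v) - (\<Delta> v \<star>\<star> \<Delta> u - prim_part v \<star>\<star> prim_part u) =
  \<Delta> (u \<star> v - v \<star> u) - (prim_part u \<star>\<star> prim_part v - prim_part v \<star>\<star> prim_part u)"
  unfolding comult_star[OF k] comult_star[OF k(2,1)] push_diff by (rule gen)
 with T2D(5)[OF A B] have "\<Delta> (u \<star> v - v \<star> u) - (prim_part u \<star>\<star> prim_part v - prim_part v \<star>\<star> prim_part u) \<in> T2 r"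
  by (simp only:)
 thus ?thesis unfolding Prim_iff pp using star_closed[OF k] star_closed[OF k(2,1)] over_diff by blast
qed

text \<open>The convolution square of the identity, or second Adams operation: it sends a group
  element to its square and doubles primitive elements.\<close>

definition sq :: "('a \<Rightarrow>\<^sub>0 complex) => ('a \<Rightarrow>\<^sub>0 complex)" where
 "sq u = \<mu> (\<Delta> u)"

lemma sq_simps: "sq (u + v) = sq u + sq v" "sq (scl c u) = scl c (sq u)" "sq (u - v) = sq u - sq v" "sq 0 = 0"
 "sq (single x c) = single (x \<otimes> x) c" by (simp_all add: sq_def push_add push_scl push_diff)

lemma sq_closed: "u over \<G> ==> (sq u) over \<G>" unfolding sq_def by (rule keys_pushforward[OF comult_closed]) auto

lemma sq_Aug: "u \<in> Aug r ==> sq u \<in> Aug r" unfolding sq_def by (intro mu_T2 comult_Aug)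

lemma mu_tens: "\<mu> (tens u v) = u \<star> v" by (simp add: push_bilinear star_def)

lemma Prim_sq: "u \<in> Prim r ==> sq u - scl 2 u \<in> Aug r"
proof -
 assume u: "u \<in> Prim r"
 have "\<mu> (\<Delta> u - prim_part u) \<in> Aug r" using u mu_T2 by (simp add: Prim_iff)
 moreover have "\<mu> (\<Delta> u - prim_part u) = sq u - (u + u)" using PrimD(1)[OF u] by (simp add: sq_def push_diff push_add mu_tens)
 moreover have "u + u = scl 2 u" using add_scl[of 1 1 u] by simp
 ultimately show ?thesis by simp
qed

lemma augmentation_sq: "pairing (\<lambda>_. 1) (sq u) = pairing (\<lambda>_. 1) u"
proof -
 have "u over UNIV" by simp
 thus ?thesis by (induction u rule: pm_induct) (simp_all add: sq_simps pairing_add)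
qed

text \<open>Squaring preserves the augmentation, yet doubles a primitive element modulo I^r, hence
  modulo I; so the augmentation equals its own double.\<close>

lemma Prim_augmentation: "u \<in> Prim r ==> r \<ge> 1 ==> u \<in> augmentation_ideal G"
proof -
 assume u: "u \<in> Prim r" and r: "r \<ge> 1"
 have "sq u - scl 2 u \<in> Aug (Suc 0)" using Aug_antimono[OF _ Prim_sq[OF u], of "Suc 0"] r by simp
 thus ?thesis using PrimD(1)[OF u] by (simp add: Aug_1 aug_ideal_iff pairing_diff pairing_scl augmentation_sq)
qed

end

section \<open>The Eulerian idempotent\<close>

text \<open>The steps are adjacent transpositions, since one of them changes a product by a single
  shorter product.\<close>

inductive rearranged :: "'b list => 'b list => bool" where
 same: "rearranged xs xs"
| swap: "rearranged (xs @ a # b # ys) (xs @ b # a # ys)"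
| step: "rearranged xs ys ==> rearranged ys zs ==> rearranged xs zs"

lemma rearranged_Cons: "rearranged xs ys ==> rearranged (k # xs) (k # ys)"
proof (induction rule: rearranged.induct)
 case (swap xs a b ys)
 show ?case using rearranged.swap[of "k # xs"] by simp
qed (auto intro: rearranged.intros)

lemma rearranged_front: "rearranged (a @ k # b) (k # a @ b)"
proof (induction a)
 case (Cons x a)
 show ?case using rearranged.step[OF rearranged_Cons[OF Cons] rearranged.swap[of "[]", simplified]] by simp
qed (simp add: rearranged.same)

text \<open>The terms of the coproduct of a product of primitive elements: each factor goes either
  to the left or to the right.\<close>

primrec splits :: "'b list => ('b list \<times> 'b list) list" where
 "splits [] = [([], [])]"
| "splits (k # ks) = map (\<lambda>(a, b). (k # a, b)) (splits ks) @ map (\<lambda>(a, b). (a, k # b)) (splits ks)"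

lemma length_splits: "length (splits ks) = 2 ^ length ks" by (induction ks) auto

lemma splits_rearranged: "(a, b) \<in> set (splits ks) ==> rearranged (a @ b) ks"
proof (induction ks arbitrary: a b)
 case (Cons k ks)
 then consider a' where "a = k # a'" "(a', b) \<in> set (splits ks)" | b' where "b = k # b'" "(a, b') \<in> set (splits ks)" by auto
 thus ?case
 proof cases
  case 1
  thus ?thesis using rearranged_Cons[OF Cons.IH] by simp
 next
  case 2
  thus ?thesis using rearranged.step[OF rearranged_front rearranged_Cons[OF Cons.IH]] by simp
 qed
qed (simp add: rearranged.same)

lemma splits_subset: "(a, b) \<in> set (splits ks) ==> set a \<subseteq> set ks \<and> set b \<subseteq> set ks" by (induction ks arbitrary: a b) fastforce+

lemma sum_list_near_const:
 assumes "subsp N (free_module S)" "\<And>x. x \<in> set xs ==> f x - u \<in> N"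
 shows "sum_list (map f xs) - scl (of_nat (length xs)) u \<in> N" using assms(2)
proof (induction xs)
 case (Cons x xs)
 have "sum_list (map f (x # xs)) - scl (of_nat (length (x # xs))) u = (f x - u) + (sum_list (map f xs) - scl (of_nat (length xs)) u)" by (simp add: add_scl)
 moreover have "(f x - u) + (sum_list (map f xs) - scl (of_nat (length xs)) u) \<in> N" by (rule free_subspD(3)[OF assms(1)]) (use Cons in auto)
 ultimately show ?case by (simp only:)
qed (use free_subspD(2)[OF assms(1)] in simp)

lemma push_sum_list: "pushforward f (sum_list us) = sum_list (map (pushforward f) us)" by (induction us) (simp_all add: push_add)

lemma bilinear_sum_list: "bilinear m u (sum_list vs) = sum_list (map (bilinear m u) vs)" by (induction vs) (simp_all add: bilin_addR)

lemma two_power_neq: "m \<noteq> 1 ==> 2 - 2 ^ m \<noteq> (0::complex)"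
proof
 assume "m \<noteq> 1" "2 - 2 ^ m = (0::complex)"
 hence "of_nat (2 ^ m) = (of_nat (2 ^ 1) :: complex)" by simp
 hence "(2::nat) ^ m = 2 ^ 1" unfolding of_nat_eq_iff .
 thus False using \<open>m \<noteq> 1\<close> power_inject_exp[of "2::nat" m 1] by simp
qed

section \<open>Products of primitive elements under the squaring operator\<close>

context group
begin

abbreviation "lprod ks \<equiv> foldr (\<star>) ks unit"

lemma lprod_closed: "(\<And>k. k \<in> set ks ==> k over \<G>) ==> (lprod ks) over \<G>" by (induction ks) (simp_all add: star_closed)

lemma lprod_append:
 assumes "\<And>k. k \<in> set ks \<union> set ls ==> k over \<G>"
 shows "lprod (ks @ ls) = lprod ks \<star> lprod ls" using assms
proof (induction ks)
 case Nil
 thus ?case using lprod_closed[of ls] by simp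
next
 case (Cons k ks)
 have "lprod (ks @ ls) = lprod ks \<star> lprod ls" by (rule Cons.IH) (use Cons.prems in auto)
 moreover have "k over \<G>" "(lprod ks) over \<G>" "(lprod ls) over \<G>" using Cons.prems by (auto intro!: lprod_closed simp del: subset_iff)
 ultimately show ?case using star_assoc by simp
qed

text \<open>\<Delta> is multiplicative and agrees with \<open>prim_part\<close> on each factor
  modulo \<open>T2 r\<close>; expanding the product of the primitive parts gives one term for each
  split.\<close>

lemma comult_lprod:
 "set ks \<subseteq> Prim r ==> \<Delta> (lprod ks) - sum_list (map (\<lambda>(a, b). tens (lprod a) (lprod b)) (splits ks)) \<in> T2 r"
proof (induction ks)
 case Nil
 thus ?case using T2D(2) by simp
next
 case (Cons k ks)
 define S where "S = sum_list (map (\<lambda>(a, b). tens (lprod a) (lprod b)) (splits ks))"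
 have k: "k over \<G>" "\<Delta> k - prim_part k \<in> T2 r" using Cons.prems by (simp_all add: Prim_iff)
 have cl: "(lprod a) over \<G>" if "set a \<subseteq> set ks" for a using that Cons.prems PrimD(1)[of _ r] by (intro lprod_closed) auto
 have Scl: "S over \<G> \<times> \<G>"
 proof -
  have "(sum_list (map (\<lambda>(a, b). tens (lprod a) (lprod b)) xs)) over \<G> \<times> \<G>" if "set xs \<subseteq> set (splits ks)" for xs using that
  proof (induction xs)
   case (Cons x xs)
   obtain a b where x: "x = (a, b)" by (cases x)
   hence "(a, b) \<in> set (splits ks)" using Cons.prems by simp
   from splits_subset[OF this] have "(tens (lprod a) (lprod b)) over \<G> \<times> \<G>" using cl by (intro tens_closed) auto
   thus ?case using Cons x by (simp add: over_add)
  qed simp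
  thus ?thesis unfolding S_def by simp
 qed
 have "\<Delta> k \<star>\<star> \<Delta> (lprod ks) - prim_part k \<star>\<star> S \<in> T2 r" unfolding S_def
  by (rule T2_star2_cong[OF k(2) Cons.IH comult_closed[OF k(1)] Scl[unfolded S_def]]) (use Cons.prems in simp)
 moreover have "prim_part k \<star>\<star> S = sum_list (map (\<lambda>(a, b). tens (lprod a) (lprod b)) (splits (k # ks)))"
 proof -
  have "sum_list (map (\<lambda>x. prim_part k \<star>\<star> (case x of (a, b) => tens (lprod a) (lprod b))) (splits ks)) =
   sum_list (map (\<lambda>x. (case x of (a, b) => tens (lprod (k # a)) (lprod b)) + (case x of (a, b) => tens (lprod a) (lprod (k # b)))) (splits ks))"
  proof (rule arg_cong[of _ _ sum_list], rule map_cong[OF refl])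
   fix x assume "x \<in> set (splits ks)"
   moreover obtain a b where x: "x = (a, b)" by (cases x)
   ultimately have "(lprod a) over \<G>" "(lprod b) over \<G>" using splits_subset cl by blast+
   thus "prim_part k \<star>\<star> (case x of (a, b) => tens (lprod a) (lprod b)) =
    (case x of (a, b) => tens (lprod (k # a)) (lprod b)) + (case x of (a, b) => tens (lprod a) (lprod (k # b)))"
    unfolding x by (simp add: bilin_addL tens_star2)
  qed
  also have "\<dots> = sum_list (map (\<lambda>(a, b). tens (lprod a) (lprod b)) (splits (k # ks)))" by (simp add: sum_list_addf comp_def case_prod_unfold)
  finally show ?thesis unfolding S_def bilinear_sum_list by (simp only: map_map comp_def)
 qed
 moreover have "\<Delta> (lprod (k # ks)) = \<Delta> k \<star>\<star> \<Delta> (lprod ks)" using comult_star[OF k(1) cl[OF order_refl]] by simp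
 ultimately show ?case by (simp only:)
qed

lemma sq_lprod:
 assumes "set ks \<subseteq> Prim r"
 shows "sq (lprod ks) - sum_list (map (\<lambda>(a, b). lprod (a @ b)) (splits ks)) \<in> Aug r"
proof -
 have e: "map (\<lambda>x. \<mu> (case x of (a, b) => tens (lprod a) (lprod b))) (splits ks) = map (\<lambda>(a, b). lprod (a @ b)) (splits ks)"
 proof (rule map_cong[OF refl])
  fix x assume "x \<in> set (splits ks)"
  moreover obtain a b where x: "x = (a, b)" by (cases x)
  ultimately have "set a \<union> set b \<subseteq> set ks" using splits_subset by fastforce
  hence "lprod (a @ b) = lprod a \<star> lprod b" using assms PrimD(1)[of _ r] by (intro lprod_append) auto
  thus "\<mu> (case x of (a, b) => tens (lprod a) (lprod b)) = (case x of (a, b) => lprod (a @ b))" by (simp add: x mu_tens)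
 qed
 from mu_T2[OF comult_lprod[OF assms]] show ?thesis by (simp only: push_diff sq_def[symmetric] push_sum_list map_map comp_def e)
qed

text \<open>Normalised so that it annihilates the eigenvalue 2^m of \<open>sq\<close> and fixes the
  eigenvalue 2.\<close>

definition eig :: "nat => ('a \<Rightarrow>\<^sub>0 complex) => ('a \<Rightarrow>\<^sub>0 complex)" where
 "eig m u = scl (1 / (2 - 2 ^ m)) (sq u - scl (2 ^ m) u)"

text \<open>The product of the \<open>(sq - 2\<^sup>m) / (2 - 2\<^sup>m)\<close> over \<open>m \<le> n\<close>, \<open>m \<noteq> 1\<close>: the projection to the eigenvalue \<open>2\<close>
 of the squaring operator, i.e. the first Eulerian idempotent.\<close>

primrec eulerian :: "nat => ('a \<Rightarrow>\<^sub>0 complex) => ('a \<Rightarrow>\<^sub>0 complex)" where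
 "eulerian 0 u = eig 0 u"
| "eulerian (Suc m) u = eulerian m (if m = 0 then u else eig (Suc m) u)"

lemma eig_simps: "eig m (u + v) = eig m u + eig m v" "eig m (scl c u) = scl c (eig m u)" "eig m 0 = 0"
proof -
 show "eig m (u + v) = eig m u + eig m v" by (simp add: eig_def sq_simps scl_add scl_diff)
 have "sq (scl c u) - scl (2 ^ m) (scl c u) = scl c (sq u - scl (2 ^ m) u)" by (simp add: sq_simps scl_diff mult.commute)
 thus "eig m (scl c u) = scl c (eig m u)" by (simp add: eig_def mult.commute)
qed (simp add: eig_def sq_simps)

lemma eulerian_simps: "eulerian n (u + v) = eulerian n u + eulerian n v" "eulerian n (scl c u) = scl c (eulerian n u)"
 "eulerian n (u - v) = eulerian n u - eulerian n v" "eulerian n 0 = 0"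
proof -
 show a: "eulerian n (u + v) = eulerian n u + eulerian n v" for u v by (induction n arbitrary: u v) (simp_all add: eig_simps)
 show s: "eulerian n (scl c u) = scl c (eulerian n u)" for c u by (induction n arbitrary: u) (simp_all add: eig_simps)
 show "eulerian n (u - v) = eulerian n u - eulerian n v" using a[of u "- v"] s[of "-1" v] by simp
 show "eulerian n 0 = 0" using s[of 0 0] by simp
qed

lemma eig_closed: "u over \<G> ==> (eig m u) over \<G>" unfolding eig_def by (rule order_trans[OF keys_scl]) (rule over_diff[OF sq_closed order_trans[OF keys_scl]])

lemma eig_Aug: "u \<in> Aug r ==> eig m u \<in> Aug r" unfolding eig_def by (intro AugD(4,5) sq_Aug)

lemma eulerian_Aug: "u \<in> Aug r ==> eulerian n u \<in> Aug r" by (induction n arbitrary: u) (simp_all add: eig_Aug)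

lemma eulerian_closed: "u over \<G> ==> (eulerian n u) over \<G>" by (induction n arbitrary: u) (simp_all add: eig_closed)

lemma eulerian_lin_hom: "eulerian n \<in> lin_hom CG CG" by (rule lin_homI) (simp_all add: eulerian_simps eulerian_closed)

text \<open>On a primitive element \<open>sq\<close> is multiplication by 2 modulo I^r, so each
  factor \<open>eig m\<close> is the identity there.\<close>

lemma eulerian_Prim: "u \<in> Prim r ==> eulerian n u - u \<in> Aug r"
proof (induction n)
 have e: "eig m u - u \<in> Aug r" if u: "u \<in> Prim r" and m: "m \<noteq> 1" for m
 proof -
  have e: "sq u - scl (2 ^ m) u = (sq u - scl 2 u) + scl (2 - 2 ^ m) u" using add_scl[of "2 - 2 ^ m" "2 ^ m" u] by (simp add: algebra_simps)
  have "eig m u - u = scl (1 / (2 - 2 ^ m)) (sq u - scl 2 u)" unfolding eig_def e scl_add scl_scl using two_power_neq[OF m] by simp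
  thus ?thesis using AugD(4)[OF Prim_sq[OF u]] by simp
 qed
 {
  case 0
  thus ?case using e[of 0] by simp
 next
  case (Suc n)
  show ?case
  proof (cases "n = 0")
   case True
   thus ?thesis using e[OF Suc.prems, of 0] by simp
  next
   case False
   have E: "eulerian (Suc n) u - u = eulerian n (eig (Suc n) u - u) + (eulerian n u - u)" using False by (simp add: eulerian_simps)
   have "eig (Suc n) u - u \<in> Aug r" using e[OF Suc.prems] False by simp
   from AugD(3)[OF eulerian_Aug[OF this] Suc.IH[OF Suc.prems]] show ?thesis unfolding E .
  qed
 }
qed

text \<open>The unit has eigenvalue 1 = 2^0, which the factor with m = 0 annihilates.\<close>

lemma eulerian_unit: "eulerian n unit = 0"
proof (induction n)
 have e: "eig m unit = scl ((1 - 2 ^ m) / (2 - 2 ^ m)) unit" for m by (simp add: eig_def sq_simps scl_diff single_diff[symmetric] diff_divide_distrib)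
 {
  case 0
  show ?case using e[of 0] by simp
 next
  case (Suc n)
  show ?case
  proof (cases "n = 0")
   case False
   hence "eulerian (Suc n) unit = eulerian n (scl ((1 - 2 ^ Suc n) / (2 - 2 ^ Suc n)) unit)" using e[of "Suc n"] by simp
   also have "\<dots> = 0" unfolding eulerian_simps Suc.IH by simp
   finally show ?thesis .
  qed (use e[of 0] in simp)
 }
qed

text \<open>The squaring operator multiplies a product of \<open>n\<close> primitive elements by \<open>2\<^sup>n\<close>, up to reordering, and
 reordering changes a product by shorter products in which two factors are replaced by their commutator.\<close>

context
 fixes r :: nat and \<L> :: "('a \<Rightarrow>\<^sub>0 complex) list set"
 assumes ne: "\<And>ks. ks \<in> \<L> ==> ks \<noteq> []"
  and prim: "\<And>ks. ks \<in> \<L> ==> set ks \<subseteq> Prim r"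
  and sw: "\<And>xs a b ys. xs @ a # b # ys \<in> \<L> ==> xs @ b # a # ys \<in> \<L>"
  and br: "\<And>xs a b ys. xs @ a # b # ys \<in> \<L> ==> xs @ (a \<star> b - b \<star> a) # ys \<in> \<L>"
begin

text \<open>The filtration by length, as in the Poincare-Birkhoff-Witt theorem; I^r is added so that
  congruences modulo I^r become memberships.\<close>

definition products :: "nat => ('a \<Rightarrow>\<^sub>0 complex) set" where
 "products n = span_of CG ({lprod ks | ks. ks \<in> \<L> \<and> length ks \<le> n} \<union> Aug r)"

lemma Lclosed: "ks \<in> \<L> ==> k \<in> set ks ==> k over \<G>" using prim PrimD(1) by blast

lemma products_generators: "{lprod ks | ks. ks \<in> \<L> \<and> length ks \<le> n} \<union> Aug r \<subseteq> carrier CG"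
proof
 fix u assume "u \<in> {lprod ks | ks. ks \<in> \<L> \<and> length ks \<le> n} \<union> Aug r"
 thus "u \<in> carrier CG" using lprod_closed[OF Lclosed] Aug_closed by fastforce
qed

lemma products_subsp: "subsp (products n) CG" unfolding products_def by (rule span_of_subsp[OF free_cvs products_generators])

lemmas productsD = free_subspD[OF products_subsp]

lemma products_base: "ks \<in> \<L> ==> length ks \<le> n ==> lprod ks \<in> products n" "u \<in> Aug r ==> u \<in> products n"
 unfolding products_def by (rule span_of_base[OF free_cvs products_generators]; auto)+

lemma products_least:
 assumes "subsp N CG" "\<And>ks. ks \<in> \<L> ==> length ks \<le> n ==> lprod ks \<in> N" "\<And>u. u \<in> Aug r ==> u \<in> N"
  and "u \<in> products n"
 shows "u \<in> N"
proof -
 have "products n \<subseteq> N" unfolding products_def by (rule span_of_subset[OF free_cvs assms(1)]) (use assms(2,3) in auto)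
 thus ?thesis using assms(4) by auto
qed

lemma products_mono: "m \<le> n ==> u \<in> products m ==> u \<in> products n" by (rule products_least[OF products_subsp]) (auto intro: products_base)

lemma lprod_rearranged:
 "rearranged xs ys ==> xs \<in> \<L> ==> ys \<in> \<L> \<and> length ys = length xs \<and> lprod xs - lprod ys \<in> products (length xs - 1)"
proof (induction rule: rearranged.induct)
 case (same xs)
 thus ?case using productsD(2) by simp
next
 case (swap xs a b ys)
 note L = Lclosed[OF swap]
 have k: "a over \<G>" "b over \<G>" "(lprod ys) over \<G>" "(lprod xs) over \<G>" using L by (auto intro!: lprod_closed simp del: subset_iff)
 have ap: "lprod (xs @ zs) = lprod xs \<star> lprod zs" if "\<And>k. k \<in> set zs ==> k over \<G>" for zs by (rule lprod_append) (use that L in auto)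
 have kb: "(a \<star> b - b \<star> a) over \<G>" using k by (intro over_diff star_closed)
 have ys: "k over \<G>" if "k \<in> set ys" for k using L[of k] that by simp
 have "lprod (xs @ a # b # ys) = lprod xs \<star> (a \<star> (b \<star> lprod ys))" "lprod (xs @ b # a # ys) = lprod xs \<star> (b \<star> (a \<star> lprod ys))"
  "lprod (xs @ (a \<star> b - b \<star> a) # ys) = lprod xs \<star> ((a \<star> b - b \<star> a) \<star> lprod ys)" by (subst ap; use k kb ys in force)+
 hence "lprod (xs @ a # b # ys) - lprod (xs @ b # a # ys) = lprod (xs @ (a \<star> b - b \<star> a) # ys)" using k by (simp add: star_diff star_assoc)
 thus ?case using sw[OF swap] products_base(1)[OF br[OF swap]] by simp
next
 case (step xs ys zs)
 hence "lprod xs - lprod zs = (lprod xs - lprod ys) + (lprod ys - lprod zs)" by simp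
 thus ?case using step productsD(3) by (metis (no_types, lifting))
qed

text \<open>Modulo I^r the image of a product is a sum of 2^n rearrangements of it, one for each
  split, and each of them differs from the product by shorter ones.\<close>

lemma sq_products_top:
 assumes "ks \<in> \<L>" "length ks = n"
 shows "sq (lprod ks) - scl (2 ^ n) (lprod ks) \<in> products (n - 1)"
proof -
 let ?S = "sum_list (map (\<lambda>(a, b). lprod (a @ b)) (splits ks))"
 have "?S - scl (of_nat (length (splits ks))) (lprod ks) \<in> products (n - 1)"
 proof (rule sum_list_near_const[OF products_subsp])
  fix x assume "x \<in> set (splits ks)"
  moreover obtain a b where x: "x = (a, b)" by (cases x)
  ultimately have "rearranged (a @ b) ks" using splits_rearranged by blast
  hence "rearranged ks (a @ b)"
  proof (induction rule: rearranged.induct)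
   case (step xs ys zs)
   thus ?case using rearranged.step by blast
  qed (auto intro: rearranged.intros)
  from lprod_rearranged[OF this assms(1)] have "lprod ks - lprod (a @ b) \<in> products (n - 1)" using assms(2) by simp
  from productsD(6)[OF this] show "(case x of (a, b) => lprod (a @ b)) - lprod ks \<in> products (n - 1)" by (simp add: x)
 qed
 moreover have "sq (lprod ks) - ?S \<in> products (n - 1)" using products_base(2)[OF sq_lprod[OF prim[OF assms(1)]]] .
 moreover have "of_nat (length (splits ks)) = (2 ^ n :: complex)" by (simp add: length_splits assms(2))
 ultimately show ?thesis using productsD(3)[of "sq (lprod ks) - ?S" "n - 1"] by fastforce
qed

lemma sq_subsp: "subsp N CG ==> subsp {u \<in> carrier CG. sq u - scl c u \<in> N} CG"
proof (rule lin_vimage[OF _ free_cvs])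
 show "(\<lambda>u. sq u - scl c u) \<in> lin_hom CG CG"
 proof (rule lin_homI)
  show "sq (c' \<odot>\<^bsub>CG\<^esub> x) - scl c (c' \<odot>\<^bsub>CG\<^esub> x) = c' \<odot>\<^bsub>CG\<^esub> (sq x - scl c x)" for c' x
   by (simp add: sq_simps scl_diff mult.commute)
  show "sq x - scl c x \<in> carrier CG" if "x \<in> carrier CG" for x using over_diff[OF sq_closed order_trans[OF keys_scl]] that by simp
 qed (simp add: sq_simps scl_add)
qed

lemma sq_products:
 assumes "\<And>ks. ks \<in> \<L> ==> length ks \<le> n ==> sq (lprod ks) - scl c (lprod ks) \<in> products m" "u \<in> products n"
 shows "sq u - scl c u \<in> products m"
proof -
 let ?N = "{u \<in> carrier CG. sq u - scl c u \<in> products m}"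
 have "u \<in> ?N"
 proof (rule products_least[OF sq_subsp[OF products_subsp] _ _ assms(2)])
  show "lprod ks \<in> ?N" if "ks \<in> \<L>" "length ks \<le> n" for ks using assms(1)[OF that] productsD(1)[OF products_base(1)[OF that]] by simp
  fix u assume u: "u \<in> Aug r"
  from products_base(2)[OF AugD(5)[OF sq_Aug[OF u] AugD(4)[OF u]]] Aug_closed[OF u] show "u \<in> ?N" by simp
 qed
 thus ?thesis by simp
qed

text \<open>On a product of length n the operator \<open>eig n\<close> removes the leading term,
  because 2^n is its eigenvalue there; no \<open>eig m\<close> increases the length.\<close>

lemma eig_products:
 assumes "u \<in> products n"
 shows "eig n u \<in> products (n - 1)" "eig m u \<in> products n"
proof -
 have stay: "sq u - scl (2 ^ m) u \<in> products n" if "u \<in> products n" for u n m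
 proof (rule sq_products[OF _ that])
  fix ks assume ks: "ks \<in> \<L>" "length ks \<le> n"
  have "sq (lprod ks) - scl (2 ^ m) (lprod ks) = (sq (lprod ks) - scl (2 ^ length ks) (lprod ks)) + scl (2 ^ length ks - 2 ^ m) (lprod ks)"
   using add_scl[of "2 ^ length ks - 2 ^ m" "2 ^ m" "lprod ks"] by (simp add: algebra_simps)
  moreover have "sq (lprod ks) - scl (2 ^ length ks) (lprod ks) \<in> products n" by (rule products_mono[OF _ sq_products_top[OF ks(1) refl]]) (use ks in simp)
  ultimately show "sq (lprod ks) - scl (2 ^ m) (lprod ks) \<in> products n" using productsD(3)[OF _ productsD(4)[OF products_base(1)[OF ks]]] by (simp only:)
 qed
 thus "eig m u \<in> products n" unfolding eig_def using productsD(4) assms by blast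
 have "sq u - scl (2 ^ n) u \<in> products (n - 1)"
 proof (rule sq_products[OF _ assms])
  fix ks assume ks: "ks \<in> \<L>" "length ks \<le> n"
  show "sq (lprod ks) - scl (2 ^ n) (lprod ks) \<in> products (n - 1)"
  proof (cases "length ks = n")
   case True
   thus ?thesis using sq_products_top[OF ks(1)] by simp
  next
   case False
   thus ?thesis using stay[OF products_base(1)[OF ks(1)], of "n - 1"] ks(2) by simp
  qed
 qed
 thus "eig n u \<in> products (n - 1)" unfolding eig_def using productsD(4) by simp
qed

text \<open>The factors with large m are applied first. Each \<open>eig m\<close> with m >= 2 lowers
  the length bound from m to m - 1, and the omission of m = 1 is what lets length 1 survive.\<close>

lemma eulerian_products: "u \<in> products n ==> n \<ge> 1 ==> eulerian n u \<in> products 1"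
proof (induction n arbitrary: u)
 case (Suc n)
 show ?case
 proof (cases "n = 0")
  case True
  thus ?thesis using eig_products(2)[OF Suc.prems(1), of 0] by simp
 next
  case False
  thus ?thesis using Suc.IH[of "eig (Suc n) u"] eig_products(1)[OF Suc.prems(1)] by simp
 qed
qed simp

text \<open>Primitive elements lie in I, so products longer than r lie in I^r, and the idempotent of
  order r treats products of every length. Its image is spanned by one-element lists of \<L> and
  I^r; only those are tested against \<open>N\<close>.\<close>

lemma eulerian_lprod:
 assumes r: "r \<ge> 1" and N: "subsp N CG" "\<And>u. u \<in> Aug r ==> u \<in> N" "\<And>k. [k] \<in> \<L> ==> k \<in> N"
  and ks: "ks \<in> \<L>"
 shows "eulerian r (lprod ks) \<in> N"
proof -
 have "lprod ks' \<in> Aug (length ks')" if "set ks' \<subseteq> set ks" for ks' using that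
 proof (induction ks')
  case (Cons k ks')
  hence "k \<in> Aug (Suc 0)" using Prim_augmentation[OF _ r] prim[OF ks] by (auto simp: Aug_1)
  from Aug_star[OF this, of "lprod ks'"] Cons show ?case by simp
 qed simp
 hence len: "lprod ks \<in> Aug (length ks)" by simp
 have "lprod ks \<in> products r"
 proof (cases "length ks \<le> r")
  case False
  thus ?thesis using products_base(2)[OF Aug_antimono[OF _ len]] by simp
 qed (use products_base(1) ks in auto)
 from eulerian_products[OF this r] show ?thesis
 proof (rule products_least[OF N(1), rotated 2])
  fix ls assume ls: "ls \<in> \<L>" "length ls \<le> 1"
  then obtain k where k: "ls = [k]" using ne[OF ls(1)] by (cases ls) auto
  thus "lprod ls \<in> N" using N(3)[of k] ls Lclosed[OF ls(1), of k] by simp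
 qed (use N(2) in auto)
qed

end

end

section \<open>Logarithms of group elements\<close>

definition binomial_poly :: "nat => complex poly" where
 "binomial_poly j = Polynomial.smult (1 / fact j) (\<Prod>i<j. [:- of_nat i, 1:])"

lemma poly_binomial_poly: "poly (binomial_poly j) (of_nat s) = of_nat (s choose j)"
 by (simp add: binomial_poly_def poly_prod binomial_gbinomial gbinomial_prod_rev lessThan_atLeast0)

lemma degree_binomial_poly: "degree (binomial_poly j) \<le> j"
proof -
 have "degree (\<Prod>i<j. [:- of_nat i, 1 :: complex:]) \<le> sum (degree \<circ> (\<lambda>i. [:- of_nat i, 1 :: complex:])) {..<j}" by (rule degree_prod_sum_le) simp
 also have "\<dots> = j" by simp
 finally show ?thesis unfolding binomial_poly_def using degree_smult_le order_trans by blast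
qed

text \<open>The derivative at t = 0 of the binomial coefficient of t over j, that is, (-1)^(j-1)/j
  for j >= 1: log(1+z) is the derivative of (1+z)^t at t = 0.\<close>

definition log_coeff :: "nat => complex" where
 "log_coeff j = coeff (binomial_poly j) 1"

lemma log_coeff_simps: "log_coeff 0 = 0" "log_coeff (Suc 0) = 1" by (simp_all add: log_coeff_def binomial_poly_def)

lemma coeff_0_binomial_poly: "coeff (binomial_poly j) 0 = (if j = 0 then 1 else 0)" using poly_binomial_poly[of j 0] by (simp add: poly_0_coeff_0)

text \<open>Extracting the linear coefficient of a polynomial from its values: the nodes \<open>2\<^sup>i\<close> make this
 explicit, the weights being the coefficients of \<open>\<Prod>\<^sub>n\<^sub>\<noteq>\<^sub>1 (y - 2\<^sup>n) / (2 - 2\<^sup>n)\<close>.\<close>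

lemma linear_coefficient_interpolation:
 "\<exists>K lam. \<forall>p :: complex poly. degree p \<le> N \<longrightarrow> (\<Sum>i\<le>K. lam i * poly p (of_nat (2 ^ i))) = coeff p 1"
proof -
 define Q :: "complex poly" where "Q = (\<Prod>n\<in>{..N} - {1}. Polynomial.smult (1 / (2 - 2 ^ n)) [:- (2 ^ n), 1:])"
 have Q: "poly Q (2 ^ n) = (if n = 1 then 1 else 0)" if "n \<le> N" for n
 proof (cases "n = 1")
  case True
  have A: "poly (Polynomial.smult (1 / (2 - 2 ^ i)) [:- (2 ^ i), 1:]) (2 ^ 1) = (1::complex)" if "i \<noteq> 1" for i :: nat
   using two_power_neq[OF that] by (simp add: diff_divide_distrib[symmetric])
  have "poly Q (2 ^ 1) = 1" unfolding Q_def poly_prod by (intro prod.neutral ballI A) auto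
  thus ?thesis using True by simp
 next
  case False
  thus ?thesis using that by (auto simp: Q_def poly_prod intro!: prod_zero)
 qed
 have "(\<Sum>i\<le>degree Q. coeff Q i * poly p (of_nat (2 ^ i))) = coeff p 1" if p: "degree p \<le> N" for p
 proof -
  have pp: "poly p x = (\<Sum>n\<le>N. coeff p n * x ^ n)" for x unfolding poly_altdef by (rule sum.mono_neutral_left) (use p in "auto simp: coeff_eq_0")
  have "(\<Sum>i\<le>degree Q. coeff Q i * poly p (of_nat (2 ^ i))) = (\<Sum>i\<le>degree Q. \<Sum>n\<le>N. coeff p n * (coeff Q i * (2 ^ n) ^ i))"
   unfolding pp by (intro sum.cong refl) (simp add: sum_distrib_left mult_ac flip: power_mult)
  also have "\<dots> = (\<Sum>n\<le>N. \<Sum>i\<le>degree Q. coeff p n * (coeff Q i * (2 ^ n) ^ i))" by (rule sum.swap)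
  also have "\<dots> = (\<Sum>n\<le>N. coeff p n * poly Q (2 ^ n))" by (simp add: poly_altdef sum_distrib_left)
  also have "\<dots> = (\<Sum>n\<le>N. if n = 1 then coeff p 1 else 0)" by (intro sum.cong refl) (simp add: Q)
  also have "\<dots> = coeff p 1" using p by (auto simp: coeff_eq_0)
  finally show ?thesis .
 qed
 thus ?thesis by blast
qed

lemma sum_mem_subsp: "subsp N (free_module S) ==> (\<And>i. i \<in> I ==> f i \<in> N) ==> sum f I \<in> N"
 by (induction I rule: infinite_finite_induct) (auto dest: free_subspD(2,3))

lemma bilinear_sum_left: "bilinear m (sum f I) v = (\<Sum>i\<in>I. bilinear m (f i) v)" by (induction I rule: infinite_finite_induct) (simp_all add: bilin_addL)

lemma bilinear_sum_right: "bilinear m u (sum f I) = (\<Sum>i\<in>I. bilinear m u (f i))" by (induction I rule: infinite_finite_induct) (simp_all add: bilin_addR)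

lemma push_sum: "pushforward h (sum f I) = (\<Sum>i\<in>I. pushforward h (f i))" by (induction I rule: infinite_finite_induct) (simp_all add: push_add)

lemma scl_sum_left: "scl (sum a I) u = (\<Sum>i\<in>I. scl (a i) u)" by (rule poly_mapping_eqI) (simp add: lookup_sum sum_distrib_right)

section \<open>Truncated logarithms\<close>

context group
begin

declare eulerian.simps [simp del]

lemma star_lin_hom:
 assumes "v over \<G>"
 shows "(\<lambda>u. u \<star> v) \<in> lin_hom CG CG"
  "(\<lambda>u. v \<star> u) \<in> lin_hom CG CG" by (rule lin_homI; use assms in "simp add: star_closed star_add star_scl")+

abbreviation "pw z j \<equiv> lprod (replicate j z)"

lemma pw_closed: "z over \<G> ==> (pw z j) over \<G>" by (rule lprod_closed) auto

lemma pw_Aug: "z \<in> Aug k ==> pw z j \<in> Aug (k * j)" by (induction j) (simp_all add: Aug_star)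

lemma pw_dlt_Aug: "x \<in> \<G> ==> r \<le> j ==> pw (dlt x) j \<in> Aug r" using pw_Aug[of "dlt x" 1 j] dlt_augmentation[of x] by (auto simp: Aug_1 intro: Aug_antimono)

text \<open>The binomial theorem for x = 1 + (x - 1). The upper limit \<open>M\<close> is left free,
  so that several powers of x can be expanded over one range.\<close>

lemma group_power_expansion:
 assumes x: "x \<in> \<G>"
 shows "s \<le> M ==> single (x [^] s) 1 = (\<Sum>j\<le>M. scl (of_nat (s choose j)) (pw (dlt x) j))"
proof (induction s arbitrary: M)
 case 0
 have "(\<Sum>j\<le>M. scl (of_nat (0 choose j)) (pw (dlt x) j)) = (\<Sum>j\<in>{0}. scl (of_nat (0 choose j)) (pw (dlt x) j))"
  by (rule sum.mono_neutral_right) (auto simp: binomial_eq_0)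
 thus ?case by simp
next
 case (Suc s)
 then obtain M' where M: "M = Suc M'" "s \<le> M'" by (cases M) auto
 let ?p = "\<lambda>j. pw (dlt x) j"
 have "single (x [^] Suc s) 1 = single x 1 \<star> single (x [^] s) 1" using x nat_pow_comm[of x 1 s] by simp
 also have "single x 1 = dlt x + unit" by simp
 also have "(dlt x + unit) \<star> single (x [^] s) 1 = dlt x \<star> single (x [^] s) 1 + single (x [^] s) 1"
 proof -
  have "(single (x [^] s) (1::complex)) over \<G>" using x by simp
  thus ?thesis unfolding star_add by (simp only: star_unit)
 qed
 also have "dlt x \<star> single (x [^] s) 1 = (\<Sum>j\<le>M'. scl (of_nat (s choose j)) (?p (Suc j)))"
  unfolding Suc.IH[OF M(2)] star_def bilinear_sum_right bilin_sclR by simp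
 also have "single (x [^] s) 1 = (\<Sum>j\<le>Suc M'. scl (of_nat (s choose j)) (?p j))" using Suc.IH[of "Suc M'"] M(2) by simp
 also have "\<dots> = ?p 0 + (\<Sum>j\<le>M'. scl (of_nat (s choose Suc j)) (?p (Suc j)))" by (subst sum.atMost_Suc_shift) simp
 finally have "single (x [^] Suc s) 1 = ?p 0 + (\<Sum>j\<le>M'. scl (of_nat (s choose j)) (?p (Suc j)) + scl (of_nat (s choose Suc j)) (?p (Suc j)))"
  by (simp only: sum.distrib add.assoc add.commute add.left_commute)
 also have "\<dots> = ?p 0 + (\<Sum>j\<le>M'. scl (of_nat (Suc s choose Suc j)) (?p (Suc j)))" by (simp only: binomial_Suc_Suc of_nat_add add_scl)
 also have "\<dots> = (\<Sum>j\<le>Suc M'. scl (of_nat (Suc s choose j)) (?p j))" by (subst sum.atMost_Suc_shift) simp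
 finally show ?case unfolding M .
qed

text \<open>The logarithm series in x - 1 cut off below degree r: the r-th term of a sequence that
  represents log x in the completion.\<close>

definition lg :: "nat => 'a => ('a \<Rightarrow>\<^sub>0 complex)" where
 "lg r x = (\<Sum>j<r. scl (log_coeff j) (pw (dlt x) j))"

lemma lg_closed: "x \<in> \<G> ==> (lg r x) over \<G>" unfolding lg_def by (rule keys_sum_subset) (rule order_trans[OF keys_scl pw_closed[OF dlt_closed]])

lemma lg_compatible:
 assumes x: "x \<in> \<G>"
 shows "r \<le> s ==> lg s x - lg r x \<in> Aug r"
proof (induction s rule: dec_induct)
 case (step n)
 have E: "lg (Suc n) x - lg r x = (lg n x - lg r x) + scl (log_coeff n) (pw (dlt x) n)" by (simp add: lg_def)
 show ?case unfolding E by (rule AugD(3)[OF step.IH AugD(4)[OF pw_dlt_Aug[OF x step.hyps(1)]]])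
qed (simp add: AugD(2))

lemma lg_minus_dlt:
 assumes "x \<in> \<G>" "r \<ge> 2"
 shows "lg r x - dlt x = (\<Sum>j\<in>{..<r} - {0, 1}. scl (log_coeff j) (pw (dlt x) j))"
proof -
 have "lg r x = (\<Sum>j\<in>{..<r} - {0, 1}. scl (log_coeff j) (pw (dlt x) j)) + (\<Sum>j\<in>{0, 1}. scl (log_coeff j) (pw (dlt x) j))"
  unfolding lg_def by (rule sum.subset_diff) (use assms(2) in auto)
 thus ?thesis using star_unit(2)[OF dlt_closed[OF assms(1)]] by (simp add: log_coeff_simps)
qed

text \<open>With x - 1 in I^k the j-th term of the series lies in I^(jk), and the linear term is x -
  1 itself.\<close>

lemma lg_lcs:
 assumes x: "x \<in> lcs G k"
 shows "lg r x \<in> Aug k" "r \<ge> 2 ==> lg r x - dlt x \<in> Aug (2 * k)"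
proof -
 note z = dlt_lcs[OF x]
 have p: "scl (log_coeff j) (pw (dlt x) j) \<in> Aug (i * k)" if "i \<le> j" for i j using AugD(4)[OF Aug_antimono[OF _ pw_Aug[OF z]]] that by simp
 have "scl (log_coeff j) (pw (dlt x) j) \<in> Aug k" for j using p[of 1 j] AugD(2) by (cases "j = 0") (simp_all add: log_coeff_simps)
 thus "lg r x \<in> Aug k" unfolding lg_def by (intro sum_mem_subsp[OF Aug_subsp])
 assume r: "r \<ge> 2"
 have "lg r x - dlt x = (\<Sum>j\<in>{..<r} - {0, 1}. scl (log_coeff j) (pw (dlt x) j))" by (rule lg_minus_dlt[OF lcs_mem[OF x] r])
 also have "\<dots> \<in> Aug (2 * k)" by (rule sum_mem_subsp[OF Aug_subsp]) (use p[of 2] in auto)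
 finally show "lg r x - dlt x \<in> Aug (2 * k)" .
qed

lemma T2_base_le: "u \<in> Aug i ==> v \<in> Aug j ==> r \<le> i + j ==> tens u v \<in> T2 r"
proof -
 assume "u \<in> Aug i" "v \<in> Aug j" "r \<le> i + j"
 hence "r - min i r \<le> j" by (cases "i \<le> r") (simp_all add: le_diff_conv add.commute)
 hence "u \<in> Aug (min i r)" "v \<in> Aug (r - min i r)"
  using Aug_antimono[of "min i r" i u] Aug_antimono[of "r - min i r" j v] \<open>u \<in> Aug i\<close> \<open>v \<in> Aug j\<close> by simp_all
 moreover have e: "min i r + (r - min i r) = r" by simp
 ultimately show ?thesis using T2_base[of u "min i r" v "r - min i r"] unfolding e by blast
qed

text \<open>Modulo I^r the logarithm is a combination \<open>W\<close> of the group elements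
  x^(2^i), with weights that extract the coefficient of t from x^t. On group elements \<Delta> is
  explicit, and the coefficients of the defect of \<open>W\<close> from primitivity are linear
  coefficients of polynomials in t without linear term, except in filtration degree at least
  r.\<close>

lemma lg_Prim:
 assumes x: "x \<in> \<G>"
 shows "lg r x \<in> Prim r"
proof -
 let ?p = "\<lambda>j. pw (dlt x) j"
 obtain K lam where lam: "\<And>p :: complex poly. degree p \<le> r ==> (\<Sum>i\<le>K. lam i * poly p (of_nat (2 ^ i))) = coeff p 1"
  using linear_coefficient_interpolation[of r] by blast
 \<comment> \<open>Large enough for every exponent 2^i and for the range below r.\<close>
 define M where "M = r + (2::nat) ^ K"
 define b where "b i j = (of_nat (2 ^ i choose j) :: complex)" for i j :: nat
 define h where "h i = single (x [^] (2 ^ i :: nat)) (1::complex)" for i :: nat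
 define W where "W = (\<Sum>i\<le>K. scl (lam i) (h i))"
 have node: "h i = (\<Sum>j\<le>M. scl (b i j) (?p j))" if "i \<le> K" for i
 proof -
  have "(2::nat) ^ i \<le> 2 ^ K" using that by simp
  hence "(2::nat) ^ i \<le> M" unfolding M_def by (rule trans_le_add2)
  from group_power_expansion[OF x this] show ?thesis unfolding b_def h_def .
 qed
 have unit: "unit = (\<Sum>j\<le>M. scl (if j = 0 then 1 else 0) (?p j))"
 proof -
  have "(\<Sum>j\<le>M. scl (if j = 0 then 1 else 0) (?p j)) = (\<Sum>j\<in>{0}. scl (if j = 0 then 1 else 0) (?p j))" by (rule sum.mono_neutral_right) auto
  thus ?thesis by simp
 qed
 have W: "W = (\<Sum>j\<le>M. scl (\<Sum>i\<le>K. lam i * b i j) (?p j))"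
 proof -
  have "W = (\<Sum>i\<le>K. \<Sum>j\<le>M. scl (lam i * b i j) (?p j))" unfolding W_def by (intro sum.cong refl) (simp add: node scl_sum)
  also have "\<dots> = (\<Sum>j\<le>M. \<Sum>i\<le>K. scl (lam i * b i j) (?p j))" by (rule sum.swap)
  finally show ?thesis by (simp add: scl_sum_left)
 qed
 \<comment> \<open>The interpolation is exact up to degree r; for larger j the coefficients are
   uncontrolled, but then the power of x - 1 lies in I^r.\<close>
 have c: "(\<Sum>i\<le>K. lam i * b i j) = log_coeff j" if "j \<le> r" for j
  using lam[of "binomial_poly j"] degree_binomial_poly[of j] that by (simp add: b_def log_coeff_def poly_binomial_poly flip: of_nat_power)
 have "W - lg r x \<in> Aug r"
 proof -
  have "W = (\<Sum>j\<in>{..M} - {..<r}. scl (\<Sum>i\<le>K. lam i * b i j) (?p j)) + (\<Sum>j\<in>{..<r}. scl (\<Sum>i\<le>K. lam i * b i j) (?p j))"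
   unfolding W by (rule sum.subset_diff) (auto simp: M_def)
  also have "(\<Sum>j\<in>{..<r}. scl (\<Sum>i\<le>K. lam i * b i j) (?p j)) = lg r x" unfolding lg_def by (intro sum.cong refl) (simp add: c)
  finally have "W - lg r x = (\<Sum>j\<in>{..M} - {..<r}. scl (\<Sum>i\<le>K. lam i * b i j) (?p j))" by simp
  also have "\<dots> \<in> Aug r" by (rule sum_mem_subsp[OF Aug_subsp], rule AugD(4), rule pw_dlt_Aug[OF x]) auto
  finally show ?thesis .
 qed
 moreover have "W \<in> Prim r"
 proof -
  have expand: "tens (\<Sum>j\<le>M. scl (a j) (?p j)) (\<Sum>j\<le>M. scl (a' j) (?p j)) = (\<Sum>j\<le>M. \<Sum>l\<le>M. scl (a j * a' l) (tens (?p j) (?p l)))" for a a'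
   unfolding bilinear_sum_left unfolding bilinear_sum_right by (simp add: bilin_sclL bilin_sclR mult.commute)
  define e where "e i j l = b i j * b i l - b i j * (if l = 0 then 1 else 0) - (if j = 0 then 1 else 0) * b i l" for i j l
  have "\<Delta> W - prim_part W = (\<Sum>i\<le>K. scl (lam i) (tens (h i) (h i)
    - tens (h i) unit - tens unit (h i)))"
   unfolding W_def push_sum bilinear_sum_left bilinear_sum_right by (simp add: sum.distrib[symmetric] sum_subtractf[symmetric] scl_diff scl_add diff_diff_eq h_def)
  also have "\<dots> = (\<Sum>i\<le>K. scl (lam i) (\<Sum>j\<le>M. \<Sum>l\<le>M. scl (e i j l) (tens (?p j) (?p l))))"
  proof (intro sum.cong refl arg_cong[of _ _ "scl _"])
   fix i assume "i \<in> {..K}"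
   hence i: "i \<le> K" by simp
   have diff_scl: "scl (s - t) u = scl s u - scl t u" for s t and u :: "'a \<times> 'a \<Rightarrow>\<^sub>0 complex"
    using add_scl[of "s - t" t u] by (simp add: algebra_simps)
   show "tens (h i) (h i)
    - tens (h i) unit - tens unit (h i) =
    (\<Sum>j\<le>M. \<Sum>l\<le>M. scl (e i j l) (tens (?p j) (?p l)))"
    unfolding node[OF i] by (subst (1 2) unit) (simp only: expand e_def diff_scl sum_subtractf)
  qed
  also have "\<dots> = (\<Sum>i\<le>K. \<Sum>j\<le>M. \<Sum>l\<le>M. scl (lam i * e i j l) (tens (?p j) (?p l)))" by (simp add: scl_sum)
  also have "\<dots> = (\<Sum>j\<le>M. \<Sum>i\<le>K. \<Sum>l\<le>M. scl (lam i * e i j l) (tens (?p j) (?p l)))" by (rule sum.swap)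
  also have "\<dots> = (\<Sum>j\<le>M. \<Sum>l\<le>M. \<Sum>i\<le>K. scl (lam i * e i j l) (tens (?p j) (?p l)))" by (intro sum.cong refl sum.swap)
  also have "\<dots> = (\<Sum>j\<le>M. \<Sum>l\<le>M. scl (\<Sum>i\<le>K. lam i * e i j l) (tens (?p j) (?p l)))" by (simp add: scl_sum_left)
  also have "\<dots> \<in> T2 r"
  proof (intro sum_mem_subsp[OF T2_subsp])
   fix j l
   show "scl (\<Sum>i\<le>K. lam i * e i j l) (tens (?p j) (?p l)) \<in> T2 r"
   proof (cases "r \<le> j + l")
    case True
    thus ?thesis using T2_base_le[OF pw_dlt_Aug[OF x order_refl] pw_dlt_Aug[OF x order_refl]] T2D(4) by blast
   next
    case False
    \<comment> \<open>If j and l are positive, both binomial polynomials vanish at 0 and their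
      product has no linear term; otherwise the subtracted terms cancel it.\<close>
    let ?q = "binomial_poly j * binomial_poly l - Polynomial.smult (if l = 0 then 1 else 0) (binomial_poly j) - Polynomial.smult (if j = 0 then 1 else 0) (binomial_poly l)"
    have "degree (binomial_poly j * binomial_poly l) \<le> j + l"
     using degree_mult_le[of "binomial_poly j" "binomial_poly l"] degree_binomial_poly[of j] degree_binomial_poly[of l] by linarith
    hence "degree ?q \<le> r" using degree_binomial_poly[of j] degree_binomial_poly[of l] False degree_smult_le
     by (intro degree_diff_le) (auto intro: order_trans[OF degree_smult_le])
    from lam[OF this] have "(\<Sum>i\<le>K. lam i * e i j l) = coeff ?q 1" by (simp add: e_def b_def poly_binomial_poly mult.commute flip: of_nat_power)
    also have "\<dots> = 0" by (simp add: coeff_mult coeff_0_binomial_poly)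
    finally show ?thesis using T2D(2) by simp
   qed
  qed
  finally show ?thesis unfolding Prim_iff W_def h_def using x by (auto intro!: keys_sum_subset order_trans[OF keys_scl] split: if_splits)
 qed
 ultimately have "W - (W - lg r x) \<in> Prim r" using PrimD(5)[OF _ Aug_Prim] by blast
 thus ?thesis by simp
qed

text \<open>Inverting the logarithm: \<open>x - 1\<close> is a power series in \<open>log x\<close> with linear coefficient \<open>1\<close>.\<close>

lemma dlt_lg:
 assumes x: "x \<in> \<G>" and N: "subsp N CG" "\<And>u. u \<in> Aug r ==> u \<in> N"
 shows "(\<And>m. m \<ge> 1 ==> pw (lg r x) m \<in> N) ==> dlt x \<in> N"
  and "r \<ge> 2 ==> (\<And>m. m \<ge> 2 ==> pw (lg r x) m \<in> N) ==> dlt x - lg r x \<in> N"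
proof -
 let ?z = "dlt x" and ?L = "lg r x"
 note ND = free_subspD[OF N(1)]
 \<comment> \<open>Powers of x - 1 with exponent at least j, modulo I^r. The powers of log x will
   span the same filtration.\<close>
 define Z where "Z j = span_of CG ({pw ?z i | i. j \<le> i} \<union> Aug r)" for j
 have gen: "{pw ?z i | i. j \<le> i} \<union> Aug r \<subseteq> carrier CG" for j using pw_closed[OF dlt_closed[OF x]] Aug_closed by fastforce
 have Zs: "subsp (Z j) CG" for j unfolding Z_def by (rule span_of_subsp[OF free_cvs gen])
 note ZD = free_subspD[OF Zs]
 have Zb: "i \<ge> j ==> pw ?z i \<in> Z j" "u \<in> Aug r ==> u \<in> Z j" for i j u unfolding Z_def by (rule span_of_base[OF free_cvs gen]; auto)+
 have Zl: "u \<in> N'" if "subsp N' CG" "\<And>i. j \<le> i ==> pw ?z i \<in> N'" "\<And>u. u \<in> Aug r ==> u \<in> N'" "u \<in> Z j" for N' u j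
 proof -
  have "Z j \<subseteq> N'" unfolding Z_def by (rule span_of_subset[OF free_cvs that(1)]) (use that(2,3) in auto)
  thus ?thesis using that(4) by auto
 qed
 have Zmono: "u \<in> Z j" if "i \<ge> j" "u \<in> Z i" for u i j by (rule Zl[OF Zs _ _ that(2)]) (use Zb that in auto)
 have Zm: "u \<star> v \<in> Z (i + j)" if u: "u \<in> Z i" and v: "v \<in> Z j" for u v i j
 proof -
  have 1: "pw ?z a \<star> v \<in> Z (i + j)" if a: "i \<le> a" for a
  proof -
   have "v \<in> {v \<in> carrier CG. pw ?z a \<star> v \<in> Z (i + j)}"
   proof (rule Zl[OF lin_vimage[OF star_lin_hom(2)[OF pw_closed[OF dlt_closed[OF x]]] free_cvs Zs] _ _ v])
    fix b assume b: "j \<le> b"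
    have "lprod (replicate a ?z @ replicate b ?z) = pw ?z a \<star> pw ?z b" by (rule lprod_append) (use dlt_closed[OF x] in auto)
    hence "pw ?z a \<star> pw ?z b = pw ?z (a + b)" by (simp only: replicate_add)
    thus "pw ?z b \<in> {v \<in> carrier CG. pw ?z a \<star> v \<in> Z (i + j)}" using Zb(1)[of "i + j" "a + b"] a b pw_closed[OF dlt_closed[OF x]] by simp
   qed (use Zb(2) Aug_left[OF pw_closed[OF dlt_closed[OF x]]] Aug_closed in auto)
   thus ?thesis by simp
  qed
  have "u \<in> {u \<in> carrier CG. u \<star> v \<in> Z (i + j)}" by (rule Zl[OF lin_vimage[OF star_lin_hom(1)[OF ZD(1)[OF v]] free_cvs Zs] _ _ u])
    (use 1 pw_closed[OF dlt_closed[OF x]] Zb(2) Aug_right[OF _ ZD(1)[OF v]] Aug_closed in auto)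
  thus ?thesis by simp
 qed
 have z1: "?z \<in> Z 1" using Zb(1)[of 1 1] star_unit(2)[OF dlt_closed[OF x]] by simp
 have L1: "?L \<in> Z 1" unfolding lg_def
 proof (rule sum_mem_subsp[OF Zs])
  show "scl (log_coeff j) (pw ?z j) \<in> Z 1" for j using ZD(4)[OF Zb(1)[of 1 j]] ZD(2) by (cases "j = 0") (simp_all add: log_coeff_simps)
 qed
 have Lz: "?L - ?z \<in> Z 2"
 proof (cases "r \<ge> 2")
  case True
  have "?L - ?z = (\<Sum>j\<in>{..<r} - {0, 1}. scl (log_coeff j) (pw ?z j))" by (rule lg_minus_dlt[OF x True])
  also have "\<dots> \<in> Z 2" by (rule sum_mem_subsp[OF Zs], rule ZD(4), rule Zb(1)) auto
  finally show ?thesis .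
 next
  \<comment> \<open>For \<open>r < 2\<close> the truncation has lost its linear term, but both
    elements lie in I^r.\<close>
  case False
  hence "?z \<in> Aug r" "?L \<in> Aug r" using Aug_antimono[of r 1] dlt_augmentation[OF x] lg_lcs(1)[of x 1 r] x by (auto simp: Aug_1)
  thus ?thesis using Zb(2) AugD(5) by blast
 qed
 have pL: "pw ?L j \<in> Z j" for j
 proof (induction j)
  case 0
  show ?case using Zb(1)[of 0 0] by simp
 next
  case (Suc j)
  show ?case using Zm[OF L1 Suc] by simp
 qed
 have diff: "pw ?L j - pw ?z j \<in> Z (Suc j)" for j
 proof (induction j)
  case 0
  show ?case using ZD(2) by simp
 next
  case (Suc j)
  have "pw ?L (Suc j) - pw ?z (Suc j) = (?L - ?z) \<star> pw ?L j + ?z \<star> (pw ?L j - pw ?z j)" by (simp add: star_diff)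
  moreover have "(?L - ?z) \<star> pw ?L j \<in> Z (Suc (Suc j))" using Zm[OF Lz pL[of j]] by simp
  moreover have "?z \<star> (pw ?L j - pw ?z j) \<in> Z (Suc (Suc j))" using Zm[OF z1 Suc] by simp
  ultimately show ?case using ZD(3) by simp
 qed
 \<comment> \<open>Downward induction on j: from j = r on everything lies in I^r, and below that a
   power of x - 1 equals the same power of log x up to \<open>Z (Suc j)\<close>.\<close>
 have ZN: "u \<in> N" if "\<And>m. m \<ge> j ==> pw ?L m \<in> N" "u \<in> Z j" for j u using that
 proof (induction "r - j" arbitrary: j u)
  case 0
  show ?case by (rule Zl[OF N(1) _ N(2) 0(3)]) (use 0 N(2) pw_dlt_Aug[OF x] in auto)
 next
  case (Suc n)
  have S: "v \<in> N" if "v \<in> Z (Suc j)" for v using Suc.hyps(1)[of "Suc j" v] Suc.hyps(2) Suc.prems(1) that by simp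
  show ?case
  proof (rule Zl[OF N(1) _ N(2) Suc.prems(2)])
   fix i assume i: "j \<le> i"
   have "pw ?L i - pw ?z i \<in> N" using S Zmono[OF _ diff[of i], of "Suc j"] i by simp
   from ND(5)[OF Suc.prems(1)[OF i] this] show "pw ?z i \<in> N" by simp
  qed
 qed
 show "(\<And>m. m \<ge> 1 ==> pw ?L m \<in> N) ==> ?z \<in> N" using ZN[of 1 ?z] z1 by simp
 assume "\<And>m. m \<ge> 2 ==> pw ?L m \<in> N"
 from ZN[of 2 "?L - ?z", OF this Lz] have "?L - ?z \<in> N" .
 from ND(6)[OF this] show "?z - ?L \<in> N" by simp
qed

text \<open>The Baker--Campbell--Hausdorff formula, in the weak form that \<open>log xy - log x - log y\<close> is a
 combination of brackets. It is obtained by applying the Eulerian idempotent to \<open>xy\<close>.\<close>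

context
 fixes r :: nat and K1 K2 :: "('a \<Rightarrow>\<^sub>0 complex) set"
 assumes r: "r \<ge> 2" and K1: "K1 \<subseteq> Prim r"
  and K2: "subsp K2 CG" "K2 \<subseteq> K1" "Aug r \<subseteq> K2"
  and br: "\<And>u v. u \<in> K1 ==> v \<in> K1 ==> u \<star> v - v \<star> u \<in> K2"
begin

text \<open>Contracting two entries of such a list produces an entry in \<open>K2\<close>, so the
  set of lists is closed under contraction; a list of length 1 in it consists of an element of
  \<open>K2\<close>.\<close>

lemma eulerian_products_K2:
 assumes "set ks \<subseteq> K1" "length ks \<ge> 2"
 shows "eulerian r (lprod ks) \<in> K2"
proof -
 let ?L = "{ks. set ks \<subseteq> K1 \<and> ks \<noteq> [] \<and> (length ks \<ge> 2 \<or> set ks \<inter> K2 \<noteq> {})}"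
 show ?thesis
 proof (rule eulerian_lprod[of ?L])
  show "xs @ (a \<star> b - b \<star> a) # ys \<in> ?L" if "xs @ a # b # ys \<in> ?L" for xs a b ys using that br[of a b] K2(2) by auto
  show "ks \<in> ?L" using assms by auto
 qed (use K1 K2 r in auto)
qed

text \<open>The idempotent kills the unit, sends the powers of log x with exponent at least 2 into
  \<open>K2\<close> and fixes log x modulo I^r; x - 1 is log x plus such powers.\<close>

lemma eulerian_single_K2:
 assumes x: "x \<in> \<G>" and lx: "lg r x \<in> K1"
 shows "eulerian r (single x 1) - lg r x \<in> K2"
proof -
 let ?N = "{u \<in> carrier CG. eulerian r u \<in> K2}"
 have N: "subsp ?N CG" by (rule lin_vimage[OF eulerian_lin_hom free_cvs K2(1)])
 have "dlt x - lg r x \<in> ?N"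
 proof (rule dlt_lg(2)[OF x N _ r])
  show "u \<in> ?N" if "u \<in> Aug r" for u using eulerian_Aug[OF that] Aug_closed[OF that] K2(3) by auto
  show "pw (lg r x) m \<in> ?N" if "2 \<le> m" for m using eulerian_products_K2[of "replicate m (lg r x)"] lx that pw_closed[OF lg_closed[OF x]] by auto
 qed
 hence "eulerian r (single x 1) - eulerian r (lg r x) \<in> K2" by (simp add: eulerian_simps eulerian_unit)
 moreover have "eulerian r (lg r x) - lg r x \<in> K2" using eulerian_Prim[OF lg_Prim[OF x]] K2(3) by auto
 ultimately show ?thesis using free_subspD(3)[OF K2(1)] by fastforce
qed

end

text \<open>The case where \<open>K1\<close> is spanned by log x and I^r and \<open>K2\<close> is
  I^r: all brackets fall into I^r, so the idempotent sends a group element to its logarithm.\<close>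

lemma eulerian_single:
 assumes x: "x \<in> \<G>" and r: "r \<ge> 2"
 shows "eulerian r (single x 1) - lg r x \<in> Aug r"
proof (rule eulerian_single_K2[of r "{scl c (lg r x) + e | c e. e \<in> Aug r}"])
 show "{scl c (lg r x) + e | c e. e \<in> Aug r} \<subseteq> Prim r" using PrimD(3)[OF PrimD(4)[OF lg_Prim[OF x]] Aug_Prim] by auto
 show "Aug r \<subseteq> {scl c (lg r x) + e | c e. e \<in> Aug r}" by (auto intro!: exI[of _ "0::complex"])
 show "lg r x \<in> {scl c (lg r x) + e | c e. e \<in> Aug r}" by (intro CollectI exI[of _ 1] exI[of _ 0]) (simp add: AugD(2))
 fix u v assume "u \<in> {scl c (lg r x) + e | c e. e \<in> Aug r}" "v \<in> {scl c (lg r x) + e | c e. e \<in> Aug r}"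
 then obtain c e d f where uv: "u = scl c (lg r x) + e" "e \<in> Aug r" "v = scl d (lg r x) + f" "f \<in> Aug r" by blast
 note l = lg_closed[OF x, of r]
 have "u \<star> v - v \<star> u = (scl c (lg r x) \<star> f - f \<star> scl c (lg r x)) + (e \<star> v - v \<star> e)"
  unfolding uv(1,3) by (simp add: star_add star_diff star_scl scl_add algebra_simps)
 moreover have "(scl c (lg r x)) over \<G>" "v over \<G>"
  unfolding uv(3) by (rule order_trans[OF keys_scl l]) (intro over_add order_trans[OF keys_scl l] Aug_closed[OF uv(4)])
 ultimately show "u \<star> v - v \<star> u \<in> Aug r" using uv(2,4) AugD(3,5) Aug_left Aug_right by simp
qed (use r Aug_subsp x in auto)

lemma lg_mult:
 assumes r: "r \<ge> 2" and K1: "K1 \<subseteq> Prim r"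
  and K2: "subsp K2 CG" "K2 \<subseteq> K1" "Aug r \<subseteq> K2"
  and br: "\<And>u v. u \<in> K1 ==> v \<in> K1 ==> u \<star> v - v \<star> u \<in> K2"
  and x: "x \<in> \<G>" "lg r x \<in> K1" and y: "y \<in> \<G>" "lg r y \<in> K1"
 shows "lg r (x \<otimes> y) - lg r x - lg r y \<in> K2"
proof -
 note K2D = free_subspD[OF K2(1)]
 have single: "eulerian r (single z 1) - lg r z \<in> K2" if "z \<in> \<G>" "lg r z \<in> K1" for z by (rule eulerian_single_K2[OF r K1 K2]) (use br that in auto)
 let ?N = "{u \<in> carrier CG. eulerian r u \<in> K2}"
 have N: "subsp ?N CG" by (rule lin_vimage[OF eulerian_lin_hom free_cvs K2(1)])
 have AN: "u \<in> ?N" if "u \<in> Aug r" for u using eulerian_Aug[OF that] Aug_closed[OF that] K2(3) by auto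
 \<comment> \<open>Both factors are expanded in powers of their logarithms with exponents at least
   1, so every product that occurs has length at least 2 and is sent into \<open>K2\<close>.\<close>
 have "dlt x \<star> dlt y \<in> ?N"
 proof -
  have 1: "pw (lg r x) m \<star> dlt y \<in> ?N" if m: "m \<ge> 1" for m
  proof -
   note k = pw_closed[OF lg_closed[OF x(1)], of m r]
   have "dlt y \<in> {v \<in> carrier CG. pw (lg r x) m \<star> v \<in> ?N}"
   proof (rule dlt_lg(1)[OF y(1) lin_vimage[OF star_lin_hom(2)[OF k] free_cvs N]])
    show "u \<in> {v \<in> carrier CG. pw (lg r x) m \<star> v \<in> ?N}" if "u \<in> Aug r" for u using AN[OF Aug_left[OF k that]] Aug_closed[OF that] by simp
    fix n :: nat assume n: "n \<ge> 1"
    have "pw (lg r x) m \<star> pw (lg r y) n = lprod (replicate m (lg r x) @ replicate n (lg r y))" by (rule lprod_append[symmetric]) (use lg_closed x y in auto)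
    moreover have "eulerian r (lprod (replicate m (lg r x) @ replicate n (lg r y))) \<in> K2" by (rule eulerian_products_K2[OF r K1 K2 br]) (use m n x y in auto)
    ultimately show "pw (lg r y) n \<in> {v \<in> carrier CG. pw (lg r x) m \<star> v \<in> ?N}"
     using star_closed[OF k pw_closed[OF lg_closed[OF y(1)], of n r]] pw_closed[OF lg_closed[OF y(1)], of n r] by simp
   qed
   thus ?thesis by simp
  qed
  have "dlt x \<in> {v \<in> carrier CG. v \<star> dlt y \<in> ?N}"
  proof (rule dlt_lg(1)[OF x(1) lin_vimage[OF star_lin_hom(1)[OF dlt_closed[OF y(1)]] free_cvs N]])
   show "u \<in> {v \<in> carrier CG. v \<star> dlt y \<in> ?N}" if "u \<in> Aug r" for u
    using AN[OF Aug_right[OF that dlt_closed[OF y(1)]]] Aug_closed[OF that] by simp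
   show "pw (lg r x) m \<in> {v \<in> carrier CG. v \<star> dlt y \<in> ?N}" if "m \<ge> 1" for m using 1[OF that] pw_closed[OF lg_closed[OF x(1)]] by simp
  qed
  thus ?thesis by simp
 qed
 hence "eulerian r (dlt x \<star> dlt y) \<in> K2" by simp
 moreover have "eulerian r (single (x \<otimes> y) 1) = eulerian r (dlt x \<star> dlt y) + eulerian r (single x 1) + eulerian r (single y 1)"
 proof -
  have "single (x \<otimes> y) 1 = dlt x \<star> dlt y + dlt x + dlt y + unit" using dlt_mult[OF x(1) y(1)] by (simp add: algebra_simps)
  thus ?thesis by (simp only: eulerian_simps eulerian_unit) simp
 qed
 ultimately have "eulerian r (single (x \<otimes> y) 1) - eulerian r (single x 1) - eulerian r (single y 1) \<in> K2" by simp
 from K2D(3)[OF K2D(3)[OF this single[OF x]] single[OF y]]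
 have "eulerian r (single (x \<otimes> y) 1) - lg r x - lg r y \<in> K2" by (simp add: algebra_simps)
 \<comment> \<open>log xy is not known to lie in \<open>K1\<close>, so the version modulo I^r is
   used for it.\<close>
 moreover have "eulerian r (single (x \<otimes> y) 1) - lg r (x \<otimes> y) \<in> K2" using eulerian_single[OF _ r, of "x \<otimes> y"] x y K2(3) by auto
 ultimately have "(eulerian r (single (x \<otimes> y) 1) - lg r x - lg r y) - (eulerian r (single (x \<otimes> y) 1) - lg r (x \<otimes> y)) \<in> K2" by (rule K2D(5))
 thus ?thesis by (simp add: algebra_simps)
qed

section \<open>The image of gr_k in I^k/I^(k+1) and the primitive elements of I^k\<close>

definition Dlt :: "nat => ('a \<Rightarrow>\<^sub>0 complex) set" where
 "Dlt k = span_of CG ({dlt x | x. x \<in> lcs G k} \<union> Aug (Suc k))"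

lemma Dlt_generators: "{dlt x | x. x \<in> lcs G k} \<union> Aug (Suc k) \<subseteq> carrier CG"
proof
 fix u assume "u \<in> {dlt x | x. x \<in> lcs G k} \<union> Aug (Suc k)"
 thus "u \<in> carrier CG" using dlt_closed[OF lcs_mem] Aug_closed by fastforce
qed

lemma Dlt_subsp: "subsp (Dlt k) CG" unfolding Dlt_def by (rule span_of_subsp[OF free_cvs Dlt_generators])

lemma Dlt_base: "x \<in> lcs G k ==> dlt x \<in> Dlt k" "u \<in> Aug (Suc k) ==> u \<in> Dlt k"
 unfolding Dlt_def by (rule span_of_base[OF free_cvs Dlt_generators]; auto)+

lemma Dlt_least:
 assumes "subsp N CG" "\<And>x. x \<in> lcs G k ==> dlt x \<in> N" "\<And>u. u \<in> Aug (Suc k) ==> u \<in> N" "u \<in> Dlt k"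
 shows "u \<in> N"
proof -
 have "Dlt k \<subseteq> N" unfolding Dlt_def by (rule span_of_subset[OF free_cvs assms(1)]) (use assms(2,3) in auto)
 thus ?thesis using assms(4) by auto
qed

lemma Dlt_Aug: "u \<in> Dlt k ==> u \<in> Aug k" by (rule Dlt_least[OF Aug_subsp]) (auto intro: dlt_lcs Aug_Suc_subset)

lemma dlt_commutator_Aug:
 assumes "x \<in> lcs G i" "y \<in> lcs G j"
 shows "dlt (com x y) - (dlt x \<star> dlt y - dlt y \<star> dlt x) \<in> Aug (Suc (i + j))"
proof -
 note c = lcs_mem[OF assms(1)] lcs_mem[OF assms(2)]
 let ?b = "dlt x \<star> dlt y - dlt y \<star> dlt x" and ?g = "inv x \<otimes> inv y"
 have b: "?b \<in> Aug (i + j)" using Aug_star[OF dlt_lcs[OF assms(1)] dlt_lcs[OF assms(2)]] Aug_star[OF dlt_lcs[OF assms(2)] dlt_lcs[OF assms(1)]]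
  by (intro AugD(5)) (simp_all add: add.commute)
 have "dlt (com x y) - ?b = ?b \<star> dlt ?g" unfolding dlt_commutator[OF c] using Aug_closed[OF b] by (simp add: star_diff(2))
 thus ?thesis using Aug_star[OF b, of "dlt ?g" 1] dlt_augmentation[of ?g] c by (simp add: Aug_1)
qed

lemma Dlt_bracket:
 assumes u: "u \<in> Dlt i" and v: "v \<in> Dlt j"
 shows "u \<star> v - v \<star> u \<in> Dlt (i + j)"
proof -
 note DD = free_subspD[OF Dlt_subsp]
 have lin: "(\<lambda>u. u \<star> w - w \<star> u) \<in> lin_hom CG CG"
  "(\<lambda>u. w \<star> u - u \<star> w) \<in> lin_hom CG CG" if "w over \<G>" for w
  by (rule lin_homI; use that in "simp add: over_diff star_closed star_add star_scl scl_diff")+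
 have aug: "a \<star> b - b \<star> a \<in> Dlt (i + j)" if "a \<in> Aug m" "b \<in> Aug n" "m + n = Suc (i + j)" for a b m n
  using Aug_star[OF that(1,2)] Aug_star[OF that(2,1)] that(3) by (intro Dlt_base(2) AugD(5)) (simp_all add: add.commute)
 have 1: "dlt x \<star> v - v \<star> dlt x \<in> Dlt (i + j)" if x: "x \<in> lcs G i" for x
 proof -
  have "v \<in> {v \<in> carrier CG. dlt x \<star> v - v \<star> dlt x \<in> Dlt (i + j)}"
  proof (rule Dlt_least[OF lin_vimage[OF lin(2)[OF dlt_closed[OF lcs_mem[OF x]]] free_cvs Dlt_subsp] _ _ v])
   fix y assume y: "y \<in> lcs G j"
   have "dlt (com x y) - (dlt (com x y) - (dlt x \<star> dlt y - dlt y \<star> dlt x)) \<in> Dlt (i + j)"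
    using Dlt_base(1)[OF com_lcs[OF x y]] Dlt_base(2)[OF dlt_commutator_Aug[OF x y]] by (rule DD(5))
   thus "dlt y \<in> {v \<in> carrier CG. dlt x \<star> v - v \<star> dlt x \<in> Dlt (i + j)}" using dlt_closed[OF lcs_mem[OF y]] by simp
  next
   fix w assume w: "w \<in> Aug (Suc j)"
   from aug[OF dlt_lcs[OF x] w] show "w \<in> {v \<in> carrier CG. dlt x \<star> v - v \<star> dlt x \<in> Dlt (i + j)}" using Aug_closed[OF w] by simp
  qed
  thus ?thesis by simp
 qed
 have "u \<in> {u \<in> carrier CG. u \<star> v - v \<star> u \<in> Dlt (i + j)}"
 proof (rule Dlt_least[OF lin_vimage[OF lin(1)[OF DD(1)[OF v]] free_cvs Dlt_subsp] _ _ u])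
  show "dlt x \<in> {u \<in> carrier CG. u \<star> v - v \<star> u \<in> Dlt (i + j)}" if "x \<in> lcs G i" for x
   using 1[OF that] dlt_closed[OF lcs_mem[OF that]] by simp
  show "w \<in> {u \<in> carrier CG. u \<star> v - v \<star> u \<in> Dlt (i + j)}" if "w \<in> Aug (Suc i)" for w
   using aug[OF that Dlt_Aug[OF v]] Aug_closed[OF that] by simp
 qed
 thus ?thesis by simp
qed

text \<open>I^n is spanned by n-fold products of elements x - 1 up to I^(n+1), and log x agrees with
  x - 1 modulo I^2, so exchanging one factor for a logarithm costs an element of I^(n+1).\<close>

lemma Aug_lg_products:
 assumes r: "r \<ge> 2" and N: "subsp N CG" "\<And>u. u \<in> Aug (Suc n) ==> u \<in> N"
  "\<And>ks. set ks \<subseteq> lg r ` \<G> ==> length ks = n ==> lprod ks \<in> N"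
  and u: "u \<in> Aug n"
 shows "u \<in> N" using N u
proof (induction n arbitrary: u N)
 case 0
 note ND = free_subspD[OF 0(1)]
 have "u - scl (pairing (\<lambda>_. 1) u) unit \<in> Aug (Suc 0)" using 0(4) by (simp add: Aug_1 aug_ideal_iff pairing_diff over_diff)
 hence "u - scl (pairing (\<lambda>_. 1) u) unit \<in> N" using 0(2) by simp
 moreover have "unit \<in> N" using 0(3)[of "[]"] by simp
 ultimately show ?case using ND(3)[OF _ ND(4)[of unit "pairing (\<lambda>_. 1) u"], of "u - scl (pairing (\<lambda>_. 1) u) unit"] by simp
next
 case (Suc n)
 note ND = free_subspD[OF Suc.prems(1)]
 have lgN: "lg r x \<star> v \<in> N" if x: "x \<in> \<G>" and v: "v \<in> Aug n" for x v
 proof -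
  have l: "lg r x \<in> Aug 1" using lg_lcs(1)[of x 1 r] x by simp
  have "v \<in> {v \<in> carrier CG. lg r x \<star> v \<in> N}"
  proof (rule Suc.IH[OF lin_vimage[OF star_lin_hom(2)[OF lg_closed[OF x]] free_cvs Suc.prems(1)] _ _ v])
   show "w \<in> {v \<in> carrier CG. lg r x \<star> v \<in> N}" if "w \<in> Aug (Suc n)" for w using Suc.prems(2) Aug_star[OF l that] Aug_closed[OF that] by simp
   fix ks assume ks: "set ks \<subseteq> lg r ` \<G>" "length ks = n"
   have "lprod (lg r x # ks) \<in> N" by (rule Suc.prems(3)) (use ks x in auto)
   moreover have "(lprod ks) over \<G>"
   proof (rule lprod_closed)
    fix k assume "k \<in> set ks"
    then obtain y where "y \<in> \<G>" "k = lg r y" using ks by auto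
    thus "k over \<G>" by (simp add: lg_closed)
   qed
   ultimately show "lprod ks \<in> {v \<in> carrier CG. lg r x \<star> v \<in> N}" by simp
  qed
  thus ?thesis by simp
 qed
 from Suc.prems(4) show ?case
 proof (induction rule: Aug_Suc_induct)
  case (prod a v)
  have vc: "v over \<G>" using Aug_closed[OF prod(2)] .
  have "a \<in> {a \<in> carrier CG. a \<star> v \<in> N}"
  proof (rule augmentation_ideal_span[OF prod(1) lin_vimage[OF star_lin_hom(1)[OF vc] free_cvs Suc.prems(1)]])
   fix x assume x: "x \<in> \<G>"
   have "lg r x - dlt x \<in> Aug 2" using lg_lcs(2)[of x 1 r] x r by simp
   from Aug_star[OF this prod(2)] have "(lg r x - dlt x) \<star> v \<in> N" using Suc.prems(2) by simp
   from ND(5)[OF lgN[OF x prod(2)] this] show "dlt x \<in> {a \<in> carrier CG. a \<star> v \<in> N}" using dlt_closed[OF x] by (simp add: star_diff)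
  qed
  thus ?case by simp
 qed (rule ND(3))
qed

text \<open>Each factor of a product carries a weight, a degree w for which it lies in
  \<open>Dlt w\<close>, and contraction to a bracket adds weights. A product of k logarithms has
  total weight k, so the idempotent moves it into \<open>Dlt k\<close>, while it fixes
  \<open>u\<close> modulo I^(k+1).\<close>

lemma Prim_Aug_Dlt:
 assumes k: "k \<ge> 1" and u: "u \<in> Prim (Suc k)" "u \<in> Aug k"
 shows "u \<in> Dlt k"
proof -
 let ?r = "Suc k"
 let ?w = "\<lambda>u w. u \<in> Prim ?r \<and> u \<in> Dlt w"
 let ?L = "{ks. ks \<noteq> [] \<and> (\<exists>ws. list_all2 ?w ks ws \<and> sum_list ws = k)}"
 have core: "eulerian ?r (lprod ks) \<in> Dlt k" if ks: "ks \<in> ?L" for ks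
 proof (rule eulerian_lprod[of ?L])
  show "set ls \<subseteq> Prim ?r" if "ls \<in> ?L" for ls using that by (auto simp: list_all2_conv_all_nth in_set_conv_nth)
  show "xs @ b # a # ys \<in> ?L" if ab: "xs @ a # b # ys \<in> ?L" for xs a b ys
  proof -
   obtain ws where ws: "list_all2 ?w (xs @ a # b # ys) ws" "sum_list ws = k" using ab by auto
   then obtain w1 i j w2 where "ws = w1 @ i # j # w2" "list_all2 ?w xs w1" "?w a i" "?w b j" "list_all2 ?w ys w2" by (auto simp: list_all2_append1 list_all2_Cons1)
   hence "list_all2 ?w (xs @ b # a # ys) (w1 @ j # i # w2) \<and> sum_list (w1 @ j # i # w2) = k" using ws(2) by (auto intro: list_all2_appendI)
   thus ?thesis by blast
  qed
  show "xs @ (a \<star> b - b \<star> a) # ys \<in> ?L" if ab: "xs @ a # b # ys \<in> ?L" for xs a b ys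
  proof -
   obtain ws where ws: "list_all2 ?w (xs @ a # b # ys) ws" "sum_list ws = k" using ab by auto
   then obtain w1 i j w2 where w: "ws = w1 @ i # j # w2" "list_all2 ?w xs w1" "?w a i" "?w b j" "list_all2 ?w ys w2" by (auto simp: list_all2_append1 list_all2_Cons1)
   have "?w (a \<star> b - b \<star> a) (i + j)" using w(3,4) Prim_bracket Dlt_bracket by simp
   hence "list_all2 ?w (xs @ (a \<star> b - b \<star> a) # ys) (w1 @ (i + j) # w2) \<and> sum_list (w1 @ (i + j) # w2) = k"
    using w ws(2) by (auto intro: list_all2_appendI)
   thus ?thesis by blast
  qed
  show "v \<in> Dlt k" if "[v] \<in> ?L" for v using that by (auto simp: list_all2_Cons1)
 qed (use ks Dlt_subsp Dlt_base(2) in auto)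
 have "u \<in> {u \<in> carrier CG. eulerian ?r u \<in> Dlt k}"
 proof (rule Aug_lg_products[of ?r, OF _ lin_vimage[OF eulerian_lin_hom free_cvs Dlt_subsp] _ _ u(2)])
  show "2 \<le> ?r" using k by simp
  show "v \<in> {u \<in> carrier CG. eulerian ?r u \<in> Dlt k}" if "v \<in> Aug ?r" for v using Dlt_base(2)[OF eulerian_Aug[OF that]] Aug_closed[OF that] by simp
  fix ks assume ks: "set ks \<subseteq> lg ?r ` \<G>" "length ks = k"
  have el: "v over \<G> \<and> ?w v 1" if v: "v \<in> set ks" for v
  proof -
   obtain x where x: "x \<in> \<G>" "v = lg ?r x" using ks(1) v by auto
   have "lg ?r x - dlt x \<in> Aug (Suc 1)" using lg_lcs(2)[of x 1 ?r] x k by (simp add: numeral_2_eq_2)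
   from free_subspD(3)[OF Dlt_subsp Dlt_base(2)[OF this] Dlt_base(1)[of x 1]] x have "v \<in> Dlt 1" by simp
   thus ?thesis using lg_Prim lg_closed x by simp
  qed
  hence "list_all2 ?w ks (replicate k 1)" using ks(2) by (auto simp: list_all2_conv_all_nth)
  hence "ks \<in> ?L" using ks(2) k by (auto intro!: exI[of _ "replicate k 1"] simp: sum_list_replicate)
  from core[OF this] show "lprod ks \<in> {u \<in> carrier CG. eulerian ?r u \<in> Dlt k}" using lprod_closed[of ks] el by simp
 qed
 hence "eulerian ?r u \<in> Dlt k" by simp
 moreover have "eulerian ?r u - u \<in> Dlt k" using Dlt_base(2) eulerian_Prim[OF u(1)] by simp
 ultimately have "eulerian ?r u - (eulerian ?r u - u) \<in> Dlt k" by (rule free_subspD(5)[OF Dlt_subsp])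
 thus ?thesis by simp
qed

end

section \<open>The Malcev Lie algebra\<close>

lemma span_insert:
 fixes V (structure)
 assumes V: "cvs V" and B: "insert b B \<subseteq> carrier V" and v: "v \<in> span_of V (insert b B)"
 shows "\<exists>c w. w \<in> span_of V B \<and> v = c \<odot> b \<oplus> w"
proof -
 have B': "B \<subseteq> carrier V" and b: "b \<in> carrier V" using B by auto
 note SD = subspD[OF span_of_subsp[OF V B']]
 note C = cvs_add_smult[OF V] cvs_smult_smult[OF V] cvs_smult_add[OF V] cvs_assoc[OF V] cvs_lcomm[OF V]
 show ?thesis using V v B
 proof (induction rule: span_of_induct)
  case zero
  show ?case using SD(2) b V by (intro exI[of _ 0] exI[of _ "\<zero>"]) simp
 next
  case (base a)
  show ?case
  proof (cases "a = b")
   case True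
   thus ?thesis using SD(2) b V by (intro exI[of _ 1] exI[of _ "\<zero>"]) simp
  next
   case False
   hence "a \<in> B" using base by simp
   thus ?thesis using span_of_base[OF V B'] b B' V by (intro exI[of _ 0] exI[of _ a]) auto
  qed
 next
  case (add x y)
  then obtain c w d z where *: "w \<in> span_of V B" "x = c \<odot> b \<oplus> w" "z \<in> span_of V B" "y = d \<odot> b \<oplus> z" by blast
  moreover have "w \<in> carrier V" "z \<in> carrier V" using * SD(1) by auto
  ultimately show ?case using SD(3)[of w z] b V by (intro exI[of _ "c + d"] exI[of _ "w \<oplus> z"]) (simp add: C)
 next
  case (smult e x)
  then obtain c w where *: "w \<in> span_of V B" "x = c \<odot> b \<oplus> w" by blast
  moreover have "w \<in> carrier V" using * SD(1) by auto
  ultimately show ?case using SD(4)[of w e] b V by (intro exI[of _ "e * c"] exI[of _ "e \<odot> w"]) (simp add: C)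
 qed
qed

text \<open>The Steinitz step: a nonzero combination involves some b with nonzero coefficient, which
  can then be expressed through v and the others.\<close>

lemma exchange:
 fixes V (structure)
 assumes V: "cvs V"
 shows "finite B ==> B \<subseteq> carrier V ==> v \<in> span_of V B ==> v \<noteq> \<zero> ==>
  \<exists>b\<in>B. b \<in> span_of V (insert v (B - {b}))"
proof (induction B rule: finite_induct)
 case empty
 have "span_of V {} \<subseteq> {\<zero>}" by (rule span_of_subset[OF V subspI[OF V]]) (use V in auto)
 thus ?case using empty by auto
next
 case (insert b B)
 have BC: "B \<subseteq> carrier V" "b \<in> carrier V" using insert.prems by auto
 obtain c w where w: "w \<in> span_of V B" "v = c \<odot> b \<oplus> w" using span_insert[OF V insert.prems(1,2)] by auto
 have wC: "w \<in> carrier V" using span_of_closed[OF V BC(1) w(1)] .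
 have vC: "v \<in> carrier V" using w wC BC V by simp
 show ?case
 proof (cases "c = 0")
  case True
  hence "v = w" using w wC BC V by simp
  then obtain b' where b': "b' \<in> B" "b' \<in> span_of V (insert v (B - {b'}))" using insert.IH[OF BC(1)] w(1) insert.prems(3) by auto
  hence "b' \<in> span_of V (insert v (insert b B - {b'}))" using span_of_mono[OF V, of "insert v (B - {b'})" "insert v (insert b B - {b'})"] by auto
  thus ?thesis using b' by auto
 next
  case False
  let ?S = "insert v (insert b B - {b})"
  have SC: "?S \<subseteq> carrier V" using vC BC by auto
  note SD = subspD[OF span_of_subsp[OF V SC]]
  have vw: "v \<in> span_of V ?S" "w \<in> span_of V ?S" using span_of_base[OF V SC, of v] w(1) span_of_mono[OF V, of B ?S] insert.hyps(2) by auto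
  have "c \<odot> b = v \<ominus> w" unfolding w(2) using cvs_add_diff[OF V, of "c \<odot> b" w] BC wC V by simp
  moreover have "b = (1 / c) \<odot> (c \<odot> b)" using False BC V by (simp add: cvs_smult_smult[OF V])
  ultimately have "b = (1 / c) \<odot> (v \<ominus> w)" by simp
  thus ?thesis using SD(4)[OF subsp_diff[OF span_of_subsp[OF V SC] vw], of "1 / c"] by auto
 qed
qed

text \<open>A surjective endomorphism of a finite-dimensional space is injective.\<close>

lemma kernel_of_two_surjections:
 fixes V (structure)
 assumes V: "cvs V" and U: "cvs U" and p1: "p1 \<in> lin_hom U V" and p2: "p2 \<in> lin_hom U V"
  and on1: "p1 ` carrier U = carrier V" and on2: "p2 ` carrier U = carrier V"
  and ker: "\<And>u. u \<in> carrier U ==> p1 u = \<zero> ==> p2 u = \<zero>"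
  and fin: "finite A" "A \<subseteq> carrier V" "carrier V \<subseteq> span_of V A"
  and u: "u \<in> carrier U" "p2 u = \<zero>"
 shows "p1 u = \<zero>"
proof (rule ccontr)
 assume nz: "p1 u \<noteq> \<zero>"
 note P1 = lin_homD[OF p1] and P2 = lin_homD[OF p2]
 define s where "s v = (SOME u. u \<in> carrier U \<and> p1 u = v)" for v
 have s: "s v \<in> carrier U" "p1 (s v) = v" if "v \<in> carrier V" for v
 proof -
  have "\<exists>u. u \<in> carrier U \<and> p1 u = v" using that on1 by force
  from someI_ex[OF this] show "s v \<in> carrier U" "p1 (s v) = v" unfolding s_def by auto
 qed
 have same: "p2 x = p2 y" if "x \<in> carrier U" "y \<in> carrier U" "p1 x = p1 y" for x y
 proof -
  have "p1 (x \<ominus>\<^bsub>U\<^esub> y) = \<zero>" using that P1(1) by (simp add: lin_hom_diff[OF p1 U V] cvs_diff_eq_zero[OF V])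
  hence "p2 (x \<ominus>\<^bsub>U\<^esub> y) = \<zero>" using that ker U by simp
  thus ?thesis using that P2(1) by (simp add: lin_hom_diff[OF p2 U V] cvs_diff_eq_zero[OF V])
 qed
 \<comment> \<open>The endomorphism of \<open>V\<close> with T p1 = p2, which exists by the
   inclusion of kernels.\<close>
 define T where "T v = p2 (s v)" for v
 have Tp: "T (p1 x) = p2 x" if "x \<in> carrier U" for x unfolding T_def by (rule same) (use that s P1(1) in auto)
 have T: "T \<in> lin_hom V V"
 proof (rule lin_homI)
  fix x assume x: "x \<in> carrier V"
  show "T x \<in> carrier V" unfolding T_def using s(1)[OF x] P2(1) by simp
  show "T (c \<odot> x) = c \<odot> T x" for c using Tp[of "c \<odot>\<^bsub>U\<^esub> s x"] s[OF x] P1(3)[of "s x" c] P2(3)[of "s x" c] U by (simp add: T_def)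
  fix y assume y: "y \<in> carrier V"
  show "T (x \<oplus> y) = T x \<oplus> T y"
   using Tp[of "s x \<oplus>\<^bsub>U\<^esub> s y"] s[OF x] s[OF y] P1(2)[of "s x" "s y"] P2(2)[of "s x" "s y"] U by (simp add: T_def)
 qed
 obtain B where B: "finite B" "card B = dim_of V" "B \<subseteq> carrier V" "carrier V \<subseteq> span_of V B" using dim_spanning_set[OF V fin] by auto
 have "p1 u \<in> span_of V B" using B(4) P1(1) u(1) by auto
 \<comment> \<open>A nonzero vector in the kernel of \<open>T\<close> replaces one member of a
   spanning set of size dim V; as \<open>T\<close> is onto, the images of the remaining members
   would span with fewer vectors.\<close>
 from exchange[OF V B(1,3) this nz] obtain b where b: "b \<in> B" "b \<in> span_of V (insert (p1 u) (B - {b}))" by auto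
 let ?S = "insert (p1 u) (B - {b})"
 have SC: "?S \<subseteq> carrier V" using B(3) P1(1) u(1) by auto
 have "span_of V B \<subseteq> span_of V ?S" by (rule span_of_subset[OF V span_of_subsp[OF V SC]]) (use b(2) span_of_base[OF V SC] in auto)
 hence S: "carrier V \<subseteq> span_of V ?S" using B(4) by auto
 let ?C = "T ` (B - {b})"
 have CC: "?C \<subseteq> carrier V" using lin_homD(1)[OF T] B(3) by auto
 have "carrier V \<subseteq> span_of V ?C"
 proof
  fix v assume "v \<in> carrier V"
  then obtain x where x: "x \<in> carrier U" "v = T (p1 x)" using on2 Tp by (metis image_iff)
  have "T (p1 x) \<in> span_of V ?C"
  proof (rule span_of_image[OF T V V SC _ _ span_of_subsp[OF V CC]])
   show "p1 x \<in> span_of V ?S" using S P1(1) x(1) by auto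
   show "T ` ?S \<subseteq> span_of V ?C" using span_of_base[OF V CC] Tp[OF u(1)] u(2) subspD(2)[OF span_of_subsp[OF V CC]] by auto
  qed
  thus "v \<in> span_of V ?C" using x by simp
 qed
 from dim_le_card_span[OF V _ CC this] have "dim_of V \<le> card ?C" using B(1) by simp
 also have "\<dots> \<le> card (B - {b})" by (rule card_image_le) (use B(1) in simp)
 also have "\<dots> < card B" using b(1) B(1) by (intro psubset_card_mono) auto
 finally show False using B(2) by simp
qed

section \<open>The completion of C[G] in terms of representing sequences\<close>

context group
begin

lemma group_algebra_cvs: "cvs GA" by (rule cvs_cong[OF free_cvs[of "\<G>"]]) (simp_all add: group_algebra_def)

lemma Aug_subsp': "subsp (Aug r) GA" by (rule subspI[OF group_algebra_cvs]) (use Aug_closed AugD(2,3,4) in "auto simp: ga_simps")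

lemma group_algebra_nonassoc: "algebra_on GA" by (rule algI[OF group_algebra_cvs]) (simp_all add: ga_simps star_closed star_add star_scl)

lemma Aug_algebra_ideal: "algebra_ideal GA (Aug r)" unfolding algebra_ideal_def using Aug_subsp' Aug_left Aug_right by (simp add: ga_simps)

abbreviation "CA \<equiv> completed_group_algebra G"

definition lim :: "(nat => 'a \<Rightarrow>\<^sub>0 complex) => nat => ('a \<Rightarrow>\<^sub>0 complex) set" where
 "lim U = (\<lambda>r. Aug r +>\<^bsub>GA\<^esub> U r)"

text \<open>The condition that the cosets of the \<open>U r\<close> form a point of the inverse
  limit; nesting of cosets becomes congruence of representatives.\<close>

definition coherent :: "(nat => 'a \<Rightarrow>\<^sub>0 complex) => bool" where
 "coherent U \<longleftrightarrow> (\<forall>r. (U r) over \<G>) \<and> (\<forall>r s. r \<le> s \<longrightarrow> U s - U r \<in> Aug r)"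

lemma coherentD: "coherent U ==> (U r) over \<G>" "coherent U ==> r \<le> s ==> U s - U r \<in> Aug r" by (auto simp: coherent_def)

lemma coherent_ops:
 assumes U: "coherent U"
 shows "coherent (\<lambda>r. scl c (U r))" "coherent V ==> coherent (\<lambda>r. U r + V r)" "coherent V ==> coherent (\<lambda>r. U r \<star> V r)"
proof -
 note D = coherentD[OF U]
 show "coherent (\<lambda>r. scl c (U r))" unfolding coherent_def using order_trans[OF keys_scl D(1)] AugD(4)[OF D(2)] by (simp add: scl_diff[symmetric])
 assume V: "coherent V"
 note E = coherentD[OF V]
 have "(U s + V s) - (U r + V r) = (U s - U r) + (V s - V r)" for r s by simp
 thus "coherent (\<lambda>r. U r + V r)" unfolding coherent_def using over_add[OF D(1) E(1)] AugD(3)[OF D(2) E(2)] by presburger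
 have "U s \<star> V s - U r \<star> V r = (U s - U r) \<star> V s + U r \<star> (V s - V r)" for r s by (simp add: star_diff)
 thus "coherent (\<lambda>r. U r \<star> V r)"
  unfolding coherent_def using star_closed[OF D(1) E(1)] AugD(3)[OF Aug_right[OF D(2) E(1)] Aug_left[OF D(1) E(2)]] by presburger
qed

lemma coherent_const: "u over \<G> ==> coherent (\<lambda>r. u)" by (simp add: coherent_def AugD(2))

lemma lim_mem: "x \<in> lim U r \<longleftrightarrow> (\<exists>i\<in>Aug r. x = i + U r)"
 using coset_mem_iff[OF Aug_subsp', of x r "U r"] by (simp add: lim_def ga_simps)

lemma lim_carrier: "coherent U ==> lim U \<in> carrier CA"
proof -
 assume U: "coherent U"
 have "lim U s \<subseteq> lim U r" if "r \<le> s" for r s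
 proof
  fix x assume "x \<in> lim U s"
  then obtain i where i: "i \<in> Aug s" "x = i + U s" by (auto simp: lim_mem)
  hence "x = (i + (U s - U r)) + U r" by simp
  thus "x \<in> lim U r" unfolding lim_mem using AugD(3)[OF Aug_antimono[OF that i(1)] coherentD(2)[OF U that]] by blast
 qed
 thus ?thesis using coherentD(1)[OF U] by (auto simp: completed_group_algebra_def completion_def quot_simps ga_simps lim_def)
qed

lemma CA_cases:
 assumes "p \<in> carrier CA"
 obtains U where "coherent U" "p = lim U"
proof -
 have p: "\<And>r. p r \<in> (\<lambda>x. Aug r +>\<^bsub>GA\<^esub> x) ` {u. u over \<G>}" "\<And>r s. r \<le> s ==> p s \<subseteq> p r"
  using assms by (auto simp: completed_group_algebra_def completion_def quot_simps ga_simps)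
 have "\<exists>u. u over \<G> \<and> p r = Aug r +>\<^bsub>GA\<^esub> u" for r using p(1)[of r] by auto
 then obtain U where U: "\<And>r. (U r) over \<G>" "\<And>r. p r = Aug r +>\<^bsub>GA\<^esub> U r" by metis
 hence pl: "p = lim U" by (auto simp: lim_def)
 have "U s - U r \<in> Aug r" if "r \<le> s" for r s
 proof -
  have "U s \<in> lim U s" unfolding lim_mem using AugD(2) by (intro bexI[of _ 0]) simp_all
  hence "U s \<in> lim U r" using p(2)[OF that] pl by auto
  thus ?thesis by (auto simp: lim_mem)
 qed
 hence "coherent U" using U(1) by (simp add: coherent_def)
 thus ?thesis using pl that by blast
qed

lemma CA_ops:
 assumes U: "coherent U"
 shows "c \<odot>\<^bsub>CA\<^esub> lim U = lim (\<lambda>r. scl c (U r))" "\<zero>\<^bsub>CA\<^esub> = lim (\<lambda>r. 0)" "\<one>\<^bsub>CA\<^esub> = lim (\<lambda>r. unit)"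
  "coherent V ==> lim U \<oplus>\<^bsub>CA\<^esub> lim V = lim (\<lambda>r. U r + V r)" "coherent V ==> lim U \<otimes>\<^bsub>CA\<^esub> lim V = lim (\<lambda>r. U r \<star> V r)"
proof -
 note k = coherentD(1)[OF U]
 show "c \<odot>\<^bsub>CA\<^esub> lim U = lim (\<lambda>r. scl c (U r))" using coset_smult[OF Aug_subsp', of "U r" r c for r] k
  by (simp add: completed_group_algebra_def completion_def lim_def ga_simps)
 show "\<zero>\<^bsub>CA\<^esub> = lim (\<lambda>r. 0)"
  using coset_zero[OF Aug_subsp'] by (simp add: completed_group_algebra_def completion_def lim_def ga_simps quot_simps)
 show "\<one>\<^bsub>CA\<^esub> = lim (\<lambda>r. unit)" by (simp add: completed_group_algebra_def completion_def lim_def ga_simps quot_simps)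
 assume V: "coherent V"
 note l = coherentD(1)[OF V]
 show "lim U \<oplus>\<^bsub>CA\<^esub> lim V = lim (\<lambda>r. U r + V r)" using coset_add[OF Aug_subsp', of "U r" "V r" r for r] k l
  by (simp add: completed_group_algebra_def completion_def lim_def ga_simps)
 show "lim U \<otimes>\<^bsub>CA\<^esub> lim V = lim (\<lambda>r. U r \<star> V r)"
  using rcoset_mult_coset[OF group_algebra_nonassoc Aug_algebra_ideal, of "U r" "V r" r for r] k l
  by (simp add: completed_group_algebra_def completion_def lim_def ga_simps quot_simps)
qed

lemma CA_cvs: "cvs CA"
proof (rule cvsI)
 have z: "\<zero>\<^bsub>CA\<^esub> = lim (\<lambda>r. 0)" "coherent (\<lambda>r. 0)" using CA_ops(2) coherent_const[of 0] by auto
 show "\<zero>\<^bsub>CA\<^esub> \<in> carrier CA" using z lim_carrier by simp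
 fix x assume "x \<in> carrier CA"
 then obtain U where U: "coherent U" "x = lim U" by (rule CA_cases)
 note oU = coherent_ops[OF U(1)] and cU = CA_ops[OF U(1)]
 show "\<zero>\<^bsub>CA\<^esub> \<oplus>\<^bsub>CA\<^esub> x = x" using CA_ops(4)[OF z(2) U(1)] U z by simp
 show "\<exists>y\<in>carrier CA. y \<oplus>\<^bsub>CA\<^esub> x = \<zero>\<^bsub>CA\<^esub>"
  using CA_ops(4)[OF oU(1) U(1), of "-1"] lim_carrier[OF oU(1), of "-1"] U z by auto
 show "c \<odot>\<^bsub>CA\<^esub> x \<in> carrier CA" for c using lim_carrier[OF oU(1)] U cU(1) by simp
 show "(c + d) \<odot>\<^bsub>CA\<^esub> x = c \<odot>\<^bsub>CA\<^esub> x \<oplus>\<^bsub>CA\<^esub> d \<odot>\<^bsub>CA\<^esub> x" for c d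
  using CA_ops(4)[OF oU(1) oU(1), of c d] U cU(1) by (simp add: add_scl)
 show "(c * d) \<odot>\<^bsub>CA\<^esub> x = c \<odot>\<^bsub>CA\<^esub> (d \<odot>\<^bsub>CA\<^esub> x)" for c d using CA_ops(1)[OF oU(1), of c d] U cU(1) by simp
 show "1 \<odot>\<^bsub>CA\<^esub> x = x" using U cU(1) by simp
 fix y assume "y \<in> carrier CA"
 then obtain V where V: "coherent V" "y = lim V" by (rule CA_cases)
 note oV = coherent_ops[OF V(1)] and cV = CA_ops[OF V(1)]
 show "x \<oplus>\<^bsub>CA\<^esub> y \<in> carrier CA" using lim_carrier[OF oU(2)[OF V(1)]] cU(4)[OF V(1)] U V by simp
 show "x \<oplus>\<^bsub>CA\<^esub> y = y \<oplus>\<^bsub>CA\<^esub> x" using cU(4)[OF V(1)] cV(4)[OF U(1)] U V by (simp add: add.commute)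
 show "c \<odot>\<^bsub>CA\<^esub> (x \<oplus>\<^bsub>CA\<^esub> y) = c \<odot>\<^bsub>CA\<^esub> x \<oplus>\<^bsub>CA\<^esub> c \<odot>\<^bsub>CA\<^esub> y" for c
  using CA_ops(1)[OF oU(2)[OF V(1)], of c] CA_ops(4)[OF oU(1) oV(1), of c c] cU(1,4) cV(1) U V by (simp add: scl_add)
 fix w assume "w \<in> carrier CA"
 then obtain W where W: "coherent W" "w = lim W" by (rule CA_cases)
 show "x \<oplus>\<^bsub>CA\<^esub> y \<oplus>\<^bsub>CA\<^esub> w = x \<oplus>\<^bsub>CA\<^esub> (y \<oplus>\<^bsub>CA\<^esub> w)"
  using CA_ops(4)[OF oU(2)[OF V(1)] W(1)] CA_ops(4)[OF U(1) oV(2)[OF W(1)]] cU(4)[OF V(1)] cV(4)[OF W(1)] U V W by (simp add: add.assoc)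
qed

lemma CA_diff: "coherent U ==> coherent V ==> lim U \<ominus>\<^bsub>CA\<^esub> lim V = lim (\<lambda>r. U r - V r)"
 using cvs_diff[OF CA_cvs lim_carrier lim_carrier, of U V] CA_ops(1)[of V "-1"] CA_ops(4)[of U "\<lambda>r. scl (-1) (V r)"] coherent_ops(1)[of V "-1"] by simp

abbreviation "square_class r w \<equiv> tensor_square_class G r w"

lemma square_class_eq: "w over \<G> \<times> \<G> ==> w' over \<G> \<times> \<G> ==>
  square_class r w = square_class r w' \<longleftrightarrow> w - w' \<in> T2 r"
 unfolding tensor_square_class_def using coset_eq_iff[OF T2_subsp, of w w' r] by simp

lemma completed_tensor_lim:
 assumes U: "coherent U" and V: "coherent V"
 shows "completed_tensor G (lim U) (lim V) r = square_class r (tens (U r) (V r))" unfolding completed_tensor_def induced2_def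
proof (rule the_elem_image_const)
 have "U r \<in> lim U r" "V r \<in> lim V r" unfolding lim_mem using AugD(2) by force+
 thus "lim U r \<times> lim V r \<noteq> {}" by auto
 fix x assume "x \<in> lim U r \<times> lim V r"
 then obtain i j where ij: "x = (i + U r, j + V r)" "i \<in> Aug r" "j \<in> Aug r" by (auto simp: lim_mem)
 note k = coherentD(1)[OF U, of r] coherentD(1)[OF V, of r] Aug_closed[OF ij(2)] Aug_closed[OF ij(3)]
 have "tens (i + U r) (j + V r) - tens (U r) (V r) = tens i (j + V r) + tens (U r) j" by (simp add: bilin_addL bilin_addR)
 moreover have "tens i (j + V r) \<in> T2 r" "tens (U r) j \<in> T2 r"
  using T2_base[OF ij(2), of "j + V r" 0] T2_base[OF _ ij(3), of "U r" 0] k by (simp_all add: over_add)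
 ultimately show "(case x of (u, v) => square_class r (tens u v)) = square_class r (tens (U r) (V r))"
  using k T2D(3) by (simp add: ij(1) square_class_eq tens_closed over_add)
qed

lemma completed_comult_lim:
 assumes U: "coherent U"
 shows "completed_comult G (lim U) r = square_class r (\<Delta> (U r))" unfolding completed_comult_def induced_def
proof (rule the_elem_image_const)
 show "lim U r \<noteq> {}" using lim_mem[of "U r" U r] AugD(2) by force
 fix x assume "x \<in> lim U r"
 then obtain i where i: "x = i + U r" "i \<in> Aug r" by (auto simp: lim_mem)
 thus "square_class r (\<Delta> x) = square_class r (\<Delta> (U r))" using comult_Aug[OF i(2)] coherentD(1)[OF U, of r] Aug_closed[OF i(2)]
  by (simp add: square_class_eq comult_closed over_add push_add)
qed

text \<open>Coproduct and tensor product of the completion are computed level by level on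
  representatives, so primitivity amounts to \<open>Prim r\<close> at every level.\<close>

lemma primitive_lim: "coherent U ==> lim U \<in> primitive_elements G \<longleftrightarrow> (\<forall>r. U r \<in> Prim r)"
proof -
 assume U: "coherent U"
 note k = coherentD(1)[OF U]
 have one: "\<one>\<^bsub>CA\<^esub> = lim (\<lambda>r. unit)" "coherent (\<lambda>r. unit)" using CA_ops(3)[OF U] coherent_const[of unit] by auto
 have add: "square_class r w \<oplus>\<^bsub>quot (free_module (\<G> \<times> \<G>)) (T2 r)\<^esub> square_class r w' = square_class r (w + w')"
  if "w over \<G> \<times> \<G>" "w' over \<G> \<times> \<G>" for w w' r
  using coset_add[OF T2_subsp, of w w' r] that by (simp add: tensor_square_class_def)
 have "lim U \<in> primitive_elements G \<longleftrightarrow> (\<forall>r. square_class r (\<Delta> (U r)) = square_class r (prim_part (U r)))" using lim_carrier[OF U] k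
  by (simp add: primitive_elements_def Let_def one fun_eq_iff completed_tensor_square_def completion_def
    completed_comult_lim[OF U] completed_tensor_lim[OF U one(2)] completed_tensor_lim[OF one(2) U] add tens_closed)
 thus ?thesis using k by (simp add: square_class_eq comult_closed prim_part_closed Prim_iff)
qed

definition mseq :: "(nat => 'a \<Rightarrow>\<^sub>0 complex) => bool" where
 "mseq U \<longleftrightarrow> coherent U \<and> (\<forall>r. U r \<in> Prim r)"

lemma mseqD: "mseq U ==> coherent U" "mseq U ==> U r \<in> Prim r" by (auto simp: mseq_def)

lemma mseq_ops:
 assumes U: "mseq U"
 shows "mseq (\<lambda>r. scl c (U r))" "mseq V ==> mseq (\<lambda>r. U r + V r)"
  "mseq V ==> mseq (\<lambda>r. U r - V r)" "mseq V ==> mseq (\<lambda>r. U r \<star> V r - V r \<star> U r)"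
proof -
 note D = mseqD[OF U]
 have diff: "coherent (\<lambda>r. X r - Y r)" if "coherent X" "coherent Y" for X Y using coherent_ops(2)[OF that(1) coherent_ops(1)[OF that(2), of "-1"]] by simp
 show "mseq (\<lambda>r. scl c (U r))" unfolding mseq_def using coherent_ops(1) D PrimD(4) by blast
 assume V: "mseq V"
 note E = mseqD[OF V]
 show "mseq (\<lambda>r. U r + V r)" unfolding mseq_def using coherent_ops(2) D E PrimD(3) by blast
 show "mseq (\<lambda>r. U r - V r)" unfolding mseq_def using diff D E PrimD(5) by blast
 show "mseq (\<lambda>r. U r \<star> V r - V r \<star> U r)" 
  unfolding mseq_def using diff[OF coherent_ops(3)[OF D(1) E(1)] coherent_ops(3)[OF E(1) D(1)]] Prim_bracket[OF D(2) E(2)] by simp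
qed

lemma mseq_zero: "mseq (\<lambda>r. 0)" unfolding mseq_def using coherent_const[of 0] PrimD(2) by simp

lemma mseq_lg: "x \<in> \<G> ==> mseq (\<lambda>r. lg r x)" unfolding mseq_def coherent_def using lg_Prim lg_closed lg_compatible by simp

text \<open>From here on elements of m(G) are handled as sequences of representatives. The r-th
  filtration step sees only the r-th term, being the kernel of the projection to C[G]/I^r.\<close>

lemma malcev_simps:
 "carrier (malcev_lie G) = lim ` {U. mseq U}"
 "mseq U ==> c \<odot>\<^bsub>malcev_lie G\<^esub> lim U = lim (\<lambda>r. scl c (U r))"
 "mseq U ==> mseq V ==> lim U \<oplus>\<^bsub>malcev_lie G\<^esub> lim V = lim (\<lambda>r. U r + V r)"
 "mseq U ==> mseq V ==> lim U \<otimes>\<^bsub>malcev_lie G\<^esub> lim V = lim (\<lambda>r. U r \<star> V r - V r \<star> U r)"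
 "mseq U ==> lim U \<in> filt (malcev_lie G) r \<longleftrightarrow> U r \<in> Aug r"
proof -
 show "carrier (malcev_lie G) = lim ` {U. mseq U}"
 proof
  show "carrier (malcev_lie G) \<subseteq> lim ` {U. mseq U}"
  proof
   fix p assume "p \<in> carrier (malcev_lie G)"
   hence p: "p \<in> primitive_elements G" by (simp add: malcev_lie_def Let_def)
   hence "p \<in> carrier CA" by (simp add: primitive_elements_def Let_def)
   then obtain U where U: "coherent U" "p = lim U" by (rule CA_cases)
   thus "p \<in> lim ` {U. mseq U}" using p primitive_lim[OF U(1)] by (auto simp: mseq_def)
  qed
  show "lim ` {U. mseq U} \<subseteq> carrier (malcev_lie G)" using primitive_lim by (auto simp: malcev_lie_def Let_def mseq_def)
 qed
 assume U: "mseq U"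
 note cU = mseqD(1)[OF U]
 show "c \<odot>\<^bsub>malcev_lie G\<^esub> lim U = lim (\<lambda>r. scl c (U r))" using CA_ops(1)[OF cU] by (simp add: malcev_lie_def Let_def)
 have "lim U r = Aug r \<longleftrightarrow> U r \<in> Aug r" using coset_eq_zero_iff[OF Aug_subsp', of "U r" r] coherentD(1)[OF cU] by (simp add: lim_def ga_simps)
 thus "lim U \<in> filt (malcev_lie G) r \<longleftrightarrow> U r \<in> Aug r"
  using primitive_lim[OF cU] mseqD(2)[OF U] by (simp add: malcev_lie_def Let_def quot_simps)
 assume V: "mseq V"
 note cV = mseqD(1)[OF V]
 show "lim U \<oplus>\<^bsub>malcev_lie G\<^esub> lim V = lim (\<lambda>r. U r + V r)" using CA_ops(4)[OF cU cV] by (simp add: malcev_lie_def Let_def)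
 show "lim U \<otimes>\<^bsub>malcev_lie G\<^esub> lim V = lim (\<lambda>r. U r \<star> V r - V r \<star> U r)"
  using CA_ops(5)[OF cU cV] CA_ops(5)[OF cV cU] CA_diff[OF coherent_ops(3)[OF cU cV] coherent_ops(3)[OF cV cU]] by (simp add: malcev_lie_def Let_def)
qed

lemma degree_completion_simps:
 "carrier (degree_completion L) = {f. \<forall>k. f k \<in> homog L k}"
 "f \<otimes>\<^bsub>degree_completion L\<^esub> g = (\<lambda>k. \<Oplus>\<^bsub>L\<^esub>i\<in>{..k}. f i \<otimes>\<^bsub>L\<^esub> g (k - i))"
 "f \<oplus>\<^bsub>degree_completion L\<^esub> g = (\<lambda>k. f k \<oplus>\<^bsub>L\<^esub> g k)" "c \<odot>\<^bsub>degree_completion L\<^esub> f = (\<lambda>k. c \<odot>\<^bsub>L\<^esub> f k)"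
 "filt (degree_completion L) r = {f. (\<forall>k. f k \<in> homog L k) \<and> (\<forall>i<r. f i = \<zero>\<^bsub>L\<^esub>)}"
 by (simp_all add: degree_completion_def Let_def)

end

section \<open>Filtered formality\<close>

lemma finsum_single_term:
 assumes L: "cvs L" and "finite A" "a \<in> A" "f a \<in> carrier L" "\<And>i. i \<in> A ==> i \<noteq> a ==> f i = \<zero>\<^bsub>L\<^esub>"
 shows "finsum L f A = f a"
proof -
 interpret V: vectorspace class_ring L by (rule L)
 have "finsum L f A = finsum L (\<lambda>i. if a = i then f a else \<zero>\<^bsub>L\<^esub>) A" by (rule V.M.finsum_cong') (use assms in auto)
 also have "\<dots> = f a" by (rule V.M.finsum_singleton) (use assms in auto)
 finally show ?thesis .
qed

context group
begin

lemma gr_homog_carrier: "f \<in> homog (gr G) k ==> f \<in> grC" by (simp add: gr_simps(6))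

text \<open>\<open>\<Phi> U k\<close> stands for the degree k component of the image of
  \<open>lim U\<close> under a filtered isomorphism from m(G) to the completion of gr(G). By
  \<open>filt_\<Phi>\<close> the filtration is preserved in both directions.\<close>

context
 fixes \<Phi> :: "(nat => 'a \<Rightarrow>\<^sub>0 complex) => nat => nat => ('a set \<Rightarrow>\<^sub>0 complex) set"
 assumes homog_\<Phi>: "\<And>U k. mseq U ==> \<Phi> U k \<in> homog (gr G) k"
  and add_\<Phi>: "\<And>U V k. mseq U ==> mseq V ==> \<Phi> (\<lambda>r. U r + V r) k = \<Phi> U k \<oplus>\<^sub>g \<Phi> V k"
  and scl_\<Phi>: "\<And>U c k. mseq U ==> \<Phi> (\<lambda>r. scl c (U r)) k = c \<odot>\<^sub>g \<Phi> U k"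
  and bracket_\<Phi>: "\<And>U V k. mseq U ==> mseq V ==>
   \<Phi> (\<lambda>r. U r \<star> V r - V r \<star> U r) k = (\<Oplus>\<^bsub>gr G\<^esub>i\<in>{..k}. \<Phi> U i \<otimes>\<^sub>g \<Phi> V (k - i))"
  and filt_\<Phi>: "\<And>U r. mseq U ==> (\<forall>i<r. \<Phi> U i = \<zero>\<^sub>g) \<longleftrightarrow> U r \<in> Aug r"
  and onto_\<Phi>: "\<And>f. (\<And>k. f k \<in> homog (gr G) k) ==> \<exists>U. mseq U \<and> (\<forall>k. \<Phi> U k = f k)"
begin

lemma \<Phi>_closed [simp]: "mseq U ==> \<Phi> U k \<in> grC" using homog_\<Phi> gr_homog_carrier by blast

lemma \<Phi>_zero: "\<Phi> (\<lambda>r. 0) k = \<zero>\<^sub>g" using filt_\<Phi>[OF mseq_zero, of "Suc k"] AugD(2) by simp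

text \<open>Components below degree r depend only on the r-th term modulo I^r, so computations in
  C[G] modulo I^r replace computations in the completion.\<close>

lemma \<Phi>_cong:
 assumes "mseq U" "mseq V" "U r - V r \<in> Aug r" "k < r"
 shows "\<Phi> U k = \<Phi> V k"
proof -
 note W = mseq_ops(3)[OF assms(1,2)]
 have "\<Phi> (\<lambda>r. U r - V r) k = \<zero>\<^sub>g" using filt_\<Phi>[OF W, of r] assms(3,4) by simp
 moreover have "\<Phi> U k = \<Phi> (\<lambda>r. U r - V r) k \<oplus>\<^sub>g \<Phi> V k" using add_\<Phi>[OF W assms(2), of k] by simp
 ultimately show ?thesis using assms(2) gr_cvs by simp
qed

text \<open>Elements of C[G] that modulo I^r come from a point of m(G) all of whose components lie
  in \<open>Z\<close>. These are the sets \<open>K1\<close> and \<open>K2\<close> for which the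
  formula for log xy is applied.\<close>

definition level :: "nat => (nat => ('a set \<Rightarrow>\<^sub>0 complex) set) set => ('a \<Rightarrow>\<^sub>0 complex) set" where
 "level r Z = {u. u over \<G> \<and> (\<exists>U. mseq U \<and> u - U r \<in> Aug r \<and> (\<forall>i. \<Phi> U i \<in> Z))}"

lemma level_subsp:
 assumes Z: "subsp Z (gr G)"
 shows "subsp (level r Z) CG"
proof (rule free_subspI)
 show "0 \<in> level r Z" unfolding level_def using mseq_zero AugD(2) subspD(2)[OF Z] \<Phi>_zero by (auto intro!: exI[of _ "\<lambda>r. 0"])
 fix u assume "u \<in> level r Z"
 then obtain U where U: "u over \<G>" "mseq U" "u - U r \<in> Aug r" "\<And>i. \<Phi> U i \<in> Z" by (auto simp: level_def)
 thus "u over \<G>" by simp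
 show "scl c u \<in> level r Z" for c unfolding level_def using U order_trans[OF keys_scl U(1)] mseq_ops(1)[OF U(2), of c] AugD(4)[OF U(3), of c] subspD(4)[OF Z U(4)]
  by (auto intro!: exI[of _ "\<lambda>r. scl c (U r)"] simp: scl_\<Phi> scl_diff simp del: subset_iff)
 fix v assume "v \<in> level r Z"
 then obtain V where V: "v over \<G>" "mseq V" "v - V r \<in> Aug r" "\<And>i. \<Phi> V i \<in> Z" by (auto simp: level_def)
 have e: "u + v - (U r + V r) = (u - U r) + (v - V r)" by simp
 have "u + v - (U r + V r) \<in> Aug r" unfolding e using AugD(3)[OF U(3) V(3)] .
 thus "u + v \<in> level r Z" unfolding level_def using over_add[OF U(1) V(1)] mseq_ops(2)[OF U(2) V(2)] subspD(3)[OF Z U(4) V(4)] add_\<Phi>[OF U(2) V(2)]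
  by (intro CollectI conjI exI[of _ "\<lambda>r. U r + V r"]) simp_all
qed

lemma level_Prim: "level r Z \<subseteq> Prim r"
proof
 fix u assume "u \<in> level r Z"
 then obtain U where "mseq U" "u - U r \<in> Aug r" by (auto simp: level_def)
 thus "u \<in> Prim r" using PrimD(3)[OF Aug_Prim[of "u - U r" r] mseqD(2)[of U r]] by simp
qed

lemma Aug_level: "subsp Z (gr G) ==> Aug r \<subseteq> level r Z"
 unfolding level_def using mseq_zero Aug_closed \<Phi>_zero subspD(2) by (auto intro!: exI[of _ "\<lambda>r. 0"] simp: subsetD)

lemma level_bracket:
 assumes Z: "subsp Z (gr G)" and br: "\<And>f g. f \<in> Y ==> g \<in> Y ==> f \<otimes>\<^sub>g g \<in> Z"
  and u: "u \<in> level r Y" and v: "v \<in> level r Y"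
 shows "u \<star> v - v \<star> u \<in> level r Z"
proof -
 obtain U where U: "u over \<G>" "mseq U" "u - U r \<in> Aug r" "\<And>i. \<Phi> U i \<in> Y" using u by (auto simp: level_def)
 obtain V where V: "v over \<G>" "mseq V" "v - V r \<in> Aug r" "\<And>i. \<Phi> V i \<in> Y" using v by (auto simp: level_def)
 note k = coherentD(1)[OF mseqD(1)[OF U(2)], of r] coherentD(1)[OF mseqD(1)[OF V(2)], of r]
 have p: "a \<star> b - a' \<star> b' \<in> Aug r" if "a - a' \<in> Aug r" "b - b' \<in> Aug r" "b over \<G>" "a' over \<G>" for a b a' b'
 proof -
  have e: "a \<star> b - a' \<star> b' = (a - a') \<star> b + a' \<star> (b - b')" by (simp add: star_diff)
  show ?thesis unfolding e using AugD(3)[OF Aug_right[OF that(1,3)] Aug_left[OF that(4,2)]] .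
 qed
 have e: "(u \<star> v - v \<star> u) - (U r \<star> V r - V r \<star> U r) = (u \<star> v - U r \<star> V r) - (v \<star> u - V r \<star> U r)" by simp
 have "(u \<star> v - v \<star> u) - (U r \<star> V r - V r \<star> U r) \<in> Aug r"
  unfolding e by (rule AugD(5)[OF p[OF U(3) V(3) V(1) k(1)] p[OF V(3) U(3) U(1) k(2)]])
 moreover have "\<Phi> (\<lambda>r. U r \<star> V r - V r \<star> U r) i \<in> Z" for i
  unfolding bracket_\<Phi>[OF U(2) V(2)] by (rule subsp_finsum[OF Z]) (use br U(4) V(4) in auto)
 ultimately show ?thesis unfolding level_def using over_diff[OF star_closed[OF U(1) V(1)] star_closed[OF V(1) U(1)]] mseq_ops(4)[OF U(2) V(2)]
  by (intro CollectI conjI exI[of _ "\<lambda>r. U r \<star> V r - V r \<star> U r"]) simp_all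
qed

abbreviation "log_comp x i \<equiv> \<Phi> (\<lambda>r. lg r x) i"

lemma lg_level: "x \<in> \<G> ==> (\<And>i. log_comp x i \<in> Z) ==> lg r x \<in> level r Z"
 unfolding level_def using lg_closed mseq_lg AugD(2) by (intro CollectI conjI exI[of _ "\<lambda>r. lg r x"]) simp_all

text \<open>Used twice: with Y = gr, Z = gr', H = G, and with Y = gr', Z = gr'', H = G'.\<close>

context
 fixes Y Z H
 assumes Z: "subsp Z (gr G)" and Y: "subsp Y (gr G)" and ZY: "Z \<subseteq> Y"
  and br: "\<And>f g. f \<in> Y ==> g \<in> Y ==> f \<otimes>\<^sub>g g \<in> Z"
  and H: "subgroup H G" and HY: "\<And>x i. x \<in> H ==> log_comp x i \<in> Y"
begin

lemma log_comp_mult: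
 assumes x: "x \<in> H" and y: "y \<in> H"
 shows "\<exists>w\<in>Z. log_comp (x \<otimes> y) i = w \<oplus>\<^sub>g (log_comp x i \<oplus>\<^sub>g log_comp y i)"
proof -
 note c = subgroup.mem_carrier[OF H x] subgroup.mem_carrier[OF H y]
 \<comment> \<open>Degree i is visible modulo I^r only when r > i, and \<open>lg_mult\<close> asks
   for r >= 2.\<close>
 let ?r = "i + 2"
 have "level ?r Z \<subseteq> level ?r Y" unfolding level_def using ZY by blast
 hence "lg ?r (x \<otimes> y) - lg ?r x - lg ?r y \<in> level ?r Z"
  by (intro lg_mult[OF _ level_Prim level_subsp[OF Z] _ Aug_level[OF Z] level_bracket[OF Z br] c(1) lg_level[OF c(1) HY[OF x]] c(2) lg_level[OF c(2) HY[OF y]]]) auto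
 then obtain W where W: "mseq W" "(lg ?r (x \<otimes> y) - lg ?r x - lg ?r y) - W ?r \<in> Aug ?r" "\<And>i. \<Phi> W i \<in> Z" unfolding level_def by auto
 note m = mseq_lg[OF c(1)] mseq_lg[OF c(2)]
 note m2 = mseq_ops(2)[OF m] mseq_ops(2)[OF W(1) mseq_ops(2)[OF m]]
 have "lg ?r (x \<otimes> y) - (W ?r + (lg ?r x + lg ?r y)) \<in> Aug ?r" using W(2) by (simp add: algebra_simps)
 from \<Phi>_cong[OF mseq_lg m2(2) this] c
 have "log_comp (x \<otimes> y) i = \<Phi> (\<lambda>r. W r + (lg r x + lg r y)) i" by simp
 also have "\<dots> = \<Phi> W i \<oplus>\<^sub>g (log_comp x i \<oplus>\<^sub>g log_comp y i)" unfolding add_\<Phi>[OF W(1) m2(1)] add_\<Phi>[OF m] ..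
 finally show ?thesis using W(3) by blast
qed

text \<open>Modulo \<open>Z\<close> the component of the logarithm is a homomorphism from
  \<open>H\<close> to an abelian group, so it vanishes on commutators.\<close>

lemma log_comp_derived:
 assumes "x \<in> derived G H"
 shows "log_comp x i \<in> Z"
proof -
 let ?Q = "quot (gr G) Z"
 note Q = quot_cvs[OF Z] and CL = coset_lin_hom[OF Z] and ZD = subspD[OF Z]
 define \<chi> where "\<chi> x = Z +>\<^sub>g log_comp x i" for x
 have lc: "log_comp x i \<in> grC" if "x \<in> H" for x using mseq_lg[OF subgroup.mem_carrier[OF H that]] by simp
 have \<chi>C: "\<chi> x \<in> carrier ?Q" if "x \<in> H" for x unfolding \<chi>_def using lin_homD(1)[OF CL lc[OF that]] .
 have \<chi>Z: "\<chi> x = \<zero>\<^bsub>?Q\<^esub> \<longleftrightarrow> log_comp x i \<in> Z" if "x \<in> H" for x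
  unfolding \<chi>_def quot_simps using coset_eq_zero_iff[OF Z lc[OF that]] .
 have \<chi>m: "\<chi> (x \<otimes> y) = \<chi> x \<oplus>\<^bsub>?Q\<^esub> \<chi> y" if xy: "x \<in> H" "y \<in> H" for x y
 proof -
  obtain w where w: "w \<in> Z" "log_comp (x \<otimes> y) i = w \<oplus>\<^sub>g (log_comp x i \<oplus>\<^sub>g log_comp y i)" using log_comp_mult[OF xy] by blast
  have "Z +>\<^sub>g w = \<zero>\<^bsub>?Q\<^esub>" using coset_eq_zero_iff[OF Z] w(1) ZD(1) by (auto simp: quot_simps)
  thus ?thesis unfolding \<chi>_def w(2) using lin_homD(2)[OF CL] lin_homD(1)[OF CL] lc[OF xy(1)] lc[OF xy(2)] w(1) ZD(1) gr_cvs Q by (auto simp: subset_iff)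
 qed
 have cancel: "a = \<zero>\<^bsub>?Q\<^esub>" if "a \<in> carrier ?Q" "b \<in> carrier ?Q" "a \<oplus>\<^bsub>?Q\<^esub> b = b" for a b
  using cvs_add_diff[OF Q that(1,2)] cvs_diff_eq_zero[OF Q that(2,2)] that(3) by simp
 note Hm = subgroup.m_closed[OF H] and Hi = subgroup.m_inv_closed[OF H] and H1 = subgroup.one_closed[OF H] and Hc = subgroup.mem_carrier[OF H]
 have \<chi>one: "\<chi> \<one> = \<zero>\<^bsub>?Q\<^esub>" by (rule cancel[OF \<chi>C[OF H1] \<chi>C[OF H1]]) (use \<chi>m[OF H1 H1] in simp)
 have com: "com x y \<in> H \<and> \<chi> (com x y) = \<zero>\<^bsub>?Q\<^esub>" if xy: "x \<in> H" "y \<in> H" for x y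
 proof
  show c: "com x y \<in> H" unfolding commutator_def using xy Hm Hi by simp
  show "\<chi> (com x y) = \<zero>\<^bsub>?Q\<^esub>"
  proof (rule cancel[OF \<chi>C[OF c] \<chi>C[OF Hm[OF xy(2,1)]]])
   have "\<chi> (com x y) \<oplus>\<^bsub>?Q\<^esub> \<chi> (y \<otimes> x) = \<chi> (x \<otimes> y)"
    using \<chi>m[OF c Hm[OF xy(2,1)]] com_swap[OF Hc[OF xy(1)] Hc[OF xy(2)]] by simp
   also have "\<dots> = \<chi> (y \<otimes> x)" using \<chi>m[OF xy] \<chi>m[OF xy(2,1)] cvs_comm[OF Q \<chi>C[OF xy(1)] \<chi>C[OF xy(2)]] by simp
   finally show "\<chi> (com x y) \<oplus>\<^bsub>?Q\<^esub> \<chi> (y \<otimes> x) = \<chi> (y \<otimes> x)" .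
  qed
 qed
 have "x \<in> H \<and> \<chi> x = \<zero>\<^bsub>?Q\<^esub>" using assms unfolding derived_def
 proof (induction x rule: generate.induct)
  case one
  show ?case using H1 \<chi>one by simp
 next
  case (incl h)
  then obtain a b where "a \<in> H" "b \<in> H" "h = a \<otimes> b \<otimes> inv a \<otimes> inv b" by auto
  thus ?case using com[of a b] by (simp add: commutator_def)
 next
  case (inv h)
  then obtain a b where ab: "a \<in> H" "b \<in> H" "h = a \<otimes> b \<otimes> inv a \<otimes> inv b" by auto
  hence "inv h = com b a" using com_inv[OF Hc[OF ab(1)] Hc[OF ab(2)]] by (simp add: commutator_def)
  thus ?case using com[OF ab(2,1)] by simp
 next
  case (eng a b)
  thus ?case using Hm \<chi>m cvs_zero_left[OF Q cvs_zero[OF Q]] by simp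
 qed
 hence "x \<in> H" "\<chi> x = \<zero>\<^bsub>?Q\<^esub>" by auto
 thus ?thesis using \<chi>Z[of x] by blast
qed

end

lemma log_comp_second_derived:
 assumes "c \<in> second_derived G"
 shows "log_comp c i \<in> gr2"
proof -
 let ?A = "grC" and ?D = "derived_lie (gr G) (grC)"
 have D: "subsp ?D (gr G)" by (rule derived_lie_subsp[OF gr_algebra order_refl])
 have 1: "log_comp x i \<in> ?D" if "x \<in> derived G (\<G>)" for x i
 proof (rule log_comp_derived[OF D subsp_carrier[OF gr_cvs] subspD(1)[OF D] _ subgroup_self _ that])
  show "f \<otimes>\<^sub>g g \<in> ?D" if "f \<in> ?A" "g \<in> ?A" for f g by (rule derived_lie_mult[OF gr_algebra order_refl that])
  show "log_comp x i \<in> ?A" if "x \<in> \<G>" for x i using mseq_lg[OF that] by simp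
 qed
 have H: "subgroup (derived G (\<G>)) G" unfolding derived_carrier_eq_lcs by (rule lcs_subgroup)
 show ?thesis
 proof (rule log_comp_derived[OF second_derived_subsp[OF gr_algebra] D _ _ H 1 assms[unfolded second_derived_def]])
  show "gr2 \<subseteq> ?D" unfolding second_derived_lie_def by (rule derived_lie_mono[OF gr_algebra subspD(1)[OF D]])
  show "f \<otimes>\<^sub>g g \<in> gr2" if "f \<in> ?D" "g \<in> ?D" for f g
   unfolding second_derived_lie_def by (rule derived_lie_mult[OF gr_algebra subspD(1)[OF D] that])
 qed
qed

definition log_lin :: "nat => ('a \<Rightarrow>\<^sub>0 complex) => nat => ('a set \<Rightarrow>\<^sub>0 complex) set" where
 "log_lin k = linear_extension (gr G) (\<lambda>x. log_comp x k)"

lemma log_lin_hom: "log_lin k \<in> lin_hom (free_module (lcs G k)) (gr G)" unfolding log_lin_def by (rule lin_ext_lin_hom[OF gr_cvs]) (use mseq_lg lcs_mem in simp)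

lemma log_lin_single: "x \<in> lcs G k ==> log_lin k (single x 1) = log_comp x k"
proof -
 assume x: "x \<in> lcs G k"
 have "log_lin k (single x 1) = 1 \<odot>\<^sub>g log_comp x k" unfolding log_lin_def by (rule lin_ext_single[OF gr_cvs _ x]) (use mseq_lg lcs_mem in simp)
 thus ?thesis using cvs_one[OF gr_cvs \<Phi>_closed[OF mseq_lg[OF lcs_mem[OF x]]]] by simp
qed

lemma log_lin_homog: "u over lcs G k ==> log_lin k u \<in> homog (gr G) k"
 using span_free_module[OF _ lin_vimage[OF log_lin_hom free_cvs gr_homog_subsp], of u "lcs G k" k k]
  log_lin_single homog_\<Phi>[OF mseq_lg[OF lcs_mem]] by simp

text \<open>The value on a chain is again a component of a point of m(G), namely of the
  corresponding combination of logarithms; surjectivity compares this point with a prescribed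
  one.\<close>

lemma log_lin_seq:
 assumes "u over lcs G k"
 shows "mseq (\<lambda>r. linear_extension CG (lg r) u)"
  and "\<Phi> (\<lambda>r. linear_extension CG (lg r) u) k = log_lin k u"
proof -
 let ?e = "\<lambda>u r. linear_extension CG (lg r) u"
 have lgc: "\<And>x. x \<in> lcs G k ==> lg r x \<in> carrier CG" for r using lg_closed lcs_mem by simp
 have "mseq (?e u) \<and> \<Phi> (?e u) k = log_lin k u" using assms
 proof (induction u rule: pm_induct)
  case zero
  have "?e 0 = (\<lambda>r. 0)" using lin_ext_zero[OF free_cvs lgc] by (intro ext) simp
  thus ?case using mseq_zero \<Phi>_zero lin_hom_zero[OF log_lin_hom free_cvs gr_cvs] by simp
 next
  case (single x c)
  have e: "?e (single x c) = (\<lambda>r. scl c (lg r x))" using lin_ext_single[OF free_cvs lgc single] by (intro ext) simp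
  note m = mseq_lg[OF lcs_mem[OF single]]
  have "log_lin k (single x c) = c \<odot>\<^sub>g log_comp x k" using lin_homD(3)[OF log_lin_hom, of "single x 1" k c] single by (simp add: log_lin_single)
  thus ?case unfolding e using mseq_ops(1)[OF m] scl_\<Phi>[OF m] by simp
 next
  case (add u v)
  have e: "?e (u + v) = (\<lambda>r. ?e u r + ?e v r)" using lin_ext_add[OF free_cvs lgc add(1,2)] by (intro ext) simp
  show ?case unfolding e using add mseq_ops(2) add_\<Phi>[of "?e u" "?e v" k] lin_homD(2)[OF log_lin_hom, of u k v] by simp
 qed
 thus "mseq (?e u)" "\<Phi> (?e u) k = log_lin k u" by auto
qed

lemma lg_dlt_Suc: "x \<in> lcs G k ==> k \<ge> 1 ==> lg (Suc k) x - dlt x \<in> Aug (Suc k)" using Aug_antimono[OF _ lg_lcs(2)[of x k "Suc k"], of "Suc k"] by simp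

text \<open>Modulo I^(k+1) the logarithm on Gamma_k is x - 1, and (x - 1)(y - 1) lies in I^(2k), so
  degree k sees no bracket correction.\<close>

lemma log_comp_mult_top:
 assumes k: "k \<ge> 1" and x: "x \<in> lcs G k" and y: "y \<in> lcs G k"
 shows "log_comp (x \<otimes> y) k = log_comp x k \<oplus>\<^sub>g log_comp y k"
proof -
 note c = lcs_mem[OF x] lcs_mem[OF y]
 let ?r = "Suc k"
 have "dlt x \<star> dlt y \<in> Aug ?r" using Aug_antimono[OF _ Aug_star[OF dlt_lcs[OF x] dlt_lcs[OF y]], of ?r] k by simp
 from AugD(3)[OF AugD(5)[OF AugD(5)[OF lg_dlt_Suc[OF lcs_mult[OF x y] k] lg_dlt_Suc[OF x k]] lg_dlt_Suc[OF y k]] this]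
 have "lg ?r (x \<otimes> y) - (lg ?r x + lg ?r y) \<in> Aug ?r" unfolding dlt_mult[OF c] by (simp add: algebra_simps)
 from \<Phi>_cong[OF mseq_lg mseq_ops(2)[OF mseq_lg[OF c(1)] mseq_lg[OF c(2)]] this, of k] c
 show ?thesis by (simp add: add_\<Phi>[OF mseq_lg[OF c(1)] mseq_lg[OF c(2)]])
qed

lemma log_lin_kernel:
 assumes u: "u over lcs G k" "cls k u = zgr k"
 shows "log_lin k u = \<zero>\<^sub>g"
proof (cases "k = 0")
 \<comment> \<open>In degree 0 the target component gr_0 is zero.\<close>
 case True
 note h = log_lin_homog[OF u(1)]
 show ?thesis
 proof
  fix i show "log_lin k u i = \<zero>\<^sub>g i"
   using h gr_at_0[OF gr_homog_carrier[OF h]] True by (cases "i = 0") (auto simp: gr_simps(2,6))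
 qed
next
 case False
 hence k: "k \<ge> 1" by simp
 note L = lin_homD[OF log_lin_hom]
 show ?thesis
 proof (rule gr_class_universal[OF log_lin_hom gr_cvs _ _ u])
  fix x y assume xy: "x \<in> lcs G k" "y \<in> lcs G k"
  let ?C = "free_module (lcs G k)"
  have a: "single x 1 + single y 1 \<in> carrier ?C" "single (x \<otimes> y) 1 \<in> carrier ?C" using xy lcs_mult by (simp_all add: over_add)
  have "log_lin k (single (x \<otimes> y) 1 - (single x 1 + single y 1)) = log_lin k (single (x \<otimes> y) 1) \<ominus>\<^sub>g log_lin k (single x 1 + single y 1)"
   using lin_hom_diff[OF log_lin_hom free_cvs gr_cvs a(2,1)] a by simp
  also have "log_lin k (single x 1 + single y 1) = log_comp (x \<otimes> y) k"
   using L(2)[of "single x 1" k "single y 1"] xy by (simp add: log_lin_single log_comp_mult_top[OF k])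
  also have "log_lin k (single (x \<otimes> y) 1) = log_comp (x \<otimes> y) k" using xy lcs_mult by (simp add: log_lin_single)
  finally show "log_lin k (single (x \<otimes> y) 1 - single x 1 - single y 1) = \<zero>\<^sub>g"
   using cvs_diff_eq_zero[OF gr_cvs] mseq_lg[of "x \<otimes> y"] xy lcs_mem by (simp add: diff_diff_eq)
 next
  fix e assume e: "e \<in> lcs G (Suc k)"
  have ek: "e \<in> lcs G k" using e lcs_Suc_subset by auto
  have "log_comp e k = \<zero>\<^sub>g" using filt_\<Phi>[OF mseq_lg[OF lcs_mem[OF ek]], of "Suc k"] lg_lcs(1)[OF e, of "Suc k"] by simp
  thus "log_lin k (single e 1) = \<zero>\<^sub>g" by (simp add: log_lin_single[OF ek])
 qed
qed

text \<open>Modulo I^(i+j+1) the logarithms may be replaced by x - 1 and y - 1, whose commutator is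
  [x,y] - 1. In the target the components of log x below i and of log y below j vanish, so a single
  term of the convolution remains.\<close>

lemma log_comp_commutator:
 assumes i: "i \<ge> 1" and j: "j \<ge> 1" and x: "x \<in> lcs G i" and y: "y \<in> lcs G j"
 shows "log_comp (com x y) (i + j) = log_comp x i \<otimes>\<^sub>g log_comp y j"
proof -
 note c = lcs_mem[OF x] lcs_mem[OF y]
 note m = mseq_lg[OF c(1)] mseq_lg[OF c(2)]
 let ?r = "Suc (i + j)"
 have r: "?r \<ge> 2" using i j by simp
 define a where "a = lg ?r x - dlt x"
 define b where "b = lg ?r y - dlt y"
 have a: "a \<in> Aug (2 * i)" and b: "b \<in> Aug (2 * j)" unfolding a_def b_def using lg_lcs(2)[OF x r] lg_lcs(2)[OF y r] .
 note z = dlt_lcs[OF x] dlt_lcs[OF y]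
 note l = lg_lcs(1)[OF x, of ?r] lg_lcs(1)[OF y, of ?r]
 have low: "u \<in> Aug n ==> n \<ge> ?r ==> u \<in> Aug ?r" for u n by (rule Aug_antimono)
 have gen: "p \<star> q - q \<star> p - (u \<star> v - v \<star> u) = ((p - u) \<star> q + u \<star> (q - v)) - ((q - v) \<star> p + v \<star> (p - u))" for p q u v
  by (simp add: star_diff algebra_simps)
 have "lg ?r x \<star> lg ?r y - lg ?r y \<star> lg ?r x - (dlt x \<star> dlt y - dlt y \<star> dlt x) =
  (a \<star> lg ?r y + dlt x \<star> b) - (b \<star> lg ?r x + dlt y \<star> a)"
  unfolding a_def b_def by (rule gen)
 also have "\<dots> \<in> Aug ?r"
  by (intro AugD(5) AugD(3) low[OF Aug_star[OF a l(2)]] low[OF Aug_star[OF z(1) b]] low[OF Aug_star[OF b l(1)]] low[OF Aug_star[OF z(2) a]])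
   (use i j in auto)
 finally have 1: "lg ?r x \<star> lg ?r y - lg ?r y \<star> lg ?r x - (dlt x \<star> dlt y - dlt y \<star> dlt x) \<in> Aug ?r" .
 have 2: "lg ?r (com x y) - dlt (com x y) \<in> Aug ?r" by (rule lg_dlt_Suc[OF com_lcs[OF x y]]) (use i in simp)
 from AugD(5)[OF AugD(3)[OF 2 dlt_commutator_Aug[OF x y]] 1]
 have "lg ?r (com x y) - (lg ?r x \<star> lg ?r y - lg ?r y \<star> lg ?r x) \<in> Aug ?r" by (simp add: algebra_simps)
 from \<Phi>_cong[OF mseq_lg mseq_ops(4)[OF m] this, of "i + j"] c
 have "log_comp (com x y) (i + j) = (\<Oplus>\<^bsub>gr G\<^esub>n\<in>{..i + j}. log_comp x n \<otimes>\<^sub>g log_comp y (i + j - n))"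
  by (simp add: bracket_\<Phi>[OF m])
 also have "\<dots> = log_comp x i \<otimes>\<^sub>g log_comp y (i + j - i)"
 proof (rule finsum_single_term[OF gr_cvs])
  note GM = algD(2)[OF gr_algebra] and Z = alg_mult_zero[OF gr_algebra]
  show "log_comp x i \<otimes>\<^sub>g log_comp y (i + j - i) \<in> grC" using GM m by simp
  fix n assume n: "n \<in> {..i + j}" "n \<noteq> i"
  show "log_comp x n \<otimes>\<^sub>g log_comp y (i + j - n) = \<zero>\<^sub>g"
  proof (cases "n < i")
   case True
   hence "log_comp x n = \<zero>\<^sub>g" using filt_\<Phi>[OF m(1), of i] lg_lcs(1)[OF x, of i] by simp
   thus ?thesis using Z(2) m(2) by simp
  next
   case False
   hence "i + j - n < j" using n by auto
   hence "log_comp y (i + j - n) = \<zero>\<^sub>g" using filt_\<Phi>[OF m(2), of j] lg_lcs(1)[OF y, of j] by simp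
   thus ?thesis using Z(1) m(1) by simp
  qed
 qed auto
 finally show ?thesis by simp
qed

lemma log_lin_bracket:
 assumes i: "i \<ge> 1" and j: "j \<ge> 1" and u: "u over lcs G i" and v: "v over lcs G j"
 shows "log_lin (i + j) (bilinear (com) u v) = log_lin i u \<otimes>\<^sub>g log_lin j v"
proof -
 note N = algD[OF gr_algebra]
 have cl: "log_lin n w \<in> grC" if "w over lcs G n" for n w using lin_homD(1)[OF log_lin_hom] that by simp
 note kb = keys_com
 have 1: "log_lin (i + j) (bilinear (com) (single x 1) v) = log_lin i (single x 1) \<otimes>\<^sub>g log_lin j v" if x: "x \<in> lcs G i" for x
 proof (rule lin_hom_eq_on_free_module[where S = "lcs G j" and L = "gr G" and u = v and f = "\<lambda>v. log_lin (i + j) (bilinear (com) (single x 1) v)" and g = "\<lambda>v. log_lin i (single x 1) \<otimes>\<^sub>g log_lin j v"])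
  have xk: "(single x (1::complex)) over lcs G i" using x by simp
  show "(\<lambda>v. log_lin (i + j) (bilinear (com) (single x 1) v)) \<in> lin_hom (free_module (lcs G j)) (gr G)"
   by (rule lin_homI) (use kb[OF xk] cl lin_homD(2,3)[OF log_lin_hom, of _ "i + j"] in "simp_all add: bilin_addR bilin_sclR")
  show "(\<lambda>v. log_lin i (single x 1) \<otimes>\<^sub>g log_lin j v) \<in> lin_hom (free_module (lcs G j)) (gr G)"
   by (rule lin_homI) (use cl[OF xk] cl N lin_homD(2,3)[OF log_lin_hom, of _ j] in simp_all)
  show "log_lin (i + j) (bilinear (com) (single x 1) (single y 1)) = log_lin i (single x 1) \<otimes>\<^sub>g log_lin j (single y 1)" if y: "y \<in> lcs G j" for y
   using log_comp_commutator[OF i j x y] x y com_lcs[OF x y] by (simp add: log_lin_single)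
 qed (use gr_cvs v in auto)
 show ?thesis
 proof (rule lin_hom_eq_on_free_module[where S = "lcs G i" and L = "gr G" and u = u and f = "\<lambda>u. log_lin (i + j) (bilinear (com) u v)" and g = "\<lambda>u. log_lin i u \<otimes>\<^sub>g log_lin j v"])
  show "(\<lambda>u. log_lin (i + j) (bilinear (com) u v)) \<in> lin_hom (free_module (lcs G i)) (gr G)"
   by (rule lin_homI) (use kb[OF _ v] cl lin_homD(2,3)[OF log_lin_hom, of _ "i + j"] in "simp_all add: bilin_addL bilin_sclL")
  show "(\<lambda>u. log_lin i u \<otimes>\<^sub>g log_lin j v) \<in> lin_hom (free_module (lcs G i)) (gr G)"
   by (rule lin_homI) (use cl[OF v] cl N lin_homD(2,3)[OF log_lin_hom, of _ i] in simp_all)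
 qed (use gr_cvs u 1 in auto)
qed

text \<open>A homogeneous element is the image of a sequence whose other components vanish. Its
  terms then lie in I^k from level k on, and \<open>Prim_Aug_Dlt\<close> writes the term of level k
  + 1 through elements x - 1, which are logarithms modulo I^(k+1).\<close>

lemma log_lin_onto:
 assumes k: "k \<ge> 1"
 shows "log_lin k ` carrier (free_module (lcs G k)) = homog (gr G) k"
proof
 show "homog (gr G) k \<subseteq> log_lin k ` carrier (free_module (lcs G k))"
 proof
  fix f assume f: "f \<in> homog (gr G) k"
  let ?r = "Suc k"
  let ?e = "\<lambda>u r. linear_extension CG (lg r) u"
  have "\<exists>U. mseq U \<and> (\<forall>i. \<Phi> U i = (if i = k then f else \<zero>\<^sub>g))" by (rule onto_\<Phi>) (use f subspD(2)[OF gr_homog_subsp] in simp)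
  then obtain U where U: "mseq U" "\<And>i. \<Phi> U i = (if i = k then f else \<zero>\<^sub>g)" by blast
  have "U k \<in> Aug k" using filt_\<Phi>[OF U(1), of k] U(2) by simp
  \<comment> \<open>Coherence carries membership in I^k from level k to level k + 1.\<close>
  hence "(U ?r - U k) + U k \<in> Aug k" by (intro AugD(3) coherentD(2)[OF mseqD(1)[OF U(1)]]) simp
  hence d: "U ?r \<in> Dlt k" using Prim_Aug_Dlt[OF k mseqD(2)[OF U(1)]] by simp
  let ?N = "{v. v over \<G> \<and> (\<exists>u. u over lcs G k \<and> v - ?e u ?r \<in> Aug ?r)}"
  have lgc: "\<And>x. x \<in> lcs G k ==> lg ?r x \<in> carrier CG" using lg_closed lcs_mem by simp
  have EL: "linear_extension CG (lg ?r) \<in> lin_hom (free_module (lcs G k)) CG" by (rule lin_ext_lin_hom[OF free_cvs lgc])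
  note el = lin_homD(2,3)[OF EL]
  have z: "?e 0 ?r = 0" using lin_hom_zero[OF EL free_cvs free_cvs] by simp
  have N: "subsp ?N CG"
  proof (rule free_subspI)
   show "0 \<in> ?N" using z AugD(2) by (auto intro!: exI[of _ 0])
   fix v assume "v \<in> ?N"
   then obtain u where u: "v over \<G>" "u over lcs G k" "v - ?e u ?r \<in> Aug ?r" by blast
   thus "v over \<G>" by simp
   have "scl c v - ?e (scl c u) ?r \<in> Aug ?r" for c using AugD(4)[OF u(3), of c] el(2)[of u c] u(2) by (simp add: scl_diff)
   thus "scl c v \<in> ?N" for c using order_trans[OF keys_scl u(1)] order_trans[OF keys_scl u(2)] by blast
   fix w assume "w \<in> ?N"
   then obtain u' where u': "w over \<G>" "u' over lcs G k" "w - ?e u' ?r \<in> Aug ?r" by blast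
   have e: "v + w - ?e (u + u') ?r = (v - ?e u ?r) + (w - ?e u' ?r)" using el(1)[of u u'] u(2) u'(2) by simp
   have "v + w - ?e (u + u') ?r \<in> Aug ?r" unfolding e using AugD(3)[OF u(3) u'(3)] .
   thus "v + w \<in> ?N" using over_add[OF u(1) u'(1)] over_add[OF u(2) u'(2)] by blast
  qed
  have "U ?r \<in> ?N"
  proof (rule Dlt_least[OF N _ _ d])
   show "w \<in> ?N" if "w \<in> Aug ?r" for w using that z Aug_closed[OF that] by (auto intro!: exI[of _ 0] simp del: subset_iff)
   fix x assume x: "x \<in> lcs G k"
   have "?e (single x 1) ?r = 1 \<odot>\<^bsub>CG\<^esub> lg ?r x" by (rule lin_ext_single[OF free_cvs lgc x])
   hence "?e (single x 1) ?r = lg ?r x" by simp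
   hence "dlt x - ?e (single x 1) ?r \<in> Aug ?r" using AugD(6)[OF lg_dlt_Suc[OF x k]] by simp
   moreover have "(single x (1::complex)) over lcs G k" using x by simp
   ultimately show "dlt x \<in> ?N" using dlt_closed[OF lcs_mem[OF x]] by blast
  qed
  then obtain u where u: "u over lcs G k" "U ?r - ?e u ?r \<in> Aug ?r" by blast
  have "\<Phi> U k = log_lin k u" using \<Phi>_cong[OF U(1) log_lin_seq(1)[OF u(1)] u(2), of k] log_lin_seq(2)[OF u(1)] by simp
  thus "f \<in> log_lin k ` carrier (free_module (lcs G k))" using U(2)[of k] u(1) by auto
 qed
qed (use log_lin_homog in auto)

text \<open>The endomorphism that sends the class of x in degree k to the degree k component of the
  image of log x. The choice of the chain does not matter, by \<open>log_lin_kernel\<close>.\<close>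

definition \<alpha> :: "(nat => ('a set \<Rightarrow>\<^sub>0 complex) set) => nat => ('a set \<Rightarrow>\<^sub>0 complex) set" where
 "\<alpha> f k = log_lin k (SOME u. u over lcs G k \<and> cls k u = f k) k"

lemma \<alpha>_eq:
 assumes u: "u over lcs G k" "cls k u = f k"
 shows "\<alpha> f k = log_lin k u k"
proof -
 define v where "v = (SOME v. v over lcs G k \<and> cls k v = f k)"
 have v: "v over lcs G k \<and> cls k v = f k" unfolding v_def by (rule someI[of _ u]) (use u in simp)
 have "cls k (u - v) = zgr k" using gr_class_diff_eq_zero[of u k v] u v by simp
 from log_lin_kernel[OF over_diff this] u v have "log_lin k (u - v) = \<zero>\<^sub>g" by simp
 hence "log_lin k u \<ominus>\<^sub>g log_lin k v = \<zero>\<^sub>g" using lin_hom_diff[OF log_lin_hom free_cvs gr_cvs, of u k v] u v by simp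
 hence "log_lin k u = log_lin k v" using cvs_diff_eq_zero[OF gr_cvs, of "log_lin k u" "log_lin k v"] lin_homD(1)[OF log_lin_hom, of _ k] u(1) v by simp
 thus ?thesis by (simp add: \<alpha>_def v_def)
qed

lemma \<alpha>_gr_elem:
 assumes u: "u over lcs G k"
 shows "\<alpha> (elt k u) = log_lin k u"
proof
 fix i show "\<alpha> (elt k u) i = log_lin k u i"
 proof (cases "i = k")
  case True
  thus ?thesis using \<alpha>_eq[OF u, of "elt k u"] by (simp add: gr_elem_def)
 next
  case False
  have "\<alpha> (elt k u) i = log_lin i 0 i" by (rule \<alpha>_eq) (use False in "simp_all add: gr_elem_def")
  also have "\<dots> = zgr i" using lin_hom_zero[OF log_lin_hom free_cvs gr_cvs, of i] by (simp add: gr_simps(2))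
  also have "\<dots> = log_lin k u i" using log_lin_homog[OF u] False by (simp add: gr_simps(6))
  finally show ?thesis .
 qed
qed

lemma \<alpha>_lin_hom: "\<alpha> \<in> lin_hom (gr G) (gr G)"
proof (rule lin_homI)
 fix f assume f: "f \<in> grC"
 have rep: "\<exists>u. u over lcs G k \<and> cls k u = f k" if "f \<in> grC" for f k using gr_comp_cases[OF gr_closed[OF that, of k]] by metis
 have L: "log_lin k u k \<in> carrier (gr_comp G k)" if "u over lcs G k" for u k using gr_closed[OF lin_homD(1)[OF log_lin_hom]] that by simp
 have cl: "\<alpha> f k \<in> carrier (gr_comp G k)" for k using rep[OF f, of k] \<alpha>_eq L by metis
 have zero: "\<alpha> f k = zgr k" if "f k = zgr k" for k using \<alpha>_eq[of 0 k f] that lin_hom_zero[OF log_lin_hom free_cvs gr_cvs, of k] by (simp add: gr_simps(2))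
 have "finite {k. \<alpha> f k \<noteq> zgr k}" by (rule finite_subset[of _ "{k. f k \<noteq> zgr k}"]) (use f zero in "auto simp: gr_simps(1)")
 thus "\<alpha> f \<in> grC" using cl by (simp add: gr_simps(1))
 show "\<alpha> (c \<odot>\<^sub>g f) = c \<odot>\<^sub>g \<alpha> f" for c
 proof
  fix k
  obtain u where u: "u over lcs G k" "cls k u = f k" using rep[OF f] by blast
  have "\<alpha> (c \<odot>\<^sub>g f) k = log_lin k (scl c u) k"
   by (rule \<alpha>_eq) (use u order_trans[OF keys_scl u(1)] in "simp_all add: gr_simps(4) gr_class_scl")
  thus "\<alpha> (c \<odot>\<^sub>g f) k = (c \<odot>\<^sub>g \<alpha> f) k"
   using \<alpha>_eq[of u k f, OF u] lin_homD(3)[OF log_lin_hom, of u k c] u by (simp add: gr_simps(4))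
 qed
 fix g assume g: "g \<in> grC"
 show "\<alpha> (f \<oplus>\<^sub>g g) = \<alpha> f \<oplus>\<^sub>g \<alpha> g"
 proof
  fix k
  obtain u where u: "u over lcs G k" "cls k u = f k" using rep[OF f] by blast
  obtain v where v: "v over lcs G k" "cls k v = g k" using rep[OF g] by blast
  have "\<alpha> (f \<oplus>\<^sub>g g) k = log_lin k (u + v) k" by (rule \<alpha>_eq) (use u v in "simp_all add: gr_simps(3) gr_class_add over_add")
  thus "\<alpha> (f \<oplus>\<^sub>g g) k = (\<alpha> f \<oplus>\<^sub>g \<alpha> g) k"
   using \<alpha>_eq[of u k f, OF u] \<alpha>_eq[of v k g, OF v] lin_homD(2)[OF log_lin_hom, of u k v] u v by (simp add: gr_simps(3))
 qed
qed

text \<open>The elements on which both sides agree form a subspace, so homogeneous elements suffice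
  in each argument; there the claim is \<open>log_lin_bracket\<close>.\<close>

lemma \<alpha>_alg_hom: "\<alpha> \<in> alg_hom (gr G) (gr G)"
proof -
 note A = lin_homD[OF \<alpha>_lin_hom] and M = algD[OF gr_algebra]
 have equalizer: "subsp {x \<in> grC. f x = g x} (gr G)" if "f \<in> lin_hom (gr G) (gr G)" "g \<in> lin_hom (gr G) (gr G)" for f g by (rule subspI[OF gr_cvs])
   (use lin_homD(2,3)[OF that(1)] lin_homD(2,3)[OF that(2)] lin_hom_zero[OF that(1) gr_cvs gr_cvs] lin_hom_zero[OF that(2) gr_cvs gr_cvs] gr_cvs in auto)
 have 1: "\<alpha> (elt i u \<otimes>\<^sub>g g) = \<alpha> (elt i u) \<otimes>\<^sub>g \<alpha> g" if u: "i \<ge> 1" "u over lcs G i" and g: "g \<in> grC" for i u g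
 proof -
  let ?e = "elt i u"
  have e: "?e \<in> grC" using u by simp
  have "g \<in> {g \<in> grC. \<alpha> (?e \<otimes>\<^sub>g g) = \<alpha> ?e \<otimes>\<^sub>g \<alpha> g}"
  proof (rule gr_decompose[OF g equalizer])
   show "(\<lambda>g. \<alpha> (?e \<otimes>\<^sub>g g)) \<in> lin_hom (gr G) (gr G)" by (rule lin_homI) (use A M e in simp_all)
   show "(\<lambda>g. \<alpha> ?e \<otimes>\<^sub>g \<alpha> g) \<in> lin_hom (gr G) (gr G)" by (rule lin_homI) (use A M e in simp_all)
   fix j and v :: "'a \<Rightarrow>\<^sub>0 complex" assume v: "j \<ge> 1" "v over lcs G j"
   have "\<alpha> (?e \<otimes>\<^sub>g elt j v) = log_lin (i + j) (bilinear (com) u v)"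
    unfolding gr_elem_mult[OF u(2) v(2)] by (rule \<alpha>_gr_elem[OF keys_com[OF u(2) v(2)]])
   thus "elt j v \<in> {g \<in> grC. \<alpha> (?e \<otimes>\<^sub>g g) = \<alpha> ?e \<otimes>\<^sub>g \<alpha> g}"
    using v(2) \<alpha>_gr_elem[OF u(2)] \<alpha>_gr_elem[OF v(2)] log_lin_bracket[OF u(1) v(1) u(2) v(2)] by simp
  qed
  thus ?thesis by simp
 qed
 have "\<alpha> (f \<otimes>\<^sub>g g) = \<alpha> f \<otimes>\<^sub>g \<alpha> g" if f: "f \<in> grC" and g: "g \<in> grC" for f g
 proof -
  have "f \<in> {f \<in> grC. \<alpha> (f \<otimes>\<^sub>g g) = \<alpha> f \<otimes>\<^sub>g \<alpha> g}"
  proof (rule gr_decompose[OF f equalizer])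
   show "(\<lambda>f. \<alpha> (f \<otimes>\<^sub>g g)) \<in> lin_hom (gr G) (gr G)" by (rule lin_homI) (use A M g in simp_all)
   show "(\<lambda>f. \<alpha> f \<otimes>\<^sub>g \<alpha> g) \<in> lin_hom (gr G) (gr G)" by (rule lin_homI) (use A M g in simp_all)
  qed (use 1 g in simp)
  thus ?thesis by simp
 qed
 thus ?thesis using \<alpha>_lin_hom unfolding alg_hom_def by blast
qed

text \<open>\<open>\<alpha>\<close> is a surjective endomorphism of \<open>gr\<close>, hence induces an automorphism of the finite-dimensional
 space \<open>(gr/gr'')\<^sub>k\<close>; and it maps the class of \<open>c \<in> G''\<close> into \<open>gr''\<close>.\<close>

lemma gr_elem_second_derived:
 assumes fg: "finite S" "S \<subseteq> \<G>" "generate G S = \<G>" and k: "k \<ge> 1"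
  and c: "c \<in> lcs G k" "c \<in> second_derived G"
 shows "elt k (single c 1) \<in> gr2"
proof -
 note P1 = chen_space_presentation[OF gr_algebra gr_homog_subsp[of k] gr_elem_lin_hom gr_elem_onto]
 note P2 = chen_space_presentation[OF gr_algebra gr_homog_subsp[of k] log_lin_hom log_lin_onto[OF k]]
 note W = chen_space_cvs[OF gr_algebra gr_homog_subsp[of k]]
 obtain B where B: "finite B" "B \<subseteq> carrier (chen_space (gr G) k)" "carrier (chen_space (gr G) k) \<subseteq> span_of (chen_space (gr G) k) B"
  using chen_rank_lie_gr_le_holonomy(2)[OF fg k] by auto
 have cC: "single c 1 \<in> carrier (free_module (lcs G k))" using c by simp
 have "gr2 +>\<^sub>g log_lin k (single c 1) = \<zero>\<^bsub>chen_space (gr G) k\<^esub>"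
  unfolding P2(3)[OF cC] unfolding log_lin_single[OF c(1)] by (rule log_comp_second_derived[OF c(2)])
 \<comment> \<open>C[Gamma_k] is mapped onto (gr/gr'')_k in two ways, by the class and by
   \<open>log_lin\<close>. The second map factors through the first by \<alpha>, and the chain of
   \<open>c\<close> lies in its kernel.\<close>
 hence "gr2 +>\<^sub>g elt k (single c 1) = \<zero>\<^bsub>chen_space (gr G) k\<^esub>"
 proof (rule kernel_of_two_surjections[OF W free_cvs P1(1) P2(1) P1(2) P2(2) _ B cC, rotated])
  fix u assume u: "u \<in> carrier (free_module (lcs G k))"
   "gr2 +>\<^sub>g elt k u = \<zero>\<^bsub>chen_space (gr G) k\<^esub>"
  hence "\<alpha> (elt k u) \<in> gr2" using P1(3)[OF u(1)] second_derived_hom[OF gr_algebra gr_algebra \<alpha>_alg_hom] by auto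
  thus "gr2 +>\<^sub>g log_lin k u = \<zero>\<^bsub>chen_space (gr G) k\<^esub>" unfolding P2(3)[OF u(1)] using \<alpha>_gr_elem u(1) by simp
 qed
 thus ?thesis unfolding P1(3)[OF cC] .
qed

end

text \<open>A filtered isomorphism composed with \<open>lim\<close> has all the properties demanded
  of \<Phi>; the equivalence for the filtration and surjectivity come from its being bijective with
  equal images of the filtration steps.\<close>

lemma filtered_formal_second_derived:
 assumes fg: "finite S" "S \<subseteq> \<G>" "generate G S = \<G>" and k: "k \<ge> 1"
  and c: "c \<in> lcs G k" "c \<in> second_derived G" and "filtered_formal G"
 shows "elt k (single c 1) \<in> gr2"
proof -
 let ?D = "degree_completion (gr G)"
 obtain \<phi> where \<phi>: "\<phi> \<in> lie_iso (malcev_lie G) ?D" and f: "\<And>r. \<phi> ` filt (malcev_lie G) r = filt ?D r"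
  using assms(7) unfolding filtered_formal_def filtered_isomorphic_def by auto
 have L: "\<phi> \<in> lin_hom (malcev_lie G) ?D" and b: "bij_betw \<phi> (carrier (malcev_lie G)) (carrier ?D)"
  and m: "\<And>x y. x \<in> carrier (malcev_lie G) ==> y \<in> carrier (malcev_lie G) ==> \<phi> (x \<otimes>\<^bsub>malcev_lie G\<^esub> y) = \<phi> x \<otimes>\<^bsub>?D\<^esub> \<phi> y"
  using \<phi> by (auto simp: lie_iso_def)
 note LD = lin_homD[OF L]
 have mc: "lim U \<in> carrier (malcev_lie G)" if "mseq U" for U using that malcev_simps(1) by auto
 have hom: "\<phi> (lim U) i \<in> homog (gr G) i" if "mseq U" for U i using LD(1)[OF mc[OF that]] by (simp add: degree_completion_simps(1))
 show ?thesis
 proof (rule gr_elem_second_derived[where \<Phi> = "\<lambda>U. \<phi> (lim U)", OF _ _ _ _ _ _ fg k c])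
  fix U assume U: "mseq U"
  show "\<phi> (lim U) i \<in> homog (gr G) i" for i using hom[OF U] .
  show "\<phi> (lim (\<lambda>r. scl a (U r))) i = a \<odot>\<^sub>g \<phi> (lim U) i" for a i
   using LD(3)[OF mc[OF U], of a] malcev_simps(2)[OF U, of a] by (simp add: degree_completion_simps(4))
  show "(\<forall>i<r. \<phi> (lim U) i = \<zero>\<^sub>g) \<longleftrightarrow> U r \<in> Aug r" for r
  proof -
   have "(\<forall>i<r. \<phi> (lim U) i = \<zero>\<^sub>g) \<longleftrightarrow> \<phi> (lim U) \<in> filt ?D r" using hom[OF U] by (simp add: degree_completion_simps(5))
   \<comment> \<open>Injectivity turns the equality of images of the filtration steps into an
     equivalence for the given point.\<close>
   also have "\<dots> \<longleftrightarrow> lim U \<in> filt (malcev_lie G) r"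
   proof
    assume "\<phi> (lim U) \<in> filt ?D r"
    then obtain p where p: "p \<in> filt (malcev_lie G) r" "\<phi> (lim U) = \<phi> p" using f[of r] by (metis imageE)
    have "p \<in> carrier (malcev_lie G)" using p(1) by (simp add: malcev_lie_def Let_def)
    hence "p = lim U" using p(2) b mc[OF U] by (metis bij_betw_def inj_onD)
    thus "lim U \<in> filt (malcev_lie G) r" using p(1) by simp
   qed (use f[of r] in auto)
   finally show ?thesis using malcev_simps(5)[OF U] by simp
  qed
  fix V assume V: "mseq V"
  show "\<phi> (lim (\<lambda>r. U r + V r)) i = \<phi> (lim U) i \<oplus>\<^sub>g \<phi> (lim V) i" for i
   using LD(2)[OF mc[OF U] mc[OF V]] malcev_simps(3)[OF U V] by (simp add: degree_completion_simps(3))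
  show "\<phi> (lim (\<lambda>r. U r \<star> V r - V r \<star> U r)) i = (\<Oplus>\<^bsub>gr G\<^esub>j\<in>{..i}. \<phi> (lim U) j \<otimes>\<^sub>g \<phi> (lim V) (i - j))" for i
   using m[OF mc[OF U] mc[OF V]] malcev_simps(4)[OF U V] by (simp add: degree_completion_simps(2))
 next
  fix g assume "\<And>i. g i \<in> homog (gr G) i"
  hence "g \<in> carrier ?D" by (simp add: degree_completion_simps(1))
  then obtain p where p: "p \<in> carrier (malcev_lie G)" "\<phi> p = g" using b by (metis bij_betw_imp_surj_on imageE)
  then obtain U where "mseq U" "p = lim U" using malcev_simps(1) by auto
  thus "\<exists>U. mseq U \<and> (\<forall>i. \<phi> (lim U) i = g i)" using p(2) by auto
 qed
qed

end

theorem corollary8p7: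
 fixes G :: "('a, 'b) monoid_scheme"
 assumes "finitely_generated_group G"
 shows "\<forall>k\<ge>1.
  chen_rank_lie (gr G) k \<le> chen_rank_lie (holonomy G) k \<and>
  (k \<le> 2 \<or> graded_formal G \<longrightarrow> chen_rank_lie (gr G) k = chen_rank_lie (holonomy G) k) \<and>
  chen_rank G k \<le> chen_rank_lie (gr G) k \<and>
  (k \<le> 3 \<or> filtered_formal G \<longrightarrow> chen_rank G k = chen_rank_lie (gr G) k)"
proof (intro allI impI)
 fix k :: nat assume k: "k \<ge> 1"
 interpret group G using assms by (simp add: finitely_generated_group_def)
 obtain S where fg: "finite S" "S \<subseteq> carrier G" "generate G S = carrier G" using assms by (auto simp: finitely_generated_group_def)
 have "chen_rank G k = chen_rank_lie (gr G) k" if "k \<le> 3 \<or> filtered_formal G"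
 proof (rule chen_rank_le(2)[OF fg k])
  fix c assume c: "c \<in> lcs G k" "c \<in> second_derived G"
  show "gr_elem G k (single c 1) \<in> second_derived_lie (gr G)"
  proof (cases "filtered_formal G")
   case True
   thus ?thesis by (rule filtered_formal_second_derived[OF fg k c])
  next
   case False
   hence "c \<in> lcs G (Suc k)" using that c(2) second_derived_subset lcs_antimono[of "Suc k" 4] by auto
   hence "gr_elem G k (single c 1) = \<zero>\<^bsub>gr G\<^esub>" by (simp add: gr_elem_eq_zero gr_class_single_zero)
   thus ?thesis using subspD(2)[OF second_derived_subsp[OF gr_algebra]] by simp
  qed
 qed
 thus "chen_rank_lie (gr G) k \<le> chen_rank_lie (holonomy G) k \<and>
  (k \<le> 2 \<or> graded_formal G \<longrightarrow> chen_rank_lie (gr G) k = chen_rank_lie (holonomy G) k) \<and>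
  chen_rank G k \<le> chen_rank_lie (gr G) k \<and>
  (k \<le> 3 \<or> filtered_formal G \<longrightarrow> chen_rank G k = chen_rank_lie (gr G) k)"
  using chen_rank_lie_gr_le_holonomy(1,3)[OF fg k] chen_rank_le(1)[OF fg k] by blast
qed

end
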